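(* Let $\Omega\subset\mathbb{R}^3$ be a bounded domain with smooth boundary, $T>0$, $n\ge 2$, and let $D_{ij}=D_{ji}>0$ ($i\neq j$, $i,j\in\{1,\dots,n\}$) be constants. Let $\boldsymbol{c}^0=(c_1^0,\dots,c_n^0)$ be initial data with $c_i^0(x)\ge 0$ for all $i$ and $\sum_{i=1}^n c_i^0(x)=1$ for a.e. $x\in\Omega$, and let $\boldsymbol{c}=(c_1,\dots,c_n)$ be a weak solution (in the sense defined in the context) of the Maxwell--Stefan system on $\Omega\times(0,T)$ with no-flux boundary condition and initial data $\boldsymbol{c}^0$, with associated fields $m_1,\dots,m_n$. Then $\boldsymbol{c}$ satisfies the entropy identity $$H(\boldsymbol{c}(t))+\frac12\sum_{\substack{i,j=1\\ i\ne j}}^n\int_0^t\int_\Omega\frac{c_ic_j}{D_{ij}}|u_i-u_j|^2\,\mathrm{d}x\,\mathrm{d}s=H(\boldsymbol{c}^0)\qquad\text{for all } t\in(0,T],$$ where $H(\boldsymbol{c})=\sum_{i=1}^n\int_\Omega c_i(\ln c_i-1)\,\mathrm{d}x$ and the dissipation integrand $c_ic_j|u_i-u_j|^2$ is understood as $|\sqrt{c_j}\,m_i-\sqrt{c_i}\,m_j|^2$.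
   Context: The Maxwell--Stefan system is $\partial_t c_i+\operatorname{div}J_i=0$ in $\Omega\times(0,T)$, $i=1,\dots,n$, with $J_i\cdot\nu=0$ on $\partial\Omega\times(0,T)$ ($\nu$ the exterior unit normal), $c_i(\cdot,0)=c_i^0$ in $\Omega$, where the fluxes $J_i$ solve $-\sum_{j\ne i}\frac{c_jJ_i-c_iJ_j}{D_{ij}}=\nabla c_i$ subject to $\sum_{i=1}^nJ_i=0$. Formally $J_i=c_iu_i$ with diffusional velocities $u_i$; one sets $m_i=\sqrt{c_i}\,u_i$, which makes sense even where $c_i=0$, and interprets $J_i=c_iu_i$ as $\sqrt{c_i}\,m_i$. The fields $m_i$. Given $\boldsymbol{c}$ with $c_i\ge0$, $\sum_i c_i=1$ and $\sqrt{c_i}\in L^2(0,T;H^1(\Omega))$, the $\mathbb{R}^3$-valued fields $m_1,\dots,m_n$ on $\Omega\times(0,T)$ are the solution (a.e.) of the linear system $$-\sum_{j=1}^nA_{ij}m_j=2\nabla\sqrt{c_i},\quad i=1,\dots,n,\qquad \sum_{i=1}^n\sqrt{c_i}\,m_i=0,$$ where $A_{ij}=-\frac{\sqrt{c_ic_j}}{D_{ij}}$ for $i\ne j$ and $A_{ii}=\sum_{k\ne i}\frac{c_k}{D_{ik}}$. These fields satisfy $m_i\in L^2(0,T;L^2(\Omega))$. Weak solution. $\boldsymbol{c}=(c_1,\dots,c_n)$ with $c_i\in L^2(0,T;H^1(\Omega))$ and $\partial_tc_i\in L^2(0,T;(H^1(\Omega))^* )$ is a weak solution with initial data $\boldsymbol{c}^0$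 if, for all $i=1,\dots,n$: (i) $\int_0^T\int_\Omega c_i\,\partial_t\varphi_i\,\mathrm{d}x\,\mathrm{d}t+\int_0^T\int_\Omega\sqrt{c_i}\,m_i\cdot\nabla\varphi_i\,\mathrm{d}x\,\mathrm{d}t=0$ for all $\varphi_i\in C^1_c(\overline\Omega\times(0,T))$, where $m_1,\dots,m_n$ is the solution of the linear system $-\sum_{j=1}^nA_{ij}m_j=2\nabla\sqrt{c_i}$ ($i=1,\dots,n$), $\sum_{i=1}^n\sqrt{c_i}\,m_i=0$, with $A_{ij}=-\frac{\sqrt{c_ic_j}}{D_{ij}}$ for $i\ne j$ and $A_{ii}=\sum_{k\ne i}\frac{c_k}{D_{ik}}$; (ii) $c_i\in L^\infty(0,T;L^\infty(\Omega))$; (iii) $c_i\ge0$ and $\sum_{j=1}^nc_j=1$ a.e. in $\Omega\times[0,T]$; (iv) $\sqrt{c_i}\in L^2(0,T;H^1(\Omega))$ and $c_i\in C([0,T];L^2(\Omega))$, with $c_i(0)=c_i^0$ in $L^2(\Omega)$. Conventions. $s\ln s:=0$ at $s=0$. The value $\boldsymbol{c}(t)$ at time $t$ refers to the representative in $C([0,T];L^2(\Omega))$. *)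

theory Defs
  imports "HOL-Analysis.Analysis"
begin

section \<open>Smooth functions, test functions and smooth domains\<close>

primrec Ck :: "nat \<Rightarrow> ('a::euclidean_space \<Rightarrow> real) \<Rightarrow> bool" where
  "Ck 0 f \<longleftrightarrow> continuous_on UNIV f"
| "Ck (Suc k) f \<longleftrightarrow> (\<forall>x. f differentiable (at x)) \<and>
     (\<forall>b\<in>Basis. Ck k (\<lambda>x. frechet_derivative f (at x) b))"

definition smooth :: "('a::euclidean_space \<Rightarrow> real) \<Rightarrow> bool" where
  "smooth f \<longleftrightarrow> (\<forall>k. Ck k f)"

definition test_functions :: "'a::euclidean_space set \<Rightarrow> ('a \<Rightarrow> real) set" where
  "test_functions U =
     {\<phi>. smooth \<phi> \<and> compact (closure {x. \<phi> x \<noteq> 0}) \<and> closure {x. \<phi> x \<noteq> 0} \<subseteq> U}"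

text \<open>Near each boundary point, and after an orthogonal change of coordinates, the set is the
  strict epigraph of a smooth function of the first two coordinates.\<close>
definition smooth_boundary :: "(real^3) set \<Rightarrow> bool" where
  "smooth_boundary \<Omega> \<longleftrightarrow>
     (\<forall>p\<in>frontier \<Omega>. \<exists>r>0. \<exists>R :: real^3 \<Rightarrow> real^3. \<exists>\<gamma> :: real^2 \<Rightarrow> real.
        orthogonal_transformation R \<and> smooth \<gamma> \<and>
        \<Omega> \<inter> ball p r = {x \<in> ball p r. \<gamma> (vector [R x $ 1, R x $ 2]) < R x $ 3})"

definition smooth_bounded_domain :: "(real^3) set \<Rightarrow> bool" where
  "smooth_bounded_domain \<Omega> \<longleftrightarrow>
     open \<Omega> \<and> connected \<Omega> \<and> \<Omega> \<noteq> {} \<and> bounded \<Omega> \<and> smooth_boundary \<Omega>"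

section \<open>Function spaces\<close>

text \<open>Elements of the spaces below are functions, not equivalence classes; the norms are
  therefore only seminorms, and identities between elements hold almost everywhere.\<close>

definition L2 :: "'a::euclidean_space set \<Rightarrow> ('a \<Rightarrow> real) set" where
  "L2 U = {u. u \<in> borel_measurable (lebesgue_on U) \<and>
              integrable (lebesgue_on U) (\<lambda>x. (u x)\<^sup>2)}"

definition L2_norm :: "'a::euclidean_space set \<Rightarrow> ('a \<Rightarrow> real) \<Rightarrow> real" where
  "L2_norm U u = sqrt (LINT x|lebesgue_on U. (u x)\<^sup>2)"

definition locally_integrable :: "(real^3) set \<Rightarrow> (real^3 \<Rightarrow> 'b::euclidean_space) \<Rightarrow> bool" where
  "locally_integrable \<Omega> u \<longleftrightarrow> (\<forall>K. compact K \<and> K \<subseteq> \<Omega> \<longrightarrow> set_integrable lebesgue K u)"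

definition weak_gradient :: "(real^3) set \<Rightarrow> (real^3 \<Rightarrow> real) \<Rightarrow> (real^3 \<Rightarrow> real^3) \<Rightarrow> bool" where
  "weak_gradient \<Omega> u g \<longleftrightarrow> locally_integrable \<Omega> u \<and> locally_integrable \<Omega> g \<and>
     (\<forall>\<phi>\<in>test_functions \<Omega>. \<forall>k.
        (LINT x|lebesgue_on \<Omega>. u x * frechet_derivative \<phi> (at x) (axis k 1))
        = - (LINT x|lebesgue_on \<Omega>. g x $ k * \<phi> x))"

definition H1 :: "(real^3) set \<Rightarrow> (real^3 \<Rightarrow> real) set" where
  "H1 \<Omega> = {u \<in> L2 \<Omega>. \<exists>g. weak_gradient \<Omega> u g \<and> (\<forall>k. (\<lambda>x. g x $ k) \<in> L2 \<Omega>)}"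

text \<open>The weak gradient is unique up to null sets, so the norm does not depend on the choice.\<close>
definition H1_norm :: "(real^3) set \<Rightarrow> (real^3 \<Rightarrow> real) \<Rightarrow> real" where
  "H1_norm \<Omega> u =
     sqrt ((LINT x|lebesgue_on \<Omega>. (u x)\<^sup>2) +
           (LINT x|lebesgue_on \<Omega>. (norm ((SOME g. weak_gradient \<Omega> u g) x))\<^sup>2))"

text \<open>Bounded linear functionals on \<open>H1 \<Omega>\<close>; their values outside \<open>H1 \<Omega>\<close> are irrelevant.
  Boundedness forces them to agree on functions that are equal almost everywhere.\<close>
definition H1_dual :: "(real^3) set \<Rightarrow> ((real^3 \<Rightarrow> real) \<Rightarrow> real) set" where
  "H1_dual \<Omega> = {F.
     (\<forall>u\<in>H1 \<Omega>. \<forall>v\<in>H1 \<Omega>. \<forall>a b. F (\<lambda>x. a * u x + b * v x) = a * F u + b * F v) \<and>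
     (\<exists>K. \<forall>u\<in>H1 \<Omega>. \<bar>F u\<bar> \<le> K * H1_norm \<Omega> u)}"

definition H1_dual_norm :: "(real^3) set \<Rightarrow> ((real^3 \<Rightarrow> real) \<Rightarrow> real) \<Rightarrow> real" where
  "H1_dual_norm \<Omega> F = (SUP u\<in>{u \<in> H1 \<Omega>. H1_norm \<Omega> u \<le> 1}. \<bar>F u\<bar>)"

text \<open>The Bochner space \<open>L\<^sup>2(0,T;X)\<close> for a space \<open>X\<close> of real-valued functions with (semi)norm \<open>N\<close>:
  almost everywhere limits of \<open>X\<close>-valued simple functions whose norm is square integrable.\<close>
definition L2_time ::
  "real \<Rightarrow> ('a \<Rightarrow> real) set \<Rightarrow> (('a \<Rightarrow> real) \<Rightarrow> real) \<Rightarrow> (real \<Rightarrow> 'a \<Rightarrow> real) set" where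
  "L2_time T X N = {u.
     (AE t in lebesgue_on {0<..<T}. u t \<in> X) \<and>
     (\<exists>s :: nat \<Rightarrow> real \<Rightarrow> 'a \<Rightarrow> real.
        (\<forall>k. finite (s k ` {0<..<T}) \<and> s k ` {0<..<T} \<subseteq> X \<and>
             (\<forall>w. {t \<in> {0<..<T}. s k t = w} \<in> sets lebesgue)) \<and>
        (AE t in lebesgue_on {0<..<T}. (\<lambda>k. N (\<lambda>x. s k t x - u t x)) \<longlonglongrightarrow> 0)) \<and>
     integrable (lebesgue_on {0<..<T}) (\<lambda>t. (N (u t))\<^sup>2)}"

text \<open>Functions on the space-time cylinder take arguments \<open>(x, t)\<close>.\<close>

definition L2_H1 :: "(real^3) set \<Rightarrow> real \<Rightarrow> ((real^3) \<times> real \<Rightarrow> real) set" where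
  "L2_H1 \<Omega> T = {u. u \<in> borel_measurable (lebesgue_on (\<Omega> \<times> {0<..<T})) \<and>
     (\<lambda>t x. u (x, t)) \<in> L2_time T (H1 \<Omega>) (H1_norm \<Omega>)}"

text \<open>\<open>\<partial>\<^sub>t u \<in> L\<^sup>2(0,T;(H\<^sup>1)\<^sup>*)\<close>: the distributional time derivative is a function \<open>\<xi>\<close> with values
  in the dual space; the defining identity between dual elements is evaluated at each \<open>v\<close>.\<close>
definition time_derivative_in_L2_H1_dual ::
  "(real^3) set \<Rightarrow> real \<Rightarrow> ((real^3) \<times> real \<Rightarrow> real) \<Rightarrow> bool" where
  "time_derivative_in_L2_H1_dual \<Omega> T u \<longleftrightarrow>
     (\<exists>\<xi>\<in>L2_time T (H1_dual \<Omega>) (H1_dual_norm \<Omega>).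
        \<forall>v\<in>H1 \<Omega>. \<forall>\<psi>\<in>test_functions {0<..<T}.
          (LINT t|lebesgue_on {0<..<T}. deriv \<psi> t * (LINT x|lebesgue_on \<Omega>. u (x, t) * v x))
          = - (LINT t|lebesgue_on {0<..<T}. \<psi> t * \<xi> t v))"

text \<open>Essentially bounded functions on the cylinder, i.e. \<open>L\<^sup>\<infinity>(0,T;L\<^sup>\<infinity>)\<close>.\<close>
definition Linf :: "(real^3) set \<Rightarrow> real \<Rightarrow> ((real^3) \<times> real \<Rightarrow> real) set" where
  "Linf \<Omega> T = {u. u \<in> borel_measurable (lebesgue_on (\<Omega> \<times> {0<..<T})) \<and>
     (\<exists>K. AE z in lebesgue_on (\<Omega> \<times> {0<..<T}). \<bar>u z\<bar> \<le> K)}"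

definition C_L2 :: "(real^3) set \<Rightarrow> real \<Rightarrow> (real \<Rightarrow> real^3 \<Rightarrow> real) set" where
  "C_L2 \<Omega> T = {v. (\<forall>t\<in>{0..T}. v t \<in> L2 \<Omega>) \<and>
     (\<forall>s\<in>{0..T}. ((\<lambda>t. L2_norm \<Omega> (\<lambda>x. v t x - v s x)) \<longlongrightarrow> 0) (at s within {0..T}))}"

definition continuous_representative ::
  "(real^3) set \<Rightarrow> real \<Rightarrow> ((real^3) \<times> real \<Rightarrow> real) \<Rightarrow> (real \<Rightarrow> real^3 \<Rightarrow> real) \<Rightarrow> bool" where
  "continuous_representative \<Omega> T u v \<longleftrightarrow> v \<in> C_L2 \<Omega> T \<and>
     (AE t in lebesgue_on {0<..<T}. AE x in lebesgue_on \<Omega>. v t x = u (x, t))"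

text \<open>\<open>C\<^sup>1\<^sub>c\<close> on \<open>closure \<Omega> \<times> (0,T)\<close>: \<open>C\<^sup>1\<close> up to the lateral boundary in the sense of being the
  restriction of a \<open>C\<^sup>1\<close> function, with compact support inside \<open>closure \<Omega> \<times> (0,T)\<close>; the support
  may touch the lateral boundary, which encodes the no-flux condition.\<close>
definition C1c_closure :: "(real^3) set \<Rightarrow> real \<Rightarrow> ((real^3) \<times> real \<Rightarrow> real) set" where
  "C1c_closure \<Omega> T = {\<phi>. Ck 1 \<phi> \<and>
     (\<exists>K. compact K \<and> K \<subseteq> closure \<Omega> \<times> {0<..<T} \<and>
          (\<forall>z \<in> closure \<Omega> \<times> {0<..<T} - K. \<phi> z = 0))}"

definition time_deriv :: "((real^3) \<times> real \<Rightarrow> real) \<Rightarrow> (real^3) \<times> real \<Rightarrow> real" where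
  "time_deriv \<phi> z = frechet_derivative \<phi> (at z) (0, 1)"

definition space_grad :: "((real^3) \<times> real \<Rightarrow> real) \<Rightarrow> (real^3) \<times> real \<Rightarrow> real^3" where
  "space_grad \<phi> z = (\<chi> k. frechet_derivative \<phi> (at z) (axis k 1, 0))"

definition weak_space_gradient ::
  "(real^3) set \<Rightarrow> real \<Rightarrow> ((real^3) \<times> real \<Rightarrow> real) \<Rightarrow> ((real^3) \<times> real \<Rightarrow> real^3) \<Rightarrow> bool" where
  "weak_space_gradient \<Omega> T u G \<longleftrightarrow>
     G \<in> borel_measurable (lebesgue_on (\<Omega> \<times> {0<..<T})) \<and>
     (AE t in lebesgue_on {0<..<T}. weak_gradient \<Omega> (\<lambda>x. u (x, t)) (\<lambda>x. G (x, t)))"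

section \<open>The Maxwell--Stefan system\<close>

definition MS_matrix :: "('n::finite \<Rightarrow> 'n \<Rightarrow> real) \<Rightarrow> ('n \<Rightarrow> real) \<Rightarrow> 'n \<Rightarrow> 'n \<Rightarrow> real" where
  "MS_matrix D y i j =
     (if i \<noteq> j then - (sqrt (y i * y j) / D i j) else (\<Sum>k\<in>UNIV - {i}. y k / D i k))"

definition MS_fields ::
  "(real^3) set \<Rightarrow> real \<Rightarrow> ('n::finite \<Rightarrow> 'n \<Rightarrow> real) \<Rightarrow> ('n \<Rightarrow> (real^3) \<times> real \<Rightarrow> real) \<Rightarrow>
   ('n \<Rightarrow> (real^3) \<times> real \<Rightarrow> real^3) \<Rightarrow> bool" where
  "MS_fields \<Omega> T D c m \<longleftrightarrow>
     (\<exists>G. (\<forall>i. weak_space_gradient \<Omega> T (\<lambda>z. sqrt (c i z)) (G i)) \<and>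
        (AE z in lebesgue_on (\<Omega> \<times> {0<..<T}).
           (\<forall>i. - (\<Sum>j\<in>UNIV. MS_matrix D (\<lambda>k. c k z) i j *\<^sub>R m j z) = 2 *\<^sub>R G i z) \<and>
           (\<Sum>i\<in>UNIV. sqrt (c i z) *\<^sub>R m i z) = 0))"

text \<open>\<open>c\<close> is a weak solution with initial data \<open>c0\<close> and associated fields \<open>m\<close>. Square
  integrability of the fields is a consequence of the linear system and is not required here.\<close>
definition MS_weak_solution ::
  "(real^3) set \<Rightarrow> real \<Rightarrow> ('n::finite \<Rightarrow> 'n \<Rightarrow> real) \<Rightarrow> ('n \<Rightarrow> real^3 \<Rightarrow> real) \<Rightarrow>
   ('n \<Rightarrow> (real^3) \<times> real \<Rightarrow> real) \<Rightarrow> ('n \<Rightarrow> (real^3) \<times> real \<Rightarrow> real^3) \<Rightarrow> bool" where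
  "MS_weak_solution \<Omega> T D c0 c m \<longleftrightarrow>
     (\<forall>i. c i \<in> L2_H1 \<Omega> T) \<and>
     (\<forall>i. time_derivative_in_L2_H1_dual \<Omega> T (c i)) \<and>
     MS_fields \<Omega> T D c m \<and>
     (\<forall>i. \<forall>\<phi>\<in>C1c_closure \<Omega> T.
        (LINT z|lebesgue_on (\<Omega> \<times> {0<..<T}). c i z * time_deriv \<phi> z) +
        (LINT z|lebesgue_on (\<Omega> \<times> {0<..<T}). (sqrt (c i z) *\<^sub>R m i z) \<bullet> space_grad \<phi> z) = 0) \<and>
     (\<forall>i. c i \<in> Linf \<Omega> T) \<and>
     (AE z in lebesgue_on (\<Omega> \<times> {0<..<T}). (\<forall>i. 0 \<le> c i z) \<and> (\<Sum>i\<in>UNIV. c i z) = 1) \<and>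
     (\<forall>i. (\<lambda>z. sqrt (c i z)) \<in> L2_H1 \<Omega> T) \<and>
     (\<forall>i. \<exists>v. continuous_representative \<Omega> T (c i) v \<and>
              (AE x in lebesgue_on \<Omega>. v 0 x = c0 i x))"

text \<open>The factor \<open>y i x\<close> makes the integrand vanish where \<open>y i x = 0\<close>, as the convention for
  \<open>s ln s\<close> demands.\<close>
definition entropy :: "(real^3) set \<Rightarrow> ('n::finite \<Rightarrow> real^3 \<Rightarrow> real) \<Rightarrow> real" where
  "entropy \<Omega> y = (\<Sum>i\<in>UNIV. LINT x|lebesgue_on \<Omega>. y i x * (ln (y i x) - 1))"

text \<open>\<open>c\<^sub>i c\<^sub>j |u\<^sub>i - u\<^sub>j|\<^sup>2 / D\<^sub>i\<^sub>j\<close>, expressed through the fields.\<close>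
definition dissipation_density ::
  "('n::finite \<Rightarrow> 'n \<Rightarrow> real) \<Rightarrow> ('n \<Rightarrow> (real^3) \<times> real \<Rightarrow> real) \<Rightarrow>
   ('n \<Rightarrow> (real^3) \<times> real \<Rightarrow> real^3) \<Rightarrow> 'n \<Rightarrow> 'n \<Rightarrow> (real^3) \<times> real \<Rightarrow> real" where
  "dissipation_density D c m i j z =
     (norm (sqrt (c j z) *\<^sub>R m i z - sqrt (c i z) *\<^sub>R m j z))\<^sup>2 / D i j"

end

theory Submission
  imports Defs
begin

text \<open>Fix \<open>\<delta> > 0\<close> and test the equation of species \<open>i\<close> with \<open>ln (c\<^sub>i + \<delta>)\<close>, which is the
  nonlinear function \<open>F s = ln (s\<^sup>2 + \<delta>)\<close> of \<open>sqrt c\<^sub>i\<close>. The weak form allows only \<open>C\<^sup>1\<close> tests; it passes to \<open>F (sqrt c\<^sub>i)\<close>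
  by localising and mollifying with a kernel whose support lies in an interior cone of the domain, so that no
  extension operator is needed. In time no chain rule is needed either: convexity of \<open>\<Phi>\<close>, \<open>\<Phi>' = ln (\<cdot> + \<delta>)\<close>, gives
  \<open>E t - E s \<ge> \<langle>c t - c s, \<Phi>' (c s)\<rangle>\<close> for \<open>t\<close> on either side of \<open>s\<close>; averaging this over
  \<open>s\<close> with \<open>t = s + h\<close> and letting \<open>h \<rightarrow> 0\<close> from the right and from the left yields both inequalities of
  the balance \<open>E \<tau> - E 0 = \<integral> J\<^sub>i \<cdot> \<nabla>\<Phi>' (c\<^sub>i)\<close>.

  As \<open>\<delta> \<rightarrow> 0\<close> the right-hand side tends to \<open>2 \<integral> m\<^sub>i \<cdot> \<nabla>(sqrt c\<^sub>i)\<close>, because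
  \<open>\<nabla>(sqrt c\<^sub>i) = 0\<close> almost everywhere on \<open>{c\<^sub>i = 0}\<close>. Contracting the linear system with \<open>m\<close> shows
  that the sum over \<open>i\<close> is minus the dissipation; the same quadratic form is coercive on the constraint, so
  \<open>m\<close> is square integrable.\<close>

section \<open>Calculus of the classes \<open>Ck\<close> and smooth bump functions\<close>

text \<open>The logarithm has to be shifted by \<delta> because \<open>ln c\<close> is unbounded
  near \<open>c = 0\<close>. It is read as a function of the square root because the linear system
  controls exactly \<open>\<nabla>(sqrt c)\<close>: the flux carries one factor
  \<open>sqrt c\<close>, the derivative of \<open>ln (s^2 + \<delta>)\<close> another, so the tested
  flux is \<open>2 * c / (c + \<delta>)\<close> times \<open>m \<bullet> \<nabla>(sqrt c)\<close>,
  which has an integrable majorant uniform in \<delta>.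

  The obstacle in time is that the continuous representative has values at every time, but a
  gradient at almost every time only. The tangent of the convex function is therefore taken at
  \<open>s\<close>, and only \<open>s\<close> is averaged. The flux between \<open>s\<close> and
  \<open>s + h\<close> then meets the gradient at time \<open>s\<close>; after averaging this is an
  integral over \<theta> of the correlation of the flux at time \<open>s + \<theta>\<close> with the
  gradient at time \<open>s\<close>, and continuity of translations in \<open>L^2\<close> controls
  it near \<theta> = 0.

  The definitions speak of Lebesgue measurable functions on the cylinder. They are replaced by Borel
  representatives extended by zero, so that Fubini and translations can be used on the whole
  space.\<close>

lemma Ck_SucI:
  assumes "\<And>x. (f has_derivative f' x) (at x)" "\<And>b. b \<in> Basis \<Longrightarrow> Ck k (\<lambda>x. f' x b)"
  shows "Ck (Suc k) f"
proof -
  have "f' = (\<lambda>x. frechet_derivative f (at x))"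
    using assms(1) frechet_derivative_at by blast
  then show ?thesis
    using assms by (auto simp: differentiable_def)
qed

lemma Ck_Suc_D: "Ck (Suc k) f \<Longrightarrow> Ck k f"
proof (induction k arbitrary: f)
  case 0
  then show ?case
    by (auto simp: continuous_on_eq_continuous_within intro: differentiable_imp_continuous_within)
next
  case (Suc k)
  have "Ck k (\<lambda>x. frechet_derivative f (at x) b)" if "b \<in> Basis" for b
    using Suc.prems that by (intro Suc.IH) auto
  then show ?case
    using Suc.prems by auto
qed

lemma Ck_has_derivative:
  "Ck (Suc k) f \<Longrightarrow> (f has_derivative frechet_derivative f (at x)) (at x)"
  by (simp add: frechet_derivative_works)

lemma Ck_const: "Ck k (\<lambda>_. c)"
proof (induction k arbitrary: c)
  case (Suc k)
  show ?case by (rule Ck_SucI[where f' = "\<lambda>_ _. 0"]) (auto intro: Suc)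
qed simp

lemma Ck_bounded_linear: "bounded_linear f \<Longrightarrow> Ck k f"
proof (cases k)
  case 0
  then show "bounded_linear f \<Longrightarrow> Ck k f"
    by (simp add: linear_continuous_on)
next
  case (Suc l)
  assume "bounded_linear f"
  then show "Ck k f"
    unfolding Suc by (intro Ck_SucI[where f' = "\<lambda>_. f"] bounded_linear_imp_has_derivative Ck_const)
qed

lemma Ck_add: "Ck k f \<Longrightarrow> Ck k g \<Longrightarrow> Ck k (\<lambda>x. f x + g x)"
proof (induction k arbitrary: f g)
  case (Suc k)
  show ?case
    by (rule Ck_SucI[OF has_derivative_add[OF Ck_has_derivative Ck_has_derivative]])
       (use Suc in auto)
qed (auto intro: continuous_on_add)

lemma Ck_mult: "Ck k f \<Longrightarrow> Ck k g \<Longrightarrow> Ck k (\<lambda>x. f x * g x)"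
proof (induction k arbitrary: f g)
  case (Suc k)
  have "Ck k f" "Ck k g"
    using Suc.prems by (auto intro: Ck_Suc_D simp del: Ck.simps)
  moreover have "Ck k (\<lambda>x. frechet_derivative f (at x) b)" "Ck k (\<lambda>x. frechet_derivative g (at x) b)"
    if "b \<in> Basis" for b
    using Suc.prems that by auto
  ultimately show ?case
    by (intro Ck_SucI[OF has_derivative_mult[OF Ck_has_derivative Ck_has_derivative]] Ck_add Suc.IH)
       (use Suc.prems in \<open>auto simp del: Ck.simps\<close>)
qed (auto intro: continuous_on_mult)

lemma Ck_cmult: "Ck k f \<Longrightarrow> Ck k (\<lambda>x. c * f x)"
  using Ck_mult[OF Ck_const] .

lemma Ck_diff: "Ck k f \<Longrightarrow> Ck k g \<Longrightarrow> Ck k (\<lambda>x. f x - g x)"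
  using Ck_add[OF _ Ck_cmult[of k g "-1"]] by simp

lemma linear_real_apply: "linear L \<Longrightarrow> L (y::real) = y * L 1"
  using linear_scale[of L y 1] by simp

lemma Ck_compose:
  fixes h :: "real \<Rightarrow> real"
  shows "Ck k h \<Longrightarrow> Ck k g \<Longrightarrow> Ck k (\<lambda>x. h (g x))"
proof (induction k arbitrary: h g)
  case 0
  then show ?case by (auto intro: continuous_on_compose2)
next
  case (Suc k)
  \<comment> \<open>On the line the derivative is multiplication by \<open>h1\<close>, so the chain
    rule leaves a product, and the induction applies to \<open>h1\<close> composed with
    \<open>g\<close>.\<close>
  define h1 where "h1 = (\<lambda>y. frechet_derivative h (at y) 1)"
  have h1: "Ck k h1"
    using Suc.prems by (auto simp: h1_def)
  have g: "Ck k g"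
    using Suc.prems by (auto intro: Ck_Suc_D simp del: Ck.simps)
  have eq: "frechet_derivative h (at y) z = z * h1 y" for y z
    unfolding h1_def using Suc.prems(1)
    by (intro linear_real_apply) (auto intro: linear_frechet_derivative)
  show ?case
  proof (rule Ck_SucI)
    show "((\<lambda>x. h (g x)) has_derivative (\<lambda>d. frechet_derivative g (at x) d * h1 (g x))) (at x)" for x
      using has_derivative_compose[OF Ck_has_derivative[OF Suc.prems(2)] Ck_has_derivative[OF Suc.prems(1)]]
      by (simp add: eq)
  next
    fix b :: 'a assume "b \<in> Basis"
    then have "Ck k (\<lambda>x. frechet_derivative g (at x) b)"
      using Suc.prems by auto
    then show "Ck k (\<lambda>x. frechet_derivative g (at x) b * h1 (g x))"
      by (rule Ck_mult[OF _ Suc.IH[OF h1 g]])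
  qed
qed

lemma has_derivative_affine_compose:
  assumes "(f has_derivative f') (at (a *\<^sub>R x + b))"
  shows "((\<lambda>x. f (a *\<^sub>R x + b)) has_derivative (\<lambda>d. f' (a *\<^sub>R d))) (at x)"
proof -
  have "((\<lambda>x. a *\<^sub>R x + b) has_derivative (\<lambda>d. a *\<^sub>R d)) (at x)"
    by (auto intro!: derivative_eq_intros)
  from has_derivative_compose[OF this assms] show ?thesis by simp
qed

lemma Ck_affine: "Ck k f \<Longrightarrow> Ck k (\<lambda>x. f (a *\<^sub>R x + b))"
proof (induction k arbitrary: f)
  case 0
  then have "continuous_on UNIV f" by simp
  then have "continuous_on UNIV (\<lambda>x. f (a *\<^sub>R x + b))"
    by (rule continuous_on_compose2) (intro continuous_intros, simp)
  then show ?case by simp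
next
  case (Suc k)
  show ?case
  proof (rule Ck_SucI[OF has_derivative_affine_compose[OF Ck_has_derivative[OF Suc.prems]]])
    fix d :: 'a assume d: "d \<in> Basis"
    have "frechet_derivative f (at y) (a *\<^sub>R d) = a * frechet_derivative f (at y) d" for y
      using linear_scale[OF linear_frechet_derivative, of f "at y"] Suc.prems by auto
    moreover have "Ck k (\<lambda>x. frechet_derivative f (at (a *\<^sub>R x + b)) d)"
      using Suc.prems d by (intro Suc.IH[of "\<lambda>y. frechet_derivative f (at y) d"]) auto
    ultimately show "Ck k (\<lambda>x. frechet_derivative f (at (a *\<^sub>R x + b)) (a *\<^sub>R d))"
      by (simp add: Ck_cmult)
  qed
qed

lemma Ck_real_SucI:
  assumes "\<And>x. (h has_real_derivative h' x) (at x)" "Ck k h'"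
  shows "Ck (Suc k) h"
proof (rule Ck_SucI)
  show "(h has_derivative (*) (h' x)) (at x)" for x
    using assms(1)[of x] by (simp only: has_field_derivative_def)
  show "Ck k (\<lambda>x. h' x * b)" if "b \<in> Basis" for b
    using that assms(2) by simp
qed

section \<open>Smooth bump functions and mollifying kernels\<close>

definition exp_bump :: "nat \<Rightarrow> real \<Rightarrow> real" where
  "exp_bump n t = (if t > 0 then (1 / t) ^ n * exp (- (1 / t)) else 0)"

lemma exp_bump_tendsto_0: "(exp_bump n \<longlongrightarrow> 0) (at 0)"
proof -
  have "((\<lambda>t. inverse t ^ n / exp (inverse t)) \<longlongrightarrow> 0) (at_right (0::real))"
    by (rule filterlim_compose[OF tendsto_power_div_exp_0 filterlim_inverse_at_top_right])
  then have "(exp_bump n \<longlongrightarrow> 0) (at_right 0)"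
    by (rule Lim_transform_eventually)
       (auto simp: exp_bump_def exp_minus field_simps eventually_at_right_less intro!: eventually_mono[OF eventually_at_right_less])
  moreover have "(exp_bump n \<longlongrightarrow> 0) (at_left 0)"
    by (rule Lim_transform_eventually[OF tendsto_const])
       (auto simp: exp_bump_def eventually_at intro!: exI[of _ 1])
  ultimately show ?thesis
    by (simp add: filterlim_split_at_real)
qed

text \<open>The functions \<open>t^(-n) * exp (- 1 / t)\<close> form a family whose span is closed
  under differentiation, so smoothness of all of them follows by one induction on \<open>k\<close>
  with \<open>n\<close> arbitrary.\<close>

lemma exp_bump_deriv:
  "(exp_bump n has_real_derivative exp_bump (n + 2) t - of_nat n * exp_bump (n + 1) t) (at t)"
proof -
  consider "t > 0" | "t < 0" | "t = 0" by linarith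
  then show ?thesis
  proof cases
    case 1
    have "((\<lambda>t. 1 / t) has_real_derivative - ((1 / t)\<^sup>2)) (at t)"
      using 1 by (auto intro!: derivative_eq_intros simp: power2_eq_square)
    note d = DERIV_power[OF this, of n] DERIV_fun_exp[OF DERIV_minus[OF this]]
    have "((\<lambda>t. (1 / t) ^ n * exp (- (1 / t))) has_real_derivative
        exp_bump (n + 2) t - of_nat n * exp_bump (n + 1) t) (at t)"
      using DERIV_mult[OF d] 1
      by (cases n) (simp_all add: exp_bump_def algebra_simps power2_eq_square del: power_one_over)
    then show ?thesis
      by (rule has_field_derivative_transform_within_open[where S = "{0<..}"])
         (use 1 in \<open>auto simp: exp_bump_def\<close>)
  next
    case 2
    have "((\<lambda>t. 0) has_real_derivative exp_bump (n + 2) t - of_nat n * exp_bump (n + 1) t) (at t)"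
      using 2 by (auto intro!: derivative_eq_intros simp: exp_bump_def)
    then show ?thesis
      by (rule has_field_derivative_transform_within_open[where S = "{..<0}"])
         (use 2 in \<open>auto simp: exp_bump_def\<close>)
  next
    case 3
    \<comment> \<open>At the origin the difference quotient is the next member of the family, so the
      derivative there is its limit 0.\<close>
    have "(exp_bump n (0 + h) - exp_bump n 0) / h = exp_bump (Suc n) h" if "h \<noteq> 0" for h
      using that by (auto simp: exp_bump_def)
    then have "((\<lambda>h. (exp_bump n (0 + h) - exp_bump n 0) / h) \<longlongrightarrow> 0) (at 0)"
      by (intro Lim_transform_eventually[OF exp_bump_tendsto_0[of "Suc n"]])
         (auto simp: eventually_at intro!: exI[of _ 1])
    then show ?thesis
      unfolding 3 by (simp add: DERIV_def exp_bump_def)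
  qed
qed

lemma Ck_exp_bump: "Ck k (exp_bump n)"
proof (induction k arbitrary: n)
  case 0
  show ?case
    using DERIV_isCont[OF exp_bump_deriv] by (simp add: continuous_on_eq_continuous_at)
next
  case (Suc k)
  show ?case
    by (rule Ck_real_SucI[OF exp_bump_deriv]) (intro Ck_diff Ck_cmult Suc)
qed

lemma Ck_sum: "finite A \<Longrightarrow> (\<And>i. i \<in> A \<Longrightarrow> Ck k (f i)) \<Longrightarrow> Ck k (\<lambda>x. \<Sum>i\<in>A. f i x)"
proof (induction A rule: finite_induct)
  case empty
  show ?case by (simp add: Ck_const del: Ck.simps)
next
  case (insert i A)
  have "Ck k (\<lambda>x. f i x + (\<Sum>i\<in>A. f i x))"
    by (rule Ck_add) (use insert in auto)
  then show ?case using insert by simp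
qed

lemma Ck_norm_square: "Ck k (\<lambda>y::'a::euclidean_space. (norm (y - e))\<^sup>2)"
proof -
  have b: "Ck k (\<lambda>y. y \<bullet> b - e \<bullet> b)" for b :: 'a
    by (rule Ck_diff[OF Ck_bounded_linear[OF bounded_linear_inner_left] Ck_const])
  have "(norm (y - e))\<^sup>2 = (\<Sum>b\<in>Basis. (y \<bullet> b - e \<bullet> b) * (y \<bullet> b - e \<bullet> b))" for y
    using euclidean_inner[of "y - e" "y - e"] by (simp add: power2_norm_eq_inner inner_diff_left)
  moreover have "Ck k (\<lambda>y. \<Sum>b\<in>Basis. (y \<bullet> b - e \<bullet> b) * (y \<bullet> b - e \<bullet> b))"
    by (rule Ck_sum) (auto intro: Ck_mult[OF b b])
  ultimately show ?thesis by presburger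
qed

lemma integrable_continuous_compact_support:
  fixes f :: "'a::euclidean_space \<Rightarrow> 'b::{banach, second_countable_topology}"
  assumes "continuous_on UNIV f" "compact K" "\<And>x. x \<notin> K \<Longrightarrow> f x = 0"
  shows "integrable lborel f"
proof -
  have "integrable lborel (\<lambda>x. indicator K x *\<^sub>R f x)"
    using assms by (intro borel_integrable_compact) (auto intro: continuous_on_subset)
  moreover have "(\<lambda>x. indicator K x *\<^sub>R f x) = f"
    using assms(3) by (auto simp: indicator_def fun_eq_iff)
  ultimately show ?thesis by simp
qed

text \<open>The centre \<open>e\<close> is free because the kernels used at the boundary sit in a
  cone away from the origin. Normalisation is possible since the bump is positive exactly on the
  open ball, which is not a null set.\<close>

lemma mollifier_exists:
  fixes e :: "'a::euclidean_space"
  assumes "\<kappa> > 0"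
  obtains \<rho> :: "'a \<Rightarrow> real" where "smooth \<rho>" "\<And>y. \<rho> y \<ge> 0" "\<And>y. \<rho> y \<noteq> 0 \<Longrightarrow> y \<in> cball e \<kappa>"
    "integrable lborel \<rho>" "(LINT y|lborel. \<rho> y) = 1"
proof -
  define r0 where "r0 = (\<lambda>y::'a. exp_bump 0 (\<kappa>\<^sup>2 - (norm (y - e))\<^sup>2))"
  have Ck: "Ck k r0" for k
    unfolding r0_def by (rule Ck_compose[OF Ck_exp_bump]) (intro Ck_diff Ck_const Ck_norm_square)
  have nn: "r0 y \<ge> 0" for y
    by (simp add: r0_def exp_bump_def)
  have pos: "r0 y > 0 \<longleftrightarrow> y \<in> ball e \<kappa>" for y
  proof -
    have "(norm (y - e))\<^sup>2 < \<kappa>\<^sup>2 \<longleftrightarrow> norm (y - e) < \<kappa>"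
      using assms by (meson power2_less_imp_less power_strict_mono norm_ge_zero less_imp_le pos2)
    then show ?thesis
      by (simp add: r0_def exp_bump_def dist_norm norm_minus_commute)
  qed
  have zero: "r0 y = 0" if "y \<notin> cball e \<kappa>" for y
  proof -
    have "\<not> r0 y > 0"
      using that unfolding pos by auto
    then show ?thesis
      using nn[of y] by linarith
  qed
  have int: "integrable lborel r0"
    by (rule integrable_continuous_compact_support[of _ "cball e \<kappa>"])
       (use Ck[of 0] in \<open>auto intro: zero\<close>)
  have "(LINT y|lborel. r0 y) \<noteq> 0"
  proof
    assume "(LINT y|lborel. r0 y) = 0"
    then have "AE y in lborel. r0 y = 0"
      using integral_nonneg_eq_0_iff_AE[OF int] nn by auto
    then have "AE y in lborel. y \<notin> ball e \<kappa>"
      by eventually_elim (use pos in force)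
    then have "ball e \<kappa> \<in> null_sets lborel"
      by (subst AE_iff_null_sets) auto
    then have "negligible (ball e \<kappa>)"
      using negligible_iff_null_sets null_sets_completion_iff by blast
    then show False
      using open_not_negligible[of "ball e \<kappa>"] assms by auto
  qed
  moreover have "(LINT y|lborel. r0 y) \<ge> 0"
    by (simp add: nn)
  ultimately have p: "(LINT y|lborel. r0 y) > 0" by linarith
  define c where "c = 1 / (LINT y|lborel. r0 y)"
  show ?thesis
  proof
    show "smooth (\<lambda>y. c * r0 y)"
      unfolding smooth_def using Ck Ck_cmult by blast
    show "c * r0 y \<ge> 0" for y
      using p nn by (simp add: c_def)
    show "y \<in> cball e \<kappa>" if "c * r0 y \<noteq> 0" for y
      using that zero[of y] by (metis mult_zero_right)
    show "integrable lborel (\<lambda>y. c * r0 y)"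
      using int by simp
    show "(LINT y|lborel. c * r0 y) = 1"
      using p int by (simp add: c_def)
  qed
qed

section \<open>Translations and mollification in the mean\<close>

lemma borel_measurable_Ck: "Ck k f \<Longrightarrow> f \<in> borel_measurable borel"
proof -
  have "Ck k f \<Longrightarrow> Ck 0 f"
    by (induction k) (blast dest: Ck_Suc_D)+
  then show "Ck k f \<Longrightarrow> f \<in> borel_measurable borel"
    by (auto intro: borel_measurable_continuous_onI)
qed

section \<open>Affine substitution and continuity of translations\<close>

lemma nn_integral_lborel_affine:
  fixes f :: "'a::euclidean_space \<Rightarrow> ennreal"
  assumes [measurable]: "f \<in> borel_measurable borel" and "c \<noteq> 0"
  shows "(\<integral>\<^sup>+z. f z \<partial>lborel) = ennreal (\<bar>c\<bar> ^ DIM('a)) * (\<integral>\<^sup>+y. f (t + c *\<^sub>R y) \<partial>lborel)"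
  by (subst lborel_affine[OF \<open>c \<noteq> 0\<close>, of t])
     (simp add: nn_integral_density nn_integral_distr nn_integral_cmult)

lemma integral_lborel_affine:
  fixes f :: "'a::euclidean_space \<Rightarrow> 'b::{banach, second_countable_topology}"
  assumes [measurable]: "f \<in> borel_measurable borel" and "c \<noteq> 0"
  shows "(LINT z|lborel. f z) = (\<bar>c\<bar> ^ DIM('a)) *\<^sub>R (LINT y|lborel. f (t + c *\<^sub>R y))"
  by (subst lborel_affine[OF \<open>c \<noteq> 0\<close>, of t])
     (simp add: integral_density integral_distr)

lemma integrable_lborel_affine:
  fixes f :: "'a::euclidean_space \<Rightarrow> 'b::{banach, second_countable_topology}"
  assumes f: "integrable lborel f" and "c \<noteq> 0"
  shows "integrable lborel (\<lambda>y. f (t + c *\<^sub>R y))"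
proof -
  have [measurable]: "f \<in> borel_measurable borel"
    using f by auto
  have "ennreal (\<bar>c\<bar> ^ DIM('a)) * (\<integral>\<^sup>+y. norm (f (t + c *\<^sub>R y)) \<partial>lborel) < \<infinity>"
    using f unfolding integrable_iff_bounded
    by (subst nn_integral_lborel_affine[OF _ \<open>c \<noteq> 0\<close>, symmetric]) auto
  then show ?thesis
    unfolding integrable_iff_bounded
    using \<open>c \<noteq> 0\<close> by (auto simp: ennreal_mult_less_top)
qed

lemma nn_integral_lborel_translate:
  fixes f :: "'a::euclidean_space \<Rightarrow> ennreal"
  assumes "f \<in> borel_measurable borel"
  shows "(\<integral>\<^sup>+x. f (x + h) \<partial>lborel) = (\<integral>\<^sup>+x. f x \<partial>lborel)"
  using nn_integral_lborel_affine[OF assms, of 1 h] by (simp add: add.commute)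

lemma integral_lborel_translate:
  fixes f :: "'a::euclidean_space \<Rightarrow> 'b::{banach, second_countable_topology}"
  assumes "f \<in> borel_measurable borel"
  shows "(LINT x|lborel. f (x + h)) = (LINT x|lborel. f x)"
  using integral_lborel_affine[OF assms, of 1 h] by (simp add: add.commute)

lemma integrable_lborel_translate:
  fixes f :: "'a::euclidean_space \<Rightarrow> 'b::{banach, second_countable_topology}"
  assumes "integrable lborel f"
  shows "integrable lborel (\<lambda>x. f (x + h))"
  using integrable_lborel_affine[OF assms, of 1 h] by (simp add: add.commute)

text \<open>Squeeze \<open>A\<close> between a compact \<open>K\<close> and an open \<open>U\<close>
  with \<open>U - K\<close> small. A shift shorter than the distance from \<open>K\<close> to the
  complement of \<open>U\<close> changes membership in \<open>A\<close> only where the point or its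
  shift lies in \<open>U - K\<close>.\<close>

lemma indicator_translation_continuous:
  fixes A :: "'a::euclidean_space set"
  assumes A: "A \<in> sets borel" "emeasure lborel A < \<infinity>" and \<eta>: "\<eta> > 0"
  shows "\<exists>d>0. \<forall>h. norm h < d \<longrightarrow>
    (\<integral>\<^sup>+x. ennreal \<bar>indicator A (x + h) - indicator A x\<bar> \<partial>lborel) \<le> ennreal \<eta>"
proof -
  have "A \<in> lmeasurable"
    using A by (auto simp: fmeasurable_def emeasure_completion)
  obtain U where U: "open U" "A \<subseteq> U" "U - A \<in> lmeasurable" "emeasure lebesgue (U - A) < ennreal (\<eta> / 4)"
    using sets_lebesgue_outer_open[of A "\<eta> / 4"] \<open>A \<in> lmeasurable\<close> \<eta> by auto
  obtain C where C: "closed C" "C \<subseteq> A" "A - C \<in> lmeasurable" "emeasure lebesgue (A - C) < ennreal (\<eta> / 8)"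
    using sets_lebesgue_inner_closed[of A "\<eta> / 8"] \<open>A \<in> lmeasurable\<close> \<eta> by auto
  \<comment> \<open>Inner regularity provides only a closed \<open>C\<close>; cutting it with a
    large ball makes it compact at small cost in measure.\<close>
  define C' where "C' n = C \<inter> cball 0 (real n)" for n :: nat
  have Cl: "C \<in> lmeasurable"
    using C by (intro fmeasurableI2[OF \<open>A \<in> lmeasurable\<close>]) (auto intro!: sets_completionI_sets borel_closed)
  have "(\<lambda>n. measure lebesgue (C' n)) \<longlonglongrightarrow> measure lebesgue (\<Union>n. C' n)"
  proof (rule Lim_measure_incseq)
    show "range C' \<subseteq> sets lebesgue"
      using \<open>closed C\<close> by (auto simp: C'_def intro!: sets_completionI_sets borel_closed)
    show "incseq C'"
      by (auto simp: incseq_def C'_def)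
    have "(\<Union>n. C' n) \<subseteq> C" by (auto simp: C'_def)
    then have "emeasure lebesgue (\<Union>n. C' n) \<le> emeasure lebesgue C"
      using Cl by (intro emeasure_mono) auto
    then show "emeasure lebesgue (\<Union> (range C')) \<noteq> \<infinity>"
      using Cl by (auto simp: fmeasurable_def)
  qed
  moreover have "(\<Union>n. C' n) = C"
    by (auto simp: C'_def real_arch_simple)
  ultimately have "(\<lambda>n. measure lebesgue (C' n)) \<longlonglongrightarrow> measure lebesgue C" by simp
  then have "\<forall>\<^sub>F n in sequentially. measure lebesgue (C' n) > measure lebesgue C - \<eta> / 8"
    using \<eta> by (intro order_tendstoD(1)) auto
  then obtain n where n: "measure lebesgue (C' n) > measure lebesgue C - \<eta> / 8"
    by (auto simp: eventually_sequentially)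
  define K where "K = C' n"
  have K: "compact K" "K \<subseteq> A"
    using C by (auto simp: K_def C'_def closed_Int_compact)
  have Kl: "K \<in> lmeasurable"
    using K(1) lmeasurable_compact by blast
  have m1: "measure lebesgue (A - C) < \<eta> / 8" "measure lebesgue (U - A) < \<eta> / 4"
    using C(3,4) U(3,4) \<eta> by (auto simp: emeasure_eq_measure2 ennreal_less_iff)
  \<comment> \<open>Pieces of size \<open>\<eta> / 4\<close>, \<open>\<eta> / 8\<close> and
    \<open>\<eta> / 8\<close>: the measure must stay below \<open>\<eta> / 2\<close> because
    \<open>Y\<close> is counted twice, once at \<open>x\<close> and once at
    \<open>x + h\<close>.\<close>
  define Y where "Y = (U - A) \<union> (A - C) \<union> (C - K)"
  have CK: "C - K \<in> lmeasurable" "measure lebesgue (C - K) < \<eta> / 8"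
    using Cl Kl n by (auto simp: K_def C'_def measurable_measure_Diff intro: fmeasurable_Diff fmeasurableD)
  have Yl: "Y \<in> lmeasurable"
    using U C CK by (auto simp: Y_def)
  have "measure lebesgue Y \<le> measure lebesgue ((U - A) \<union> (A - C)) + measure lebesgue (C - K)"
    unfolding Y_def using U C CK by (intro measure_Un_le) auto
  also have "\<dots> \<le> measure lebesgue (U - A) + measure lebesgue (A - C) + measure lebesgue (C - K)"
    using U C CK by (intro add_right_mono measure_Un_le) auto
  also have "\<dots> < \<eta> / 2"
    using m1 CK by simp
  finally have Y: "measure lebesgue Y \<le> \<eta> / 2" by simp
  have YU: "Y = U - K"
    using U C K by (auto simp: Y_def K_def C'_def)
  then have Yb: "Y \<in> sets borel"
    using U K by (auto intro: borel_open borel_compact)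
  have eY: "emeasure lborel Y \<le> ennreal (\<eta> / 2)"
  proof -
    have "emeasure lborel Y = emeasure lebesgue Y"
      using Yb by simp
    also have "\<dots> = ennreal (measure lebesgue Y)"
      using Yl by (rule emeasure_eq_measure2)
    finally show ?thesis
      using Y by (simp add: ennreal_leI)
  qed
  obtain d where d: "d > 0" "\<And>x y. x \<in> K \<Longrightarrow> dist x y < d \<Longrightarrow> y \<in> U"
  proof -
    have "K \<subseteq> U"
      using K U by blast
    then obtain d where "d > 0" "(\<Union>x\<in>K. ball x d) \<subseteq> U"
      using compact_subset_open_imp_ball_epsilon_subset[OF K(1) U(1)] by blast
    then show ?thesis
      using that[of d] by (meson UN_subset_iff mem_ball subsetD)
  qed
  have "(\<integral>\<^sup>+x. ennreal \<bar>indicator A (x + h) - indicator A x\<bar> \<partial>lborel) \<le> ennreal \<eta>" if h: "norm h < d" for h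
  proof -
    have le: "ennreal \<bar>indicator A (x + h) - indicator A x\<bar> \<le> indicator Y x + indicator Y (x + h)" for x
    proof -
      have "x \<in> Y \<or> x + h \<in> Y" if "(x \<in> A) \<noteq> (x + h \<in> A)"
      proof (cases "x \<in> A")
        case True
        then show ?thesis
          using that d(2)[of x "x + h"] h U K by (auto simp: YU dist_norm)
      next
        case False
        then show ?thesis
          using that d(2)[of "x + h" x] h U K by (auto simp: YU dist_norm)
      qed
      then show ?thesis
        by (auto simp: indicator_def)
    qed
    have "(\<integral>\<^sup>+x. ennreal \<bar>indicator A (x + h) - indicator A x\<bar> \<partial>lborel)
        \<le> (\<integral>\<^sup>+x. (indicator Y x + indicator Y (x + h)) \<partial>lborel)"
      by (intro nn_integral_mono le)
    also have "\<dots> = emeasure lborel Y + (\<integral>\<^sup>+x. indicator Y (x + h) \<partial>lborel)"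
      using Yb by (subst nn_integral_add) auto
    also have "(\<integral>\<^sup>+x. indicator Y (x + h) \<partial>lborel) = emeasure lborel Y"
      using Yb by (subst nn_integral_lborel_translate) auto
    also have "emeasure lborel Y + emeasure lborel Y \<le> ennreal (\<eta> / 2) + ennreal (\<eta> / 2)"
      by (intro add_mono eY)
    also have "\<dots> = ennreal \<eta>"
      using \<eta> by (subst ennreal_plus[symmetric]) auto
    finally show ?thesis .
  qed
  then show ?thesis
    using d(1) by blast
qed

text \<open>Density: the claim holds for indicators and passes to sums. Translation preserves the
  integral, so approximating \<open>f\<close> by \<open>s i\<close> costs the same before and after
  the shift.\<close>

lemma L1_translation_continuous:
  fixes f :: "'a::euclidean_space \<Rightarrow> 'b::{banach, second_countable_topology}"
  assumes "integrable lborel f"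
  shows "\<forall>\<eta>>0. \<exists>d>0. \<forall>h. norm h < d \<longrightarrow> (\<integral>\<^sup>+x. norm (f (x + h) - f x) \<partial>lborel) \<le> ennreal \<eta>"
  using assms
proof (induction f rule: integrable_induct)
  case (base A c)
  show ?case
  proof (intro allI impI)
    fix \<eta> :: real assume "\<eta> > 0"
    then have "\<eta> / (norm c + 1) > 0"
      by (simp add: add_nonneg_pos)
    moreover have "A \<in> sets borel" "emeasure lborel A < \<infinity>"
      using base by auto
    ultimately obtain d where d: "d > 0" "\<And>h. norm h < d \<Longrightarrow>
        (\<integral>\<^sup>+x. ennreal \<bar>indicator A (x + h) - indicator A x\<bar> \<partial>lborel) \<le> ennreal (\<eta> / (norm c + 1))"
      using indicator_translation_continuous[of A "\<eta> / (norm c + 1)"] by blast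
    have "(\<integral>\<^sup>+x. norm (indicator A (x + h) *\<^sub>R c - indicator A x *\<^sub>R c) \<partial>lborel) \<le> ennreal \<eta>"
      if "norm h < d" for h
    proof -
      have [measurable]: "A \<in> sets borel" by fact
      have "(\<integral>\<^sup>+x. norm (indicator A (x + h) *\<^sub>R c - indicator A x *\<^sub>R c) \<partial>lborel)
         = (\<integral>\<^sup>+x. ennreal (norm c) * ennreal \<bar>indicator A (x + h) - indicator A x\<bar> \<partial>lborel)"
        by (simp add: scaleR_diff_left[symmetric] ennreal_mult[symmetric] mult.commute del: scaleR_diff_left)
      also have "\<dots> = ennreal (norm c) * (\<integral>\<^sup>+x. ennreal \<bar>indicator A (x + h) - indicator A x\<bar> \<partial>lborel)"
        by (rule nn_integral_cmult) measurable
      also have "\<dots> \<le> ennreal (norm c) * ennreal (\<eta> / (norm c + 1))"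
        by (intro mult_left_mono d that) auto
      also have "\<dots> = ennreal (norm c * (\<eta> / (norm c + 1)))"
        using \<open>\<eta> > 0\<close> by (subst ennreal_mult[symmetric]) (auto intro!: divide_nonneg_nonneg add_nonneg_nonneg)
      also have "\<dots> \<le> ennreal \<eta>"
        using \<open>\<eta> > 0\<close> by (intro ennreal_leI, subst times_divide_eq_right, subst pos_divide_le_eq)
          (use norm_ge_zero[of c] in \<open>auto simp: algebra_simps simp del: norm_ge_zero\<close>)
      finally show ?thesis .
    qed
    then show "\<exists>d>0. \<forall>h. norm h < d \<longrightarrow>
        (\<integral>\<^sup>+x. norm (indicator A (x + h) *\<^sub>R c - indicator A x *\<^sub>R c) \<partial>lborel) \<le> ennreal \<eta>"
      using d(1) by blast
  qed
next
  case (add f g)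
  show ?case
  proof (intro allI impI)
    fix \<eta> :: real assume "\<eta> > 0"
    then have "\<eta> / 2 > 0" by simp
    obtain d1 where d1: "d1 > 0" "\<And>h. norm h < d1 \<Longrightarrow> (\<integral>\<^sup>+x. norm (f (x + h) - f x) \<partial>lborel) \<le> ennreal (\<eta> / 2)"
      using add.IH(1) \<open>\<eta> / 2 > 0\<close> by meson
    obtain d2 where d2: "d2 > 0" "\<And>h. norm h < d2 \<Longrightarrow> (\<integral>\<^sup>+x. norm (g (x + h) - g x) \<partial>lborel) \<le> ennreal (\<eta> / 2)"
      using add.IH(2) \<open>\<eta> / 2 > 0\<close> by meson
    have [measurable]: "f \<in> borel_measurable borel" "g \<in> borel_measurable borel"
      using add.hyps by auto
    have "(\<integral>\<^sup>+x. norm (f (x + h) + g (x + h) - (f x + g x)) \<partial>lborel) \<le> ennreal \<eta>"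
      if "norm h < min d1 d2" for h
    proof -
      have "(\<integral>\<^sup>+x. norm (f (x + h) + g (x + h) - (f x + g x)) \<partial>lborel)
         \<le> (\<integral>\<^sup>+x. (ennreal (norm (f (x + h) - f x)) + ennreal (norm (g (x + h) - g x))) \<partial>lborel)"
        by (intro nn_integral_mono)
           (simp add: ennreal_plus[symmetric] norm_diff_triangle_ineq del: ennreal_plus)
      also have "\<dots> = (\<integral>\<^sup>+x. norm (f (x + h) - f x) \<partial>lborel) + (\<integral>\<^sup>+x. norm (g (x + h) - g x) \<partial>lborel)"
        by (rule nn_integral_add) measurable
      also have "\<dots> \<le> ennreal (\<eta> / 2) + ennreal (\<eta> / 2)"
        using that by (intro add_mono d1 d2) auto
      also have "\<dots> = ennreal \<eta>"
        using \<open>\<eta> > 0\<close> by (subst ennreal_plus[symmetric]) auto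
      finally show ?thesis .
    qed
    then show "\<exists>d>0. \<forall>h. norm h < d \<longrightarrow>
        (\<integral>\<^sup>+x. norm (f (x + h) + g (x + h) - (f x + g x)) \<partial>lborel) \<le> ennreal \<eta>"
      using d1(1) d2(1) by (intro exI[of _ "min d1 d2"]) auto
  qed
next
  case (lim f s)
  have [measurable]: "f \<in> borel_measurable borel" "\<And>i. s i \<in> borel_measurable borel"
    using lim.hyps by auto
  have "(\<lambda>i. \<integral>\<^sup>+x. norm (f x - s i x) \<partial>lborel) \<longlonglongrightarrow> 0"
    using lim.hyps by (intro nn_integral_dominated_convergence_norm[where w = "\<lambda>x. 2 * norm (f x)"])
      (auto simp: integrable_iff_bounded ennreal_mult nn_integral_cmult ennreal_mult_less_top)
  show ?case
  proof (intro allI impI)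
    fix \<eta> :: real assume "\<eta> > 0"
    then have "\<eta> / 3 > 0" by simp
    have "\<forall>\<^sub>F i in sequentially. (\<integral>\<^sup>+x. norm (f x - s i x) \<partial>lborel) < ennreal (\<eta> / 3)"
      using \<open>\<eta> / 3 > 0\<close> \<open>(\<lambda>i. \<integral>\<^sup>+x. norm (f x - s i x) \<partial>lborel) \<longlonglongrightarrow> 0\<close>
      by (intro order_tendstoD(2)) auto
    then obtain i where i: "(\<integral>\<^sup>+x. norm (f x - s i x) \<partial>lborel) \<le> ennreal (\<eta> / 3)"
      by (auto simp: eventually_sequentially intro: less_imp_le)
    obtain d where d: "d > 0" "\<And>h. norm h < d \<Longrightarrow> (\<integral>\<^sup>+x. norm (s i (x + h) - s i x) \<partial>lborel) \<le> ennreal (\<eta> / 3)"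
      using lim.IH \<open>\<eta> / 3 > 0\<close> by meson
    have "(\<integral>\<^sup>+x. norm (f (x + h) - f x) \<partial>lborel) \<le> ennreal \<eta>" if "norm h < d" for h
    proof -
      have tri: "norm (f (x + h) - f x) \<le>
          norm (f (x + h) - s i (x + h)) + norm (s i (x + h) - s i x) + norm (f x - s i x)" for x
        by norm
      have "(\<integral>\<^sup>+x. norm (f (x + h) - f x) \<partial>lborel)
         \<le> (\<integral>\<^sup>+x. (ennreal (norm (f (x + h) - s i (x + h))) + ennreal (norm (s i (x + h) - s i x)))
               + ennreal (norm (f x - s i x)) \<partial>lborel)"
        by (intro nn_integral_mono)
           (simp add: ennreal_plus[symmetric] tri del: ennreal_plus)
      also have "\<dots> = (\<integral>\<^sup>+x. norm (f (x + h) - s i (x + h)) \<partial>lborel)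
          + (\<integral>\<^sup>+x. norm (s i (x + h) - s i x) \<partial>lborel) + (\<integral>\<^sup>+x. norm (f x - s i x) \<partial>lborel)"
        by (subst nn_integral_add, measurable)+
      also have "(\<integral>\<^sup>+x. norm (f (x + h) - s i (x + h)) \<partial>lborel) = (\<integral>\<^sup>+x. norm (f x - s i x) \<partial>lborel)"
        by (rule nn_integral_lborel_translate[of "\<lambda>x. norm (f x - s i x)"]) measurable
      also have "(\<integral>\<^sup>+x. norm (f x - s i x) \<partial>lborel) + (\<integral>\<^sup>+x. norm (s i (x + h) - s i x) \<partial>lborel)
          + (\<integral>\<^sup>+x. norm (f x - s i x) \<partial>lborel) \<le> ennreal (\<eta> / 3) + ennreal (\<eta> / 3) + ennreal (\<eta> / 3)"
        using that by (intro add_mono d i) auto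
      also have "\<dots> = ennreal \<eta>"
        using \<open>\<eta> > 0\<close> by (simp add: ennreal_plus[symmetric] del: ennreal_plus)
      finally show ?thesis .
    qed
    then show "\<exists>d>0. \<forall>h. norm h < d \<longrightarrow> (\<integral>\<^sup>+x. norm (f (x + h) - f x) \<partial>lborel) \<le> ennreal \<eta>"
      using d(1) by blast
  qed
qed

text \<open>Strong convergence of translates and mollifications of \<open>G\<close> is only ever needed when integrated against a
  fixed weight \<open>B\<close>; this covers square integrable and bounded weights at once.\<close>

definition translation_continuous ::
  "('a::euclidean_space \<Rightarrow> 'c::real_normed_vector) \<Rightarrow> ('a \<Rightarrow> 'b::real_normed_vector) \<Rightarrow> bool" where
  "translation_continuous B G \<longleftrightarrow> (\<forall>\<eta>>0. \<exists>d>0. \<forall>h. norm h < d \<longrightarrow>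
     (\<integral>\<^sup>+x. ennreal (norm (B x) * norm (G (x + h) - G x)) \<partial>lborel) \<le> ennreal \<eta>)"

lemma translation_continuous_bounded:
  fixes G :: "'a::euclidean_space \<Rightarrow> 'b::{banach, second_countable_topology}"
  assumes G: "integrable lborel G" and B: "\<And>x. norm (B x) \<le> M"
  shows "translation_continuous B G"
  unfolding translation_continuous_def
proof (intro allI impI)
  fix \<eta> :: real assume "\<eta> > 0"
  have [measurable]: "G \<in> borel_measurable borel" using G by auto
  have "M \<ge> 0" using B[of undefined] norm_ge_zero order_trans by blast
  have "\<eta> / (M + 1) > 0"
    using \<open>\<eta> > 0\<close> \<open>M \<ge> 0\<close> by simp
  then obtain d where d: "d > 0" "\<And>h. norm h < d \<Longrightarrow> (\<integral>\<^sup>+x. norm (G (x + h) - G x) \<partial>lborel) \<le> ennreal (\<eta> / (M + 1))"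
    using L1_translation_continuous[OF G] by meson
  have "(\<integral>\<^sup>+x. ennreal (norm (B x) * norm (G (x + h) - G x)) \<partial>lborel) \<le> ennreal \<eta>" if "norm h < d" for h
  proof -
    have "(\<integral>\<^sup>+x. ennreal (norm (B x) * norm (G (x + h) - G x)) \<partial>lborel)
        \<le> (\<integral>\<^sup>+x. ennreal M * ennreal (norm (G (x + h) - G x)) \<partial>lborel)"
      using \<open>M \<ge> 0\<close> B by (intro nn_integral_mono) (simp add: ennreal_mult[symmetric] mult_right_mono)
    also have "\<dots> = ennreal M * (\<integral>\<^sup>+x. norm (G (x + h) - G x) \<partial>lborel)"
      by (rule nn_integral_cmult) measurable
    also have "\<dots> \<le> ennreal M * ennreal (\<eta> / (M + 1))"
      by (intro mult_left_mono d that) auto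
    also have "\<dots> = ennreal (M * (\<eta> / (M + 1)))"
      using \<open>\<eta> > 0\<close> \<open>M \<ge> 0\<close> by (subst ennreal_mult[symmetric]) auto
    also have "\<dots> \<le> ennreal \<eta>"
      using \<open>\<eta> > 0\<close> \<open>M \<ge> 0\<close> by (intro ennreal_leI) (simp add: field_simps)
    finally show ?thesis .
  qed
  then show "\<exists>d>0. \<forall>h. norm h < d \<longrightarrow>
     (\<integral>\<^sup>+x. ennreal (norm (B x) * norm (G (x + h) - G x)) \<partial>lborel) \<le> ennreal \<eta>"
    using d(1) by blast
qed

text \<open>Where \<open>B\<close> is at most \<open>N\<close>, continuity in \<open>L^1\<close>
  suffices; where it is larger, Young's inequality with weight \<open>K\<close> puts the cost on the
  tail of \<open>B\<close> and on the fixed square norm of \<open>G\<close>.\<close>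

lemma translation_continuous_L2:
  fixes G :: "'a::euclidean_space \<Rightarrow> 'b::{banach, second_countable_topology}"
    and B :: "'a \<Rightarrow> 'c::{banach, second_countable_topology}"
  assumes G: "integrable lborel G" "integrable lborel (\<lambda>x. (norm (G x))\<^sup>2)"
    and B[measurable]: "B \<in> borel_measurable borel" and B2: "integrable lborel (\<lambda>x. (norm (B x))\<^sup>2)"
  shows "translation_continuous B G"
  unfolding translation_continuous_def
proof (intro allI impI)
  fix \<eta> :: real assume "\<eta> > 0"
  have [measurable]: "G \<in> borel_measurable borel" using G by auto
  define g where "g = (LINT x|lborel. (norm (G x))\<^sup>2)"
  have g0: "g \<ge> 0" by (simp add: g_def)
  \<comment> \<open>\<open>K\<close> comes first: the Young term in \<open>G\<close> integrates to
    \<open>2 / K * g\<close>, which has to stay below \<open>\<eta> / 3\<close>. Then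
    \<open>N\<close> makes the tail of \<open>B\<close> small for this \<open>K\<close>, and
    \<open>d\<close> is chosen for this \<open>N\<close>.\<close>
  define K where "K = 6 * (g + 1) / \<eta>"
  have K: "K > 0" using g0 \<open>\<eta> > 0\<close> by (simp add: K_def)
  have Kg: "2 / K * g \<le> \<eta> / 3"
    using g0 \<open>\<eta> > 0\<close> by (simp add: K_def field_simps)
  define t where "t N x = indicator {x. norm (B x) > real N} x * (norm (B x))\<^sup>2" for N x
  have [measurable]: "t N \<in> borel_measurable borel" for N
    unfolding t_def by measurable
  have "(\<lambda>N. LINT x|lborel. t N x) \<longlonglongrightarrow> (LINT x|(lborel :: 'a measure). 0)"
  proof (rule integral_dominated_convergence[where w = "\<lambda>x. (norm (B x))\<^sup>2"])
    show "integrable lborel (\<lambda>x. (norm (B x))\<^sup>2)" by fact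
    show "AE x in lborel. (\<lambda>N. t N x) \<longlonglongrightarrow> 0"
    proof (rule AE_I2)
      fix x
      obtain N where "norm (B x) \<le> real N" using real_arch_simple by blast
      then have "\<forall>n\<ge>N. t n x = 0" by (auto simp: t_def indicator_def)
      then show "(\<lambda>N. t N x) \<longlonglongrightarrow> 0"
        by (intro tendsto_eventually) (auto simp: eventually_sequentially)
    qed
  qed (auto simp: t_def indicator_def)
  then have "\<forall>\<^sub>F N in sequentially. (LINT x|lborel. t N x) < 2 / K * (\<eta> / 3)"
    using K \<open>\<eta> > 0\<close> by (intro order_tendstoD(2)) auto
  then obtain N where N: "(LINT x|lborel. t N x) < 2 / K * (\<eta> / 3)"
    by (auto simp: eventually_sequentially)
  have tint: "integrable lborel (t N)"
    by (rule Bochner_Integration.integrable_bound[OF B2]) (auto simp: t_def indicator_def)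
  have "\<eta> / (3 * (real N + 1)) > 0" using \<open>\<eta> > 0\<close> by simp
  then obtain d where d: "d > 0" "\<And>h. norm h < d \<Longrightarrow>
      (\<integral>\<^sup>+x. norm (G (x + h) - G x) \<partial>lborel) \<le> ennreal (\<eta> / (3 * (real N + 1)))"
    using L1_translation_continuous[OF G(1)] by meson
  have "(\<integral>\<^sup>+x. ennreal (norm (B x) * norm (G (x + h) - G x)) \<partial>lborel) \<le> ennreal \<eta>" if "norm h < d" for h
  proof -
    define D where "D x = G (x + h) - G x" for x
    have [measurable]: "D \<in> borel_measurable borel" unfolding D_def by measurable
    have Dint: "integrable lborel D"
      unfolding D_def using G by (intro Bochner_Integration.integrable_diff integrable_lborel_translate)
    have "(\<integral>\<^sup>+x. norm (D x) \<partial>lborel) = ennreal (LINT x|lborel. norm (D x))"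
      using Dint by (intro nn_integral_eq_integral) auto
    then have D1: "(LINT x|lborel. norm (D x)) \<le> \<eta> / (3 * (real N + 1))"
      using d(2)[OF that] \<open>\<eta> > 0\<close> by (simp add: D_def)
    have Gt: "integrable lborel (\<lambda>x. (norm (G (x + h)))\<^sup>2)"
      using integrable_lborel_translate[OF G(2)] .
    have gt: "(LINT x|lborel. (norm (G (x + h)))\<^sup>2) = g"
      unfolding g_def by (rule integral_lborel_translate) measurable
    define R where "R x = real N * norm (D x) + K / 2 * t N x
        + 1 / K * ((norm (G (x + h)))\<^sup>2 + (norm (G x))\<^sup>2)" for x
    have Rint: "integrable lborel R"
      unfolding R_def using Dint tint Gt G by auto
    have le: "norm (B x) * norm (D x) \<le> R x" for x
    proof (cases "norm (B x) \<le> real N")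
      case True
      then have "norm (B x) * norm (D x) \<le> real N * norm (D x)"
        by (intro mult_right_mono) auto
      moreover have "t N x = 0"
        using True by (simp add: t_def)
      moreover have "1 / K * ((norm (G (x + h)))\<^sup>2 + (norm (G x))\<^sup>2) \<ge> 0"
        using K by simp
      ultimately show ?thesis
        unfolding R_def by (simp only: mult_zero_right add_0_right add_increasing2)
    next
      case False
      have "norm (D x) \<le> norm (G (x + h)) + norm (G x)"
        unfolding D_def by (rule norm_triangle_ineq4)
      then have "(norm (D x))\<^sup>2 \<le> (norm (G (x + h)) + norm (G x))\<^sup>2"
        by (intro power_mono) auto
      also have "\<dots> \<le> 2 * ((norm (G (x + h)))\<^sup>2 + (norm (G x))\<^sup>2)"
        using sum_squares_bound[of "norm (G (x + h))" "norm (G x)"] by (simp add: power2_sum)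
      finally have 1: "(norm (D x))\<^sup>2 / (2 * K) \<le> 1 / K * ((norm (G (x + h)))\<^sup>2 + (norm (G x))\<^sup>2)"
        using K by (simp add: field_simps)
      have "0 \<le> (K * norm (B x) - norm (D x))\<^sup>2" by simp
      then have "norm (B x) * norm (D x) \<le> K / 2 * (norm (B x))\<^sup>2 + (norm (D x))\<^sup>2 / (2 * K)"
        using K by (simp add: power2_diff field_simps power2_eq_square)
      moreover have "real N * norm (D x) \<ge> 0" by simp
      moreover have tN: "t N x = (norm (B x))\<^sup>2"
        using False by (simp add: t_def)
      ultimately show ?thesis
        using 1 unfolding R_def tN by linarith
    qed
    have "(LINT x|lborel. R x) = real N * (LINT x|lborel. norm (D x)) + K / 2 * (LINT x|lborel. t N x)
        + 1 / K * (g + g)"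
      unfolding R_def using Dint tint Gt G gt by (simp add: g_def)
    also have "\<dots> \<le> real N * (\<eta> / (3 * (real N + 1))) + K / 2 * (2 / K * (\<eta> / 3)) + \<eta> / 3"
      using D1 N K Kg by (intro add_mono mult_left_mono) auto
    also have "\<dots> \<le> \<eta>"
    proof -
      have "real N * (\<eta> / (3 * (real N + 1))) \<le> \<eta> / 3"
        using \<open>\<eta> > 0\<close> by (simp add: field_simps)
      moreover have e: "K / 2 * (2 / K * (\<eta> / 3)) = \<eta> / 3"
        using K by simp
      ultimately show ?thesis unfolding e by linarith
    qed
    finally have "(LINT x|lborel. R x) \<le> \<eta>" .
    have "(\<integral>\<^sup>+x. ennreal (norm (B x) * norm (D x)) \<partial>lborel) \<le> (\<integral>\<^sup>+x. ennreal (R x) \<partial>lborel)"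
      by (intro nn_integral_mono ennreal_leI le)
    also have "\<dots> = ennreal (LINT x|lborel. R x)"
      using Rint le by (intro nn_integral_eq_integral) (auto intro!: AE_I2 order_trans[OF _ le])
    also have "\<dots> \<le> ennreal \<eta>"
      using \<open>(LINT x|lborel. R x) \<le> \<eta>\<close> by (rule ennreal_leI)
    finally show ?thesis by (simp add: D_def)
  qed
  then show "\<exists>d>0. \<forall>h. norm h < d \<longrightarrow>
     (\<integral>\<^sup>+x. ennreal (norm (B x) * norm (G (x + h) - G x)) \<partial>lborel) \<le> ennreal \<eta>"
    using d(1) by blast
qed

section \<open>Mollification\<close>

definition mollifier :: "('a::euclidean_space \<Rightarrow> real) \<Rightarrow> 'a set \<Rightarrow> bool" where
  "mollifier \<rho> S \<longleftrightarrow> smooth \<rho> \<and> (\<forall>y. \<rho> y \<ge> 0) \<and> compact S \<and> (\<forall>y. \<rho> y \<noteq> 0 \<longrightarrow> y \<in> S) \<and>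
     integrable lborel \<rho> \<and> (LINT y|lborel. \<rho> y) = 1"

text \<open>The kernel is reflected compared with the usual convolution: the average runs over
  \<open>x + \<epsilon> *\<^sub>R S\<close>, so a set \<open>S\<close> of inward directions samples
  \<open>f\<close> inside the domain only.\<close>

definition mollify :: "('a::euclidean_space \<Rightarrow> real) \<Rightarrow> real \<Rightarrow> ('a \<Rightarrow> 'b) \<Rightarrow> 'a \<Rightarrow> 'b::{banach, second_countable_topology}" where
  "mollify \<rho> \<epsilon> f x = (LINT y|lborel. \<rho> y *\<^sub>R f (x + \<epsilon> *\<^sub>R y))"

lemma mollifierD:
  assumes "mollifier \<rho> S"
  shows "Ck k \<rho>" "\<rho> y \<ge> 0" "compact S" "y \<notin> S \<Longrightarrow> \<rho> y = 0" "integrable lborel \<rho>" "(LINT y|lborel. \<rho> y) = 1"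
    "\<rho> \<in> borel_measurable borel"
  using assms by (auto simp: mollifier_def smooth_def)

lemma mollifier_cball_exists:
  fixes e :: "'a::euclidean_space"
  assumes "\<kappa> > 0"
  obtains \<rho> where "mollifier \<rho> (cball e \<kappa>)"
proof -
  obtain \<rho> :: "'a \<Rightarrow> real" where "smooth \<rho>" "\<And>y. \<rho> y \<ge> 0" "\<And>y. \<rho> y \<noteq> 0 \<Longrightarrow> y \<in> cball e \<kappa>"
    "integrable lborel \<rho>" "(LINT y|lborel. \<rho> y) = 1"
    using mollifier_exists[OF assms] by metis
  then show ?thesis
    by (intro that[of \<rho>]) (auto simp: mollifier_def simp del: mem_cball)
qed

lemma continuous_compact_support_bounded:
  fixes f :: "'a::euclidean_space \<Rightarrow> real"
  assumes "continuous_on UNIV f" "compact S" "\<And>y. y \<notin> S \<Longrightarrow> f y = 0"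
  obtains M where "M \<ge> 0" "\<And>y. \<bar>f y\<bar> \<le> M"
proof -
  have "compact (f ` S)"
    using assms by (intro compact_continuous_image) (auto intro: continuous_on_subset)
  then obtain M where M: "\<And>y. y \<in> S \<Longrightarrow> \<bar>f y\<bar> \<le> M"
    using compact_imp_bounded[of "f ` S"] by (auto simp: bounded_iff)
  have "\<bar>f y\<bar> \<le> max M 0" for y
    using M[of y] assms(3)[of y] by (cases "y \<in> S") auto
  then show ?thesis
    by (intro that[of "max M 0"]) auto
qed

lemma mollify_integrable:
  fixes f :: "'a::euclidean_space \<Rightarrow> 'b::{banach, second_countable_topology}"
  assumes \<rho>: "mollifier \<rho> S" and f: "integrable lborel f" and "\<epsilon> \<noteq> 0"
  shows "integrable lborel (\<lambda>y. \<rho> y *\<^sub>R f (x + \<epsilon> *\<^sub>R y))"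
proof -
  note [measurable] = mollifierD(7)[OF \<rho>]
  have [measurable]: "f \<in> borel_measurable borel" using f by auto
  obtain M where M: "M \<ge> 0" "\<And>y. \<bar>\<rho> y\<bar> \<le> M"
    using continuous_compact_support_bounded[of \<rho> S] mollifierD(1)[OF \<rho>, of 0] mollifierD(3,4)[OF \<rho>]
    by auto
  have "integrable lborel (\<lambda>y. M *\<^sub>R f (x + \<epsilon> *\<^sub>R y))"
    by (intro integrable_scaleR_right integrable_lborel_affine f \<open>\<epsilon> \<noteq> 0\<close>)
  then show ?thesis
    by (rule Bochner_Integration.integrable_bound) (use M in \<open>auto intro!: AE_I2 mult_right_mono\<close>)
qed

lemma borel_measurable_mollify:
  fixes f :: "'a::euclidean_space \<Rightarrow> 'b::{banach, second_countable_topology}"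
  assumes \<rho>: "mollifier \<rho> S" and [measurable]: "f \<in> borel_measurable borel"
  shows "mollify \<rho> \<epsilon> f \<in> borel_measurable borel"
proof -
  note [measurable] = mollifierD(7)[OF \<rho>]
  show ?thesis
    unfolding mollify_def by measurable
qed

text \<open>By Tonelli the error is at most the average, with weight \<open>\<rho>\<close>, of the
  errors of the translates by \<open>\<epsilon> *\<^sub>R y\<close>. These shifts are shorter than
  \<open>d\<close> once \<open>\<epsilon> < d / R\<close>, where \<open>R\<close> bounds the
  support.\<close>

lemma mollify_converges:
  fixes G :: "'a::euclidean_space \<Rightarrow> 'b::{banach, second_countable_topology}"
  assumes \<rho>: "mollifier \<rho> S" and G: "integrable lborel G" and [measurable]: "B \<in> borel_measurable borel"
    and BG: "translation_continuous B G" and "\<eta> > 0"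
  shows "\<exists>d>0. \<forall>\<epsilon>. 0 < \<epsilon> \<and> \<epsilon> < d \<longrightarrow>
    (\<integral>\<^sup>+x. ennreal (norm (B x) * norm (mollify \<rho> \<epsilon> G x - G x)) \<partial>lborel) \<le> ennreal \<eta>"
proof -
  note [measurable] = mollifierD(7)[OF \<rho>]
  have [measurable]: "G \<in> borel_measurable borel" using G by auto
  obtain R where R: "R > 0" "\<And>y. y \<in> S \<Longrightarrow> norm y \<le> R"
    using mollifierD(3)[OF \<rho>] compact_imp_bounded bounded_pos by metis
  obtain d where d: "d > 0" "\<And>h. norm h < d \<Longrightarrow>
     (\<integral>\<^sup>+x. ennreal (norm (B x) * norm (G (x + h) - G x)) \<partial>lborel) \<le> ennreal \<eta>"
    using BG \<open>\<eta> > 0\<close> unfolding translation_continuous_def by meson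
  have "(\<integral>\<^sup>+x. ennreal (norm (B x) * norm (mollify \<rho> \<epsilon> G x - G x)) \<partial>lborel) \<le> ennreal \<eta>"
    if \<epsilon>: "0 < \<epsilon>" "\<epsilon> < d / R" for \<epsilon>
  proof -
    have int: "integrable lborel (\<lambda>y. \<rho> y *\<^sub>R G (x + \<epsilon> *\<^sub>R y))" for x
      using mollify_integrable[OF \<rho> G] \<epsilon> by auto
    have int2: "integrable lborel (\<lambda>y. \<rho> y *\<^sub>R G x)" for x
      using mollifierD(5)[OF \<rho>] by simp
    have eq: "mollify \<rho> \<epsilon> G x - G x = (LINT y|lborel. \<rho> y *\<^sub>R (G (x + \<epsilon> *\<^sub>R y) - G x))" for x
    proof -
      have "G x = (LINT y|lborel. \<rho> y *\<^sub>R G x)"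
        using mollifierD(5,6)[OF \<rho>] by simp
      then have "mollify \<rho> \<epsilon> G x - G x
          = (LINT y|lborel. \<rho> y *\<^sub>R G (x + \<epsilon> *\<^sub>R y)) - (LINT y|lborel. \<rho> y *\<^sub>R G x)"
        by (simp only: mollify_def)
      also have "\<dots> = (LINT y|lborel. \<rho> y *\<^sub>R G (x + \<epsilon> *\<^sub>R y) - \<rho> y *\<^sub>R G x)"
        by (rule Bochner_Integration.integral_diff[symmetric, OF int int2])
      finally show ?thesis by (simp add: scaleR_diff_right)
    qed
    have le: "ennreal (norm (mollify \<rho> \<epsilon> G x - G x)) \<le> (\<integral>\<^sup>+y. ennreal (\<rho> y * norm (G (x + \<epsilon> *\<^sub>R y) - G x)) \<partial>lborel)" for x
    proof -
      have "integrable lborel (\<lambda>y. \<rho> y *\<^sub>R (G (x + \<epsilon> *\<^sub>R y) - G x))"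
        using Bochner_Integration.integrable_diff[OF int int2] by (simp add: scaleR_diff_right)
      then have "ennreal (norm (mollify \<rho> \<epsilon> G x - G x)) \<le> (\<integral>\<^sup>+y. ennreal (norm (\<rho> y *\<^sub>R (G (x + \<epsilon> *\<^sub>R y) - G x))) \<partial>lborel)"
        unfolding eq by (rule integral_norm_bound_ennreal)
      then show ?thesis
        using mollifierD(2)[OF \<rho>] by simp
    qed
    have "(\<integral>\<^sup>+x. ennreal (norm (B x) * norm (mollify \<rho> \<epsilon> G x - G x)) \<partial>lborel)
        \<le> (\<integral>\<^sup>+x. ennreal (norm (B x)) * (\<integral>\<^sup>+y. ennreal (\<rho> y * norm (G (x + \<epsilon> *\<^sub>R y) - G x)) \<partial>lborel) \<partial>lborel)"
      by (intro nn_integral_mono) (simp add: ennreal_mult mult_left_mono le)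
    also have "\<dots> = (\<integral>\<^sup>+x. (\<integral>\<^sup>+y. ennreal (norm (B x)) * ennreal (\<rho> y * norm (G (x + \<epsilon> *\<^sub>R y) - G x)) \<partial>lborel) \<partial>lborel)"
      by (intro nn_integral_cong nn_integral_cmult[symmetric]) measurable
    also have "\<dots> = (\<integral>\<^sup>+y. (\<integral>\<^sup>+x. ennreal (norm (B x)) * ennreal (\<rho> y * norm (G (x + \<epsilon> *\<^sub>R y) - G x)) \<partial>lborel) \<partial>lborel)"
      by (rule lborel_pair.Fubini') measurable
    also have "\<dots> = (\<integral>\<^sup>+y. ennreal (\<rho> y) * (\<integral>\<^sup>+x. ennreal (norm (B x) * norm (G (x + \<epsilon> *\<^sub>R y) - G x)) \<partial>lborel) \<partial>lborel)"
      by (intro nn_integral_cong, subst nn_integral_cmult[symmetric])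
         (use mollifierD(2)[OF \<rho>] in \<open>auto simp: ennreal_mult[symmetric] mult_ac\<close>)
    also have "\<dots> \<le> (\<integral>\<^sup>+y. ennreal (\<rho> y) * ennreal \<eta> \<partial>lborel)"
    proof (rule nn_integral_mono)
      fix y
      show "ennreal (\<rho> y) * (\<integral>\<^sup>+x. ennreal (norm (B x) * norm (G (x + \<epsilon> *\<^sub>R y) - G x)) \<partial>lborel) \<le> ennreal (\<rho> y) * ennreal \<eta>"
      proof (cases "y \<in> S")
        case True
        have "norm (\<epsilon> *\<^sub>R y) \<le> \<epsilon> * R"
          using R(2)[OF True] \<epsilon> by simp
        also have "\<dots> < d"
          using \<epsilon> R by (simp add: pos_less_divide_eq)
        finally show ?thesis
          by (intro mult_left_mono d) auto
      next
        case False
        then show ?thesis using mollifierD(4)[OF \<rho>] by simp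
      qed
    qed
    also have "\<dots> = (\<integral>\<^sup>+y. ennreal (\<rho> y) \<partial>lborel) * ennreal \<eta>"
      by (rule nn_integral_multc) measurable
    also have "(\<integral>\<^sup>+y. ennreal (\<rho> y) \<partial>lborel) = 1"
      using mollifierD[OF \<rho>] by (subst nn_integral_eq_integral) auto
    finally show ?thesis by simp
  qed
  then show ?thesis
    using d(1) R(1) by (intro exI[of _ "d / R"]) auto
qed

text \<open>Convergence in the mean gives pointwise convergence along a subsequence, which is what a
  nonlinear function of the mollification calls for.\<close>

lemma mollify_AE_converges:
  fixes w :: "'a::euclidean_space \<Rightarrow> 'b::{banach, second_countable_topology}"
  assumes \<rho>: "mollifier \<rho> S" and w: "integrable lborel w"
  obtains e :: "nat \<Rightarrow> real" where "\<And>n. e n > 0" "e \<longlonglongrightarrow> 0"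
    "AE x in lborel. (\<lambda>n. mollify \<rho> (e n) w x) \<longlonglongrightarrow> w x"
proof -
  have [measurable]: "w \<in> borel_measurable borel" using w by auto
  note [measurable] = borel_measurable_mollify[OF \<rho>]
  have "translation_continuous (\<lambda>_. 1::real) w"
    by (rule translation_continuous_bounded[OF w, where M = 1]) auto
  from mollify_converges[OF \<rho> w _ this]
  have "\<exists>d>0. \<forall>\<epsilon>. 0 < \<epsilon> \<and> \<epsilon> < d \<longrightarrow>
      (\<integral>\<^sup>+x. ennreal (norm (mollify \<rho> \<epsilon> w x - w x)) \<partial>lborel) \<le> ennreal (1 / real (Suc n))" for n
    by (auto simp: )
  then obtain d where d: "\<And>n. d n > 0" "\<And>n \<epsilon>. 0 < \<epsilon> \<Longrightarrow> \<epsilon> < d n \<Longrightarrow>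
      (\<integral>\<^sup>+x. ennreal (norm (mollify \<rho> \<epsilon> w x - w x)) \<partial>lborel) \<le> ennreal (1 / real (Suc n))"
    by metis
  \<comment> \<open>The first entry keeps the error below \<open>1 / Suc n\<close>, halving makes
    the comparison with \<open>d n\<close> strict, and the second entry forces \<open>e\<close> to
    tend to 0.\<close>
  define e where "e n = min (d n) (1 / real (Suc n)) / 2" for n
  have e: "e n > 0" "e n < d n" "e n \<le> 1 / real (Suc n)" for n
    using d(1)[of n] by (auto simp: e_def min_def field_simps)
  define u where "u n x = mollify \<rho> (e n) w x - w x" for n x
  have [measurable]: "u n \<in> borel_measurable borel" for n
    unfolding u_def by measurable
  have b: "(\<integral>\<^sup>+x. ennreal (norm (u n x)) \<partial>lborel) \<le> ennreal (1 / real (Suc n))" for n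
    unfolding u_def by (rule d(2)[OF e(1,2)])
  have int: "integrable lborel (u n)" for n
    by (rule integrableI_bounded) (use b[of n] in \<open>auto intro: order_le_less_trans\<close>)
  have "(LINT x|lborel. norm (u n x)) \<le> 1 / real (Suc n)" for n
    using b[of n] int[of n] by (subst (asm) nn_integral_eq_integral) auto
  moreover have e0: "(\<lambda>n. 1 / real (Suc n)) \<longlonglongrightarrow> 0"
    using LIMSEQ_inverse_real_of_nat by (simp add: inverse_eq_divide)
  ultimately have "(\<lambda>n. LINT x|lborel. norm (u n x)) \<longlonglongrightarrow> 0"
    by (intro tendsto_sandwich[OF _ _ tendsto_const[of 0] e0]) auto
  then obtain r :: "nat \<Rightarrow> nat" where r: "strict_mono r" "AE x in lborel. (\<lambda>n. u (r n) x) \<longlonglongrightarrow> 0"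
    using tendsto_L1_AE_subseq[of lborel u, OF int] by blast
  show ?thesis
  proof (rule that[of "e \<circ> r"])
    show "(e \<circ> r) n > 0" for n using e by simp
    have "e \<longlonglongrightarrow> 0"
      by (rule tendsto_sandwich[OF _ _ tendsto_const[of 0] e0])
        (simp_all only: e(3) less_imp_le[OF e(1)] eventually_True)
    then show "(e \<circ> r) \<longlonglongrightarrow> 0"
      using r(1) by (rule LIMSEQ_subseq_LIMSEQ)
    show "AE x in lborel. (\<lambda>n. mollify \<rho> ((e \<circ> r) n) w x) \<longlonglongrightarrow> w x"
      using r(2) by eventually_elim (simp add: u_def LIM_zero_iff)
  qed
qed

section \<open>Differentiating convolutions\<close>

lemma frechet_derivative_expand:
  fixes f :: "'a::euclidean_space \<Rightarrow> real"
  assumes "f differentiable (at x)"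
  shows "frechet_derivative f (at x) d = (\<Sum>b\<in>Basis. (d \<bullet> b) * frechet_derivative f (at x) b)"
proof -
  have l: "linear (frechet_derivative f (at x))"
    by (rule linear_frechet_derivative[OF assms])
  have "frechet_derivative f (at x) d = frechet_derivative f (at x) (\<Sum>b\<in>Basis. (d \<bullet> b) *\<^sub>R b)"
    by (simp add: euclidean_representation)
  also have "\<dots> = (\<Sum>b\<in>Basis. (d \<bullet> b) * frechet_derivative f (at x) b)"
    by (simp add: linear_sum[OF l] linear_scale[OF l])
  finally show ?thesis .
qed

lemma Ck1_continuous_derivative:
  fixes f :: "'a::euclidean_space \<Rightarrow> real"
  assumes "Ck (Suc 0) f"
  shows "continuous_on UNIV (\<lambda>x. frechet_derivative f (at x) d)"
proof -
  have "continuous_on UNIV (\<lambda>x. \<Sum>b\<in>Basis. (d \<bullet> b) * frechet_derivative f (at x) b)"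
    using assms by (intro continuous_on_sum continuous_on_mult_left) auto
  moreover have "(\<lambda>x. frechet_derivative f (at x) d) = (\<lambda>x. \<Sum>b\<in>Basis. (d \<bullet> b) * frechet_derivative f (at x) b)"
    using assms by (intro ext frechet_derivative_expand) auto
  ultimately show ?thesis by (simp only:)
qed

lemma frechet_derivative_zero_outside:
  fixes f :: "'a::euclidean_space \<Rightarrow> real"
  assumes "closed S" "\<And>y. y \<notin> S \<Longrightarrow> f y = 0" "x \<notin> S"
  shows "frechet_derivative f (at x) = (\<lambda>_. 0)"
proof -
  have "((\<lambda>_. 0) has_derivative (\<lambda>_. 0)) (at x)"
    by (auto intro: derivative_intros)
  then have "(f has_derivative (\<lambda>_. 0)) (at x)"
    by (rule has_derivative_transform_within_open[where s = "- S"]) (use assms in auto)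
  then show ?thesis
    using frechet_derivative_at by metis
qed

lemma Ck1_compact_support_bound:
  fixes f :: "'a::euclidean_space \<Rightarrow> real"
  assumes f: "Ck (Suc 0) f" and S: "compact S" "\<And>y. y \<notin> S \<Longrightarrow> f y = 0"
  obtains L where "L \<ge> 0" "\<And>x d. \<bar>frechet_derivative f (at x) d\<bar> \<le> L * norm d" "\<And>x y. \<bar>f y - f x\<bar> \<le> L * norm (y - x)"
proof -
  have "\<exists>M. M \<ge> 0 \<and> (\<forall>x. \<bar>frechet_derivative f (at x) b\<bar> \<le> M)" for b
  proof -
    have z: "frechet_derivative f (at y) b = 0" if "y \<notin> S" for y
      using frechet_derivative_zero_outside[OF compact_imp_closed[OF S(1)] S(2) that] by simp
    show ?thesis
      by (rule continuous_compact_support_bounded[OF Ck1_continuous_derivative[OF f] S(1) z]) blast+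
  qed
  then obtain M where M: "\<And>b. M b \<ge> 0" "\<And>b x. \<bar>frechet_derivative f (at x) b\<bar> \<le> M b"
    by metis
  define L where "L = (\<Sum>b\<in>Basis. M b)"
  have L0: "L \<ge> 0" unfolding L_def by (intro sum_nonneg M)
  have diff: "f differentiable (at x)" for x using f by simp
  have bd: "\<bar>frechet_derivative f (at x) d\<bar> \<le> L * norm d" for x d
  proof -
    have "\<bar>frechet_derivative f (at x) d\<bar> = \<bar>\<Sum>b\<in>Basis. (d \<bullet> b) * frechet_derivative f (at x) b\<bar>"
      by (subst frechet_derivative_expand[OF diff]) simp
    also have "\<dots> \<le> (\<Sum>b\<in>Basis. norm d * M b)"
      by (rule order_trans[OF sum_abs], rule sum_mono)
         (auto simp: abs_mult intro!: mult_mono M(2) Basis_le_norm)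
    also have "\<dots> = L * norm d"
      by (simp add: L_def sum_distrib_left mult.commute)
    finally show ?thesis .
  qed
  have "norm (f y - f x) \<le> L * norm (y - x)" for x y
  proof (rule differentiable_bound[of UNIV f "\<lambda>x. frechet_derivative f (at x)"])
    show "onorm (frechet_derivative f (at x)) \<le> L" for x
      by (rule onorm_le) (use bd in auto)
  qed (use Ck_has_derivative[OF f] in auto)
  then show ?thesis
    using that[OF L0 bd] by simp
qed

text \<open>Differentiation under the integral sign: the remainder quotient \<open>q\<close> is
  dominated by \<open>2 * L * norm (f z)\<close>, with \<open>L\<close> a Lipschitz constant of
  \<open>k\<close>. The minus sign arises because \<open>x\<close> enters as
  \<open>z - x\<close>.\<close>

lemma convolution_has_derivative:
  fixes k f :: "'a::euclidean_space \<Rightarrow> real"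
  assumes k: "Ck (Suc 0) k" and S: "compact S" "\<And>y. y \<notin> S \<Longrightarrow> k y = 0" and f: "integrable lborel f"
  shows "((\<lambda>x. LINT z|lborel. k (z - x) * f z) has_derivative
     (\<lambda>d. - (LINT z|lborel. frechet_derivative k (at (z - x)) d * f z))) (at x)"
    and "Ck (Suc 0) (\<lambda>x. LINT z|lborel. k (z - x) * f z)"
proof -
  let ?D = "\<lambda>y. frechet_derivative k (at y)"
  have [measurable]: "f \<in> borel_measurable borel" using f by auto
  have [measurable]: "k \<in> borel_measurable borel" using borel_measurable_Ck[OF k] .
  have [measurable]: "(\<lambda>y. ?D y d) \<in> borel_measurable borel" for d
    by (rule borel_measurable_continuous_onI[OF Ck1_continuous_derivative[OF k]])
  obtain L where L: "L \<ge> 0" "\<And>x d. \<bar>?D x d\<bar> \<le> L * norm d" "\<And>x y. \<bar>k y - k x\<bar> \<le> L * norm (y - x)"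
    using Ck1_compact_support_bound[OF k S] by metis
  obtain M where M: "M \<ge> 0" "\<And>y. \<bar>k y\<bar> \<le> M"
    using continuous_compact_support_bounded[of k S] Ck_Suc_D[OF k] S by auto
  have lin: "linear (?D y)" for y
    using k by (intro linear_frechet_derivative) auto
  have int1: "integrable lborel (\<lambda>z. k (z - x) * f z)" for x
    by (rule Bochner_Integration.integrable_bound[OF integrable_mult_right[OF f, of M]])
       (use M in \<open>auto intro!: AE_I2 mult_right_mono simp: abs_mult\<close>)
  have int2: "integrable lborel (\<lambda>z. ?D (z - x) d * f z)" for x d
    by (rule Bochner_Integration.integrable_bound[OF integrable_mult_right[OF f, of "L * norm d"]])
       (use L in \<open>auto intro!: AE_I2 mult_right_mono simp: abs_mult\<close>)
  define U where "U x d = - (LINT z|lborel. ?D (z - x) d * f z)" for x d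
  have deriv: "((\<lambda>x. LINT z|lborel. k (z - x) * f z) has_derivative U x) (at x)" for x
    unfolding has_derivative_at
  proof
    show "bounded_linear (U x)"
    proof (rule linear_conv_bounded_linear[THEN iffD1], rule linearI)
      show "U x (a + b) = U x a + U x b" for a b
        unfolding U_def using int2 by (simp add: linear_add[OF lin] distrib_right)
      show "U x (r *\<^sub>R a) = r *\<^sub>R U x a" for r a
        unfolding U_def using int2 by (simp add: linear_scale[OF lin] mult.assoc)
    qed
    define q where "q h z = (k (z - (x + h)) - k (z - x) + ?D (z - x) h) * f z / norm h" for h z
    have eq: "norm ((LINT z|lborel. k (z - (x + h)) * f z) - (LINT z|lborel. k (z - x) * f z) - U x h) / norm h
        = \<bar>LINT z|lborel. q h z\<bar>" for h
    proof -
      have "(LINT z|lborel. q h z) = ((LINT z|lborel. k (z - (x + h)) * f z) - (LINT z|lborel. k (z - x) * f z) - U x h) / norm h"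
        unfolding q_def U_def using int1 int2 by (simp add: left_diff_distrib distrib_right)
      then show ?thesis by simp
    qed
    have "((\<lambda>h. LINT z|lborel. q h z) \<longlongrightarrow> 0) (at 0)"
      unfolding tendsto_at_iff_sequentially
    proof (intro allI impI)
      fix X :: "nat \<Rightarrow> 'a" assume X: "\<forall>i. X i \<in> UNIV - {0}" "X \<longlonglongrightarrow> 0"
      have "(\<lambda>n. LINT z|lborel. q (X n) z) \<longlonglongrightarrow> (LINT z|(lborel :: 'a measure). (0::real))"
      proof (rule integral_dominated_convergence[where w = "\<lambda>z. 2 * L * norm (f z)"])
        show "integrable lborel (\<lambda>z. 2 * L * norm (f z))" using f by simp
        show "(\<lambda>z. q (X n) z) \<in> borel_measurable lborel" for n
          unfolding q_def by measurable
        show "AE z in lborel. (\<lambda>n. q (X n) z) \<longlonglongrightarrow> 0"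
        proof (rule AE_I2)
          fix z
          have "((\<lambda>h. norm (k (z - x + h) - k (z - x) - ?D (z - x) h) / norm h) \<longlongrightarrow> 0) (at 0)"
            using Ck_has_derivative[OF k, of "z - x"] unfolding has_derivative_at by simp
          \<comment> \<open>Moving \<open>x\<close> by \<open>X i\<close> moves the argument of
            \<open>k\<close> by \<open>- X i\<close>.\<close>
          moreover have "filterlim (\<lambda>i. - X i) (at 0) sequentially"
            using X tendsto_minus[OF X(2)] by (simp add: filterlim_at)
          ultimately have "(\<lambda>i. norm (k (z - x + (- X i)) - k (z - x) - ?D (z - x) (- X i)) / norm (- X i)) \<longlonglongrightarrow> 0"
            by (rule filterlim_compose)
          then have "(\<lambda>i. \<bar>k (z - (x + X i)) - k (z - x) + ?D (z - x) (X i)\<bar> / norm (X i)) \<longlonglongrightarrow> 0"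
            by (simp add: linear_neg[OF lin] diff_diff_eq)
          from tendsto_mult[OF this tendsto_const[of "\<bar>f z\<bar>"]]
          have "(\<lambda>i. \<bar>q (X i) z\<bar>) \<longlonglongrightarrow> 0"
            by (simp add: q_def abs_mult)
          then show "(\<lambda>n. q (X n) z) \<longlonglongrightarrow> 0"
            by (simp add: tendsto_rabs_zero_iff)
        qed
        show "AE z in lborel. norm (q (X n) z) \<le> 2 * L * norm (f z)" for n
        proof (rule AE_I2)
          fix z
          have "X n \<noteq> 0" using X by simp
          have "\<bar>k (z - (x + X n)) - k (z - x) + ?D (z - x) (X n)\<bar> \<le> L * norm (X n) + L * norm (X n)"
            by (rule order_trans[OF abs_triangle_ineq], rule add_mono)
               (use L(3)[of "z - (x + X n)" "z - x"] L(2) in auto)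
          then have "\<bar>k (z - (x + X n)) - k (z - x) + ?D (z - x) (X n)\<bar> / norm (X n) \<le> 2 * L"
            using \<open>X n \<noteq> 0\<close> by (simp add: pos_divide_le_eq)
          from mult_right_mono[OF this, of "\<bar>f z\<bar>"]
          show "norm (q (X n) z) \<le> 2 * L * norm (f z)"
            by (simp add: q_def abs_mult)
        qed
      qed auto
      then show "((\<lambda>h. LINT z|lborel. q h z) \<circ> X) \<longlonglongrightarrow> 0"
        by (simp add: o_def)
    qed
    from tendsto_rabs[OF this]
    show "(\<lambda>h. norm ((LINT z|lborel. k (z - (x + h)) * f z) - (LINT z|lborel. k (z - x) * f z) - U x h) / norm h) \<midarrow>0\<rightarrow> 0"
      unfolding eq by simp
  qed
  then show "((\<lambda>x. LINT z|lborel. k (z - x) * f z) has_derivative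
     (\<lambda>d. - (LINT z|lborel. ?D (z - x) d * f z))) (at x)"
    unfolding U_def .
  show "Ck (Suc 0) (\<lambda>x. LINT z|lborel. k (z - x) * f z)"
  proof (rule Ck_SucI[OF deriv])
    fix b :: 'a
    have "isCont (\<lambda>x. U x b) x" for x
      unfolding continuous_at_sequentially o_def
    proof (intro allI impI)
      fix X assume X: "X \<longlonglongrightarrow> x"
      have "(\<lambda>n. LINT z|lborel. ?D (z - X n) b * f z) \<longlonglongrightarrow> (LINT z|lborel. ?D (z - x) b * f z)"
      proof (rule integral_dominated_convergence[where w = "\<lambda>z. L * norm b * norm (f z)"])
        show "integrable lborel (\<lambda>z. L * norm b * norm (f z))" using f by simp
        show "AE z in lborel. (\<lambda>n. ?D (z - X n) b * f z) \<longlonglongrightarrow> ?D (z - x) b * f z"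
        proof (rule AE_I2)
          fix z
          have "isCont (\<lambda>y. ?D y b) (z - x)"
            using Ck1_continuous_derivative[OF k] by (simp add: continuous_on_eq_continuous_at)
          then show "(\<lambda>n. ?D (z - X n) b * f z) \<longlonglongrightarrow> ?D (z - x) b * f z"
            by (intro tendsto_mult tendsto_const isCont_tendsto_compose[of _ "\<lambda>y. ?D y b"] tendsto_diff X)
        qed
        show "AE z in lborel. norm (?D (z - X n) b * f z) \<le> L * norm b * norm (f z)" for n
          using L(2) by (auto simp: abs_mult intro!: mult_right_mono)
      qed measurable
      then show "(\<lambda>n. U (X n) b) \<longlonglongrightarrow> U x b"
        unfolding U_def by (rule tendsto_minus)
    qed
    then show "Ck 0 (\<lambda>x. U x b)"
      by (simp add: continuous_on_eq_continuous_at)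
  qed
qed

text \<open>Convolve \<open>\<phi>\<close> with the indicator of a ball that contains every shift of
  the support by less than 1. Near the origin the result is constant by translation invariance, and
  its derivative there is minus the integral in question.\<close>

lemma integral_derivative_eq_0:
  fixes \<phi> :: "'a::euclidean_space \<Rightarrow> real"
  assumes \<phi>: "Ck (Suc 0) \<phi>" and S: "compact S" "\<And>y. y \<notin> S \<Longrightarrow> \<phi> y = 0"
  shows "(LINT x|lborel. frechet_derivative \<phi> (at x) b) = 0"
proof -
  have [measurable]: "\<phi> \<in> borel_measurable borel" using borel_measurable_Ck[OF \<phi>] .
  obtain R where R: "\<And>y. y \<in> S \<Longrightarrow> norm y \<le> R"
    using compact_imp_bounded[OF S(1)] bounded_iff by metis
  define f where "f = (indicator (cball 0 (R + 1)) :: 'a \<Rightarrow> real)"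
  have f: "integrable lborel f"
    unfolding f_def using emeasure_bounded_finite[of "cball 0 (R + 1) :: 'a set"] by auto
  define u where "u x = (LINT z|lborel. \<phi> (z - x) * f z)" for x
  have u: "u x = (LINT z|lborel. \<phi> z)" if "x \<in> ball 0 1" for x
  proof -
    have "\<phi> (z - x) * f z = \<phi> (z + (- x))" for z
    proof (cases "z - x \<in> S")
      case True
      then have "norm z \<le> R + 1"
        using R[OF True] that norm_triangle_ineq[of "z - x" x] by auto
      then show ?thesis by (simp add: f_def)
    qed (use S in auto)
    then show ?thesis
      unfolding u_def by (simp only: integral_lborel_translate[OF borel_measurable_Ck[OF \<phi>]])
  qed
  have "((\<lambda>_. LINT z|lborel. \<phi> z) has_derivative (\<lambda>_. 0)) (at 0)"
    by (rule has_derivative_const)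
  then have "(u has_derivative (\<lambda>_. 0)) (at 0)"
    by (rule has_derivative_transform_within_open[where s = "ball 0 1"]) (use u in auto)
  moreover have "(u has_derivative (\<lambda>d. - (LINT z|lborel. frechet_derivative \<phi> (at (z - 0)) d * f z))) (at 0)"
    unfolding u_def by (rule convolution_has_derivative(1)[OF \<phi> S f])
  ultimately have "(\<lambda>_. 0) = (\<lambda>d. - (LINT z|lborel. frechet_derivative \<phi> (at (z - 0)) d * f z))"
    by (rule has_derivative_unique)
  from fun_cong[OF this, of b] have "(LINT z|lborel. frechet_derivative \<phi> (at z) b * f z) = 0"
    by simp
  moreover have "frechet_derivative \<phi> (at z) b * f z = frechet_derivative \<phi> (at z) b" for z
  proof (cases "z \<in> S")
    case True
    then show ?thesis
      using R[of z] by (auto simp: f_def)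
  next
    case False
    then show ?thesis
      by (simp add: frechet_derivative_zero_outside[OF compact_imp_closed[OF S(1)] S(2)])
  qed
  ultimately show ?thesis by simp
qed

section \<open>Weak gradients and mollification\<close>

lemma borel_measurable_vec_nth [measurable]:
  fixes f :: "'a \<Rightarrow> real^'n"
  assumes [measurable]: "f \<in> borel_measurable M"
  shows "(\<lambda>x. f x $ k) \<in> borel_measurable M"
proof -
  have "(\<lambda>x. f x \<bullet> axis k 1) \<in> borel_measurable M"
    by measurable
  then show ?thesis
    by (simp add: inner_axis)
qed

lemma mollify_eq_convolution:
  fixes f :: "'a::euclidean_space \<Rightarrow> 'b::{banach, second_countable_topology}"
  assumes \<rho>: "mollifier \<rho> S" and [measurable]: "f \<in> borel_measurable borel" and "\<epsilon> > 0"
  shows "mollify \<rho> \<epsilon> f x = (1 / \<epsilon> ^ DIM('a)) *\<^sub>R (LINT z|lborel. \<rho> ((1 / \<epsilon>) *\<^sub>R (z - x)) *\<^sub>R f z)"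
proof -
  note [measurable] = mollifierD(7)[OF \<rho>]
  have "(LINT z|lborel. \<rho> ((1 / \<epsilon>) *\<^sub>R (z - x)) *\<^sub>R f z)
      = (\<bar>\<epsilon>\<bar> ^ DIM('a)) *\<^sub>R (LINT y|lborel. \<rho> ((1 / \<epsilon>) *\<^sub>R ((x + \<epsilon> *\<^sub>R y) - x)) *\<^sub>R f (x + \<epsilon> *\<^sub>R y))"
    by (rule integral_lborel_affine) (use \<open>\<epsilon> > 0\<close> in simp_all)
  then show ?thesis
    using \<open>\<epsilon> > 0\<close> by (simp add: mollify_def)
qed

lemma mollifier_scaled_support:
  assumes \<rho>: "mollifier \<rho> S" and "\<epsilon> > 0"
  shows "compact ((\<lambda>y. x + \<epsilon> *\<^sub>R y) ` S)"
    and "z \<notin> (\<lambda>y. x + \<epsilon> *\<^sub>R y) ` S \<Longrightarrow> \<rho> ((1 / \<epsilon>) *\<^sub>R (z - x)) = 0"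
proof -
  show "compact ((\<lambda>y. x + \<epsilon> *\<^sub>R y) ` S)"
    using mollifierD(3)[OF \<rho>] by (intro compact_continuous_image continuous_intros)
  assume "z \<notin> (\<lambda>y. x + \<epsilon> *\<^sub>R y) ` S"
  moreover have "z = x + \<epsilon> *\<^sub>R ((1 / \<epsilon>) *\<^sub>R (z - x))"
    using \<open>\<epsilon> > 0\<close> by simp
  ultimately have "(1 / \<epsilon>) *\<^sub>R (z - x) \<notin> S"
    by blast
  then show "\<rho> ((1 / \<epsilon>) *\<^sub>R (z - x)) = 0"
    by (rule mollifierD(4)[OF \<rho>])
qed

lemma Ck_mollifier_scaled:
  assumes "mollifier \<rho> S"
  shows "Ck k (\<lambda>z. \<rho> ((1 / \<epsilon>) *\<^sub>R (z - x)))"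
  using Ck_affine[OF mollifierD(1)[OF assms], of k "1 / \<epsilon>" "- ((1 / \<epsilon>) *\<^sub>R x)"]
  by (simp add: scaleR_diff_right)

lemma mollifier_scaled_test_function:
  assumes \<rho>: "mollifier \<rho> S" and "\<epsilon> > 0" and sub: "\<And>y. y \<in> S \<Longrightarrow> x + \<epsilon> *\<^sub>R y \<in> \<Omega>"
  shows "(\<lambda>z. \<rho> ((1 / \<epsilon>) *\<^sub>R (z - x))) \<in> test_functions \<Omega>"
proof -
  let ?K = "(\<lambda>y. x + \<epsilon> *\<^sub>R y) ` S"
  have K: "compact ?K" "{z. \<rho> ((1 / \<epsilon>) *\<^sub>R (z - x)) \<noteq> 0} \<subseteq> ?K"
    using mollifier_scaled_support(1)[OF \<rho> \<open>\<epsilon> > 0\<close>] mollifier_scaled_support(2)[OF \<rho> \<open>\<epsilon> > 0\<close>, of _ x]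
    by auto
  then have cl: "closure {z. \<rho> ((1 / \<epsilon>) *\<^sub>R (z - x)) \<noteq> 0} \<subseteq> ?K"
    by (intro closure_minimal compact_imp_closed)
  have "compact (closure {z. \<rho> ((1 / \<epsilon>) *\<^sub>R (z - x)) \<noteq> 0})"
    using bounded_subset[OF compact_imp_bounded[OF K(1)] K(2)] by (simp add: compact_closure)
  then show ?thesis
    using cl sub Ck_mollifier_scaled[OF \<rho>] unfolding test_functions_def smooth_def by blast
qed

text \<open>The derivative falls on the kernel, written as a function of \<open>z\<close> with
  \<open>x\<close> fixed; in this form it is, up to a factor, the left-hand side of
  \<open>wgrad\<close> for one test function.\<close>

lemma mollify_Ck1:
  fixes w :: "'a::euclidean_space \<Rightarrow> real"
  assumes \<rho>: "mollifier \<rho> S" and w: "integrable lborel w" and "\<epsilon> > 0"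
  shows "Ck (Suc 0) (mollify \<rho> \<epsilon> w)"
    and "frechet_derivative (mollify \<rho> \<epsilon> w) (at x) b =
      - (1 / \<epsilon> ^ DIM('a)) * (LINT z|lborel. frechet_derivative (\<lambda>z. \<rho> ((1 / \<epsilon>) *\<^sub>R (z - x))) (at z) b * w z)"
proof -
  define k where "k z = \<rho> ((1 / \<epsilon>) *\<^sub>R z)" for z
  define S' where "S' = (\<lambda>y. 0 + \<epsilon> *\<^sub>R y) ` S"
  have [measurable]: "w \<in> borel_measurable borel" using w by auto
  have k: "Ck (Suc 0) k" "compact S'" "\<And>y. y \<notin> S' \<Longrightarrow> k y = 0"
    using Ck_mollifier_scaled[OF \<rho>, of "Suc 0" \<epsilon> 0] mollifier_scaled_support(1)[OF \<rho> \<open>\<epsilon> > 0\<close>, of 0]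
      mollifier_scaled_support(2)[OF \<rho> \<open>\<epsilon> > 0\<close>, of _ 0]
    unfolding k_def[abs_def] S'_def by (simp_all del: Ck.simps)
  note c = convolution_has_derivative[OF k w]
  have eq: "mollify \<rho> \<epsilon> w = (\<lambda>x. (1 / \<epsilon> ^ DIM('a)) * (LINT z|lborel. k (z - x) * w z))"
    using mollify_eq_convolution[OF \<rho> _ \<open>\<epsilon> > 0\<close>, of w] by (simp add: k_def fun_eq_iff)
  show "Ck (Suc 0) (mollify \<rho> \<epsilon> w)"
    unfolding eq by (rule Ck_cmult[OF c(2)])
  have "((\<lambda>x. (1 / \<epsilon> ^ DIM('a)) * (LINT z|lborel. k (z - x) * w z)) has_derivative
     (\<lambda>d. (1 / \<epsilon> ^ DIM('a)) * - (LINT z|lborel. frechet_derivative k (at (z - x)) d * w z))) (at x)"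
    by (rule has_derivative_mult_right[OF c(1)])
  then have "frechet_derivative (mollify \<rho> \<epsilon> w) (at x) =
     (\<lambda>d. (1 / \<epsilon> ^ DIM('a)) * - (LINT z|lborel. frechet_derivative k (at (z - x)) d * w z))"
    unfolding eq by (rule frechet_derivative_at[symmetric])
  moreover have "frechet_derivative k (at (z - x)) = frechet_derivative (\<lambda>z. \<rho> ((1 / \<epsilon>) *\<^sub>R (z - x))) (at z)" for z
  proof -
    have "(k has_derivative frechet_derivative k (at (z - x))) (at (1 *\<^sub>R z + (- x)))"
      using Ck_has_derivative[OF k(1), of "z - x"] by simp
    from has_derivative_affine_compose[OF this]
    have "((\<lambda>z. \<rho> ((1 / \<epsilon>) *\<^sub>R (z - x))) has_derivative frechet_derivative k (at (z - x))) (at z)"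
      by (simp add: k_def)
    then show ?thesis by (rule frechet_derivative_at)
  qed
  ultimately show "frechet_derivative (mollify \<rho> \<epsilon> w) (at x) b =
      - (1 / \<epsilon> ^ DIM('a)) * (LINT z|lborel. frechet_derivative (\<lambda>z. \<rho> ((1 / \<epsilon>) *\<^sub>R (z - x))) (at z) b * w z)"
    by simp
qed

text \<open>Only the \<open>L\<^sup>1\<close> convergence of mollifications is used: mollifications of \<open>g\<close> vanish well inside the domain.\<close>

lemma fundamental_lemma_of_calculus_of_variations:
  fixes g :: "'a::euclidean_space \<Rightarrow> real"
  assumes "open \<Omega>" and [measurable]: "g \<in> borel_measurable borel"
    and loc: "\<And>K. compact K \<Longrightarrow> K \<subseteq> \<Omega> \<Longrightarrow> integrable lborel (\<lambda>x. indicator K x * g x)"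
    and zero: "\<And>\<phi>. \<phi> \<in> test_functions \<Omega> \<Longrightarrow> (LINT x|lborel. g x * \<phi> x) = 0"
  shows "AE x in lborel. x \<in> \<Omega> \<longrightarrow> g x = 0"
proof -
  define N where "N = {x \<in> \<Omega>. g x \<noteq> 0}"
  have Nb: "N \<in> sets borel"
    unfolding N_def using \<open>open \<Omega>\<close> by measurable
  have "negligible N"
  proof (rule iffD2[OF locally_negligible_alt], rule ballI)
    fix p assume "p \<in> N"
    then have "p \<in> \<Omega>" by (simp add: N_def)
    then obtain r0 where r0: "r0 > 0" "cball p r0 \<subseteq> \<Omega>"
      using \<open>open \<Omega>\<close> open_contains_cball by blast
    define r where "r = r0 / 2"
    have r: "r > 0" "cball p (2 * r) \<subseteq> \<Omega>" using r0 by (auto simp: r_def)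
    \<comment> \<open>Truncation makes \<open>g\<close> integrable, and a kernel at a point of
      \<open>ball p r\<close> with \<open>\<epsilon> < r\<close> does not notice it.\<close>
    define f where "f x = indicator (cball p (2 * r)) x * g x" for x
    have f: "integrable lborel f"
      unfolding f_def using loc[OF compact_cball r(2)] .
    have [measurable]: "f \<in> borel_measurable borel" using f by auto
    obtain \<rho> :: "'a \<Rightarrow> real" where \<rho>: "mollifier \<rho> (cball 0 1)"
      using mollifier_cball_exists[of 1 0] by auto
    obtain e :: "nat \<Rightarrow> real" where e: "\<And>n. e n > 0" "e \<longlonglongrightarrow> 0"
      "AE x in lborel. (\<lambda>n. mollify \<rho> (e n) f x) \<longlonglongrightarrow> f x"
      by (rule mollify_AE_converges[OF \<rho> f]) blast
    have z: "mollify \<rho> \<epsilon> f x = 0" if x: "x \<in> ball p r" and \<epsilon>: "0 < \<epsilon>" "\<epsilon> < r" for x \<epsilon>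
    proof -
      have in2: "x + \<epsilon> *\<^sub>R y \<in> cball p (2 * r)" if "y \<in> cball 0 1" for y
      proof -
        have "norm (\<epsilon> *\<^sub>R y) \<le> \<epsilon>"
          using that \<epsilon> by (simp add: mult_left_le)
        moreover have "dist p (x + \<epsilon> *\<^sub>R y) \<le> dist p x + norm (\<epsilon> *\<^sub>R y)"
          using dist_triangle[of p "x + \<epsilon> *\<^sub>R y" x] by (simp add: dist_norm)
        ultimately show ?thesis using x \<epsilon> unfolding mem_ball mem_cball by linarith
      qed
      have "(\<lambda>z. \<rho> ((1 / \<epsilon>) *\<^sub>R (z - x))) \<in> test_functions \<Omega>"
        by (rule mollifier_scaled_test_function[OF \<rho> \<epsilon>(1)]) (use in2 r in blast)
      from zero[OF this] have "(LINT z|lborel. g z * \<rho> ((1 / \<epsilon>) *\<^sub>R (z - x))) = 0" .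
      moreover have "\<rho> ((1 / \<epsilon>) *\<^sub>R (z - x)) * f z = g z * \<rho> ((1 / \<epsilon>) *\<^sub>R (z - x))" for z
      proof (cases "z \<in> cball p (2 * r)")
        case False
        then have "z \<notin> (\<lambda>y. x + \<epsilon> *\<^sub>R y) ` cball 0 1" using in2 by blast
        from mollifier_scaled_support(2)[OF \<rho> \<epsilon>(1) this] show ?thesis by simp
      qed (simp add: f_def)
      ultimately have "(LINT z|lborel. \<rho> ((1 / \<epsilon>) *\<^sub>R (z - x)) * f z) = 0"
        by (simp only:)
      then show ?thesis
        using mollify_eq_convolution[OF \<rho> _ \<epsilon>(1), of f x] by simp
    qed
    have ev: "\<forall>\<^sub>F n in sequentially. e n < r"
      using e(2) r(1) by (rule order_tendstoD)
    have "AE x in lborel. x \<in> ball p r \<longrightarrow> g x = 0"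
      using e(3)
    proof eventually_elim
      case (elim x)
      show ?case
      proof
        assume x: "x \<in> ball p r"
        have "\<forall>\<^sub>F n in sequentially. mollify \<rho> (e n) f x = 0"
          using ev by eventually_elim (rule z[OF x e(1)])
        then have "(\<lambda>n. mollify \<rho> (e n) f x) \<longlonglongrightarrow> 0"
          by (rule tendsto_eventually)
        then have "f x = 0"
          using elim LIMSEQ_unique by blast
        moreover have "x \<in> cball p (2 * r)" using x r by auto
        ultimately show "g x = 0" by (simp add: f_def)
      qed
    qed
    then have "AE x in lborel. x \<notin> N \<inter> ball p r"
      by eventually_elim (auto simp: N_def)
    then have "N \<inter> ball p r \<in> null_sets lborel"
      using Nb by (subst AE_iff_null_sets) auto
    then have "negligible (N \<inter> ball p r)"
      using negligible_iff_null_sets null_sets_completion_iff by blast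
    then show "\<exists>U. openin (top_of_set N) U \<and> p \<in> U \<and> negligible U"
      using \<open>p \<in> N\<close> r(1) by (intro exI[of _ "N \<inter> ball p r"]) auto
  qed
  then have "N \<in> null_sets lborel"
    using Nb by (simp add: negligible_iff_null_sets null_sets_completion_iff)
  then have "AE x in lborel. x \<notin> N" by (rule AE_not_in)
  then show ?thesis by eventually_elim (auto simp: N_def)
qed

section \<open>Classical gradients of mollified functions\<close>

definition grad :: "(real^3 \<Rightarrow> real) \<Rightarrow> real^3 \<Rightarrow> real^3" where
  "grad \<psi> x = (\<chi> k. frechet_derivative \<psi> (at x) (axis k 1))"

text \<open>The counterpart of \<open>weak_gradient\<close> for integrals over the whole space: a
  test function and its derivatives vanish off \<open>\<Omega>\<close>, so only the values of
  \<open>w\<close> and \<open>G\<close> on \<open>\<Omega>\<close> matter.\<close>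

definition wgrad :: "(real^3) set \<Rightarrow> (real^3 \<Rightarrow> real) \<Rightarrow> (real^3 \<Rightarrow> real^3) \<Rightarrow> bool" where
  "wgrad \<Omega> w G \<longleftrightarrow> (\<forall>\<phi>\<in>test_functions \<Omega>. \<forall>k.
     (LINT x|lborel. w x * frechet_derivative \<phi> (at x) (axis k 1)) = - (LINT x|lborel. G x $ k * \<phi> x))"

text \<open>The scaled kernel at \<open>x\<close> is itself an admissible test function as soon as
  \<open>x + \<epsilon> *\<^sub>R S\<close> lies in the domain; if \<open>S\<close> points inwards,
  \<open>x\<close> may be arbitrarily close to the boundary.\<close>

lemma grad_mollify:
  assumes \<rho>: "mollifier \<rho> S" and w: "integrable lborel w" and G: "integrable lborel G"
    and wG: "wgrad \<Omega> w G" and "\<epsilon> > 0" and sub: "\<And>y. y \<in> S \<Longrightarrow> x + \<epsilon> *\<^sub>R y \<in> \<Omega>"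
  shows "grad (mollify \<rho> \<epsilon> w) x = mollify \<rho> \<epsilon> G x"
proof -
  have [measurable]: "G \<in> borel_measurable borel" using G by auto
  have "grad (mollify \<rho> \<epsilon> w) x $ k = mollify \<rho> \<epsilon> G x $ k" for k
  proof -
    let ?\<phi> = "\<lambda>z. \<rho> ((1 / \<epsilon>) *\<^sub>R (z - x))"
    have "mollify \<rho> \<epsilon> G x $ k = (LINT y|lborel. (\<rho> y *\<^sub>R G (x + \<epsilon> *\<^sub>R y)) $ k)"
      unfolding mollify_def using mollify_integrable[OF \<rho> G, of \<epsilon> x] \<open>\<epsilon> > 0\<close>
      by (intro integral_bounded_linear[OF bounded_linear_vec_nth, symmetric]) simp
    also have "\<dots> = mollify \<rho> \<epsilon> (\<lambda>z. G z $ k) x"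
      by (simp add: mollify_def)
    also have "\<dots> = (1 / \<epsilon> ^ DIM(real^3)) * (LINT z|lborel. G z $ k * ?\<phi> z)"
      by (subst mollify_eq_convolution[OF \<rho> _ \<open>\<epsilon> > 0\<close>]) (auto simp: mult.commute)
    also have "(LINT z|lborel. G z $ k * ?\<phi> z) = - (LINT z|lborel. w z * frechet_derivative ?\<phi> (at z) (axis k 1))"
      using wG mollifier_scaled_test_function[OF \<rho> \<open>\<epsilon> > 0\<close> sub] unfolding wgrad_def by simp
    finally show ?thesis
      unfolding grad_def using mollify_Ck1(2)[OF \<rho> w \<open>\<epsilon> > 0\<close>, of x "axis k 1"] by (simp add: mult.commute)
  qed
  then show ?thesis by (simp add: vec_eq_iff)
qed

text \<open>Averaging keeps the range, so a nonlinear function of the mollification is evaluated on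
  \<open>{0..1}\<close> only and bounded uniformly in \<open>\<epsilon>\<close>.\<close>

lemma mollify_bounds:
  fixes w :: "'a::euclidean_space \<Rightarrow> real"
  assumes \<rho>: "mollifier \<rho> S" and w: "integrable lborel w" "\<And>x. 0 \<le> w x" "\<And>x. w x \<le> 1" and "\<epsilon> > 0"
  shows "mollify \<rho> \<epsilon> w x \<in> {0..1}"
proof -
  have "(LINT y|lborel. \<rho> y *\<^sub>R w (x + \<epsilon> *\<^sub>R y)) \<le> (LINT y|lborel. \<rho> y)"
    using mollify_integrable[OF \<rho> w(1), of \<epsilon> x] mollifierD(2,5)[OF \<rho>] w \<open>\<epsilon> > 0\<close>
    by (intro integral_mono) (auto simp: mult_left_le)
  moreover have "(LINT y|lborel. \<rho> y *\<^sub>R w (x + \<epsilon> *\<^sub>R y)) \<ge> 0"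
    using mollifierD(2)[OF \<rho>] w by (intro integral_nonneg_AE) auto
  ultimately show ?thesis
    using mollifierD(6)[OF \<rho>] by (simp add: mollify_def)
qed

lemma grad_mult:
  assumes "Ck (Suc 0) f" "Ck (Suc 0) g"
  shows "grad (\<lambda>x. f x * g x) x = g x *\<^sub>R grad f x + f x *\<^sub>R grad g x"
proof -
  have "frechet_derivative (\<lambda>x. f x * g x) (at x) =
      (\<lambda>d. f x * frechet_derivative g (at x) d + frechet_derivative f (at x) d * g x)"
    by (rule frechet_derivative_at[symmetric], rule has_derivative_mult; rule Ck_has_derivative) fact+
  then show ?thesis
    by (simp add: grad_def vec_eq_iff)
qed

lemma grad_compose:
  assumes "Ck (Suc 0) g" "\<And>s. (F has_real_derivative F' s) (at s)"
  shows "grad (\<lambda>x. F (g x)) x = F' (g x) *\<^sub>R grad g x"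
proof -
  have "(F has_derivative (*) (F' (g x))) (at (g x))"
    using assms(2) by (simp only: has_field_derivative_def)
  from has_derivative_compose[OF Ck_has_derivative[OF assms(1)] this]
  have "frechet_derivative (\<lambda>x. F (g x)) (at x) = (\<lambda>d. F' (g x) * frechet_derivative g (at x) d)"
    by (rule frechet_derivative_at[symmetric])
  then show ?thesis
    by (simp add: grad_def vec_eq_iff)
qed

lemma grad_locally_zero:
  assumes "open U" "x \<in> U" "\<And>y. y \<in> U \<Longrightarrow> f y = 0"
  shows "grad f x = 0"
  using frechet_derivative_zero_outside[of "- U" f x] assms
  by (simp add: grad_def vec_eq_iff closed_Compl)

lemma grad_diff_one:
  assumes "Ck (Suc 0) f"
  shows "grad (\<lambda>x. 1 - f x) x = - grad f x"
proof -
  have "frechet_derivative (\<lambda>x. 1 - f x) (at x) = (\<lambda>d. 0 - frechet_derivative f (at x) d)"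
    by (rule frechet_derivative_at[symmetric], rule has_derivative_diff)
       (use Ck_has_derivative[OF assms] in auto)
  then show ?thesis
    by (simp add: grad_def vec_eq_iff)
qed

lemma continuous_on_grad: "Ck (Suc 0) \<psi> \<Longrightarrow> continuous_on UNIV (grad \<psi>)"
  unfolding grad_def by (intro continuous_on_vec_lambda Ck1_continuous_derivative)

lemma continuous_bounded_on_bounded:
  fixes f :: "'a::euclidean_space \<Rightarrow> 'b::real_normed_vector"
  assumes "continuous_on UNIV f" "bounded \<Omega>"
  obtains M where "M \<ge> 0" "\<And>x. x \<in> \<Omega> \<Longrightarrow> norm (f x) \<le> M"
proof -
  have "compact (closure \<Omega>)" using assms(2) by (simp add: compact_closure)
  then have "compact (f ` closure \<Omega>)"
    using assms(1) by (intro compact_continuous_image) (auto intro: continuous_on_subset)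
  then obtain M where "\<And>x. x \<in> closure \<Omega> \<Longrightarrow> norm (f x) \<le> M"
    using compact_imp_bounded[of "f ` closure \<Omega>"] unfolding bounded_iff by blast
  then show ?thesis
    using closure_subset[of \<Omega>] by (intro that[of "max M 0"]) fastforce+
qed

section \<open>Nonlinear test functions of Sobolev functions\<close>

text \<open>The vectors \<open>y\<close> near \<open>e\<close> point into the domain, so a mollifier supported there turns a weak
  gradient on the domain into a classical gradient up to the boundary.\<close>

definition interior_cone_condition :: "'a::euclidean_space set \<Rightarrow> bool" where
  "interior_cone_condition \<Omega> \<longleftrightarrow> (\<forall>p\<in>closure \<Omega>. \<exists>r>0. \<exists>e. \<exists>\<kappa>>0. \<exists>\<delta>>0.
     \<forall>x\<in>\<Omega> \<inter> ball p r. \<forall>\<epsilon> y. 0 < \<epsilon> \<and> \<epsilon> < \<delta> \<and> y \<in> cball e \<kappa> \<longrightarrow> x + \<epsilon> *\<^sub>R y \<in> \<Omega>)"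

section \<open>Cutoff functions of class C1\<close>

lemma pos_part_square_deriv:
  "((\<lambda>s::real. (max 0 s)\<^sup>2) has_real_derivative 2 * max 0 s) (at s)"
proof -
  consider "s > 0" | "s < 0" | "s = 0" by linarith
  then show ?thesis
  proof cases
    case 1
    have "((\<lambda>s. s\<^sup>2) has_real_derivative 2 * max 0 s) (at s)"
      using 1 by (auto intro!: derivative_eq_intros)
    then show ?thesis
      by (rule has_field_derivative_transform_within_open[where S = "{0<..}"]) (use 1 in auto)
  next
    case 2
    have "((\<lambda>s. 0) has_real_derivative 2 * max 0 s) (at s)"
      using 2 by (auto intro!: derivative_eq_intros)
    then show ?thesis
      by (rule has_field_derivative_transform_within_open[where S = "{..<0}"]) (use 2 in auto)
  next
    case 3
    have "((\<lambda>h::real. max 0 h) \<longlongrightarrow> max 0 0) (at 0)"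
      by (intro tendsto_max tendsto_const tendsto_ident_at)
    then have "((\<lambda>h. max 0 h) \<longlongrightarrow> (0::real)) (at 0)" by simp
    moreover have "\<forall>\<^sub>F h in at 0. max 0 h = ((max 0 (0 + h))\<^sup>2 - (max 0 0)\<^sup>2) / (h::real)"
      by (auto simp: eventually_at power2_eq_square max_def intro!: exI[of _ 1])
    ultimately have "((\<lambda>h::real. ((max 0 (0 + h))\<^sup>2 - (max 0 0)\<^sup>2) / h) \<longlongrightarrow> 0) (at 0)"
      by (rule Lim_transform_eventually)
    then show ?thesis
      unfolding 3 by (simp add: DERIV_def)
  qed
qed

text \<open>With \<open>q s = (max 0 s)^2\<close> the ramp is \<open>1 - q (1 - q x)\<close>: the
  squared positive part is of class \<open>C^1\<close>, and the nesting flattens both ends.\<close>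

lemma C1_ramp_exists:
  obtains R R' :: "real \<Rightarrow> real" where "\<And>x. (R has_real_derivative R' x) (at x)" "continuous_on UNIV R'"
    "\<And>x. x \<le> 0 \<Longrightarrow> R x = 0" "\<And>x. x \<ge> 1 \<Longrightarrow> R x = 1" "\<And>x. x \<notin> {0..1} \<Longrightarrow> R' x = 0" "\<And>x. \<bar>R x\<bar> \<le> 1"
proof
  let ?q = "\<lambda>s::real. (max 0 s)\<^sup>2"
  let ?R = "\<lambda>x. 1 - ?q (1 - ?q x)"
  let ?R' = "\<lambda>x. 2 * max 0 (1 - ?q x) * (2 * max 0 x)"
  show "(?R has_real_derivative ?R' x) (at x)" for x
  proof -
    have "((\<lambda>x. 1 - ?q x) has_real_derivative 0 - 2 * max 0 x) (at x)"
      by (intro DERIV_diff DERIV_const pos_part_square_deriv)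
    from DERIV_diff[OF DERIV_const DERIV_chain2[OF pos_part_square_deriv this]]
    show ?thesis by simp
  qed
  show "continuous_on UNIV ?R'"
    by (intro continuous_intros)
  show "?R x = 0" if "x \<le> 0" for x
    using that by simp
  have q1: "?q x \<ge> 1" if "x \<ge> 1" for x
    using that by simp
  show "?R x = 1" if "x \<ge> 1" for x
    using q1[OF that] by simp
  show "?R' x = 0" if "x \<notin> {0..1}" for x
  proof (cases "x < 0")
    case False
    then have "?q x \<ge> 1" using that by (intro q1) auto
    then show ?thesis by simp
  qed simp
  show "\<bar>?R x\<bar> \<le> 1" for x
  proof -
    have "0 \<le> max 0 (1 - ?q x)" "max 0 (1 - ?q x) \<le> 1" by auto
    then have "?q (1 - ?q x) \<le> 1" by (intro power_le_one)
    then show ?thesis by (simp add: abs_le_iff)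
  qed
qed

lemma C1_cutoff_exists:
  fixes p :: "'a::euclidean_space"
  assumes "r > 0"
  obtains \<beta> :: "'a \<Rightarrow> real" where "Ck (Suc 0) \<beta>" "\<And>x. x \<in> ball p (r / 2) \<Longrightarrow> \<beta> x = 1"
    "\<And>x. x \<notin> ball p r \<Longrightarrow> \<beta> x = 0"
proof -
  obtain R R' :: "real \<Rightarrow> real" where R: "\<And>x. (R has_real_derivative R' x) (at x)" "continuous_on UNIV R'"
    "\<And>x. x \<le> 0 \<Longrightarrow> R x = 0" "\<And>x. x \<ge> 1 \<Longrightarrow> R x = 1"
    by (rule C1_ramp_exists) (rule that)
  have R1: "Ck (Suc 0) R"
    by (rule Ck_real_SucI[OF R(1)]) (simp add: R(2))
  \<comment> \<open>Affine in the squared distance: radius \<open>r / 2\<close> gives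
    \<open>- 1 / 2\<close> and radius \<open>r\<close> gives 1, so the ramp is 0 on the half-sized
    ball and 1 outside the full one.\<close>
  define s where "s x = 2 / r\<^sup>2 * (norm (x - p))\<^sup>2 - 1" for x
  show ?thesis
  proof
    have "Ck (Suc 0) s"
      unfolding s_def by (rule Ck_diff[OF Ck_cmult[OF Ck_norm_square] Ck_const])
    from Ck_diff[OF Ck_const Ck_compose[OF R1 this]]
    show "Ck (Suc 0) (\<lambda>x. 1 - R (s x))" .
    show "1 - R (s x) = 1" if "x \<in> ball p (r / 2)" for x
    proof -
      have "norm (x - p) \<le> r / 2"
        using that by (simp add: dist_norm norm_minus_commute)
      then have "(norm (x - p))\<^sup>2 \<le> (r / 2)\<^sup>2"
        by (intro power_mono) auto
      then have "2 * (norm (x - p))\<^sup>2 \<le> r\<^sup>2"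
        using zero_le_power2[of "norm (x - p)"] unfolding power_divide power2_eq_square[of 2] by linarith
      then have "s x \<le> 0"
        using assms by (simp add: s_def pos_divide_le_eq)
      then show ?thesis by (simp add: R(3))
    qed
    show "1 - R (s x) = 0" if "x \<notin> ball p r" for x
    proof -
      have "r \<le> norm (x - p)"
        using that by (simp add: dist_norm norm_minus_commute)
      then have "r\<^sup>2 \<le> (norm (x - p))\<^sup>2"
        using assms by (intro power_mono) auto
      then have "s x \<ge> 1"
        using assms by (simp add: s_def pos_le_divide_eq)
      then show ?thesis by (simp add: R(4))
    qed
  qed
qed

section \<open>Testing with a nonlinear function of a Sobolev function\<close>

lemma integrable_inner_L2:
  fixes f g :: "'a \<Rightarrow> 'b::euclidean_space"
  assumes [measurable]: "f \<in> borel_measurable M" "g \<in> borel_measurable M"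
    and "integrable M (\<lambda>x. (norm (f x))\<^sup>2)" "integrable M (\<lambda>x. (norm (g x))\<^sup>2)"
  shows "integrable M (\<lambda>x. norm (f x) * norm (g x))" "integrable M (\<lambda>x. f x \<bullet> g x)"
proof -
  have s: "integrable M (\<lambda>x. (norm (f x))\<^sup>2 + (norm (g x))\<^sup>2)"
    using assms by auto
  have le: "norm (f x) * norm (g x) \<le> (norm (f x))\<^sup>2 + (norm (g x))\<^sup>2" for x
    using sum_squares_bound[of "norm (f x)" "norm (g x)"] mult_nonneg_nonneg[OF norm_ge_zero[of "f x"] norm_ge_zero[of "g x"]]
    by linarith
  show "integrable M (\<lambda>x. norm (f x) * norm (g x))"
    by (rule Bochner_Integration.integrable_bound[OF s]) (use le in auto)
  show "integrable M (\<lambda>x. f x \<bullet> g x)"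
    by (rule Bochner_Integration.integrable_bound[OF s])
       (auto intro!: AE_I2 order_trans[OF Cauchy_Schwarz_ineq2 le])
qed

text \<open>\<open>test\<close> is the weak form of \<open>a = div B\<close> with vanishing normal
  component of \<open>B\<close>, since \<open>\<psi>\<close> is arbitrary at the boundary. It covers
  a concentration increment paired with its time-integrated flux, and a derivative of a test
  function paired with the corresponding vector field.\<close>

locale sobolev_test =
  fixes \<Omega> :: "(real^3) set" and w :: "real^3 \<Rightarrow> real" and G :: "real^3 \<Rightarrow> real^3"
    and a :: "real^3 \<Rightarrow> real" and B :: "real^3 \<Rightarrow> real^3" and F F' :: "real \<Rightarrow> real"
  assumes open_domain: "open \<Omega>" and bounded_domain: "bounded \<Omega>"
    and w: "integrable lborel w" "\<And>x. 0 \<le> w x" "\<And>x. w x \<le> 1"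
    and G: "integrable lborel G" "integrable lborel (\<lambda>x. (norm (G x))\<^sup>2)"
    and wG: "wgrad \<Omega> w G"
    and a: "integrable lborel a" "\<And>x. x \<notin> \<Omega> \<Longrightarrow> a x = 0"
    and B: "integrable lborel B" "integrable lborel (\<lambda>x. (norm (B x))\<^sup>2)" "\<And>x. x \<notin> \<Omega> \<Longrightarrow> B x = 0"
    and F: "\<And>s. (F has_real_derivative F' s) (at s)" "continuous_on UNIV F'"
    and test: "\<And>\<psi>. Ck (Suc 0) \<psi> \<Longrightarrow> (LINT x|lborel. a x * \<psi> x) + (LINT x|lborel. B x \<bullet> grad \<psi> x) = 0"
begin

text \<open>The identity assumed for \<open>C\<^sup>1\<close> tests, formally evaluated at the test \<open>\<theta> F w\<close>.\<close>

definition tested :: "(real^3 \<Rightarrow> real) \<Rightarrow> real" where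
  "tested \<theta> = (LINT x|lborel. a x * (\<theta> x * F (w x)) + B x \<bullet> (F (w x) *\<^sub>R grad \<theta> x + (\<theta> x * F' (w x)) *\<^sub>R G x))"

lemma measurable_data [measurable]:
  "w \<in> borel_measurable borel" "G \<in> borel_measurable borel" "a \<in> borel_measurable borel"
  "B \<in> borel_measurable borel" "F \<in> borel_measurable borel" "F' \<in> borel_measurable borel"
proof -
  have "continuous_on UNIV F"
    using DERIV_isCont[OF F(1)] by (simp add: continuous_on_eq_continuous_at)
  then show "F \<in> borel_measurable borel" by (rule borel_measurable_continuous_onI)
  show "F' \<in> borel_measurable borel" using F(2) by (rule borel_measurable_continuous_onI)
qed (use w G a B in auto)

lemma F_bounds:
  obtains M where "M \<ge> 0" "\<And>s. s \<in> {0..1} \<Longrightarrow> \<bar>F s\<bar> \<le> M" "\<And>s. s \<in> {0..1} \<Longrightarrow> \<bar>F' s\<bar> \<le> M"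
proof -
  have c: "continuous_on UNIV F"
    using DERIV_isCont[OF F(1)] by (simp add: continuous_on_eq_continuous_at)
  obtain M1 where M1: "M1 \<ge> 0" "\<And>s. s \<in> {0..1} \<Longrightarrow> norm (F s) \<le> M1"
    using continuous_bounded_on_bounded[OF c, of "{0..1}"] by auto
  obtain M2 where M2: "M2 \<ge> 0" "\<And>s. s \<in> {0..1} \<Longrightarrow> norm (F' s) \<le> M2"
    using continuous_bounded_on_bounded[OF F(2), of "{0..1}"] by auto
  show ?thesis
    by (rule that[of "max M1 M2"]) (use M1 M2 in \<open>auto simp: le_max_iff_disj\<close>)
qed

lemma BG_integrable: "integrable lborel (\<lambda>x. norm (B x) * norm (G x))"
  by (rule integrable_inner_L2(1)) (use B G in auto)

lemma integrable_terms:
  assumes \<theta>: "Ck (Suc 0) \<theta>"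
  shows "integrable lborel (\<lambda>x. a x * (\<theta> x * F (w x)))"
    "integrable lborel (\<lambda>x. B x \<bullet> (F (w x) *\<^sub>R grad \<theta> x))"
    "integrable lborel (\<lambda>x. B x \<bullet> ((\<theta> x * F' (w x)) *\<^sub>R G x))"
proof -
  have [measurable]: "\<theta> \<in> borel_measurable borel" "grad \<theta> \<in> borel_measurable borel"
    using borel_measurable_Ck[OF \<theta>] borel_measurable_continuous_onI[OF continuous_on_grad[OF \<theta>]] by auto
  have c: "continuous_on UNIV \<theta>" using Ck_Suc_D[OF \<theta>] by simp
  obtain M where M: "M \<ge> 0" "\<And>s. s \<in> {0..1} \<Longrightarrow> \<bar>F s\<bar> \<le> M" "\<And>s. s \<in> {0..1} \<Longrightarrow> \<bar>F' s\<bar> \<le> M"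
    by (rule F_bounds) blast
  obtain M1 where M1: "M1 \<ge> 0" "\<And>x. x \<in> \<Omega> \<Longrightarrow> norm (\<theta> x) \<le> M1"
    by (rule continuous_bounded_on_bounded[OF c bounded_domain]) blast
  obtain M2 where M2: "M2 \<ge> 0" "\<And>x. x \<in> \<Omega> \<Longrightarrow> norm (grad \<theta> x) \<le> M2"
    by (rule continuous_bounded_on_bounded[OF continuous_on_grad[OF \<theta>] bounded_domain]) blast
  have Fw: "\<bar>F (w x)\<bar> \<le> M" "\<bar>F' (w x)\<bar> \<le> M" for x
    using M w(2,3)[of x] by auto
  show "integrable lborel (\<lambda>x. a x * (\<theta> x * F (w x)))"
  proof (rule Bochner_Integration.integrable_bound[OF integrable_mult_left[OF a(1), of "M1 * M"]])
    have "\<bar>a x * (\<theta> x * F (w x))\<bar> \<le> \<bar>a x * (M1 * M)\<bar>" for x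
    proof (cases "x \<in> \<Omega>")
      case True
      have "\<bar>\<theta> x\<bar> * \<bar>F (w x)\<bar> \<le> M1 * M"
        using M1(2)[OF True] Fw(1)[of x] M1(1) by (intro mult_mono) auto
      then show ?thesis
        using M(1) M1(1) by (simp add: abs_mult mult_left_mono)
    qed (use a in simp)
    then show "AE x in lborel. norm (a x * (\<theta> x * F (w x))) \<le> norm (a x * (M1 * M))" by simp
  qed measurable
  show "integrable lborel (\<lambda>x. B x \<bullet> (F (w x) *\<^sub>R grad \<theta> x))"
  proof (rule Bochner_Integration.integrable_bound[OF integrable_mult_left[OF integrable_norm[OF B(1)], of "M * M2"]])
    have "\<bar>B x \<bullet> (F (w x) *\<^sub>R grad \<theta> x)\<bar> \<le> norm (B x) * (M * M2)" for x
    proof (cases "x \<in> \<Omega>")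
      case True
      have "norm (F (w x) *\<^sub>R grad \<theta> x) \<le> M * M2"
        using M2(2)[OF True] Fw(1)[of x] M(1) by (auto intro: mult_mono)
      then show ?thesis
        by (intro order_trans[OF Cauchy_Schwarz_ineq2] mult_left_mono) auto
    qed (use B in simp)
    then show "AE x in lborel. norm (B x \<bullet> (F (w x) *\<^sub>R grad \<theta> x)) \<le> norm (norm (B x) * (M * M2))"
      using M(1) M2(1) by (simp add: abs_mult)
  qed measurable
  show "integrable lborel (\<lambda>x. B x \<bullet> ((\<theta> x * F' (w x)) *\<^sub>R G x))"
  proof (rule Bochner_Integration.integrable_bound[OF integrable_mult_left[OF BG_integrable, of "M1 * M"]])
    have "\<bar>B x \<bullet> ((\<theta> x * F' (w x)) *\<^sub>R G x)\<bar> \<le> norm (B x) * norm (G x) * (M1 * M)" for x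
    proof (cases "x \<in> \<Omega>")
      case True
      have "\<bar>\<theta> x * F' (w x)\<bar> \<le> M1 * M"
        using M1(2)[OF True] Fw(2)[of x] M1(1) by (auto simp: abs_mult intro: mult_mono)
      then have "norm ((\<theta> x * F' (w x)) *\<^sub>R G x) \<le> norm (G x) * (M1 * M)"
        by (subst norm_scaleR, subst mult.commute) (rule mult_left_mono[OF _ norm_ge_zero])
      then have "norm (B x) * norm ((\<theta> x * F' (w x)) *\<^sub>R G x) \<le> norm (B x) * (norm (G x) * (M1 * M))"
        by (intro mult_left_mono) auto
      then show ?thesis
        using Cauchy_Schwarz_ineq2[of "B x" "(\<theta> x * F' (w x)) *\<^sub>R G x"] by (simp add: mult.assoc)
    qed (use B in simp)
    then show "AE x in lborel. norm (B x \<bullet> ((\<theta> x * F' (w x)) *\<^sub>R G x)) \<le> norm (norm (B x) * norm (G x) * (M1 * M))"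
      using M(1) M1(1) by (simp add: abs_mult)
  qed measurable
qed

lemma tested_eq:
  assumes "Ck (Suc 0) \<theta>"
  shows "tested \<theta> = (LINT x|lborel. a x * (\<theta> x * F (w x))) + (LINT x|lborel. B x \<bullet> (F (w x) *\<^sub>R grad \<theta> x))
     + (LINT x|lborel. B x \<bullet> ((\<theta> x * F' (w x)) *\<^sub>R G x))"
  unfolding tested_def inner_add_right using integrable_terms[OF assms] by simp

text \<open>Within one cone neighbourhood the mollification \<open>wn n\<close> of \<open>w\<close>
  has the mollified \<open>G\<close> as its classical gradient at all points of
  \<open>\<Omega>\<close> where \<open>\<zeta>\<close> can be nonzero. The function
  \<open>\<zeta> * F (wn n)\<close> is of class \<open>C^1\<close>, hence an admissible test, and
  the identity passes to the limit.\<close>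

lemma tested_local:
  assumes \<zeta>: "Ck (Suc 0) \<zeta>" "\<And>x. x \<notin> ball p r \<Longrightarrow> \<zeta> x = 0"
    and \<kappa>: "\<kappa> > 0" and \<delta>: "\<delta> > 0"
    and cone: "\<And>x \<epsilon> y. x \<in> \<Omega> \<Longrightarrow> x \<in> ball p r \<Longrightarrow> 0 < \<epsilon> \<Longrightarrow> \<epsilon> < \<delta> \<Longrightarrow> y \<in> cball e \<kappa> \<Longrightarrow> x + \<epsilon> *\<^sub>R y \<in> \<Omega>"
  shows "tested \<zeta> = 0"
proof -
  obtain \<rho> where \<rho>: "mollifier \<rho> (cball e \<kappa>)"
    by (rule mollifier_cball_exists[OF \<kappa>]) blast
  obtain \<epsilon>0 where \<epsilon>0: "\<And>n. \<epsilon>0 n > 0" "\<epsilon>0 \<longlonglongrightarrow> 0"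
    "AE x in lborel. (\<lambda>n. mollify \<rho> (\<epsilon>0 n) w x) \<longlonglongrightarrow> w x"
    by (rule mollify_AE_converges[OF \<rho> w(1)]) blast
  define wn where "wn n = mollify \<rho> (\<epsilon>0 n) w" for n
  define Gn where "Gn n = mollify \<rho> (\<epsilon>0 n) G" for n
  have [measurable]: "wn n \<in> borel_measurable borel" "Gn n \<in> borel_measurable borel" for n
    unfolding wn_def Gn_def by (auto intro: borel_measurable_mollify[OF \<rho>])
  have [measurable]: "\<zeta> \<in> borel_measurable borel" "grad \<zeta> \<in> borel_measurable borel"
    using borel_measurable_Ck[OF \<zeta>(1)] borel_measurable_continuous_onI[OF continuous_on_grad[OF \<zeta>(1)]] by auto
  have c: "continuous_on UNIV \<zeta>" using Ck_Suc_D[OF \<zeta>(1)] by simp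
  obtain M where M: "M \<ge> 0" "\<And>s. s \<in> {0..1} \<Longrightarrow> \<bar>F s\<bar> \<le> M" "\<And>s. s \<in> {0..1} \<Longrightarrow> \<bar>F' s\<bar> \<le> M"
    by (rule F_bounds) blast
  obtain M1 where M1: "M1 \<ge> 0" "\<And>x. x \<in> \<Omega> \<Longrightarrow> norm (\<zeta> x) \<le> M1"
    by (rule continuous_bounded_on_bounded[OF c bounded_domain]) blast
  obtain M2 where M2: "M2 \<ge> 0" "\<And>x. x \<in> \<Omega> \<Longrightarrow> norm (grad \<zeta> x) \<le> M2"
    by (rule continuous_bounded_on_bounded[OF continuous_on_grad[OF \<zeta>(1)] bounded_domain]) blast
  have wn01: "wn n x \<in> {0..1}" for n x
    unfolding wn_def by (rule mollify_bounds[OF \<rho> w \<epsilon>0(1)])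
  have Fwn: "\<bar>F (wn n x)\<bar> \<le> M" "\<bar>F' (wn n x)\<bar> \<le> M" for n x
    using M wn01 by auto
  have Ckwn: "Ck (Suc 0) (wn n)" for n
    unfolding wn_def by (rule mollify_Ck1[OF \<rho> w(1) \<epsilon>0(1)])
  have CkF: "Ck (Suc 0) F"
    by (rule Ck_real_SucI[OF F(1)]) (use F(2) in simp)
  note CkFwn = Ck_compose[OF CkF Ckwn]
  have contF: "isCont F s" "isCont F' s" for s
    using DERIV_isCont[OF F(1)] F(2) by (auto simp: continuous_on_eq_continuous_at)
  have lim: "AE x in lborel. (\<lambda>n. F (wn n x)) \<longlonglongrightarrow> F (w x) \<and> (\<lambda>n. F' (wn n x)) \<longlonglongrightarrow> F' (w x)"
    using \<epsilon>0(3) unfolding wn_def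
    by eventually_elim (auto intro: isCont_tendsto_compose[OF contF(1)] isCont_tendsto_compose[OF contF(2)])
  define A where "A n = (LINT x|lborel. a x * (\<zeta> x * F (wn n x)))" for n
  define C where "C n = (LINT x|lborel. B x \<bullet> (F (wn n x) *\<^sub>R grad \<zeta> x))" for n
  define E where "E n = (LINT x|lborel. B x \<bullet> ((\<zeta> x * F' (wn n x)) *\<^sub>R G x))" for n
  \<comment> \<open>The deviation of the mollified gradient from \<open>G\<close> is split off
    because it is small only in the mean against \<open>B\<close>; the other terms converge by
    domination.\<close>
  define R where "R n x = B x \<bullet> ((\<zeta> x * F' (wn n x)) *\<^sub>R (Gn n x - G x))" for n x
  have [measurable]: "R n \<in> borel_measurable borel" for n
    unfolding R_def[abs_def] by measurable
  have limA: "A \<longlonglongrightarrow> (LINT x|lborel. a x * (\<zeta> x * F (w x)))"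
    unfolding A_def
  proof (rule integral_dominated_convergence[where w = "\<lambda>x. norm (a x) * (M1 * M)"])
    show "AE x in lborel. norm (a x * (\<zeta> x * F (wn n x))) \<le> norm (a x) * (M1 * M)" for n
    proof (rule AE_I2)
      fix x
      show "norm (a x * (\<zeta> x * F (wn n x))) \<le> norm (a x) * (M1 * M)"
      proof (cases "x \<in> \<Omega>")
        case True
        have "\<bar>\<zeta> x\<bar> * \<bar>F (wn n x)\<bar> \<le> M1 * M"
          using M1(2)[OF True] Fwn(1)[of n x] M1(1) by (intro mult_mono) auto
        then show ?thesis by (simp add: abs_mult mult_left_mono)
      qed (use a in simp)
    qed
    show "AE x in lborel. (\<lambda>n. a x * (\<zeta> x * F (wn n x))) \<longlonglongrightarrow> a x * (\<zeta> x * F (w x))"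
      using lim by eventually_elim (intro tendsto_mult tendsto_const, simp)
  qed (use a in auto)
  have limC: "C \<longlonglongrightarrow> (LINT x|lborel. B x \<bullet> (F (w x) *\<^sub>R grad \<zeta> x))"
    unfolding C_def
  proof (rule integral_dominated_convergence[where w = "\<lambda>x. norm (B x) * (M * M2)"])
    show "AE x in lborel. norm (B x \<bullet> (F (wn n x) *\<^sub>R grad \<zeta> x)) \<le> norm (B x) * (M * M2)" for n
    proof (rule AE_I2)
      fix x
      show "norm (B x \<bullet> (F (wn n x) *\<^sub>R grad \<zeta> x)) \<le> norm (B x) * (M * M2)"
      proof (cases "x \<in> \<Omega>")
        case True
        have "norm (F (wn n x) *\<^sub>R grad \<zeta> x) \<le> M * M2"
          using M2(2)[OF True] Fwn(1)[of n x] M(1) by (auto intro: mult_mono)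
        then show ?thesis
          unfolding real_norm_def by (intro order_trans[OF Cauchy_Schwarz_ineq2] mult_left_mono) auto
      qed (use B in simp)
    qed
    show "AE x in lborel. (\<lambda>n. B x \<bullet> (F (wn n x) *\<^sub>R grad \<zeta> x)) \<longlonglongrightarrow> B x \<bullet> (F (w x) *\<^sub>R grad \<zeta> x)"
      using lim by eventually_elim (intro tendsto_inner tendsto_scaleR tendsto_const, simp)
  qed (use B in auto)
  have zF': "\<bar>\<zeta> x * F' (wn n x)\<bar> \<le> M1 * M" if "x \<in> \<Omega>" for n x
    using M1(2)[OF that] Fwn(2)[of n x] M1(1) by (auto simp: abs_mult intro: mult_mono)
  have bnd: "\<bar>B x \<bullet> ((\<zeta> x * F' (wn n x)) *\<^sub>R V)\<bar> \<le> norm (B x) * norm V * (M1 * M)" for n x V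
  proof (cases "x \<in> \<Omega>")
    case True
    have "norm ((\<zeta> x * F' (wn n x)) *\<^sub>R V) \<le> norm V * (M1 * M)"
      by (subst norm_scaleR, subst mult.commute) (rule mult_left_mono[OF zF'[OF True] norm_ge_zero])
    then have "norm (B x) * norm ((\<zeta> x * F' (wn n x)) *\<^sub>R V) \<le> norm (B x) * (norm V * (M1 * M))"
      by (intro mult_left_mono) auto
    then show ?thesis
      using Cauchy_Schwarz_ineq2[of "B x" "(\<zeta> x * F' (wn n x)) *\<^sub>R V"] by (simp add: mult.assoc)
  qed (use B in simp)
  have limE: "E \<longlonglongrightarrow> (LINT x|lborel. B x \<bullet> ((\<zeta> x * F' (w x)) *\<^sub>R G x))"
    unfolding E_def
  proof (rule integral_dominated_convergence[where w = "\<lambda>x. norm (B x) * norm (G x) * (M1 * M)"])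
    show "AE x in lborel. norm (B x \<bullet> ((\<zeta> x * F' (wn n x)) *\<^sub>R G x)) \<le> norm (B x) * norm (G x) * (M1 * M)" for n
      using bnd by simp
    show "AE x in lborel. (\<lambda>n. B x \<bullet> ((\<zeta> x * F' (wn n x)) *\<^sub>R G x)) \<longlonglongrightarrow> B x \<bullet> ((\<zeta> x * F' (w x)) *\<^sub>R G x)"
      using lim by eventually_elim (intro tendsto_inner tendsto_scaleR tendsto_mult tendsto_const, simp)
  qed (use BG_integrable in auto)
  have BGc: "translation_continuous B G"
    by (rule translation_continuous_L2) (use B G in auto)
  have R0: "\<forall>\<^sub>F n in sequentially. integrable lborel (R n) \<and> \<bar>LINT x|lborel. R n x\<bar> \<le> \<eta>" if "\<eta> > 0" for \<eta>
  proof -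
    define \<eta>' where "\<eta>' = \<eta> / (M1 * M + 1)"
    have "M1 * M \<ge> 0" using M M1 by simp
    then have "\<eta>' > 0" using that by (simp add: \<eta>'_def)
    have "\<exists>d>0. \<forall>\<epsilon>. 0 < \<epsilon> \<and> \<epsilon> < d \<longrightarrow>
        (\<integral>\<^sup>+x. ennreal (norm (B x) * norm (mollify \<rho> \<epsilon> G x - G x)) \<partial>lborel) \<le> ennreal \<eta>'"
      by (rule mollify_converges[OF \<rho> G(1) _ BGc \<open>\<eta>' > 0\<close>]) measurable
    then obtain d where d: "d > 0" "\<And>\<epsilon>. 0 < \<epsilon> \<Longrightarrow> \<epsilon> < d \<Longrightarrow>
        (\<integral>\<^sup>+x. ennreal (norm (B x) * norm (mollify \<rho> \<epsilon> G x - G x)) \<partial>lborel) \<le> ennreal \<eta>'"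
      by blast
    have "\<forall>\<^sub>F n in sequentially. \<epsilon>0 n < d"
      using \<epsilon>0(2) d(1) by (rule order_tendstoD)
    then show ?thesis
    proof eventually_elim
      case (elim n)
      have "(\<integral>\<^sup>+x. ennreal (norm (R n x)) \<partial>lborel)
          \<le> (\<integral>\<^sup>+x. ennreal (M1 * M) * ennreal (norm (B x) * norm (Gn n x - G x)) \<partial>lborel)"
        using bnd[of _ n] \<open>M1 * M \<ge> 0\<close>
        by (intro nn_integral_mono) (simp add: R_def ennreal_mult[symmetric] mult.commute[of "M1 * M"] del: ennreal_mult'')
      also have "\<dots> = ennreal (M1 * M) * (\<integral>\<^sup>+x. ennreal (norm (B x) * norm (Gn n x - G x)) \<partial>lborel)"
        by (rule nn_integral_cmult) measurable
      also have "\<dots> \<le> ennreal (M1 * M) * ennreal \<eta>'"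
        unfolding Gn_def by (intro mult_left_mono d(2) \<epsilon>0(1) elim) auto
      also have "\<dots> = ennreal (M1 * M * \<eta>')"
        using \<open>M1 * M \<ge> 0\<close> \<open>\<eta>' > 0\<close> by (subst ennreal_mult[symmetric]) auto
      also have "\<dots> \<le> ennreal \<eta>"
      proof (rule ennreal_leI)
        have "M1 * M * \<eta>' \<le> (M1 * M + 1) * \<eta>'"
          using \<open>\<eta>' > 0\<close> by (intro mult_right_mono) auto
        also have "\<dots> = \<eta>"
          using \<open>M1 * M \<ge> 0\<close> by (simp add: \<eta>'_def)
        finally show "M1 * M * \<eta>' \<le> \<eta>" .
      qed
      finally have le: "(\<integral>\<^sup>+x. ennreal (norm (R n x)) \<partial>lborel) \<le> ennreal \<eta>" .
      have int: "integrable lborel (R n)"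
        by (rule integrableI_bounded) (use le in \<open>auto intro: order_le_less_trans\<close>)
      have "ennreal (norm (LINT x|lborel. R n x)) \<le> ennreal \<eta>"
        using integral_norm_bound_ennreal[OF int] le by (rule order_trans)
      then show ?case
        using int that by (simp add: ennreal_le_iff)
    qed
  qed
  have limR: "(\<lambda>n. LINT x|lborel. R n x) \<longlonglongrightarrow> 0"
  proof (rule tendstoI)
    fix \<eta> :: real assume "\<eta> > 0"
    then have "\<eta> / 2 > 0" by simp
    from R0[OF this] show "\<forall>\<^sub>F n in sequentially. dist (LINT x|lborel. R n x) 0 < \<eta>"
      by eventually_elim (use \<open>\<eta> > 0\<close> in auto)
  qed
  have "\<forall>\<^sub>F n in sequentially. A n + C n + E n + (LINT x|lborel. R n x) = 0"
    using R0[OF zero_less_one] order_tendstoD(2)[OF \<epsilon>0(2) \<delta>]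
  proof eventually_elim
    case (elim n)
    define \<psi> where "\<psi> x = \<zeta> x * F (wn n x)" for x
    have Ck\<psi>: "Ck (Suc 0) \<psi>"
      unfolding \<psi>_def by (rule Ck_mult[OF \<zeta>(1) CkFwn])
    have Bg: "B x \<bullet> grad \<psi> x = B x \<bullet> (F (wn n x) *\<^sub>R grad \<zeta> x) + B x \<bullet> ((\<zeta> x * F' (wn n x)) *\<^sub>R G x) + R n x" for x
    proof -
      have g: "grad \<psi> x = F (wn n x) *\<^sub>R grad \<zeta> x + (\<zeta> x * F' (wn n x)) *\<^sub>R grad (wn n) x"
        unfolding \<psi>_def grad_mult[OF \<zeta>(1) CkFwn] grad_compose[OF Ckwn F(1)] by simp
      have "B x \<bullet> ((\<zeta> x * F' (wn n x)) *\<^sub>R grad (wn n) x) = B x \<bullet> ((\<zeta> x * F' (wn n x)) *\<^sub>R Gn n x)"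
      \<comment> \<open>Outside \<open>\<Omega>\<close> the factor \<open>B\<close> vanishes and
        outside the ball \<open>\<zeta>\<close> does, so the two gradients are compared only where
        the cone is available.\<close>
      proof (cases "x \<in> \<Omega> \<and> x \<in> ball p r")
        case True
        have "grad (wn n) x = Gn n x"
          unfolding wn_def Gn_def
          by (rule grad_mollify[OF \<rho> w(1) G(1) wG \<epsilon>0(1)]) (use True cone \<epsilon>0(1) elim in blast)
        then show ?thesis by simp
      next
        case False
        then show ?thesis using B(3) \<zeta>(2) by auto
      qed
      then show ?thesis
        unfolding g R_def by (simp add: inner_add_right inner_diff_right algebra_simps)
    qed
    have i1: "integrable lborel (\<lambda>x. B x \<bullet> (F (wn n x) *\<^sub>R grad \<zeta> x))"
    proof (rule Bochner_Integration.integrable_bound[OF integrable_mult_left[OF integrable_norm[OF B(1)], of "M * M2"]])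
      have "\<bar>B x \<bullet> (F (wn n x) *\<^sub>R grad \<zeta> x)\<bar> \<le> norm (B x) * (M * M2)" for x
      proof (cases "x \<in> \<Omega>")
        case True
        have "norm (F (wn n x) *\<^sub>R grad \<zeta> x) \<le> M * M2"
          using M2(2)[OF True] Fwn(1)[of n x] M(1) by (auto intro: mult_mono)
        then show ?thesis
          by (intro order_trans[OF Cauchy_Schwarz_ineq2] mult_left_mono) auto
      qed (use B in simp)
      then show "AE x in lborel. norm (B x \<bullet> (F (wn n x) *\<^sub>R grad \<zeta> x)) \<le> norm (norm (B x) * (M * M2))"
        using M(1) M2(1) by (simp add: abs_mult)
    qed measurable
    have i2: "integrable lborel (\<lambda>x. B x \<bullet> ((\<zeta> x * F' (wn n x)) *\<^sub>R G x))"
      by (rule Bochner_Integration.integrable_bound[OF integrable_mult_left[OF BG_integrable, of "M1 * M"]])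
         (use bnd M(1) M1(1) in \<open>auto simp: abs_mult\<close>)
    have "(LINT x|lborel. B x \<bullet> grad \<psi> x) = C n + E n + (LINT x|lborel. R n x)"
      unfolding Bg C_def E_def using i1 i2 elim by simp
    then show ?case
      using test[OF Ck\<psi>] by (simp add: A_def \<psi>_def)
  qed
  then have "(\<lambda>n. A n + C n + E n + (LINT x|lborel. R n x)) \<longlonglongrightarrow> 0"
    by (rule tendsto_eventually)
  moreover have "(\<lambda>n. A n + C n + E n + (LINT x|lborel. R n x)) \<longlonglongrightarrow> tested \<zeta> + 0"
    unfolding tested_eq[OF \<zeta>(1)] by (intro tendsto_add limA limC limE limR)
  ultimately show ?thesis
    using LIMSEQ_unique by fastforce
qed

text \<open>Induction on the cover: a cutoff \<open>\<beta>\<close> of one ball splits \<open>\<theta> = \<theta> \<beta> + \<theta> (1 - \<beta>)\<close>, which replaces a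
  partition of unity.\<close>

lemma tested_zero_outside_cover:
  assumes "finite P"
    and "\<And>p. p \<in> P \<Longrightarrow> r p > 0 \<and> (\<forall>\<zeta>. Ck (Suc 0) \<zeta> \<longrightarrow> (\<forall>x. x \<notin> ball p (r p) \<longrightarrow> \<zeta> x = 0) \<longrightarrow> tested \<zeta> = 0)"
    and "Ck (Suc 0) \<theta>" "\<And>x. x \<in> \<Omega> \<Longrightarrow> x \<notin> (\<Union>p\<in>P. ball p (r p / 2)) \<Longrightarrow> \<theta> x = 0"
  shows "tested \<theta> = 0"
  using assms
proof (induction P arbitrary: \<theta> rule: finite_induct)
  case empty
  have "a x * (\<theta> x * F (w x)) + B x \<bullet> (F (w x) *\<^sub>R grad \<theta> x + (\<theta> x * F' (w x)) *\<^sub>R G x) = 0" for x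
  proof (cases "x \<in> \<Omega>")
    case True
    \<comment> \<open>With no ball left, \<open>\<theta>\<close> vanishes on the open set
      \<open>\<Omega>\<close> and so does its gradient; off \<open>\<Omega>\<close> the data
      \<open>a\<close> and \<open>B\<close> are zero.\<close>
    have "grad \<theta> x = 0"
      by (rule grad_locally_zero[OF open_domain True]) (use empty in auto)
    then show ?thesis using True empty by simp
  qed (use a B in simp)
  then show ?case by (simp add: tested_def)
next
  case (insert p P)
  have rp: "r p > 0" and loc: "\<And>\<zeta>. Ck (Suc 0) \<zeta> \<Longrightarrow> (\<And>x. x \<notin> ball p (r p) \<Longrightarrow> \<zeta> x = 0) \<Longrightarrow> tested \<zeta> = 0"
    using insert.prems(1)[of p] by auto
  obtain \<beta> where \<beta>: "Ck (Suc 0) \<beta>" "\<And>x. x \<in> ball p (r p / 2) \<Longrightarrow> \<beta> x = 1"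
    "\<And>x. x \<notin> ball p (r p) \<Longrightarrow> \<beta> x = 0"
    by (rule C1_cutoff_exists[OF rp]) blast
  have C1: "Ck (Suc 0) (\<lambda>x. \<theta> x * \<beta> x)"
    by (rule Ck_mult[OF insert.prems(2) \<beta>(1)])
  have C2': "Ck (Suc 0) (\<lambda>x. 1 - \<beta> x)"
    by (rule Ck_diff[OF Ck_const \<beta>(1)])
  have C2: "Ck (Suc 0) (\<lambda>x. \<theta> x * (1 - \<beta> x))"
    by (rule Ck_mult[OF insert.prems(2) C2'])
  have "tested (\<lambda>x. \<theta> x * \<beta> x) = 0"
    by (rule loc[OF C1]) (simp add: \<beta>(3))
  moreover have "tested (\<lambda>x. \<theta> x * (1 - \<beta> x)) = 0"
  proof (rule insert.IH[OF _ C2])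
    show "\<theta> x * (1 - \<beta> x) = 0" if "x \<in> \<Omega>" "x \<notin> (\<Union>p\<in>P. ball p (r p / 2))" for x
      using that insert.prems(3)[of x] \<beta>(2)[of x] by auto
  qed (use insert.prems(1) in blast)
  moreover have "tested \<theta> = tested (\<lambda>x. \<theta> x * \<beta> x) + tested (\<lambda>x. \<theta> x * (1 - \<beta> x))"
  proof -
    note i = integrable_terms[OF insert.prems(2)] integrable_terms[OF C1] integrable_terms[OF C2]
    have g: "grad \<theta> x = grad (\<lambda>x. \<theta> x * \<beta> x) x + grad (\<lambda>x. \<theta> x * (1 - \<beta> x)) x" for x
      unfolding grad_mult[OF insert.prems(2) \<beta>(1)] grad_mult[OF insert.prems(2) C2'] grad_diff_one[OF \<beta>(1)]
      by (simp add: algebra_simps)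
    have e1: "(LINT x|lborel. a x * (\<theta> x * F (w x)))
       = (LINT x|lborel. a x * ((\<theta> x * \<beta> x) * F (w x))) + (LINT x|lborel. a x * ((\<theta> x * (1 - \<beta> x)) * F (w x)))"
      by (subst Bochner_Integration.integral_add[symmetric, OF i(4) i(7)]) (simp add: algebra_simps)
    have e2: "(LINT x|lborel. B x \<bullet> (F (w x) *\<^sub>R grad \<theta> x))
       = (LINT x|lborel. B x \<bullet> (F (w x) *\<^sub>R grad (\<lambda>x. \<theta> x * \<beta> x) x)) + (LINT x|lborel. B x \<bullet> (F (w x) *\<^sub>R grad (\<lambda>x. \<theta> x * (1 - \<beta> x)) x))"
      by (subst Bochner_Integration.integral_add[symmetric, OF i(5) i(8)]) (simp add: g inner_add_right scaleR_add_right)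
    have e3: "(LINT x|lborel. B x \<bullet> ((\<theta> x * F' (w x)) *\<^sub>R G x))
       = (LINT x|lborel. B x \<bullet> ((\<theta> x * \<beta> x * F' (w x)) *\<^sub>R G x)) + (LINT x|lborel. B x \<bullet> ((\<theta> x * (1 - \<beta> x) * F' (w x)) *\<^sub>R G x))"
      by (subst Bochner_Integration.integral_add[symmetric, OF i(6) i(9)]) (simp add: algebra_simps)
    show ?thesis
      unfolding tested_eq[OF insert.prems(2)] tested_eq[OF C1] tested_eq[OF C2] e1 e2 e3 by simp
  qed
  ultimately show ?case by simp
qed

text \<open>This is \<open>tested\<close> with \<open>\<theta> = 1\<close>. The cover consists of
  balls of half the radius because the cutoff belonging to a ball equals 1 on the half-sized
  one.\<close>

lemma chain_rule_test:
  assumes "interior_cone_condition \<Omega>"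
  shows "(LINT x|lborel. a x * F (w x)) + (LINT x|lborel. B x \<bullet> (F' (w x) *\<^sub>R G x)) = 0"
proof -
  have "\<exists>r. r > 0 \<and> (\<forall>\<zeta>. Ck (Suc 0) \<zeta> \<longrightarrow> (\<forall>x. x \<notin> ball p r \<longrightarrow> \<zeta> x = 0) \<longrightarrow> tested \<zeta> = 0)" if p: "p \<in> closure \<Omega>" for p
  proof -
    obtain r e \<kappa> \<delta> where c: "r > 0" "\<kappa> > 0" "\<delta> > 0" "\<And>x \<epsilon> y. x \<in> \<Omega> \<Longrightarrow> x \<in> ball p r \<Longrightarrow> 0 < \<epsilon> \<Longrightarrow> \<epsilon> < \<delta> \<Longrightarrow> y \<in> cball e \<kappa> \<Longrightarrow> x + \<epsilon> *\<^sub>R y \<in> \<Omega>"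
      using bspec[OF assms[unfolded interior_cone_condition_def] p] unfolding Ball_def Int_iff
      by (elim exE conjE) blast
    have "tested \<zeta> = 0" if "Ck (Suc 0) \<zeta>" "\<And>x. x \<notin> ball p r \<Longrightarrow> \<zeta> x = 0" for \<zeta>
      by (rule tested_local[OF that c(2,3,4)])
    then show ?thesis
      using c(1) by blast
  qed
  then obtain r where r: "\<And>p. p \<in> closure \<Omega> \<Longrightarrow> r p > 0 \<and>
      (\<forall>\<zeta>. Ck (Suc 0) \<zeta> \<longrightarrow> (\<forall>x. x \<notin> ball p (r p) \<longrightarrow> \<zeta> x = 0) \<longrightarrow> tested \<zeta> = 0)"
    by metis
  have "compact (closure \<Omega>)" using bounded_domain by (simp add: compact_closure)
  moreover have "closure \<Omega> \<subseteq> (\<Union>p\<in>closure \<Omega>. ball p (r p / 2))"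
    using r by (intro subsetI UN_I) auto
  ultimately obtain P where P: "P \<subseteq> closure \<Omega>" "finite P" "closure \<Omega> \<subseteq> (\<Union>p\<in>P. ball p (r p / 2))"
    using compactE_image[of "closure \<Omega>" "closure \<Omega>" "\<lambda>p. ball p (r p / 2)"] by auto
  have "tested (\<lambda>_. 1) = 0"
    by (rule tested_zero_outside_cover[OF P(2)]) (use P r closure_subset in \<open>blast intro: Ck_const\<close>)+
  moreover have "grad (\<lambda>_. 1) x = 0" for x
    by (simp add: grad_def vec_eq_iff)
  ultimately show ?thesis
    unfolding tested_eq[OF Ck_const] by simp
qed

end

text \<open>Above a graph with Lipschitz constant \<open>L\<close>, a move with vertical part at
  least \<open>1 - \<kappa>\<close> and horizontal part at most \<open>\<kappa>\<close> stays above
  the graph if \<open>L * \<kappa> \<le> 1 - \<kappa>\<close>. At interior points every short move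
  is allowed.\<close>

lemma smooth_bounded_domain_cone:
  assumes "smooth_bounded_domain \<Omega>"
  shows "interior_cone_condition \<Omega>"
  unfolding interior_cone_condition_def
proof
  fix p assume p: "p \<in> closure \<Omega>"
  have "open \<Omega>" and sb: "smooth_boundary \<Omega>"
    using assms by (auto simp: smooth_bounded_domain_def)
  let ?cone = "\<lambda>r e \<kappa> \<delta>. \<forall>x\<in>\<Omega> \<inter> ball p r. \<forall>\<epsilon> y. 0 < \<epsilon> \<and> \<epsilon> < \<delta> \<and> y \<in> cball e \<kappa> \<longrightarrow> x + \<epsilon> *\<^sub>R y \<in> \<Omega>"
  show "\<exists>r>0. \<exists>e. \<exists>\<kappa>>0. \<exists>\<delta>>0. ?cone r e \<kappa> \<delta>"
  proof (cases "p \<in> \<Omega>")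
    case True
    then obtain r where r: "r > 0" "ball p r \<subseteq> \<Omega>"
      using \<open>open \<Omega>\<close> open_contains_ball by blast
    have "?cone (r / 2) 0 1 (r / 2)"
    proof (intro ballI allI impI)
      fix x \<epsilon> and y :: "real^3" assume x: "x \<in> \<Omega> \<inter> ball p (r / 2)" and y: "0 < \<epsilon> \<and> \<epsilon> < r / 2 \<and> y \<in> cball 0 1"
      have "norm (\<epsilon> *\<^sub>R y) \<le> \<epsilon>"
        using y by (simp add: mult_left_le)
      moreover have "dist p (x + \<epsilon> *\<^sub>R y) \<le> dist p x + norm (\<epsilon> *\<^sub>R y)"
        using dist_triangle[of p "x + \<epsilon> *\<^sub>R y" x] by (simp add: dist_norm)
      moreover have "dist p x < r / 2" "\<epsilon> < r / 2"
        using x y by auto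
      ultimately have "dist p (x + \<epsilon> *\<^sub>R y) < r"
        by linarith
      then show "x + \<epsilon> *\<^sub>R y \<in> \<Omega>" using r by auto
    qed
    then show ?thesis
      using r(1) by (intro exI[of _ "r / 2"] exI[of _ 0] exI[of _ 1] conjI) auto
  next
    case False
    then have "p \<in> frontier \<Omega>"
      using p \<open>open \<Omega>\<close> by (simp add: frontier_def interior_open)
    from bspec[OF sb[unfolded smooth_boundary_def] this] obtain r and R :: "real^3 \<Rightarrow> real^3" and \<gamma> :: "real^2 \<Rightarrow> real" where
      r: "r > 0" and R: "orthogonal_transformation R" and "smooth \<gamma>" and
      eq: "\<Omega> \<inter> ball p r = {x \<in> ball p r. \<gamma> (vector [R x $ 1, R x $ 2]) < R x $ 3}"
      by blast
    define u :: "real^3 \<Rightarrow> real^2" where "u x = vector [R x $ 1, R x $ 2]" for x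
    have lin: "linear R" using R by (simp add: orthogonal_transformation_linear)
    have u_add: "u (x + c *\<^sub>R y) - u x = c *\<^sub>R u y" for x y c
      by (simp add: u_def vec_eq_iff forall_2 linear_add[OF lin] linear_scale[OF lin])
    have u_le': "(norm (vector [v $ 1, v $ 2] :: real^2))\<^sup>2 \<le> (norm v)\<^sup>2" for v :: "real^3"
      unfolding power2_norm_eq_inner by (simp add: inner_vec_def sum_2 sum_3)
    have u_le: "norm (u x) \<le> norm x" for x
      using power2_le_imp_le[OF u_le'[of "R x"]] orthogonal_transformation_norm[OF R, of x] by (simp add: u_def)
    have \<gamma>: "Ck (Suc 0) \<gamma>" using \<open>smooth \<gamma>\<close> by (simp add: smooth_def del: Ck.simps)
    \<comment> \<open>The graph function is Lipschitz on bounded sets; this one contains the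
      projections of all points of \<open>ball p r\<close>.\<close>
    let ?K = "cball 0 (norm p + r) :: (real^2) set"
    have "\<exists>M. M \<ge> 0 \<and> (\<forall>x\<in>?K. norm (frechet_derivative \<gamma> (at x) b) \<le> M)" for b
      by (rule continuous_bounded_on_bounded[OF Ck1_continuous_derivative[OF \<gamma>], of ?K b]) auto
    then obtain M where M: "\<And>b. M b \<ge> 0" "\<And>b x. x \<in> ?K \<Longrightarrow> norm (frechet_derivative \<gamma> (at x) b) \<le> M b"
      by metis
    define L where "L = (\<Sum>b\<in>Basis. M b)"
    have L0: "L \<ge> 0" unfolding L_def by (intro sum_nonneg M)
    have diff: "\<gamma> differentiable (at x)" for x using \<gamma> by simp
    have bd: "\<bar>frechet_derivative \<gamma> (at x) d\<bar> \<le> L * norm d" if "x \<in> ?K" for x d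
    proof -
      have "\<bar>frechet_derivative \<gamma> (at x) d\<bar> = \<bar>\<Sum>b\<in>Basis. (d \<bullet> b) * frechet_derivative \<gamma> (at x) b\<bar>"
        by (subst frechet_derivative_expand[OF diff]) simp
      also have "\<dots> \<le> (\<Sum>b\<in>Basis. norm d * M b)"
        by (rule order_trans[OF sum_abs], rule sum_mono, unfold abs_mult, rule mult_mono)
           (use M(2)[OF that] in \<open>auto intro: Basis_le_norm\<close>)
      also have "\<dots> = L * norm d"
        by (simp add: L_def sum_distrib_left mult.commute)
      finally show ?thesis .
    qed
    have lip: "\<gamma> y \<le> \<gamma> x + L * norm (y - x)" if "x \<in> ?K" "y \<in> ?K" for x y
    proof -
      have "norm (\<gamma> y - \<gamma> x) \<le> L * norm (y - x)"
      proof (rule differentiable_bound[of ?K \<gamma> "\<lambda>x. frechet_derivative \<gamma> (at x)"])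
        show "(\<gamma> has_derivative frechet_derivative \<gamma> (at x)) (at x within ?K)" for x
          by (rule has_derivative_at_withinI[OF Ck_has_derivative[OF \<gamma>]])
        show "onorm (frechet_derivative \<gamma> (at x)) \<le> L" if "x \<in> ?K" for x
          by (rule onorm_le) (use bd[OF that] in auto)
      qed (use that in auto)
      then show ?thesis by simp
    qed
    have "surj R" using R by (rule orthogonal_transformation_surj)
    then obtain e where e: "R e = axis 3 1" by (metis surjD)
    have "norm e = 1"
      using orthogonal_transformation_norm[OF R, of e] by (simp add: e)
    \<comment> \<open>The solution of \<open>L * \<kappa> = 1 - \<kappa>\<close>, that is, the
      widest admissible opening.\<close>
    define \<kappa> where "\<kappa> = 1 / (L + 1)"
    have \<kappa>: "\<kappa> > 0" "\<kappa> \<le> 1" "L * \<kappa> = 1 - \<kappa>"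
      using L0 by (auto simp: \<kappa>_def field_simps)
    \<comment> \<open>Since \<open>norm y \<le> 2\<close>, a step with
      \<open>\<epsilon> < r / 4\<close> is shorter than \<open>r / 2\<close> and does not leave
      \<open>ball p r\<close>, where the graph description is valid.\<close>
    have "?cone (r / 2) e \<kappa> (r / 4)"
    proof (intro ballI allI impI)
      fix x \<epsilon> y assume x: "x \<in> \<Omega> \<inter> ball p (r / 2)" and y: "0 < \<epsilon> \<and> \<epsilon> < r / 4 \<and> y \<in> cball e \<kappa>"
      define z where "z = x + \<epsilon> *\<^sub>R y"
      have ye: "norm (y - e) \<le> \<kappa>"
        using y by (simp add: dist_norm norm_minus_commute)
      have Ry: "R y = axis 3 1 + R (y - e)"
        using linear_add[OF lin, of e "y - e"] by (simp add: e)
      have "\<bar>R (y - e) $ 3\<bar> \<le> \<kappa>"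
        using component_le_norm_cart[of "R (y - e)" 3] ye orthogonal_transformation_norm[OF R, of "y - e"] by linarith
      then have y3: "R y $ 3 \<ge> 1 - \<kappa>"
        unfolding Ry by (simp add: axis_def)
      \<comment> \<open>The axis of the cone is vertical in the rotated coordinates, so only the
        deviation from it contributes horizontally.\<close>
      have "u y = u (y - e)"
        by (simp add: u_def Ry axis_def)
      then have uy: "norm (u y) \<le> \<kappa>"
        using u_le[of "y - e"] ye by simp
      have "norm y \<le> 2"
        using norm_triangle_ineq[of e "y - e"] ye \<kappa> \<open>norm e = 1\<close> by simp
      then have "norm (\<epsilon> *\<^sub>R y) \<le> \<epsilon> * 2"
        using y by simp
      moreover have "dist p z \<le> dist p x + norm (\<epsilon> *\<^sub>R y)"
        using dist_triangle[of p z x] by (simp add: dist_norm z_def)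
      moreover have xp: "dist p x < r / 2" "\<epsilon> < r / 4" "\<epsilon> > 0"
        using x y by auto
      ultimately have zp: "dist p z < r" by linarith
      have nx: "norm v \<le> norm p + r" if "dist p v < r" for v
        using that norm_triangle_ineq2[of v p] by (simp add: dist_norm norm_minus_commute)
      have "u x \<in> ?K" "u z \<in> ?K"
        using u_le[of x] u_le[of z] nx[of x] nx[OF zp] xp by auto
      then have "\<gamma> (u z) \<le> \<gamma> (u x) + L * norm (u z - u x)"
        by (rule lip)
      also have "norm (u z - u x) = \<epsilon> * norm (u y)"
        using xp by (simp add: z_def u_add)
      also have "L * (\<epsilon> * norm (u y)) \<le> L * (\<epsilon> * \<kappa>)"
        using uy xp L0 by (intro mult_left_mono) auto
      also have "\<gamma> (u x) + L * (\<epsilon> * \<kappa>) < R x $ 3 + L * (\<epsilon> * \<kappa>)"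
      proof -
        have "x \<in> \<Omega> \<inter> ball p r" using x r by auto
        then show ?thesis unfolding eq u_def by simp
      qed
      also have "L * (\<epsilon> * \<kappa>) = \<epsilon> * (1 - \<kappa>)"
        using \<kappa>(3) by (simp add: mult.left_commute)
      also have "R x $ 3 + \<epsilon> * (1 - \<kappa>) \<le> R z $ 3"
        using y3 xp by (simp add: z_def linear_add[OF lin] linear_scale[OF lin])
      finally have "\<gamma> (u z) < R z $ 3" by simp
      then have "z \<in> \<Omega> \<inter> ball p r"
        unfolding eq using zp by (simp add: u_def)
      then show "x + \<epsilon> *\<^sub>R y \<in> \<Omega>" by (simp add: z_def)
    qed
    then show ?thesis
      using r \<kappa>(1) by (intro exI[of _ "r / 2"] exI[of _ e] exI[of _ \<kappa>] exI[of _ "r / 4"] conjI) auto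
  qed
qed

section \<open>Vanishing of the gradient on the zero set\<close>

lemma test_functionsD:
  assumes "\<phi> \<in> test_functions \<Omega>"
  obtains S where "compact S" "S \<subseteq> \<Omega>" "\<And>x. x \<notin> S \<Longrightarrow> \<phi> x = 0" "\<And>k. Ck k \<phi>"
proof (rule that)
  show "compact (closure {x. \<phi> x \<noteq> 0})" "closure {x. \<phi> x \<noteq> 0} \<subseteq> \<Omega>" "\<And>k. Ck k \<phi>"
    using assms by (auto simp: test_functions_def smooth_def)
  show "\<phi> x = 0" if "x \<notin> closure {x. \<phi> x \<noteq> 0}" for x
    using that closure_subset[of "{x. \<phi> x \<noteq> 0}"] by auto
qed

text \<open>The chain rule applied to \<open>d arctan (w / d)\<close>, which tends to 0 uniformly while its derivative tends to the
  indicator of \<open>{w = 0}\<close>.\<close>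

lemma weak_gradient_zero_on_zero_set:
  assumes "open \<Omega>" "bounded \<Omega>" and cone: "interior_cone_condition \<Omega>"
    and w: "integrable lborel w" "\<And>x. 0 \<le> w x" "\<And>x. w x \<le> 1"
    and G: "integrable lborel G" "integrable lborel (\<lambda>x. (norm (G x))\<^sup>2)"
    and wG: "wgrad \<Omega> w G"
  shows "AE x in lborel. x \<in> \<Omega> \<and> w x = 0 \<longrightarrow> G x = 0"
proof -
  have [measurable]: "w \<in> borel_measurable borel" "G \<in> borel_measurable borel" using w G by auto
  have "AE x in lborel. x \<in> \<Omega> \<longrightarrow> (if w x = 0 then G x $ k else 0) = 0" for k
  proof (rule fundamental_lemma_of_calculus_of_variations[OF \<open>open \<Omega>\<close>])
    define g where "g x = (if w x = 0 then G x $ k else 0)" for x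
    have gG: "\<bar>g x\<bar> \<le> norm (G x)" for x
      using component_le_norm_cart[of "G x" k] by (simp add: g_def)
    show [measurable]: "(\<lambda>x. if w x = 0 then G x $ k else 0) \<in> borel_measurable borel" by measurable
    show "integrable lborel (\<lambda>x. indicator K x * (if w x = 0 then G x $ k else 0))" if "compact K" for K
    proof (rule Bochner_Integration.integrable_bound[OF G(1)])
      have "K \<in> sets borel" using that by (rule borel_compact)
      then show "(\<lambda>x. indicator K x * (if w x = 0 then G x $ k else 0)) \<in> borel_measurable lborel" by measurable
      show "AE x in lborel. norm (indicator K x * (if w x = 0 then G x $ k else 0)) \<le> norm (G x)"
        using component_le_norm_cart[of _ k] by (intro AE_I2) (auto simp: indicator_def)
    qed
    fix \<phi> assume "\<phi> \<in> test_functions \<Omega>"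
    then obtain S where S: "compact S" "S \<subseteq> \<Omega>" "\<And>x. x \<notin> S \<Longrightarrow> \<phi> x = 0" "\<And>k. Ck k \<phi>"
      by (rule test_functionsD) blast
    let ?D = "\<lambda>x. frechet_derivative \<phi> (at x) (axis k 1)"
    have \<phi>1: "Ck (Suc 0) \<phi>" by (rule S(4))
    have D0: "?D x = 0" if "x \<notin> S" for x
      using frechet_derivative_zero_outside[OF compact_imp_closed[OF S(1)] S(3) that] by simp
    have contD: "continuous_on UNIV ?D" by (rule Ck1_continuous_derivative[OF \<phi>1])
    have cont: "continuous_on UNIV \<phi>" using S(4)[of 0] by simp
    have [measurable]: "\<phi> \<in> borel_measurable borel" "?D \<in> borel_measurable borel"
      using cont contD by (auto intro: borel_measurable_continuous_onI)
    obtain M1 where M1: "M1 \<ge> 0" "\<And>x. \<bar>\<phi> x\<bar> \<le> M1"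
      using continuous_compact_support_bounded[OF cont S(1,3)] by metis
    have Dint: "integrable lborel ?D"
      by (rule integrable_continuous_compact_support[OF contD S(1) D0])
    \<comment> \<open>For a \<open>C^1\<close> test \<open>\<psi>\<close> the identity says that the
      integral of the \<open>k\<close>-th derivative of \<open>\<phi> * \<psi>\<close> vanishes; the
      chain rule extends it to the test \<open>d * arctan (w / d)\<close>.\<close>
    have eq: "(LINT x|lborel. ?D x * (d * arctan (w x / d))) + (LINT x|lborel. (\<phi> x *\<^sub>R axis k 1) \<bullet> ((1 / (1 + (w x / d)\<^sup>2)) *\<^sub>R G x)) = 0"
      if "d > 0" for d
    proof -
      interpret sobolev_test \<Omega> w G ?D "\<lambda>x. \<phi> x *\<^sub>R axis k 1" "\<lambda>s. d * arctan (s / d)" "\<lambda>s. 1 / (1 + (s / d)\<^sup>2)"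
      proof
        show "?D x = 0" "\<phi> x *\<^sub>R axis k 1 = 0" if "x \<notin> \<Omega>" for x
          using that S(2,3) D0 by auto
        have cf: "continuous_on UNIV (\<lambda>x. \<phi> x *\<^sub>R (axis k 1 :: real^3))"
          using cont by (intro continuous_intros)
        show "integrable lborel (\<lambda>x. \<phi> x *\<^sub>R (axis k 1 :: real^3))"
          by (rule integrable_continuous_compact_support[OF cf S(1)]) (simp add: S(3))
        show "integrable lborel (\<lambda>x. (norm (\<phi> x *\<^sub>R (axis k 1 :: real^3)))\<^sup>2)"
          by (rule integrable_continuous_compact_support[OF _ S(1)])
             (use cont in \<open>auto simp: S(3) intro!: continuous_on_power continuous_on_norm\<close>)
        have "1 + (s / d)\<^sup>2 > 0" for s
          by (simp add: add_pos_nonneg)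
        then have ne: "1 + (s / d)\<^sup>2 \<noteq> 0" for s
          by (metis less_irrefl)
        show "((\<lambda>s. d * arctan (s / d)) has_real_derivative 1 / (1 + (s / d)\<^sup>2)) (at s)" for s
          using \<open>d > 0\<close> by (auto intro!: derivative_eq_intros simp: divide_inverse)
        show "continuous_on UNIV (\<lambda>s. 1 / (1 + (s / d)\<^sup>2))"
          using ne \<open>d > 0\<close> by (intro continuous_intros) auto
        fix \<psi> :: "real^3 \<Rightarrow> real" assume \<psi>: "Ck (Suc 0) \<psi>"
        have "(LINT x|lborel. frechet_derivative (\<lambda>x. \<phi> x * \<psi> x) (at x) (axis k 1)) = 0"
          by (rule integral_derivative_eq_0[OF Ck_mult[OF \<phi>1 \<psi>] S(1)]) (simp add: S(3))
        moreover have "frechet_derivative (\<lambda>x. \<phi> x * \<psi> x) (at x) (axis k 1)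
            = ?D x * \<psi> x + (\<phi> x *\<^sub>R axis k 1) \<bullet> grad \<psi> x" for x
        proof -
          have "frechet_derivative (\<lambda>x. \<phi> x * \<psi> x) (at x) (axis k 1) = grad (\<lambda>x. \<phi> x * \<psi> x) x $ k"
            by (simp add: grad_def)
          then show ?thesis
            unfolding grad_mult[OF \<phi>1 \<psi>] by (simp add: inner_axis' grad_def[of \<phi>])
        qed
        moreover have "integrable lborel (\<lambda>x. ?D x * \<psi> x)"
          using contD Ck_Suc_D[OF \<psi>] D0
          by (intro integrable_continuous_compact_support[OF _ S(1)] continuous_on_mult) auto
        moreover have "integrable lborel (\<lambda>x. (\<phi> x *\<^sub>R axis k 1) \<bullet> grad \<psi> x)"
          using cf continuous_on_grad[OF \<psi>] S(3)
          by (intro integrable_continuous_compact_support[OF _ S(1)] continuous_on_inner) auto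
        ultimately show "(LINT x|lborel. ?D x * \<psi> x) + (LINT x|lborel. (\<phi> x *\<^sub>R axis k 1) \<bullet> grad \<psi> x) = 0"
          by simp
      qed (fact assms Dint)+
      show ?thesis by (rule chain_rule_test[OF cone])
    qed
    define d where "d n = 1 / real (Suc n)" for n
    have d: "d n > 0" "d n \<le> 1" for n by (auto simp: d_def)
    have d0: "d \<longlonglongrightarrow> 0"
      unfolding d_def using LIMSEQ_inverse_real_of_nat by (simp add: inverse_eq_divide)
    have arc: "\<bar>d n * arctan t\<bar> \<le> d n * (pi / 2)" for n t
    proof -
      have "\<bar>arctan t\<bar> \<le> pi / 2"
        using arctan_bounded[of t] by linarith
      then have "d n * \<bar>arctan t\<bar> \<le> d n * (pi / 2)"
        using d(1)[of n] by (intro mult_left_mono) auto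
      then show ?thesis
        using d(1)[of n] by (simp add: abs_mult)
    qed
    have l1: "(\<lambda>n. LINT x|lborel. ?D x * (d n * arctan (w x / d n))) \<longlonglongrightarrow> (LINT x|(lborel :: (real^3) measure). 0)"
    proof (rule integral_dominated_convergence[where w = "\<lambda>x. norm (?D x) * (pi / 2)"])
      show "AE x in lborel. (\<lambda>n. ?D x * (d n * arctan (w x / d n))) \<longlonglongrightarrow> 0"
      proof (rule AE_I2)
        fix x
        have "(\<lambda>n. d n * arctan (w x / d n)) \<longlonglongrightarrow> 0"
        proof (rule Lim_null_comparison)
          show "\<forall>\<^sub>F n in sequentially. norm (d n * arctan (w x / d n)) \<le> d n * (pi / 2)"
            using arc by simp
          show "(\<lambda>n. d n * (pi / 2)) \<longlonglongrightarrow> 0"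
            using tendsto_mult_left_zero[OF d0] by simp
        qed
        then show "(\<lambda>n. ?D x * (d n * arctan (w x / d n))) \<longlonglongrightarrow> 0"
          by (rule tendsto_mult_right_zero)
      qed
      show "AE x in lborel. norm (?D x * (d n * arctan (w x / d n))) \<le> norm (?D x) * (pi / 2)" for n
      proof (rule AE_I2)
        fix x
        have "\<bar>d n * arctan (w x / d n)\<bar> \<le> 1 * (pi / 2)"
          using arc[of n "w x / d n"] d(2)[of n] pi_gt_zero by (meson mult_right_mono order_trans less_imp_le pi_half_gt_zero)
        then show "norm (?D x * (d n * arctan (w x / d n))) \<le> norm (?D x) * (pi / 2)"
          by (simp only: real_norm_def abs_mult[of "?D x"]) (intro mult_left_mono, auto)
      qed
    qed (use Dint in auto)
    have l2: "(\<lambda>n. LINT x|lborel. (\<phi> x *\<^sub>R axis k 1) \<bullet> ((1 / (1 + (w x / d n)\<^sup>2)) *\<^sub>R G x)) \<longlonglongrightarrow> (LINT x|lborel. g x * \<phi> x)"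
    proof (rule integral_dominated_convergence[where w = "\<lambda>x. M1 * norm (G x)"])
      show "(\<lambda>x. g x * \<phi> x) \<in> borel_measurable lborel" unfolding g_def by measurable
      show "AE x in lborel. (\<lambda>n. (\<phi> x *\<^sub>R axis k 1) \<bullet> ((1 / (1 + (w x / d n)\<^sup>2)) *\<^sub>R G x)) \<longlonglongrightarrow> g x * \<phi> x"
      proof (rule AE_I2)
        fix x
        have "(\<lambda>n. 1 / (1 + (w x / d n)\<^sup>2)) \<longlonglongrightarrow> (if w x = 0 then 1 else 0)"
        proof (cases "w x = 0")
          case False
          then have "w x > 0" using w(2)[of x] by simp
          have "filterlim (\<lambda>n. w x * real (Suc n)) at_top sequentially"
            by (rule filterlim_tendsto_pos_mult_at_top[OF tendsto_const \<open>w x > 0\<close>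
                  filterlim_compose[OF filterlim_real_sequentially filterlim_Suc]])
          then have "filterlim (\<lambda>n. (w x * real (Suc n))\<^sup>2) at_top sequentially"
            by (intro filterlim_pow_at_top) auto
          then have "filterlim (\<lambda>n. 1 + (w x * real (Suc n))\<^sup>2) at_top sequentially"
            by (rule filterlim_tendsto_add_at_top[OF tendsto_const])
          then have "(\<lambda>n. inverse (1 + (w x * real (Suc n))\<^sup>2)) \<longlonglongrightarrow> 0"
            by (rule tendsto_inverse_0_at_top)
          then show ?thesis using False by (simp add: d_def inverse_eq_divide)
        qed simp
        from tendsto_mult[OF this tendsto_const[of "\<phi> x * G x $ k"]]
        show "(\<lambda>n. (\<phi> x *\<^sub>R axis k 1) \<bullet> ((1 / (1 + (w x / d n)\<^sup>2)) *\<^sub>R G x)) \<longlonglongrightarrow> g x * \<phi> x"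
          by (cases "w x = 0") (simp_all add: g_def inner_axis' mult_ac)
      qed
      show "AE x in lborel. norm ((\<phi> x *\<^sub>R axis k 1) \<bullet> ((1 / (1 + (w x / d n)\<^sup>2)) *\<^sub>R G x)) \<le> M1 * norm (G x)" for n
      proof (rule AE_I2)
        fix x
        have "1 / (1 + (w x / d n)\<^sup>2) \<le> 1"
          by (simp add: divide_le_eq_1 add_pos_nonneg)
        then have "\<bar>1 / (1 + (w x / d n)\<^sup>2)\<bar> * \<bar>G x $ k\<bar> \<le> 1 * norm (G x)"
          by (intro mult_mono component_le_norm_cart) (auto simp: add_nonneg_nonneg)
        then have "\<bar>\<phi> x\<bar> * (\<bar>1 / (1 + (w x / d n)\<^sup>2)\<bar> * \<bar>G x $ k\<bar>) \<le> M1 * norm (G x)"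
          using M1 by (intro mult_mono) auto
        moreover have "(\<phi> x *\<^sub>R axis k 1) \<bullet> ((1 / (1 + (w x / d n)\<^sup>2)) *\<^sub>R G x) = \<phi> x * ((1 / (1 + (w x / d n)\<^sup>2)) * G x $ k)"
          by (simp add: inner_axis')
        ultimately show "norm ((\<phi> x *\<^sub>R axis k 1) \<bullet> ((1 / (1 + (w x / d n)\<^sup>2)) *\<^sub>R G x)) \<le> M1 * norm (G x)"
          by (simp only: real_norm_def abs_mult)
      qed
    qed (use G in auto)
    have "(\<lambda>n. 0) \<longlonglongrightarrow> (LINT x|(lborel :: (real^3) measure). 0) + (LINT x|lborel. g x * \<phi> x)"
      using tendsto_add[OF l1 l2] unfolding eq[OF d(1)] .
    then have "(LINT x|lborel. g x * \<phi> x) = 0"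
      using LIMSEQ_unique[OF _ tendsto_const] by fastforce
    then show "(LINT x|lborel. (if w x = 0 then G x $ k else 0) * \<phi> x) = 0"
      by (simp add: g_def)
  qed
  then have "AE x in lborel. \<forall>k. x \<in> \<Omega> \<longrightarrow> (if w x = 0 then G x $ k else 0) = 0"
    unfolding AE_all_countable ..
  then show ?thesis
    by eventually_elim (auto simp: vec_eq_iff)
qed

section \<open>The linear system for the fields\<close>

text \<open>Complete the square: the diagonal entries supply the terms
  \<open>y j / D i j * (x i \<bullet> x i)\<close>, the off-diagonal ones the mixed terms, and
  symmetry of \<open>D\<close> lets both orders of a pair share one coefficient.\<close>

lemma MS_quadratic_form:
  fixes x :: "'n::finite \<Rightarrow> 'v::real_inner"
  assumes y: "\<And>i. y i \<ge> 0" and sym: "\<And>i j. i \<noteq> j \<Longrightarrow> D i j = D j i"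
  shows "(\<Sum>i\<in>UNIV. \<Sum>j\<in>UNIV. MS_matrix D y i j * (x i \<bullet> x j))
    = 1/2 * (\<Sum>i\<in>UNIV. \<Sum>j\<in>UNIV - {i}. (norm (sqrt (y j) *\<^sub>R x i - sqrt (y i) *\<^sub>R x j))\<^sup>2 / D i j)"
proof -
  have sq: "sqrt (y i) * (sqrt (y i) * z) = y i * z" for i z
    using y by (simp add: mult.assoc[symmetric])
  define a where "a i j = y j / D i j * (x i \<bullet> x i)" for i j
  define b where "b i j = sqrt (y i * y j) / D i j * (x i \<bullet> x j)" for i j
  have "(norm (sqrt (y j) *\<^sub>R x i - sqrt (y i) *\<^sub>R x j))\<^sup>2 / D i j = a i j + a j i - 2 * b i j" if "i \<noteq> j" for i j
  proof -
    have "(norm (sqrt (y j) *\<^sub>R x i - sqrt (y i) *\<^sub>R x j))\<^sup>2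
        = y j * (x i \<bullet> x i) + y i * (x j \<bullet> x j) - 2 * (sqrt (y i * y j) * (x i \<bullet> x j))"
      unfolding power2_norm_eq_inner
      by (simp add: inner_diff_left inner_diff_right inner_commute[of "x j" "x i"] real_sqrt_mult sq algebra_simps)
    then show ?thesis
      using sym[OF that] by (simp add: a_def b_def add_divide_distrib diff_divide_distrib)
  qed
  then have "(\<Sum>i\<in>UNIV. \<Sum>j\<in>UNIV - {i}. (norm (sqrt (y j) *\<^sub>R x i - sqrt (y i) *\<^sub>R x j))\<^sup>2 / D i j)
      = (\<Sum>i\<in>UNIV. \<Sum>j\<in>UNIV - {i}. a i j + a j i - 2 * b i j)"
    by (intro sum.cong refl) auto
  also have "\<dots> = (\<Sum>i\<in>UNIV. \<Sum>j\<in>UNIV - {i}. a i j) + (\<Sum>i\<in>UNIV. \<Sum>j\<in>UNIV - {i}. a j i)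
      - 2 * (\<Sum>i\<in>UNIV. \<Sum>j\<in>UNIV - {i}. b i j)"
    by (simp add: sum.distrib sum_subtractf sum_distrib_left)
  also have "(\<Sum>i\<in>UNIV. \<Sum>j\<in>UNIV - {i}. a j i) = (\<Sum>i\<in>UNIV. \<Sum>j\<in>UNIV - {i}. a i j)"
  proof -
    have off: "(\<Sum>j\<in>UNIV - {i}. f j) = (\<Sum>j\<in>UNIV. if j \<noteq> i then f j else 0)" for f :: "'n \<Rightarrow> real" and i
      by (rule sum.mono_neutral_cong_left) auto
    have "(\<Sum>i\<in>UNIV. \<Sum>j\<in>UNIV - {i}. a j i) = (\<Sum>i\<in>UNIV. \<Sum>j\<in>UNIV. if j \<noteq> i then a j i else 0)"
      unfolding off ..
    also have "\<dots> = (\<Sum>j\<in>UNIV. \<Sum>i\<in>UNIV. if j \<noteq> i then a j i else 0)"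
      by (rule sum.swap)
    also have "\<dots> = (\<Sum>j\<in>UNIV. \<Sum>i\<in>UNIV - {j}. a j i)"
      unfolding off by (intro sum.cong refl) auto
    finally show ?thesis .
  qed
  finally have "1/2 * (\<Sum>i\<in>UNIV. \<Sum>j\<in>UNIV - {i}. (norm (sqrt (y j) *\<^sub>R x i - sqrt (y i) *\<^sub>R x j))\<^sup>2 / D i j)
      = (\<Sum>i\<in>UNIV. (\<Sum>j\<in>UNIV - {i}. a i j) - (\<Sum>j\<in>UNIV - {i}. b i j))"
    by (simp add: sum_subtractf)
  also have "\<dots> = (\<Sum>i\<in>UNIV. \<Sum>j\<in>UNIV. MS_matrix D y i j * (x i \<bullet> x j))"
  proof (rule sum.cong[OF refl])
    fix i
    have "(\<Sum>j\<in>UNIV. MS_matrix D y i j * (x i \<bullet> x j))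
        = MS_matrix D y i i * (x i \<bullet> x i) + (\<Sum>j\<in>UNIV - {i}. MS_matrix D y i j * (x i \<bullet> x j))"
      by (rule sum.remove) auto
    also have "MS_matrix D y i i * (x i \<bullet> x i) = (\<Sum>j\<in>UNIV - {i}. a i j)"
      by (simp add: MS_matrix_def a_def sum_distrib_right)
    also have "(\<Sum>j\<in>UNIV - {i}. MS_matrix D y i j * (x i \<bullet> x j)) = - (\<Sum>j\<in>UNIV - {i}. b i j)"
      unfolding sum_negf[symmetric] by (intro sum.cong refl) (auto simp: MS_matrix_def b_def)
    finally show "(\<Sum>j\<in>UNIV - {i}. a i j) - (\<Sum>j\<in>UNIV - {i}. b i j) = (\<Sum>j\<in>UNIV. MS_matrix D y i j * (x i \<bullet> x j))"
      by simp
  qed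
  finally show ?thesis by simp
qed

text \<open>Bounding every off-diagonal \<open>D i j\<close> by \<open>K\<close> reduces the claim
  to equal coefficients. Because the \<open>y i\<close> sum to 1, half the double sum of squares
  then equals the left-hand side, as in Lagrange's identity.\<close>

lemma MS_coercive:
  fixes x :: "'n::finite \<Rightarrow> 'v::real_inner"
  assumes y: "\<And>i. y i \<ge> 0" "(\<Sum>i\<in>UNIV. y i) = 1"
    and sym: "\<And>i j. i \<noteq> j \<Longrightarrow> D i j = D j i" and pos: "\<And>i j. i \<noteq> j \<Longrightarrow> D i j > 0"
    and K: "\<And>i j. i \<noteq> j \<Longrightarrow> D i j \<le> K" "K > 0"
  shows "(\<Sum>i\<in>UNIV. (norm (x i))\<^sup>2) - (norm (\<Sum>i\<in>UNIV. sqrt (y i) *\<^sub>R x i))\<^sup>2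
    \<le> K * (\<Sum>i\<in>UNIV. \<Sum>j\<in>UNIV. MS_matrix D y i j * (x i \<bullet> x j))"
proof -
  have sq: "sqrt (y i) * (sqrt (y i) * z) = y i * z" for i z
    using y by (simp add: mult.assoc[symmetric])
  let ?q = "\<lambda>i j. (norm (sqrt (y j) *\<^sub>R x i - sqrt (y i) *\<^sub>R x j))\<^sup>2"
  have q: "?q i j = y j * (x i \<bullet> x i) + y i * (x j \<bullet> x j) - 2 * ((sqrt (y i) *\<^sub>R x i) \<bullet> (sqrt (y j) *\<^sub>R x j))" for i j
    unfolding power2_norm_eq_inner
    by (simp add: inner_diff_left inner_diff_right inner_commute[of "x j" "x i"] sq algebra_simps)
  have yx: "(\<Sum>i\<in>UNIV. \<Sum>j\<in>UNIV. y j * (x i \<bullet> x i)) = (\<Sum>i\<in>UNIV. x i \<bullet> x i)"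
    by (simp add: sum_distrib_right[symmetric] y)
  have xy: "(\<Sum>i\<in>UNIV. \<Sum>j\<in>UNIV. y i * (x j \<bullet> x j)) = (\<Sum>i\<in>UNIV. x i \<bullet> x i)"
  proof -
    have "(\<Sum>i\<in>UNIV. \<Sum>j\<in>UNIV. y i * (x j \<bullet> x j)) = (\<Sum>i\<in>UNIV. y i) * (\<Sum>j\<in>UNIV. x j \<bullet> x j)"
      by (rule sum_product[symmetric])
    then show ?thesis by (simp only: y(2) mult_1)
  qed
  have "(\<Sum>i\<in>UNIV. \<Sum>j\<in>UNIV. ?q i j) = 2 * ((\<Sum>i\<in>UNIV. x i \<bullet> x i) -
      (\<Sum>i\<in>UNIV. \<Sum>j\<in>UNIV. (sqrt (y i) *\<^sub>R x i) \<bullet> (sqrt (y j) *\<^sub>R x j)))"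
  proof -
    have two: "(\<Sum>i\<in>UNIV. \<Sum>j\<in>UNIV. 2 * ((sqrt (y i) *\<^sub>R x i) \<bullet> (sqrt (y j) *\<^sub>R x j)))
        = 2 * (\<Sum>i\<in>UNIV. \<Sum>j\<in>UNIV. (sqrt (y i) *\<^sub>R x i) \<bullet> (sqrt (y j) *\<^sub>R x j))"
      by (simp only: sum_distrib_left)
    show ?thesis
      unfolding q sum.distrib sum_subtractf yx xy two by simp
  qed
  also have "(\<Sum>i\<in>UNIV. \<Sum>j\<in>UNIV. (sqrt (y i) *\<^sub>R x i) \<bullet> (sqrt (y j) *\<^sub>R x j))
      = (norm (\<Sum>i\<in>UNIV. sqrt (y i) *\<^sub>R x i))\<^sup>2"
    unfolding power2_norm_eq_inner inner_sum_left inner_sum_right by (rule sum.swap)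
  finally have 1: "(\<Sum>i\<in>UNIV. (norm (x i))\<^sup>2) - (norm (\<Sum>i\<in>UNIV. sqrt (y i) *\<^sub>R x i))\<^sup>2
      = 1/2 * (\<Sum>i\<in>UNIV. \<Sum>j\<in>UNIV. ?q i j)"
    by (simp add: power2_norm_eq_inner)
  have "(\<Sum>i\<in>UNIV. \<Sum>j\<in>UNIV. ?q i j) = (\<Sum>i\<in>UNIV. \<Sum>j\<in>UNIV - {i}. ?q i j)"
    by (rule sum.cong[OF refl], rule sum.mono_neutral_right) auto
  also have "\<dots> \<le> (\<Sum>i\<in>UNIV. \<Sum>j\<in>UNIV - {i}. K * (?q i j / D i j))"
  proof (intro sum_mono)
    fix i j :: 'n assume "j \<in> UNIV - {i}"
    then have d: "D i j > 0" "D i j \<le> K" using pos K by auto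
    then have "?q i j * D i j \<le> ?q i j * K" by (intro mult_left_mono) auto
    then show "?q i j \<le> K * (?q i j / D i j)"
      using d by (simp add: pos_le_divide_eq mult.commute)
  qed
  also have "\<dots> = K * (\<Sum>i\<in>UNIV. \<Sum>j\<in>UNIV - {i}. ?q i j / D i j)"
    by (simp add: sum_distrib_left)
  finally have "(\<Sum>i\<in>UNIV. \<Sum>j\<in>UNIV. ?q i j) \<le> K * (\<Sum>i\<in>UNIV. \<Sum>j\<in>UNIV - {i}. ?q i j / D i j)" .
  moreover have qf: "(\<Sum>i\<in>UNIV. \<Sum>j\<in>UNIV. MS_matrix D y i j * (x i \<bullet> x j))
      = 1/2 * (\<Sum>i\<in>UNIV. \<Sum>j\<in>UNIV - {i}. ?q i j / D i j)"
    by (rule MS_quadratic_form[OF y(1) sym])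
  ultimately show ?thesis
    unfolding 1 qf by simp
qed

text \<open>The matrix of the system is singular along \<open>sqrt y\<close>; adding the constraint as a rank-one term makes it
  invertible, so that Cramer's rule expresses the fields as Borel functions of the data.\<close>

definition MS_regularized :: "('n::finite \<Rightarrow> 'n \<Rightarrow> real) \<Rightarrow> ('n \<Rightarrow> real) \<Rightarrow> real^'n^'n" where
  "MS_regularized D y = (\<chi> i j. MS_matrix D y i j + sqrt (y i) * sqrt (y j))"

text \<open>For \<open>v\<close> in the kernel, \<open>Q + s * s = 0\<close>. Coercivity bounds the
  square norm of \<open>v\<close> by \<open>K * Q + s * s\<close>, and \<open>K \<ge> 1\<close>
  raises this to \<open>K * (Q + s * s) = 0\<close>.\<close>

lemma MS_regularized_det:
  fixes D :: "'n::finite \<Rightarrow> 'n \<Rightarrow> real"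
  assumes y: "\<And>i. y i \<ge> 0" "(\<Sum>i\<in>UNIV. y i) = 1"
    and sym: "\<And>i j. i \<noteq> j \<Longrightarrow> D i j = D j i" and pos: "\<And>i j. i \<noteq> j \<Longrightarrow> D i j > 0"
    and K: "\<And>i j. i \<noteq> j \<Longrightarrow> D i j \<le> K" "K \<ge> 1"
  shows "det (MS_regularized D y) \<noteq> 0"
proof -
  have "v = 0" if v: "MS_regularized D y *v v = 0" for v
  proof -
    define s where "s = (\<Sum>i\<in>UNIV. sqrt (y i) * v $ i)"
    define Q where "Q = (\<Sum>i\<in>UNIV. \<Sum>j\<in>UNIV. MS_matrix D y i j * (v $ i * v $ j))"
    have "0 = v \<bullet> (MS_regularized D y *v v)" by (simp add: v)
    also have "\<dots> = (\<Sum>i\<in>UNIV. \<Sum>j\<in>UNIV. MS_matrix D y i j * (v $ i * v $ j) + (sqrt (y i) * v $ i) * (sqrt (y j) * v $ j))"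
      by (simp add: inner_vec_def matrix_vector_mult_def MS_regularized_def sum_distrib_left algebra_simps)
    also have "\<dots> = Q + s * s"
      by (simp add: Q_def s_def sum.distrib sum_product)
    finally have Q: "Q + s * s = 0" by simp
    have "(\<Sum>i\<in>UNIV. (v $ i)\<^sup>2) - s\<^sup>2 \<le> K * Q"
      using MS_coercive[of y D K "\<lambda>i. v $ i", OF y sym pos K(1)] K(2) by (simp add: s_def Q_def)
    then have "(\<Sum>i\<in>UNIV. (v $ i)\<^sup>2) \<le> K * Q + s * s"
      by (simp add: power2_eq_square)
    also have "\<dots> \<le> K * Q + K * (s * s)"
      using mult_right_mono[OF K(2), of "s * s"] by simp
    also have "\<dots> = K * (Q + s * s)"
      by (simp add: distrib_left)
    finally have "(\<Sum>i\<in>UNIV. (v $ i)\<^sup>2) \<le> 0"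
      by (simp add: Q)
    then have "\<forall>i. (v $ i)\<^sup>2 = 0"
      using sum_nonneg_eq_0_iff[of UNIV "\<lambda>i. (v $ i)\<^sup>2"] sum_nonneg[of UNIV "\<lambda>i. (v $ i)\<^sup>2"] by auto
    then show "v = 0" by (simp add: vec_eq_iff)
  qed
  then have "invertible (MS_regularized D y)"
    by (simp add: invertible_left_inverse matrix_left_invertible_ker)
  then show ?thesis by (simp add: invertible_det_nz)
qed

text \<open>The constraint annihilates the rank-one term, so each spatial component of the fields
  solves the regularised system with right-hand side \<open>- 2 * g\<close>.\<close>

lemma MS_fields_cramer:
  fixes D :: "'n::finite \<Rightarrow> 'n \<Rightarrow> real" and x g :: "'n \<Rightarrow> real^3"
  assumes det: "det (MS_regularized D y) \<noteq> 0"
    and eq: "\<And>i. - (\<Sum>j\<in>UNIV. MS_matrix D y i j *\<^sub>R x j) = 2 *\<^sub>R g i" "(\<Sum>i\<in>UNIV. sqrt (y i) *\<^sub>R x i) = 0"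
  shows "x k $ l = det (\<chi> i j. if j = k then - 2 * g i $ l else MS_regularized D y $ i $ j) / det (MS_regularized D y)"
proof -
  define v :: "real^'n" where "v = (\<chi> i. x i $ l)"
  have "MS_regularized D y *v v = (\<chi> i. - 2 * g i $ l)"
  proof (rule vec_eq_iff[THEN iffD2], rule allI)
    fix i
    have 1: "- (\<Sum>j\<in>UNIV. MS_matrix D y i j * x j $ l) = 2 * g i $ l"
      using arg_cong[OF eq(1)[of i], of "\<lambda>v. v $ l"] by simp
    have 2: "(\<Sum>j\<in>UNIV. sqrt (y j) * x j $ l) = 0"
      using arg_cong[OF eq(2), of "\<lambda>v. v $ l"] by simp
    have "(MS_regularized D y *v v) $ i = (\<Sum>j\<in>UNIV. MS_matrix D y i j * x j $ l) + sqrt (y i) * (\<Sum>j\<in>UNIV. sqrt (y j) * x j $ l)"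
      by (simp add: matrix_vector_mult_def MS_regularized_def v_def sum.distrib distrib_right sum_distrib_left mult.assoc)
    then show "(MS_regularized D y *v v) $ i = (\<chi> i. - 2 * g i $ l) $ i"
      using 1 unfolding 2 by simp
  qed
  then have "v = (\<chi> k. det (\<chi> i j. if j = k then (\<chi> i. - 2 * g i $ l) $ i else MS_regularized D y $ i $ j) / det (MS_regularized D y))"
    by (rule cramer[OF det, THEN iffD1])
  then have "v $ k = (\<chi> k. det (\<chi> i j. if j = k then (\<chi> i. - 2 * g i $ l) $ i else MS_regularized D y $ i $ j) / det (MS_regularized D y)) $ k"
    by simp
  then show ?thesis by (simp add: v_def cong: if_cong)
qed

lemma borel_measurable_det:
  fixes A :: "'a \<Rightarrow> real^'n^'n"
  assumes "\<And>i j. (\<lambda>x. A x $ i $ j) \<in> borel_measurable M"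
  shows "(\<lambda>x. det (A x)) \<in> borel_measurable M"
  unfolding det_def by (intro borel_measurable_sum borel_measurable_times borel_measurable_const borel_measurable_prod assms)

text \<open>Contract the \<open>i\<close>-th equation with \<open>x i\<close> and sum: the quadratic
  form becomes \<open>- 2\<close> times the pairing with \<open>g\<close>. The bound follows from
  coercivity and Young's inequality, with half of the square norm absorbed on the left.\<close>

lemma MS_fields_bound:
  fixes x g :: "'n::finite \<Rightarrow> 'v::real_inner"
  assumes y: "\<And>i. y i \<ge> 0" "(\<Sum>i\<in>UNIV. y i) = 1"
    and sym: "\<And>i j. i \<noteq> j \<Longrightarrow> D i j = D j i" and pos: "\<And>i j. i \<noteq> j \<Longrightarrow> D i j > 0"
    and K: "\<And>i j. i \<noteq> j \<Longrightarrow> D i j \<le> K" "K > 0"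
    and eq: "\<And>i. - (\<Sum>j\<in>UNIV. MS_matrix D y i j *\<^sub>R x j) = 2 *\<^sub>R g i" "(\<Sum>i\<in>UNIV. sqrt (y i) *\<^sub>R x i) = 0"
  shows "1/2 * (\<Sum>i\<in>UNIV. \<Sum>j\<in>UNIV - {i}. (norm (sqrt (y j) *\<^sub>R x i - sqrt (y i) *\<^sub>R x j))\<^sup>2 / D i j)
      = - 2 * (\<Sum>i\<in>UNIV. x i \<bullet> g i)"
    and "(\<Sum>i\<in>UNIV. (norm (x i))\<^sup>2) \<le> 4 * K\<^sup>2 * (\<Sum>i\<in>UNIV. (norm (g i))\<^sup>2)"
proof -
  have Q: "(\<Sum>i\<in>UNIV. \<Sum>j\<in>UNIV. MS_matrix D y i j * (x i \<bullet> x j)) = - 2 * (\<Sum>i\<in>UNIV. x i \<bullet> g i)"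
  proof -
    have "(\<Sum>j\<in>UNIV. MS_matrix D y i j * (x i \<bullet> x j)) = - 2 * (x i \<bullet> g i)" for i
    proof -
      have "(\<Sum>j\<in>UNIV. MS_matrix D y i j * (x i \<bullet> x j)) = x i \<bullet> (\<Sum>j\<in>UNIV. MS_matrix D y i j *\<^sub>R x j)"
        by (simp add: inner_sum_right)
      also have "(\<Sum>j\<in>UNIV. MS_matrix D y i j *\<^sub>R x j) = - (2 *\<^sub>R g i)"
        using eq(1)[of i] by (metis minus_minus)
      finally show ?thesis by simp
    qed
    then show ?thesis by (simp add: sum_distrib_left)
  qed
  then show "1/2 * (\<Sum>i\<in>UNIV. \<Sum>j\<in>UNIV - {i}. (norm (sqrt (y j) *\<^sub>R x i - sqrt (y i) *\<^sub>R x j))\<^sup>2 / D i j)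
      = - 2 * (\<Sum>i\<in>UNIV. x i \<bullet> g i)"
    using MS_quadratic_form[of y D x, OF y(1) sym] by simp
  have "(\<Sum>i\<in>UNIV. (norm (x i))\<^sup>2) \<le> K * (- 2 * (\<Sum>i\<in>UNIV. x i \<bullet> g i))"
    using MS_coercive[of y D K x, OF y sym pos K] eq(2) Q by simp
  also have "\<dots> = (\<Sum>i\<in>UNIV. - 2 * K * (x i \<bullet> g i))"
    by (simp add: sum_distrib_left mult.assoc mult.left_commute)
  also have "\<dots> \<le> (\<Sum>i\<in>UNIV. (norm (x i))\<^sup>2 / 2 + 2 * K\<^sup>2 * (norm (g i))\<^sup>2)"
  proof (rule sum_mono)
    fix i
    have "0 \<le> (norm (x i + (2 * K) *\<^sub>R g i))\<^sup>2" by simp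
    also have "\<dots> = (norm (x i))\<^sup>2 + 4 * K * (x i \<bullet> g i) + 4 * K\<^sup>2 * (norm (g i))\<^sup>2"
      unfolding power2_norm_eq_inner
      by (simp add: inner_add_left inner_add_right inner_commute[of "g i" "x i"] power2_eq_square algebra_simps)
    finally show "- 2 * K * (x i \<bullet> g i) \<le> (norm (x i))\<^sup>2 / 2 + 2 * K\<^sup>2 * (norm (g i))\<^sup>2"
      by simp
  qed
  also have "\<dots> = (\<Sum>i\<in>UNIV. (norm (x i))\<^sup>2) / 2 + 2 * K\<^sup>2 * (\<Sum>i\<in>UNIV. (norm (g i))\<^sup>2)"
    by (simp add: sum.distrib sum_distrib_left sum_divide_distrib)
  finally show "(\<Sum>i\<in>UNIV. (norm (x i))\<^sup>2) \<le> 4 * K\<^sup>2 * (\<Sum>i\<in>UNIV. (norm (g i))\<^sup>2)"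
    by simp
qed

section \<open>Entropy balance of one species\<close>

text \<open>The tests approximate the indicator of \<open>{s<..<t}\<close> from inside, so
  \<open>s = 0\<close> and \<open>t = T\<close> are allowed. Integration against their derivatives
  averages \<open>g\<close> just after \<open>s\<close> and just before \<open>t\<close>, and these
  averages converge by continuity.\<close>

lemma weak_time_derivative:
  fixes g k :: "real \<Rightarrow> real"
  assumes g: "continuous_on {0..T} g" and k: "integrable lborel k"
    and weak: "\<And>\<eta> \<eta>' a b. (\<And>t. (\<eta> has_real_derivative \<eta>' t) (at t)) \<Longrightarrow> continuous_on UNIV \<eta>' \<Longrightarrow> 0 < a \<Longrightarrow> b < T \<Longrightarrow>
      (\<And>t. t \<notin> {a..b} \<Longrightarrow> \<eta> t = 0) \<Longrightarrow> 
      (LINT t|lborel. indicator {0<..<T} t * (\<eta>' t * g t)) + (LINT t|lborel. \<eta> t * k t) = 0"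
    and st: "0 \<le> s" "s < t" "t \<le> T"
  shows "g t - g s = (LINT r|lborel. indicator {s<..<t} r * k r)"
proof -
  have [measurable]: "k \<in> borel_measurable borel" using k by auto
  obtain R R' :: "real \<Rightarrow> real" where R: "\<And>x. (R has_real_derivative R' x) (at x)" "continuous_on UNIV R'"
    "\<And>x. x \<le> 0 \<Longrightarrow> R x = 0" "\<And>x. x \<ge> 1 \<Longrightarrow> R x = 1" "\<And>x. x \<notin> {0..1} \<Longrightarrow> R' x = 0" "\<And>x. \<bar>R x\<bar> \<le> 1"
    using C1_ramp_exists by blast
  have [measurable]: "R' \<in> borel_measurable borel"
    using R(2) by (rule borel_measurable_continuous_onI)
  have contR: "continuous_on UNIV R"
    using DERIV_isCont[OF R(1)] by (simp add: continuous_on_eq_continuous_at)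
  have [measurable]: "R \<in> borel_measurable borel"
    using contR by (rule borel_measurable_continuous_onI)
  define g0 where "g0 r = indicator {0..T} r * g r" for r
  have [measurable]: "g0 \<in> borel_measurable borel"
    using borel_measurable_continuous_on_indicator[OF _ g] by (simp add: g0_def[abs_def])
  have "compact (g ` {0..T})"
    using g by (intro compact_continuous_image) auto
  from compact_imp_bounded[OF this] have "\<exists>Mg. \<forall>r\<in>{0..T}. \<bar>g r\<bar> \<le> Mg"
    by (simp add: bounded_iff)
  then obtain Mg where Mg: "\<And>r. r \<in> {0..T} \<Longrightarrow> \<bar>g r\<bar> \<le> Mg"
    by metis
  have Mg0: "Mg \<ge> 0" using Mg[of s] st by auto
  have g0_le: "\<bar>g0 r\<bar> \<le> Mg" for r
    using Mg[of r] Mg0 by (auto simp: g0_def indicator_def)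
  have R'int: "integrable lborel R'"
    by (rule integrable_continuous_compact_support[OF R(2), of "{0..1}"]) (use R(5) in auto)
  have R'1: "(LINT y|lborel. R' y) = 1"
  proof -
    have "(LINT y|lborel. R' y * indicator {0..1} y) = R 1 - R 0"
      by (rule integral_FTC_Icc_real) (use R(1,2) in \<open>auto simp: continuous_on_eq_continuous_at\<close>)
    moreover have "R' y * indicator {0..1} y = R' y" for y
      using R(5)[of y] by (auto simp: indicator_def)
    ultimately show ?thesis using R(3,4) by simp
  qed
  \<comment> \<open>With \<open>n m * (t - s) > 3\<close> the falling ramp has not begun before
    \<open>s + 1 / n m\<close>, and the rising one is complete after \<open>t - 1 / n m\<close>;
    this places the support inside \<open>{s + 1 / n m..t - 1 / n m}\<close>.\<close>
  obtain N :: nat where N: "3 / (t - s) < real N"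
    using reals_Archimedean2 by blast
  define n where "n m = real (N + m)" for m :: nat
  have npos: "n m > 0" for m
  proof -
    have "3 / (t - s) > 0" using st by simp
    then have "real N > 0" using N by linarith
    then show ?thesis by (simp add: n_def add_pos_nonneg)
  qed
  have n3: "n m * (t - s) > 3" for m
  proof -
    have "3 < real N * (t - s)" using N st by (simp add: pos_divide_less_eq)
    also have "\<dots> \<le> n m * (t - s)" using st by (intro mult_right_mono) (auto simp: n_def)
    finally show ?thesis .
  qed
  have ninf: "filterlim n at_top sequentially"
    unfolding n_def using filterlim_compose[OF filterlim_real_sequentially filterlim_add_const_nat_at_top[of N]]
    by (simp add: add.commute)
  have ninv: "(\<lambda>m. x / n m) \<longlonglongrightarrow> 0" for x
    by (rule tendsto_divide_0[OF tendsto_const filterlim_at_top_imp_at_infinity[OF ninf]])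
  define \<eta> where "\<eta> m r = R (n m * (r - s) - 1) - R (n m * (r - t) + 2)" for m r
  define \<eta>' where "\<eta>' m r = n m * R' (n m * (r - s) - 1) - n m * R' (n m * (r - t) + 2)" for m r
  have \<eta>_deriv: "(\<eta> m has_real_derivative \<eta>' m r) (at r)" for m r
  proof -
    have a: "((\<lambda>r. n m * (r - s) - 1) has_real_derivative n m) (at r)" "((\<lambda>r. n m * (r - t) + 2) has_real_derivative n m) (at r)"
      by (auto intro!: derivative_eq_intros)
    from DERIV_diff[OF DERIV_chain2[OF R(1) a(1)] DERIV_chain2[OF R(1) a(2)]]
    show ?thesis by (simp add: \<eta>_def[abs_def] \<eta>'_def mult.commute)
  qed
  have \<eta>'_cont: "continuous_on UNIV (\<eta>' m)" for m
    unfolding \<eta>'_def by (intro continuous_intros continuous_on_compose2[OF R(2)]) auto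
  have \<eta>_supp: "\<eta> m r = 0" if "r \<notin> {s + 1 / n m..t - 1 / n m}" for m r
  proof (cases "r < s + 1 / n m")
    case True
    then have 1: "n m * (r - s) < 1"
      using npos[of m] by (simp add: field_simps)
    have "n m * (r - t) = n m * (r - s) - n m * (t - s)" by (simp add: algebra_simps)
    then have "n m * (r - t) + 2 \<le> 0" using 1 n3[of m] by linarith
    then show ?thesis using 1 R(3) by (simp add: \<eta>_def)
  next
    case False
    then have "r > t - 1 / n m" using that by auto
    then have 1: "n m * (r - t) > - 1"
      using npos[of m] by (simp add: field_simps)
    have "n m * (r - s) = n m * (r - t) + n m * (t - s)" by (simp add: algebra_simps)
    then have "n m * (r - s) - 1 \<ge> 1" using 1 n3[of m] by linarith
    then show ?thesis using 1 R(4) by (simp add: \<eta>_def)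
  qed
  have \<eta>_le: "\<bar>\<eta> m r\<bar> \<le> 2" for m r
    using R(6)[of "n m * (r - s) - 1"] R(6)[of "n m * (r - t) + 2"] by (simp add: \<eta>_def)
  have eq: "(LINT r|lborel. indicator {0<..<T} r * (\<eta>' m r * g r)) + (LINT r|lborel. \<eta> m r * k r) = 0" for m
  proof (rule weak[OF \<eta>_deriv \<eta>'_cont _ _ \<eta>_supp])
    have "1 / n m > 0" using npos[of m] by simp
    then show "0 < s + 1 / n m" "t - 1 / n m < T"
      using st by linarith+
  qed
  have lim2: "(\<lambda>m. LINT r|lborel. \<eta> m r * k r) \<longlonglongrightarrow> (LINT r|lborel. indicator {s<..<t} r * k r)"
  proof (rule integral_dominated_convergence[where w = "\<lambda>r. 2 * norm (k r)"])
    show "integrable lborel (\<lambda>r. 2 * norm (k r))" using k by simp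
    show "(\<lambda>r. \<eta> m r * k r) \<in> borel_measurable lborel" for m
      unfolding \<eta>_def by measurable
    show "AE r in lborel. norm (\<eta> m r * k r) \<le> 2 * norm (k r)" for m
      using \<eta>_le by (auto simp: abs_mult intro!: mult_right_mono)
    show "AE r in lborel. (\<lambda>m. \<eta> m r * k r) \<longlonglongrightarrow> indicator {s<..<t} r * k r"
    proof (intro AE_I2 tendsto_mult tendsto_const)
      fix r
      show "(\<lambda>m. \<eta> m r) \<longlonglongrightarrow> indicator {s<..<t} r"
      proof (cases "r \<in> {s<..<t}")
        case True
        have "\<forall>\<^sub>F m in sequentially. n m \<ge> max (2 / (r - s)) (2 / (t - r))"
          using ninf unfolding filterlim_at_top by blast
        then have "\<forall>\<^sub>F m in sequentially. \<eta> m r = indicator {s<..<t} r"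
        proof eventually_elim
          case (elim m)
          have "n m * (r - s) \<ge> 2" "n m * (t - r) \<ge> 2"
            using elim True by (auto simp: pos_divide_le_eq)
          then have "n m * (r - s) - 1 \<ge> 1" "n m * (r - t) + 2 \<le> 0"
            by (auto simp: algebra_simps)
          then show ?case using R(3,4) True by (simp add: \<eta>_def)
        qed
        then show ?thesis by (rule tendsto_eventually)
      next
        case False
        have "r \<notin> {s + 1 / n m..t - 1 / n m}" for m
        proof
          assume "r \<in> {s + 1 / n m..t - 1 / n m}"
          moreover have "1 / n m > 0" using npos[of m] by simp
          ultimately have "r \<in> {s<..<t}"
            unfolding atLeastAtMost_iff greaterThanLessThan_iff by linarith
          then show False using False by simp
        qed
        then show ?thesis using False \<eta>_supp by simp
      qed
    qed
  qed measurable
  \<comment> \<open>The scaled \<open>R'\<close> is an approximate identity. The shift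
    \<open>\<alpha>\<close> puts its mass on the side of \<open>p\<close> that lies in
    \<open>{0..T}\<close>: after \<open>s\<close> for \<open>- 1\<close>, before \<open>t\<close>
    for \<open>2\<close>.\<close>
  have lim: "(\<lambda>m. LINT r|lborel. n m * R' (n m * (r - p) + \<alpha>) * g0 r) \<longlonglongrightarrow> g p"
    if p: "p \<in> {0..T}" and ev: "\<And>m y. y \<in> {0..1} \<Longrightarrow> p + (y - \<alpha>) / n m \<in> {0..T}" for p \<alpha>
  proof -
    have sub: "(LINT r|lborel. n m * R' (n m * (r - p) + \<alpha>) * g0 r) = (LINT y|lborel. R' y * g0 (p + (y - \<alpha>) / n m))" for m
    proof -
      have "(LINT r|lborel. n m * R' (n m * (r - p) + \<alpha>) * g0 r)
          = \<bar>1 / n m\<bar> * (LINT y|lborel. n m * R' (n m * ((p - \<alpha> / n m + 1 / n m * y) - p) + \<alpha>) * g0 (p - \<alpha> / n m + 1 / n m * y))"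
        using lborel_integral_real_affine[of "1 / n m" "\<lambda>r. n m * R' (n m * (r - p) + \<alpha>) * g0 r" "p - \<alpha> / n m"] npos[of m]
        by simp
      moreover have "n m * ((p - \<alpha> / n m + 1 / n m * y) - p) + \<alpha> = y" for y
        using npos[of m] by (simp add: field_simps)
      moreover have shift: "p - \<alpha> / n m + y / n m = p + (y - \<alpha>) / n m" for y
        by (simp add: diff_divide_distrib)
      ultimately show ?thesis
        using npos[of m] by (simp add: mult.assoc shift)
    qed
    have "(\<lambda>m. LINT y|lborel. R' y * g0 (p + (y - \<alpha>) / n m)) \<longlonglongrightarrow> (LINT y|lborel. R' y * g p)"
    proof (rule integral_dominated_convergence[where w = "\<lambda>y. norm (R' y) * Mg"])
      show "integrable lborel (\<lambda>y. norm (R' y) * Mg)" using R'int by simp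
      show "AE y in lborel. norm (R' y * g0 (p + (y - \<alpha>) / n m)) \<le> norm (R' y) * Mg" for m
        using g0_le by (auto simp: abs_mult intro!: mult_left_mono)
      show "AE y in lborel. (\<lambda>m. R' y * g0 (p + (y - \<alpha>) / n m)) \<longlonglongrightarrow> R' y * g p"
      proof (rule AE_I2)
        fix y
        show "(\<lambda>m. R' y * g0 (p + (y - \<alpha>) / n m)) \<longlonglongrightarrow> R' y * g p"
        proof (cases "y \<in> {0..1}")
          case True
          have "(\<lambda>m. p + (y - \<alpha>) / n m) \<longlonglongrightarrow> p + 0"
            by (intro tendsto_add tendsto_const ninv)
          then have "(\<lambda>m. g (p + (y - \<alpha>) / n m)) \<longlonglongrightarrow> g p"
            using continuous_on_tendsto_compose[OF g, of "\<lambda>m. p + (y - \<alpha>) / n m" p sequentially] p ev[OF True] by simp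
          moreover have "g0 (p + (y - \<alpha>) / n m) = g (p + (y - \<alpha>) / n m)" for m
            using ev[OF True, of m] by (simp add: g0_def)
          ultimately show ?thesis by (intro tendsto_mult tendsto_const) simp
        qed (use R(5) in simp)
      qed
    qed measurable
    then show ?thesis
      unfolding sub using R'1 R'int by simp
  qed
  have small: "3 / n m \<le> t - s" for m
    using n3[of m] npos[of m] by (simp add: pos_divide_le_eq mult.commute)
  have lims: "(\<lambda>m. LINT r|lborel. n m * R' (n m * (r - s) + (- 1)) * g0 r) \<longlonglongrightarrow> g s"
  proof (rule lim)
    fix m and y :: real assume y: "y \<in> {0..1}"
    have "(y - (- 1)) / n m \<le> 3 / n m" using npos[of m] y by (intro divide_right_mono) auto
    moreover have "0 \<le> (y - (- 1)) / n m" using npos[of m] y by simp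
    ultimately show "s + (y - (- 1)) / n m \<in> {0..T}"
      using small[of m] st unfolding atLeastAtMost_iff by linarith
  qed (use st in auto)
  have limt: "(\<lambda>m. LINT r|lborel. n m * R' (n m * (r - t) + 2) * g0 r) \<longlonglongrightarrow> g t"
  proof (rule lim)
    fix m and y :: real assume y: "y \<in> {0..1}"
    have "- 3 / n m \<le> (y - 2) / n m" using npos[of m] y by (intro divide_right_mono) auto
    moreover have "(y - 2) / n m \<le> 0" using npos[of m] y by (simp add: divide_nonpos_pos)
    ultimately show "t + (y - 2) / n m \<in> {0..T}"
      using small[of m] st unfolding atLeastAtMost_iff by (simp add: )
  qed (use st in auto)
  have gint: "integrable lborel (\<lambda>r. n m * R' (n m * (r - p) + \<alpha>) * g0 r)" for m p \<alpha>
  proof -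
    have "integrable lborel (\<lambda>r. R' ((\<alpha> - n m * p) + n m * r))"
      using npos[of m] R'int by (intro lborel_integrable_real_affine) auto
    then have i: "integrable lborel (\<lambda>r. n m * R' (n m * (r - p) + \<alpha>) * Mg)"
      by (simp add: algebra_simps)
    show ?thesis
      by (rule Bochner_Integration.integrable_bound[OF i])
         (use g0_le Mg0 in \<open>auto simp: abs_mult intro!: AE_I2 mult_left_mono\<close>)
  qed
  have split: "(LINT r|lborel. indicator {0<..<T} r * (\<eta>' m r * g r))
      = (LINT r|lborel. n m * R' (n m * (r - s) + (- 1)) * g0 r) - (LINT r|lborel. n m * R' (n m * (r - t) + 2) * g0 r)" for m
  proof -
    \<comment> \<open>The weak identity uses the open interval and \<open>g0\<close> the closed
      one.\<close>
    have "AE r in lborel. r \<noteq> 0 \<and> r \<noteq> T"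
      by (intro AE_conjI AE_lborel_singleton)
    then have ae: "AE r in lborel. indicator {0<..<T} r * (\<eta>' m r * g r)
        = n m * R' (n m * (r - s) + (- 1)) * g0 r - n m * R' (n m * (r - t) + 2) * g0 r"
      by eventually_elim (auto simp: \<eta>'_def g0_def indicator_def left_diff_distrib)
    have eqf: "(\<lambda>r. indicator {0<..<T} r * (\<eta>' m r * g r)) = (\<lambda>r. indicator {0<..<T} r * (\<eta>' m r * g0 r))"
      by (auto simp: g0_def indicator_def fun_eq_iff)
    have [measurable]: "\<eta>' m \<in> borel_measurable borel"
      using \<eta>'_cont by (rule borel_measurable_continuous_onI)
    have "(LINT r|lborel. indicator {0<..<T} r * (\<eta>' m r * g r))
      = (LINT r|lborel. n m * R' (n m * (r - s) + (- 1)) * g0 r - n m * R' (n m * (r - t) + 2) * g0 r)"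
      by (rule integral_cong_AE[OF _ _ ae]) (subst eqf, measurable)
    then show ?thesis
      unfolding Bochner_Integration.integral_diff[OF gint gint] .
  qed
  have "(\<lambda>m. 0) \<longlonglongrightarrow> (g s - g t) + (LINT r|lborel. indicator {s<..<t} r * k r)"
    using tendsto_add[OF tendsto_diff[OF lims limt] lim2] unfolding split[symmetric] eq .
  then have "(g s - g t) + (LINT r|lborel. indicator {s<..<t} r * k r) = 0"
    using LIMSEQ_unique[OF _ tendsto_const] by fastforce
  then show ?thesis by simp
qed

section \<open>Separated test functions and integrals over space-time\<close>

lemma borel_measurable_fst [measurable]:
  "(fst :: 'a::topological_space \<times> 'b::topological_space \<Rightarrow> 'a) \<in> borel_measurable borel"
  by (intro borel_measurable_continuous_onI continuous_intros)

lemma borel_measurable_snd [measurable]: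
  "(snd :: 'a::topological_space \<times> 'b::topological_space \<Rightarrow> 'b) \<in> borel_measurable borel"
  by (intro borel_measurable_continuous_onI continuous_intros)

lemma product_test_function:
  fixes \<psi> :: "real^3 \<Rightarrow> real"
  assumes \<psi>: "Ck (Suc 0) \<psi>" and \<eta>: "\<And>t. (\<eta> has_real_derivative \<eta>' t) (at t)" "continuous_on UNIV \<eta>'"
  defines "\<phi> \<equiv> \<lambda>z. \<psi> (fst z) * \<eta> (snd z)"
  shows "Ck (Suc 0) \<phi>" "time_deriv \<phi> z = \<psi> (fst z) * \<eta>' (snd z)" "space_grad \<phi> z = \<eta> (snd z) *\<^sub>R grad \<psi> (fst z)"
proof -
  let ?f' = "\<lambda>z d. \<psi> (fst z) * (\<eta>' (snd z) * snd d) + frechet_derivative \<psi> (at (fst z)) (fst d) * \<eta> (snd z)"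
  have d: "(\<phi> has_derivative ?f' z) (at z)" for z
  proof -
    have 1: "((\<lambda>z. \<psi> (fst z)) has_derivative (\<lambda>d. frechet_derivative \<psi> (at (fst z)) (fst d))) (at z)"
      by (rule has_derivative_compose[OF has_derivative_fst[OF has_derivative_ident] Ck_has_derivative[OF \<psi>]])
    have "(\<eta> has_derivative (*) (\<eta>' (snd z))) (at (snd z))"
      using \<eta>(1) by (simp only: has_field_derivative_def)
    then have 2: "((\<lambda>z. \<eta> (snd z)) has_derivative (\<lambda>d. \<eta>' (snd z) * snd d)) (at z)"
      by (rule has_derivative_compose[OF has_derivative_snd[OF has_derivative_ident]])
    show ?thesis
      unfolding \<phi>_def by (rule has_derivative_mult[OF 1 2])
  qed
  have c\<psi>: "continuous_on UNIV \<psi>" using Ck_Suc_D[OF \<psi>] by simp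
  have c\<eta>: "continuous_on UNIV \<eta>"
    using DERIV_isCont[OF \<eta>(1)] by (simp add: continuous_on_eq_continuous_at)
  show "Ck (Suc 0) \<phi>"
  proof (rule Ck_SucI[OF d])
    fix b :: "(real^3) \<times> real"
    have "continuous_on UNIV (\<lambda>z. ?f' z b)"
      by (intro continuous_intros continuous_on_compose2[OF c\<psi>] continuous_on_compose2[OF c\<eta>]
          continuous_on_compose2[OF \<eta>(2)] continuous_on_compose2[OF Ck1_continuous_derivative[OF \<psi>]]) auto
    then show "Ck 0 (\<lambda>z. ?f' z b)" by simp
  qed
  have fd: "frechet_derivative \<phi> (at z) = ?f' z"
    by (rule frechet_derivative_at[OF d, symmetric])
  have "linear (frechet_derivative \<psi> (at (fst z)))"
    using \<psi> by (intro linear_frechet_derivative) auto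
  then show "time_deriv \<phi> z = \<psi> (fst z) * \<eta>' (snd z)"
    by (simp add: time_deriv_def fd linear_0)
  show "space_grad \<phi> z = \<eta> (snd z) *\<^sub>R grad \<psi> (fst z)"
    by (simp add: space_grad_def fd grad_def vec_eq_iff mult.commute)
qed

lemma integrable_bounded_support:
  fixes f :: "'a::euclidean_space \<Rightarrow> 'b::{banach, second_countable_topology}"
  assumes "f \<in> borel_measurable borel" "bounded U" "U \<in> sets borel" "\<And>x. x \<notin> U \<Longrightarrow> f x = 0" "\<And>x. x \<in> U \<Longrightarrow> norm (f x) \<le> M"
  shows "integrable lborel f"
proof -
  have "integrable lborel (\<lambda>x. indicator U x * M)"
    using emeasure_bounded_finite[OF assms(2)] assms(3) by (intro integrable_mult_left) auto
  then show ?thesis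
    by (rule Bochner_Integration.integrable_bound)
       (use assms in \<open>auto simp: indicator_def intro!: AE_I2 intro: order_trans[OF _ abs_ge_self]\<close>)
qed

lemma integrable_L2_bounded_support:
  fixes f :: "'a::euclidean_space \<Rightarrow> 'b::{banach, second_countable_topology}"
  assumes [measurable]: "f \<in> borel_measurable borel" and U: "bounded U" "U \<in> sets borel"
    and z: "\<And>x. x \<notin> U \<Longrightarrow> f x = 0" and i: "integrable lborel (\<lambda>x. (norm (f x))\<^sup>2)"
  shows "integrable lborel f"
proof -
  have 1: "integrable lborel (\<lambda>x. indicator U x + (norm (f x))\<^sup>2)"
    using emeasure_bounded_finite[OF U(1)] U(2) i by (intro Bochner_Integration.integrable_add) auto
  have le: "norm (f x) \<le> indicator U x + (norm (f x))\<^sup>2" for x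
  proof (cases "x \<in> U")
    case True
    have "0 \<le> (norm (f x) - 1)\<^sup>2 + 1 + (norm (f x))\<^sup>2" by simp
    then show ?thesis using True by (simp add: power2_diff)
  qed (use z in simp)
  show ?thesis
    by (rule Bochner_Integration.integrable_bound[OF 1]) (use le in \<open>auto intro: order_trans\<close>)
qed

lemma integral_lborel_prod_swapped:
  fixes f :: "'a::euclidean_space \<times> 'b::euclidean_space \<Rightarrow> 'c::{banach, second_countable_topology}"
  assumes "integrable lborel f"
  shows "(LINT z|lborel. f z) = (LINT y|lborel. LINT x|lborel. f (x, y))"
    and "integrable lborel (\<lambda>y. LINT x|lborel. f (x, y))"
    and "AE y in lborel. integrable lborel (\<lambda>x. f (x, y))"
    and "AE x in lborel. integrable lborel (\<lambda>y. f (x, y))"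
proof -
  have i: "integrable (lborel \<Otimes>\<^sub>M lborel) (case_prod (\<lambda>x y. f (x, y)))"
    using assms by (simp add: lborel_prod)
  show "(LINT z|lborel. f z) = (LINT y|lborel. LINT x|lborel. f (x, y))"
    using lborel_pair.integral_snd[OF i] by (simp add: lborel_prod)
  show "integrable lborel (\<lambda>y. LINT x|lborel. f (x, y))"
    by (rule lborel_pair.integrable_snd[OF i])
  show "AE y in lborel. integrable lborel (\<lambda>x. f (x, y))"
    by (rule lborel_pair.AE_integrable_snd[OF i])
  show "AE x in lborel. integrable lborel (\<lambda>y. f (x, y))"
    using lborel_pair.AE_integrable_fst[OF i] by simp
qed

text \<open>The kernel of the oriented integral from \<open>s\<close> to \<open>t\<close>. Both
  orders of the two times occur because the time step \<open>h\<close> takes both signs.\<close>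

definition signed_indicator :: "real \<Rightarrow> real \<Rightarrow> real \<Rightarrow> real" where
  "signed_indicator s t r = indicator {s<..<t} r - indicator {t<..<s} r"

lemma signed_indicator_measurable [measurable]: "signed_indicator s t \<in> borel_measurable borel"
  unfolding signed_indicator_def[abs_def] by measurable

lemma signed_indicator_le: "\<bar>signed_indicator s t r\<bar> \<le> 1"
  by (auto simp: signed_indicator_def indicator_def)

text \<open>One species with Borel data extended by zero off the cylinder. \<open>v\<close> is
  defined at every time and tied to \<open>c\<close> at almost every time by \<open>v_c\<close>; its
  continuity is recorded in the \<open>L^1\<close> norm, which suits Lipschitz functionals.\<close>

locale ms_species =
  fixes \<Omega> :: "(real^3) set" and T :: real
    and c :: "(real^3) \<times> real \<Rightarrow> real" and J G :: "(real^3) \<times> real \<Rightarrow> real^3"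
    and v :: "real \<Rightarrow> real^3 \<Rightarrow> real"
  assumes domain: "open \<Omega>" "bounded \<Omega>" "interior_cone_condition \<Omega>" and T: "T > 0"
    and c: "c \<in> borel_measurable borel" "\<And>z. 0 \<le> c z" "\<And>z. c z \<le> 1" "\<And>z. z \<notin> \<Omega> \<times> {0<..<T} \<Longrightarrow> c z = 0"
    and J: "J \<in> borel_measurable borel" "integrable lborel (\<lambda>z. (norm (J z))\<^sup>2)" "\<And>z. z \<notin> \<Omega> \<times> {0<..<T} \<Longrightarrow> J z = 0"
    and G: "G \<in> borel_measurable borel" "integrable lborel (\<lambda>z. (norm (G z))\<^sup>2)" "\<And>z. z \<notin> \<Omega> \<times> {0<..<T} \<Longrightarrow> G z = 0"
    and wG: "AE t in lborel. t \<in> {0<..<T} \<longrightarrow> wgrad \<Omega> (\<lambda>x. sqrt (c (x, t))) (\<lambda>x. G (x, t))"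
    and weak: "\<And>\<phi>. \<phi> \<in> C1c_closure \<Omega> T \<Longrightarrow>
      (LINT z|lborel. c z * time_deriv \<phi> z) + (LINT z|lborel. J z \<bullet> space_grad \<phi> z) = 0"
    and v: "\<And>t. t \<in> {0..T} \<Longrightarrow> v t \<in> borel_measurable borel" "\<And>t x. t \<in> {0..T} \<Longrightarrow> 0 \<le> v t x"
      "\<And>t x. t \<in> {0..T} \<Longrightarrow> v t x \<le> 1" "\<And>t x. t \<in> {0..T} \<Longrightarrow> x \<notin> \<Omega> \<Longrightarrow> v t x = 0"
    and v_cont: "\<And>s. s \<in> {0..T} \<Longrightarrow> ((\<lambda>t. LINT x|lborel. \<bar>v t x - v s x\<bar>) \<longlongrightarrow> 0) (at s within {0..T})"
    and v_c: "AE t in lborel. t \<in> {0<..<T} \<longrightarrow> (AE x in lborel. v t x = c (x, t))"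
begin

lemmas [measurable] = c(1) J(1) G(1)

lemma domain_borel [measurable]: "\<Omega> \<in> sets borel"
  using domain(1) by auto

lemma cylinder: "bounded (\<Omega> \<times> {0<..<T})" "\<Omega> \<times> {0<..<T} \<in> sets borel"
  using domain by (auto intro!: bounded_Times borel_open open_Times)

lemma J_integrable: "integrable lborel J"
  by (rule integrable_L2_bounded_support[OF J(1) cylinder J(3,2)])

lemma v_integrable: "t \<in> {0..T} \<Longrightarrow> integrable lborel (v t)"
  using v by (intro integrable_bounded_support[OF _ domain(2) domain_borel, of _ 1]) auto

text \<open>Continuity of \<open>v\<close> in the mean passes to functionals whose density is
  Lipschitz in \<open>v\<close>: the pairing with a test function and the entropy.\<close>

lemma functional_continuous:
  assumes f: "\<And>t. t \<in> {0..T} \<Longrightarrow> integrable lborel (f t)"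
    and le: "\<And>s t x. s \<in> {0..T} \<Longrightarrow> t \<in> {0..T} \<Longrightarrow> \<bar>f t x - f s x\<bar> \<le> M * \<bar>v t x - v s x\<bar>"
  shows "continuous_on {0..T} (\<lambda>t. LINT x|lborel. (f t x :: real))"
  unfolding continuous_on_def
proof
  fix s assume s: "s \<in> {0..T}"
  have "((\<lambda>t. (LINT x|lborel. f t x) - (LINT x|lborel. f s x)) \<longlongrightarrow> 0) (at s within {0..T})"
  proof (rule Lim_null_comparison)
    show "((\<lambda>t. M * (LINT x|lborel. \<bar>v t x - v s x\<bar>)) \<longlongrightarrow> 0) (at s within {0..T})"
      using tendsto_mult_right_zero[OF v_cont[OF s]] .
    have "norm ((LINT x|lborel. f t x) - (LINT x|lborel. f s x)) \<le> M * (LINT x|lborel. \<bar>v t x - v s x\<bar>)" if t: "t \<in> {0..T}" for t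
    proof -
      have "norm ((LINT x|lborel. f t x) - (LINT x|lborel. f s x)) = norm (LINT x|lborel. f t x - f s x)"
        using f s t by simp
      also have "\<dots> \<le> (LINT x|lborel. norm (f t x - f s x))"
        by (rule integral_norm_bound)
      also have "\<dots> \<le> (LINT x|lborel. M * \<bar>v t x - v s x\<bar>)"
        using f s t le v_integrable by (intro integral_mono) auto
      finally show ?thesis by simp
    qed
    then show "\<forall>\<^sub>F t in at s within {0..T}. norm ((LINT x|lborel. f t x) - (LINT x|lborel. f s x)) \<le> M * (LINT x|lborel. \<bar>v t x - v s x\<bar>)"
      by (auto simp: eventually_at_filter)
  qed
  then show "((\<lambda>t. LINT x|lborel. f t x) \<longlongrightarrow> (LINT x|lborel. f s x)) (at s within {0..T})"
    by (simp add: LIM_zero_iff)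
qed

text \<open>Integrating the flux in time turns the evolution equation between two times into a
  stationary identity in space, the form required by \<open>sobolev_test\<close>.\<close>

definition flux :: "real \<Rightarrow> real \<Rightarrow> real^3 \<Rightarrow> real^3" where
  "flux s t x = (LINT r|lborel. signed_indicator s t r *\<^sub>R J (x, r))"

lemma flux_measurable [measurable]: "flux s t \<in> borel_measurable borel"
  unfolding flux_def[abs_def] by measurable

lemma flux_outside: "x \<notin> \<Omega> \<Longrightarrow> flux s t x = 0"
  using J(3) by (simp add: flux_def)

lemma J_section_integrable: "AE x in lborel. integrable lborel (\<lambda>r. J (x, r))"
  by (rule integral_lborel_prod_swapped(4)[OF J_integrable])

lemma signed_section_integrable:
  assumes "integrable lborel (\<lambda>r. J (x, r))"
  shows "integrable lborel (\<lambda>r. signed_indicator s t r *\<^sub>R J (x, r))"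
  by (rule Bochner_Integration.integrable_bound[OF assms])
     (use signed_indicator_le in \<open>auto intro!: AE_I2 mult_left_le_one_le\<close>)

text \<open>Cauchy-Schwarz in time, which costs the factor \<open>T\<close>. Where the section is
  not integrable, the integral has the default value 0 and the bound is trivial.\<close>

lemma flux_L2: "integrable lborel (\<lambda>x. (norm (flux s t x))\<^sup>2)"
proof (rule integrableI_bounded)
  define I where "I = (\<lambda>r. indicator {0<..<T} r :: ennreal)"
  have I2: "(\<integral>\<^sup>+r. (I r)^2 \<partial>lborel) = ennreal T"
  proof -
    have "(\<integral>\<^sup>+r. (I r)^2 \<partial>lborel) = (\<integral>\<^sup>+r. indicator {0<..<T} r \<partial>lborel)"
      by (intro nn_integral_cong) (auto simp: I_def indicator_def)
    then show ?thesis using T by simp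
  qed
  have "ennreal (norm ((norm (flux s t x))\<^sup>2)) \<le> ennreal T * (\<integral>\<^sup>+r. ennreal ((norm (J (x, r)))\<^sup>2) \<partial>lborel)" for x
  proof -
    have "ennreal (norm (flux s t x)) \<le> (\<integral>\<^sup>+r. I r * ennreal (norm (J (x, r))) \<partial>lborel)"
    proof (cases "integrable lborel (\<lambda>r. signed_indicator s t r *\<^sub>R J (x, r))")
      case True
      have "ennreal (norm (flux s t x)) \<le> (\<integral>\<^sup>+r. ennreal (norm (signed_indicator s t r *\<^sub>R J (x, r))) \<partial>lborel)"
        unfolding flux_def by (rule integral_norm_bound_ennreal[OF True])
      also have "\<dots> \<le> (\<integral>\<^sup>+r. I r * ennreal (norm (J (x, r))) \<partial>lborel)"
      proof (rule nn_integral_mono)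
        fix r
        show "ennreal (norm (signed_indicator s t r *\<^sub>R J (x, r))) \<le> I r * ennreal (norm (J (x, r)))"
        proof (cases "r \<in> {0<..<T}")
          case True
          then show ?thesis
            using signed_indicator_le[of s t r] by (auto simp: I_def intro!: ennreal_leI mult_left_le_one_le)
        next
          case False
          then show ?thesis using J(3)[of "(x, r)"] by simp
        qed
      qed
      finally show ?thesis .
    next
      case False
      then show ?thesis by (simp add: flux_def not_integrable_integral_eq)
    qed
    then have "(ennreal (norm (flux s t x)))\<^sup>2 \<le> (\<integral>\<^sup>+r. I r * ennreal (norm (J (x, r))) \<partial>lborel)\<^sup>2"
      by (intro power_mono) auto
    also have "\<dots> \<le> (\<integral>\<^sup>+r. (I r)^2 \<partial>lborel) * (\<integral>\<^sup>+r. (ennreal (norm (J (x, r))))^2 \<partial>lborel)"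
      by (rule Cauchy_Schwarz_nn_integral) (auto simp: I_def)
    finally show ?thesis
      by (simp add: I2 ennreal_power)
  qed
  then have "(\<integral>\<^sup>+x. ennreal (norm ((norm (flux s t x))\<^sup>2)) \<partial>lborel)
      \<le> (\<integral>\<^sup>+x. ennreal T * (\<integral>\<^sup>+r. ennreal ((norm (J (x, r)))\<^sup>2) \<partial>lborel) \<partial>lborel)"
    by (intro nn_integral_mono)
  also have "\<dots> = ennreal T * (\<integral>\<^sup>+x. (\<integral>\<^sup>+r. ennreal ((norm (J (x, r)))\<^sup>2) \<partial>lborel) \<partial>lborel)"
    by (rule nn_integral_cmult) measurable
  also have "(\<integral>\<^sup>+x. (\<integral>\<^sup>+r. ennreal ((norm (J (x, r)))\<^sup>2) \<partial>lborel) \<partial>lborel) = (\<integral>\<^sup>+z. ennreal ((norm (J z))\<^sup>2) \<partial>lborel)"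
    using lborel.nn_integral_fst[of "\<lambda>z. ennreal ((norm (J z))\<^sup>2)" lborel] by (simp add: lborel_prod)
  also have "ennreal T * \<dots> < \<infinity>"
    using J(2) by (simp add: integrable_iff_bounded ennreal_mult_less_top)
  finally show "(\<integral>\<^sup>+x. ennreal (norm ((norm (flux s t x))\<^sup>2)) \<partial>lborel) < \<infinity>" .
qed measurable

lemma flux_integrable: "integrable lborel (flux s t)"
  by (rule integrable_L2_bounded_support[OF _ domain(2) domain_borel flux_outside flux_L2]) auto

text \<open>A test \<open>\<psi> x * \<eta> t\<close> turns the weak form into a scalar equation for
  the pairing \<open>g\<close> of \<open>v\<close> with \<open>\<psi>\<close>. As \<open>g\<close>
  is continuous, the equation integrates to an identity between any two times.\<close>

lemma increment:
  assumes \<psi>: "Ck (Suc 0) \<psi>" and st: "s \<in> {0..T}" "t \<in> {0..T}"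
  shows "(LINT x|lborel. (v t x - v s x) * \<psi> x) = (LINT x|lborel. flux s t x \<bullet> grad \<psi> x)"
proof -
  have c\<psi>: "continuous_on UNIV \<psi>" using Ck_Suc_D[OF \<psi>] by simp
  have [measurable]: "\<psi> \<in> borel_measurable borel" "grad \<psi> \<in> borel_measurable borel"
    using borel_measurable_Ck[OF \<psi>] borel_measurable_continuous_onI[OF continuous_on_grad[OF \<psi>]] by auto
  obtain M where M: "M \<ge> 0" "\<And>x. x \<in> \<Omega> \<Longrightarrow> norm (\<psi> x) \<le> M"
    by (rule continuous_bounded_on_bounded[OF c\<psi> domain(2)]) blast
  obtain M2 where M2: "M2 \<ge> 0" "\<And>x. x \<in> \<Omega> \<Longrightarrow> norm (grad \<psi> x) \<le> M2"
    by (rule continuous_bounded_on_bounded[OF continuous_on_grad[OF \<psi>] domain(2)]) blast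
  define g where "g t = (LINT x|lborel. v t x * \<psi> x)" for t
  define k where "k r = (LINT x|lborel. J (x, r) \<bullet> grad \<psi> x)" for r
  have v\<psi>: "integrable lborel (\<lambda>x. v t x * \<psi> x)" if t: "t \<in> {0..T}" for t
  proof (rule integrable_bounded_support[OF _ domain(2) domain_borel])
    show "(\<lambda>x. v t x * \<psi> x) \<in> borel_measurable borel" using v(1)[OF t] by measurable
    show "v t x * \<psi> x = 0" if "x \<notin> \<Omega>" for x using v(4)[OF t that] by simp
    show "norm (v t x * \<psi> x) \<le> 1 * M" if "x \<in> \<Omega>" for x
      unfolding norm_mult using v(2,3)[OF t] M(2)[OF that] M(1) by (intro mult_mono) auto
  qed
  have g_cont: "continuous_on {0..T} g"
    unfolding g_def
  proof (rule functional_continuous[OF v\<psi>])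
    show "\<bar>v t x * \<psi> x - v s x * \<psi> x\<bar> \<le> M * \<bar>v t x - v s x\<bar>" if "s \<in> {0..T}" "t \<in> {0..T}" for s t x
    proof (cases "x \<in> \<Omega>")
      case True
      have "\<bar>v t x * \<psi> x - v s x * \<psi> x\<bar> = \<bar>\<psi> x\<bar> * \<bar>v t x - v s x\<bar>"
        by (metis abs_mult left_diff_distrib mult.commute)
      also have "\<dots> \<le> M * \<bar>v t x - v s x\<bar>"
        using M(2)[OF True] by (intro mult_right_mono) auto
      finally show ?thesis .
    qed (use v(4) that in simp)
  qed
  have Jg: "integrable lborel (\<lambda>z. J z \<bullet> grad \<psi> (fst z))"
  proof (rule Bochner_Integration.integrable_bound[OF integrable_mult_left[OF integrable_norm[OF J_integrable], of M2]])
    have "\<bar>J z \<bullet> grad \<psi> (fst z)\<bar> \<le> norm (J z) * M2" for z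
    proof (cases "fst z \<in> \<Omega>")
      case True
      then show ?thesis
        by (intro order_trans[OF Cauchy_Schwarz_ineq2] mult_left_mono M2) auto
    next
      case False
      then have "J z = 0" using J(3)[of z] by (cases z) auto
      then show ?thesis by simp
    qed
    then show "AE z in lborel. norm (J z \<bullet> grad \<psi> (fst z)) \<le> norm (norm (J z) * M2)"
      using M2(1) by (simp add: abs_mult)
  qed measurable
  have k_int: "integrable lborel k"
    unfolding k_def using integral_lborel_prod_swapped(2)[OF Jg] by simp
  have weak1: "(LINT t|lborel. indicator {0<..<T} t * (\<eta>' t * g t)) + (LINT t|lborel. \<eta> t * k t) = 0"
    if \<eta>: "\<And>t. (\<eta> has_real_derivative \<eta>' t) (at t)" "continuous_on UNIV \<eta>'"
      and ab: "0 < a" "b < T" and supp: "\<And>t. t \<notin> {a..b} \<Longrightarrow> \<eta> t = 0" for \<eta> \<eta>' a b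
  proof -
    define \<phi> where "\<phi> = (\<lambda>z. \<psi> (fst z) * \<eta> (snd z))"
    note p = product_test_function[OF \<psi> \<eta>, folded \<phi>_def]
    have c\<eta>: "continuous_on UNIV \<eta>"
      using DERIV_isCont[OF \<eta>(1)] by (simp add: continuous_on_eq_continuous_at)
    have [measurable]: "\<eta> \<in> borel_measurable borel" "\<eta>' \<in> borel_measurable borel"
      using c\<eta> \<eta>(2) by (auto intro: borel_measurable_continuous_onI)
    obtain M' where M': "M' \<ge> 0" "\<And>t. t \<in> {0..T} \<Longrightarrow> norm (\<eta>' t) \<le> M'"
      by (rule continuous_bounded_on_bounded[OF \<eta>(2), of "{0..T}"]) auto
    obtain M'' where M'': "M'' \<ge> 0" "\<And>t. t \<in> {0..T} \<Longrightarrow> norm (\<eta> t) \<le> M''"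
      by (rule continuous_bounded_on_bounded[OF c\<eta>, of "{0..T}"]) auto
    have "\<phi> \<in> C1c_closure \<Omega> T"
      unfolding C1c_closure_def mem_Collect_eq One_nat_def
    \<comment> \<open>The support is cut down in time only, so \<open>\<psi>\<close> keeps arbitrary
      values at the boundary of \<open>\<Omega>\<close>; here the no-flux condition enters.\<close>
    proof (intro conjI exI[of _ "closure \<Omega> \<times> {a..b}"])
      show "compact (closure \<Omega> \<times> {a..b})"
        using domain(2) by (intro compact_Times) (auto simp: compact_closure)
      show "closure \<Omega> \<times> {a..b} \<subseteq> closure \<Omega> \<times> {0<..<T}"
        using ab by auto
      show "\<forall>z\<in>closure \<Omega> \<times> {0<..<T} - closure \<Omega> \<times> {a..b}. \<phi> z = 0"
      proof
        fix z assume "z \<in> closure \<Omega> \<times> {0<..<T} - closure \<Omega> \<times> {a..b}"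
        then have "snd z \<notin> {a..b}" by (cases z) auto
        then show "\<phi> z = 0" using supp by (simp add: \<phi>_def)
      qed
    qed (fact p(1))
    from weak[OF this]
    have eq: "(LINT z|lborel. c z * (\<psi> (fst z) * \<eta>' (snd z))) + (LINT z|lborel. J z \<bullet> (\<eta> (snd z) *\<^sub>R grad \<psi> (fst z))) = 0"
      by (simp only: p)
    have i1: "integrable lborel (\<lambda>z. c z * (\<psi> (fst z) * \<eta>' (snd z)))"
    proof (rule integrable_bounded_support[OF _ cylinder])
      show "norm (c z * (\<psi> (fst z) * \<eta>' (snd z))) \<le> 1 * (M * M')" if "z \<in> \<Omega> \<times> {0<..<T}" for z
        unfolding norm_mult using that c(2,3)[of z] M M' by (intro mult_mono) auto
    qed (use c in auto)
    have i2: "integrable lborel (\<lambda>z. J z \<bullet> (\<eta> (snd z) *\<^sub>R grad \<psi> (fst z)))"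
    proof (rule Bochner_Integration.integrable_bound[OF integrable_mult_left[OF integrable_norm[OF Jg], of M'']])
      have "\<bar>J z \<bullet> (\<eta> (snd z) *\<^sub>R grad \<psi> (fst z))\<bar> \<le> \<bar>J z \<bullet> grad \<psi> (fst z)\<bar> * M''" for z
      proof (cases "z \<in> \<Omega> \<times> {0<..<T}")
        case True
        then have "\<bar>\<eta> (snd z)\<bar> \<le> M''" using M''(2)[of "snd z"] by auto
        then show ?thesis by (simp add: abs_mult mult.commute mult_right_mono)
      qed (use J(3) in simp)
      then show "AE z in lborel. norm (J z \<bullet> (\<eta> (snd z) *\<^sub>R grad \<psi> (fst z))) \<le> norm (norm (J z \<bullet> grad \<psi> (fst z)) * M'')"
        using M''(1) by (simp add: abs_mult)
    qed measurable
    have [measurable]: "(\<lambda>t. indicator {0<..<T} t * (\<eta>' t * g t)) \<in> borel_measurable borel"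
    proof -
      have "(\<lambda>t. indicator {0..T} t *\<^sub>R g t) \<in> borel_measurable borel"
        by (rule borel_measurable_continuous_on_indicator[OF _ g_cont]) auto
      then have "(\<lambda>t. indicator {0<..<T} t * (\<eta>' t * (indicator {0..T} t *\<^sub>R g t))) \<in> borel_measurable borel"
        by measurable
      moreover have "(\<lambda>t. indicator {0<..<T} t * (\<eta>' t * (indicator {0..T} t *\<^sub>R g t))) = (\<lambda>t. indicator {0<..<T} t * (\<eta>' t * g t))"
        by (auto simp: indicator_def fun_eq_iff)
      ultimately show ?thesis by simp
    qed
    have "(LINT z|lborel. c z * (\<psi> (fst z) * \<eta>' (snd z))) = (LINT t|lborel. LINT x|lborel. c (x, t) * (\<psi> x * \<eta>' t))"
      using integral_lborel_prod_swapped(1)[OF i1] by simp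
    also have "\<dots> = (LINT t|lborel. indicator {0<..<T} t * (\<eta>' t * g t))"
    proof (rule integral_cong_AE)
      show "AE t in lborel. (LINT x|lborel. c (x, t) * (\<psi> x * \<eta>' t)) = indicator {0<..<T} t * (\<eta>' t * g t)"
        using v_c
      proof eventually_elim
        case (elim t)
        show ?case
        proof (cases "t \<in> {0<..<T}")
          case True
          then have t: "t \<in> {0..T}" by auto
          have "(LINT x|lborel. c (x, t) * (\<psi> x * \<eta>' t)) = (LINT x|lborel. \<eta>' t * (v t x * \<psi> x))"
          proof (rule integral_cong_AE)
            show "AE x in lborel. c (x, t) * (\<psi> x * \<eta>' t) = \<eta>' t * (v t x * \<psi> x)"
              using elim True by (auto elim!: eventually_mono)
            show "(\<lambda>x. \<eta>' t * (v t x * \<psi> x)) \<in> borel_measurable lborel"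
              using v(1)[OF t] by measurable
          qed measurable
          then show ?thesis using True by (simp add: g_def)
        next
          case False
          then show ?thesis using c(4) by simp
        qed
      qed
    qed measurable
    finally have e1: "(LINT z|lborel. c z * (\<psi> (fst z) * \<eta>' (snd z))) = (LINT t|lborel. indicator {0<..<T} t * (\<eta>' t * g t))" .
    have e2: "(LINT z|lborel. J z \<bullet> (\<eta> (snd z) *\<^sub>R grad \<psi> (fst z))) = (LINT t|lborel. \<eta> t * k t)"
      using integral_lborel_prod_swapped(1)[OF i2] by (simp add: k_def)
    show ?thesis using eq unfolding e1 e2 .
  qed
  have incr: "g t - g s = (LINT r|lborel. indicator {s<..<t} r * k r)" if "0 \<le> s" "s < t" "t \<le> T" for s t
    by (rule weak_time_derivative[OF g_cont k_int weak1 that]) auto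
  have "g t - g s = (LINT r|lborel. signed_indicator s t r * k r)"
  proof -
    consider "s < t" | "t < s" | "s = t" by linarith
    then show ?thesis
    proof cases
      case 1
      then show ?thesis using incr[of s t] st by (simp add: signed_indicator_def)
    next
      case 2
      then have "g t - g s = - (LINT r|lborel. indicator {t<..<s} r * k r)" using incr[of t s] st by simp
      then show ?thesis using 2 by (simp add: signed_indicator_def)
    next
      case 3
      then show ?thesis by (simp add: signed_indicator_def)
    qed
  qed
  also have "\<dots> = (LINT x|lborel. flux s t x \<bullet> grad \<psi> x)"
  proof -
    have i: "integrable lborel (\<lambda>z. signed_indicator s t (snd z) * (J z \<bullet> grad \<psi> (fst z)))"
      by (rule Bochner_Integration.integrable_bound[OF Jg])
         (use signed_indicator_le in \<open>auto simp: abs_mult intro!: AE_I2 mult_left_le_one_le\<close>)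
    have "(LINT r|lborel. signed_indicator s t r * k r) = (LINT z|lborel. signed_indicator s t (snd z) * (J z \<bullet> grad \<psi> (fst z)))"
      using integral_lborel_prod_swapped(1)[OF i] by (simp add: k_def)
    also have "\<dots> = (LINT x|lborel. LINT r|lborel. signed_indicator s t r * (J (x, r) \<bullet> grad \<psi> x))"
      using lborel_pair.integral_fst'[of "\<lambda>z. signed_indicator s t (snd z) * (J z \<bullet> grad \<psi> (fst z))"] i
      by (simp add: lborel_prod)
    also have "\<dots> = (LINT x|lborel. flux s t x \<bullet> grad \<psi> x)"
    proof (rule integral_cong_AE)
      show "AE x in lborel. (LINT r|lborel. signed_indicator s t r * (J (x, r) \<bullet> grad \<psi> x)) = flux s t x \<bullet> grad \<psi> x"
        using J_section_integrable
      proof eventually_elim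
        case (elim x)
        then show ?case
          unfolding flux_def
          using integral_inner_left[of "grad \<psi> x" lborel "\<lambda>r. signed_indicator s t r *\<^sub>R J (x, r)"] signed_section_integrable
          by simp
      qed
    qed measurable
    finally show ?thesis .
  qed
  finally show ?thesis
    using v\<psi> st by (simp add: g_def left_diff_distrib)
qed

end

section \<open>Convexity and averaging in time\<close>

lemma signed_indicator_translate: "signed_indicator s (s + h) (s + \<theta>) = signed_indicator 0 h \<theta>"
  by (auto simp: signed_indicator_def indicator_def)

lemma integral_signed_indicator:
  "integrable lborel (signed_indicator 0 h)" "(LINT \<theta>|lborel. signed_indicator 0 h \<theta>) = h"
  "(LINT \<theta>|lborel. \<bar>signed_indicator 0 h \<theta>\<bar>) = \<bar>h\<bar>"
proof -
  have i: "integrable lborel (indicator {a<..<b} :: real \<Rightarrow> real)" for a b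
    by (intro integrable_real_indicator emeasure_bounded_finite) auto
  show 1: "integrable lborel (signed_indicator 0 h)"
    unfolding signed_indicator_def[abs_def] by (intro Bochner_Integration.integrable_diff i)
  show "(LINT \<theta>|lborel. signed_indicator 0 h \<theta>) = h"
    unfolding signed_indicator_def using i by (cases "h \<ge> 0") (auto simp: Bochner_Integration.integral_diff)
  have "\<bar>signed_indicator 0 h \<theta>\<bar> = indicator {0<..<h} \<theta> + indicator {h<..<0} \<theta>" for \<theta>
    by (auto simp: signed_indicator_def indicator_def)
  then show "(LINT \<theta>|lborel. \<bar>signed_indicator 0 h \<theta>\<bar>) = \<bar>h\<bar>"
    using i by (cases "h \<ge> 0") auto
qed

text \<open>\<open>conv\<close> makes \<open>F (sqrt a)\<close> a subgradient of
  \<open>\<Phi>\<close> at \<open>a\<close>. The argument of \<open>F\<close> is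
  \<open>sqrt a\<close> because the square root is the function whose weak gradient is
  given.\<close>

locale ms_entropy_pair = ms_species +
  fixes F F' \<Phi> :: "real \<Rightarrow> real" and K :: real
  assumes F: "\<And>s. (F has_real_derivative F' s) (at s)" "continuous_on UNIV F'"
    and \<Phi>: "\<Phi> \<in> borel_measurable borel"
    and conv: "\<And>a b. a \<in> {0..1} \<Longrightarrow> b \<in> {0..1} \<Longrightarrow> F (sqrt a) * (b - a) \<le> \<Phi> b - \<Phi> a"
    and lip: "\<And>a b. a \<in> {0..1} \<Longrightarrow> b \<in> {0..1} \<Longrightarrow> \<bar>\<Phi> b - \<Phi> a\<bar> \<le> K * \<bar>b - a\<bar>"
begin

lemmas [measurable] = \<Phi>

lemma F_measurable [measurable]: "F \<in> borel_measurable borel" "F' \<in> borel_measurable borel"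
proof -
  have "continuous_on UNIV F"
    using DERIV_isCont[OF F(1)] by (simp add: continuous_on_eq_continuous_at)
  then show "F \<in> borel_measurable borel" by (rule borel_measurable_continuous_onI)
  show "F' \<in> borel_measurable borel" using F(2) by (rule borel_measurable_continuous_onI)
qed

definition E :: "real \<Rightarrow> real" where
  "E t = (LINT x|lborel. indicator \<Omega> x * \<Phi> (v t x))"

lemma \<Phi>_integrable:
  assumes t: "t \<in> {0..T}"
  shows "integrable lborel (\<lambda>x. indicator \<Omega> x * \<Phi> (v t x))"
proof (rule integrable_bounded_support[OF _ domain(2) domain_borel])
  show "(\<lambda>x. indicator \<Omega> x * \<Phi> (v t x)) \<in> borel_measurable borel"
    using v(1)[OF t] by measurable
  show "norm (indicator \<Omega> x * \<Phi> (v t x)) \<le> \<bar>\<Phi> 0\<bar> + \<bar>K\<bar>" if "x \<in> \<Omega>" for x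
  proof -
    have "\<bar>\<Phi> (v t x) - \<Phi> 0\<bar> \<le> K * \<bar>v t x - 0\<bar>"
      using v(2,3)[OF t] by (intro lip) auto
    also have "\<dots> \<le> \<bar>K\<bar> * 1"
      using v(2,3)[OF t] by (intro mult_mono) auto
    finally show ?thesis using that by simp
  qed
qed simp

lemma E_continuous: "continuous_on {0..T} E"
  unfolding E_def
proof (rule functional_continuous[OF \<Phi>_integrable, of _ K])
  fix s t x assume st: "s \<in> {0..T}" "t \<in> {0..T}"
  show "\<bar>indicator \<Omega> x * \<Phi> (v t x) - indicator \<Omega> x * \<Phi> (v s x)\<bar> \<le> K * \<bar>v t x - v s x\<bar>"
  proof (cases "x \<in> \<Omega>")
    case True
    then show ?thesis using lip[of "v s x" "v t x"] v(2,3) st by simp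
  next
    case False
    then show ?thesis using v(4) st by simp
  qed
qed

lemma G_section: "AE t in lborel. integrable lborel (\<lambda>x. (norm (G (x, t)))\<^sup>2)"
  by (rule integral_lborel_prod_swapped(3)[OF G(2)])

text \<open>The tangent inequality at time \<open>s\<close>, with the increment evaluated by the
  chain rule for the test \<open>F (sqrt c)\<close>. The exceptional null set concerns
  \<open>s\<close> alone: \<open>t\<close> is arbitrary and may lie on either side of
  \<open>s\<close>.\<close>

lemma E_increment:
  "AE s in lborel. s \<in> {0<..<T} \<longrightarrow> (\<forall>t\<in>{0..T}.
     (LINT x|lborel. flux s t x \<bullet> (F' (sqrt (c (x, s))) *\<^sub>R G (x, s))) \<le> E t - E s)"
  using wG v_c G_section
proof eventually_elim
  case (elim s)
  show ?case
  proof (intro impI ballI)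
    assume s: "s \<in> {0<..<T}" fix t assume t: "t \<in> {0..T}"
    have s': "s \<in> {0..T}" using s by auto
    note vm [measurable] = v(1)[OF t] v(1)[OF s']
    \<comment> \<open>The increment enters as \<open>v s - v t\<close>, the sign with which
      \<open>increment\<close> becomes the hypothesis \<open>test\<close>.\<close>
    interpret S: sobolev_test \<Omega> "\<lambda>x. sqrt (c (x, s))" "\<lambda>x. G (x, s)" "\<lambda>x. v s x - v t x" "flux s t" F F'
    proof
      show "integrable lborel (\<lambda>x. sqrt (c (x, s)))"
        by (rule integrable_bounded_support[OF _ domain(2) domain_borel, of _ 1])
           (use c in \<open>auto simp: abs_le_square_iff real_sqrt_le_1_iff\<close>)
      show "0 \<le> sqrt (c (x, s))" "sqrt (c (x, s)) \<le> 1" for x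
        using c(2,3) by auto
      show g2: "integrable lborel (\<lambda>x. (norm (G (x, s)))\<^sup>2)" using elim by simp
      show "integrable lborel (\<lambda>x. G (x, s))"
        by (rule integrable_L2_bounded_support[OF _ domain(2) domain_borel _ g2]) (use G(3) in auto)
      show "wgrad \<Omega> (\<lambda>x. sqrt (c (x, s))) (\<lambda>x. G (x, s))" using elim s by simp
      show "integrable lborel (\<lambda>x. v s x - v t x)"
        using v_integrable[OF s'] v_integrable[OF t] by simp
      show "v s x - v t x = 0" if "x \<notin> \<Omega>" for x using v(4)[OF s' that] v(4)[OF t that] by simp
      fix \<psi> :: "real^3 \<Rightarrow> real" assume \<psi>: "Ck (Suc 0) \<psi>"
      have "(v s x - v t x) * \<psi> x = - ((v t x - v s x) * \<psi> x)" for x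
        by (simp add: left_diff_distrib)
      then show "(LINT x|lborel. (v s x - v t x) * \<psi> x) + (LINT x|lborel. flux s t x \<bullet> grad \<psi> x) = 0"
        using increment[OF \<psi> s' t] by simp
    qed (fact domain flux_integrable flux_L2 flux_outside F)+
    have "(LINT x|lborel. flux s t x \<bullet> (F' (sqrt (c (x, s))) *\<^sub>R G (x, s)))
        = - (LINT x|lborel. (v s x - v t x) * F (sqrt (c (x, s))))"
      using S.chain_rule_test[OF domain(3)] by simp
    also have "\<dots> = (LINT x|lborel. (v t x - v s x) * F (sqrt (c (x, s))))"
      by (simp add: left_diff_distrib[symmetric] minus_mult_left del: mult_minus_left left_diff_distrib flip: integral_minus)
    also have "\<dots> \<le> (LINT x|lborel. indicator \<Omega> x * \<Phi> (v t x) - indicator \<Omega> x * \<Phi> (v s x))"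
    proof (rule integral_mono_AE)
      obtain M where M: "M \<ge> 0" "\<And>s. s \<in> {0..1} \<Longrightarrow> \<bar>F s\<bar> \<le> M"
        by (rule S.F_bounds) blast
      show "integrable lborel (\<lambda>x. (v t x - v s x) * F (sqrt (c (x, s))))"
      proof (rule integrable_bounded_support[OF _ domain(2) domain_borel])
        show "norm ((v t x - v s x) * F (sqrt (c (x, s)))) \<le> 1 * M" if "x \<in> \<Omega>" for x
          unfolding norm_mult using v(2,3)[OF t, of x] v(2,3)[OF s', of x] M c(2,3)[of "(x, s)"]
          by (intro mult_mono) (auto simp: abs_le_iff)
        show "(v t x - v s x) * F (sqrt (c (x, s))) = 0" if "x \<notin> \<Omega>" for x
          using v(4)[OF s' that] v(4)[OF t that] by simp
      qed measurable
      show "integrable lborel (\<lambda>x. indicator \<Omega> x * \<Phi> (v t x) - indicator \<Omega> x * \<Phi> (v s x))"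
        by (intro Bochner_Integration.integrable_diff \<Phi>_integrable t s')
      have "AE x in lborel. v s x = c (x, s)" using elim s by simp
      then show "AE x in lborel. (v t x - v s x) * F (sqrt (c (x, s))) \<le> indicator \<Omega> x * \<Phi> (v t x) - indicator \<Omega> x * \<Phi> (v s x)"
      proof eventually_elim
        fix x assume eq: "v s x = c (x, s)"
        show "(v t x - v s x) * F (sqrt (c (x, s))) \<le> indicator \<Omega> x * \<Phi> (v t x) - indicator \<Omega> x * \<Phi> (v s x)"
        proof (cases "x \<in> \<Omega>")
          case True
          then show ?thesis
            using conv[of "v s x" "v t x"] v(2,3)[OF t, of x] v(2,3)[OF s', of x]
            by (simp add: eq[symmetric] mult.commute)
        next
          case False
          then show ?thesis using v(4)[OF s' False] v(4)[OF t False] by simp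
        qed
      qed
    qed
    also have "\<dots> = E t - E s"
      using \<Phi>_integrable[OF t] \<Phi>_integrable[OF s'] by (simp add: E_def)
    finally show "(LINT x|lborel. flux s t x \<bullet> (F' (sqrt (c (x, s))) *\<^sub>R G (x, s))) \<le> E t - E s" .
  qed
qed

lemma F'_bound:
  obtains M where "M \<ge> 0" "\<And>z. \<bar>F' (sqrt (c z))\<bar> \<le> M"
proof -
  obtain M where M: "M \<ge> 0" "\<And>s. s \<in> {0..1} \<Longrightarrow> norm (F' s) \<le> M"
    by (rule continuous_bounded_on_bounded[OF F(2), of "{0..1}"]) auto
  have "sqrt (c z) \<in> {0..1}" for z using c(2,3)[of z] by auto
  then show ?thesis using M by (intro that[of M]) auto
qed

text \<open>\<open>Q h\<close> integrates the entropy increments over the starting time, and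
  \<open>C \<theta>\<close> is the correlation in time of flux and tested gradient. The bound
  \<open>h * C 0 - \<eta> * \<bar>h\<bar> \<le> Q h\<close> holds for both signs of
  \<open>h\<close>; dividing by \<open>h\<close> reverses it for negative \<open>h\<close>, so the
  limit of \<open>Q h / h\<close> is pinned to \<open>C 0\<close>.\<close>

lemma entropy_balance:
  assumes \<tau>: "\<tau> \<in> {0<..T}"
  shows "integrable lborel (\<lambda>z. indicator {0<..<\<tau>} (snd z) * (J z \<bullet> (F' (sqrt (c z)) *\<^sub>R G z)))"
    and "E \<tau> - E 0 = (LINT z|lborel. indicator {0<..<\<tau>} (snd z) * (J z \<bullet> (F' (sqrt (c z)) *\<^sub>R G z)))"
proof -
  \<comment> \<open>Both factors are cut off at \<open>0\<close> and \<open>\<tau>\<close>, so that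
    they are square integrable on the whole space and can be translated freely in time.\<close>
  define j where "j z = indicator {0<..<\<tau>} (snd z) *\<^sub>R J z" for z
  define V where "V z = indicator {0<..<\<tau>} (snd z) *\<^sub>R (F' (sqrt (c z)) *\<^sub>R G z)" for z
  have [measurable]: "j \<in> borel_measurable borel" "V \<in> borel_measurable borel"
    unfolding j_def[abs_def] V_def[abs_def] by measurable
  have j_int: "integrable lborel j"
    by (rule Bochner_Integration.integrable_bound[OF J_integrable]) (auto simp: j_def indicator_def)
  have j2: "integrable lborel (\<lambda>z. (norm (j z))\<^sup>2)"
    by (rule Bochner_Integration.integrable_bound[OF J(2)]) (auto simp: j_def indicator_def)
  obtain M where M: "M \<ge> 0" "\<And>z. \<bar>F' (sqrt (c z))\<bar> \<le> M"
    by (rule F'_bound) blast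
  have V2: "integrable lborel (\<lambda>z. (norm (V z))\<^sup>2)"
  proof (rule Bochner_Integration.integrable_bound[OF integrable_mult_right[OF G(2), of "M\<^sup>2"]])
    have "norm (V z) \<le> M * norm (G z)" for z
      using mult_right_mono[OF M(2)[of z] norm_ge_zero[of "G z"]] M(1) by (auto simp: V_def indicator_def)
    then have "(norm (V z))\<^sup>2 \<le> (M * norm (G z))\<^sup>2" for z
      by (intro power_mono) auto
    then show "AE z in lborel. norm ((norm (V z))\<^sup>2) \<le> norm (M\<^sup>2 * (norm (G z))\<^sup>2)"
      by (simp add: power_mult_distrib)
  qed measurable
  have jV: "j z \<bullet> V z = indicator {0<..<\<tau>} (snd z) * (J z \<bullet> (F' (sqrt (c z)) *\<^sub>R G z))" for z
    by (simp add: j_def V_def indicator_def)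
  show "integrable lborel (\<lambda>z. indicator {0<..<\<tau>} (snd z) * (J z \<bullet> (F' (sqrt (c z)) *\<^sub>R G z)))"
    unfolding jV[symmetric] by (rule integrable_inner_L2(2)[OF _ _ j2 V2]) auto
  define C where "C \<theta> = (LINT z|lborel. j (z + (0, \<theta>)) \<bullet> V z)" for \<theta>
  have C0: "C 0 = (LINT z|lborel. indicator {0<..<\<tau>} (snd z) * (J z \<bullet> (F' (sqrt (c z)) *\<^sub>R G z)))"
    by (simp add: C_def jV zero_prod_def[symmetric])
  have jt2: "integrable lborel (\<lambda>z. (norm (j (z + w)))\<^sup>2)" for w
    by (rule integrable_lborel_translate[OF j2])
  have jVt: "integrable lborel (\<lambda>z. j (z + w) \<bullet> V z)" for w
    by (rule integrable_inner_L2(2)[OF _ _ jt2 V2]) auto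
  have C_cont: "\<exists>d>0. \<forall>\<theta>. \<bar>\<theta>\<bar> < d \<longrightarrow> \<bar>C \<theta> - C 0\<bar> \<le> \<eta>" if "\<eta> > 0" for \<eta>
  proof -
    \<comment> \<open>Continuity of \<open>C\<close> at 0 is continuity of the translates of
      \<open>j\<close> against the square integrable weight \<open>V\<close>.\<close>
    have "translation_continuous V j"
      by (rule translation_continuous_L2[OF j_int j2 _ V2]) auto
    then obtain d where d: "d > 0" "\<And>w. norm w < d \<Longrightarrow> (\<integral>\<^sup>+z. ennreal (norm (V z) * norm (j (z + w) - j z)) \<partial>lborel) \<le> ennreal \<eta>"
      using \<open>\<eta> > 0\<close> unfolding translation_continuous_def by meson
    have "\<bar>C \<theta> - C 0\<bar> \<le> \<eta>" if \<theta>: "\<bar>\<theta>\<bar> < d" for \<theta>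
    proof -
      define w :: "(real^3) \<times> real" where "w = (0, \<theta>)"
      have "norm w < d" using \<theta> by (simp add: w_def norm_Pair)
      have "C \<theta> - C 0 = (LINT z|lborel. j (z + w) \<bullet> V z - j (z + 0) \<bullet> V z)"
        using jVt[of w] jVt[of 0] by (simp add: C_def w_def zero_prod_def[symmetric])
      also have "\<dots> = (LINT z|lborel. (j (z + w) - j z) \<bullet> V z)"
        by (simp add: inner_diff_left)
      finally have eq: "C \<theta> - C 0 = (LINT z|lborel. (j (z + w) - j z) \<bullet> V z)" .
      have int: "integrable lborel (\<lambda>z. (j (z + w) - j z) \<bullet> V z)"
        using Bochner_Integration.integrable_diff[OF jVt[of w] jVt[of 0]] by (simp add: inner_diff_left)
      have "ennreal (norm (C \<theta> - C 0)) \<le> (\<integral>\<^sup>+z. ennreal (norm ((j (z + w) - j z) \<bullet> V z)) \<partial>lborel)"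
        unfolding eq by (rule integral_norm_bound_ennreal[OF int])
      also have "\<dots> \<le> (\<integral>\<^sup>+z. ennreal (norm (V z) * norm (j (z + w) - j z)) \<partial>lborel)"
        by (intro nn_integral_mono ennreal_leI) (simp add: Cauchy_Schwarz_ineq2 mult.commute[of "norm (V _)"])
      also have "\<dots> \<le> ennreal \<eta>" by (rule d(2)) fact
      finally show ?thesis using \<open>\<eta> > 0\<close> by simp
    qed
    then show ?thesis using d(1) by blast
  qed
  \<comment> \<open>Freezing the entropy outside \<open>{0..\<tau>}\<close> gives
    \<open>e (s + h)\<close> a meaning for all \<open>s\<close>. It matches the cutoff in
    \<open>j\<close>, which carries no flux there.\<close>
  define cl where "cl t = max 0 (min t \<tau>)" for t
  have cl: "cl t \<in> {0..T}" "cl t \<in> {0..\<tau>}" for t using \<tau> by (auto simp: cl_def)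
  define e where "e t = E (cl t)" for t
  have e_cont: "continuous_on UNIV e"
    unfolding e_def by (rule continuous_on_compose2[OF E_continuous]) (use cl in \<open>auto simp: cl_def intro!: continuous_intros\<close>)
  have [measurable]: "e \<in> borel_measurable borel"
    using e_cont by (rule borel_measurable_continuous_onI)
  define Q where "Q h = (LINT s|lborel. (e (s + h) - e s) * indicator {0..\<tau>} s)" for h
  have Q_int: "integrable lborel (\<lambda>s. (e (s + h) - e s) * indicator {0..\<tau>} s)" for h
  proof -
    have "continuous_on {0..\<tau>} (\<lambda>s. e (s + h) - e s)"
      by (intro continuous_intros continuous_on_compose2[OF e_cont] continuous_on_subset[OF e_cont]) auto
    then have "integrable lborel (\<lambda>s. indicator {0..\<tau>} s *\<^sub>R (e (s + h) - e s))"
      by (intro borel_integrable_compact) auto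
    then show ?thesis by (simp add: mult.commute)
  qed
  have Q_ge: "integrable lborel (\<lambda>\<theta>. signed_indicator 0 h \<theta> * C \<theta>)"
    "(LINT \<theta>|lborel. signed_indicator 0 h \<theta> * C \<theta>) \<le> Q h" for h
  proof -
    \<comment> \<open>Fubini in the variables \<open>\<theta>\<close> and \<open>(x, s)\<close>:
      integrating over \<open>(x, s)\<close> first produces \<open>C \<theta>\<close>, over
      \<open>\<theta>\<close> first the flux between \<open>s\<close> and
      \<open>s + h\<close>.\<close>
    define P where "P p = signed_indicator 0 h (fst p) * (j (snd p + (0, fst p)) \<bullet> V (snd p))" for p :: "real \<times> ((real^3) \<times> real)"
    have [measurable]: "P \<in> borel_measurable borel"
    proof -
      have "(\<lambda>p :: real \<times> ((real^3) \<times> real). snd p + (0, fst p)) \<in> borel_measurable borel"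
        by (intro borel_measurable_continuous_onI continuous_intros)
      then show ?thesis unfolding P_def[abs_def] by measurable
    qed
    have P_int: "integrable lborel P"
    proof (rule integrableI_bounded)
      \<comment> \<open>By \<open>a * b \<le> a^2 + b^2\<close> and translation invariance, one
        bound serves all \<open>\<theta>\<close>.\<close>
      define A where "A = (LINT z|lborel. (norm (j z))\<^sup>2) + (LINT z|lborel. (norm (V z))\<^sup>2)"
      have "(\<integral>\<^sup>+z. ennreal (norm (P (\<theta>, z))) \<partial>lborel) \<le> ennreal \<bar>signed_indicator 0 h \<theta>\<bar> * ennreal A" for \<theta>
      proof -
        have i: "integrable lborel (\<lambda>z. (norm (j (z + (0, \<theta>))))\<^sup>2 + (norm (V z))\<^sup>2)"
          using jt2 V2 by (intro Bochner_Integration.integrable_add)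
        have "(\<integral>\<^sup>+z. ennreal (norm (P (\<theta>, z))) \<partial>lborel)
            \<le> (\<integral>\<^sup>+z. ennreal \<bar>signed_indicator 0 h \<theta>\<bar> * ennreal ((norm (j (z + (0, \<theta>))))\<^sup>2 + (norm (V z))\<^sup>2) \<partial>lborel)"
        proof (rule nn_integral_mono)
          fix z
          have "\<bar>j (z + (0, \<theta>)) \<bullet> V z\<bar> \<le> norm (j (z + (0, \<theta>))) * norm (V z)"
            by (rule Cauchy_Schwarz_ineq2)
          also have "\<dots> \<le> (norm (j (z + (0, \<theta>))))\<^sup>2 + (norm (V z))\<^sup>2"
            using sum_squares_bound[of "norm (j (z + (0, \<theta>)))" "norm (V z)"]
              mult_nonneg_nonneg[OF norm_ge_zero[of "j (z + (0, \<theta>))"] norm_ge_zero[of "V z"]] by linarith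
          finally have "norm (P (\<theta>, z)) \<le> \<bar>signed_indicator 0 h \<theta>\<bar> * ((norm (j (z + (0, \<theta>))))\<^sup>2 + (norm (V z))\<^sup>2)"
            unfolding P_def real_norm_def abs_mult fst_conv snd_conv by (intro mult_left_mono) auto
          then show "ennreal (norm (P (\<theta>, z))) \<le> ennreal \<bar>signed_indicator 0 h \<theta>\<bar> * ennreal ((norm (j (z + (0, \<theta>))))\<^sup>2 + (norm (V z))\<^sup>2)"
            by (subst ennreal_mult[symmetric]) (auto intro: ennreal_leI)
        qed
        also have "\<dots> = ennreal \<bar>signed_indicator 0 h \<theta>\<bar> * (\<integral>\<^sup>+z. ennreal ((norm (j (z + (0, \<theta>))))\<^sup>2 + (norm (V z))\<^sup>2) \<partial>lborel)"
          by (rule nn_integral_cmult) measurable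
        also have "(\<integral>\<^sup>+z. ennreal ((norm (j (z + (0, \<theta>))))\<^sup>2 + (norm (V z))\<^sup>2) \<partial>lborel)
            = ennreal (LINT z|lborel. (norm (j (z + (0, \<theta>))))\<^sup>2 + (norm (V z))\<^sup>2)"
          by (rule nn_integral_eq_integral[OF i]) auto
        also have "(LINT z|lborel. (norm (j (z + (0, \<theta>))))\<^sup>2 + (norm (V z))\<^sup>2) = A"
          using jt2 V2 integral_lborel_translate[of "\<lambda>z. (norm (j z))\<^sup>2" "(0, \<theta>)"] by (simp add: A_def)
        finally show ?thesis .
      qed
      then have "(\<integral>\<^sup>+\<theta>. (\<integral>\<^sup>+z. ennreal (norm (P (\<theta>, z))) \<partial>lborel) \<partial>lborel) \<le> (\<integral>\<^sup>+\<theta>. ennreal \<bar>signed_indicator 0 h \<theta>\<bar> * ennreal A \<partial>lborel)"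
        by (intro nn_integral_mono)
      also have "\<dots> = (\<integral>\<^sup>+\<theta>. ennreal \<bar>signed_indicator 0 h \<theta>\<bar> \<partial>lborel) * ennreal A"
        by (rule nn_integral_multc) measurable
      also have "\<dots> < \<infinity>"
        using integral_signed_indicator(1)[of h] by (simp add: integrable_iff_bounded ennreal_mult_less_top)
      finally show "(\<integral>\<^sup>+p. ennreal (norm (P p)) \<partial>lborel) < \<infinity>"
        using lborel.nn_integral_fst[of "\<lambda>p. ennreal (norm (P p))" lborel] by (simp add: lborel_prod)
    qed measurable
    have P_int': "integrable (lborel \<Otimes>\<^sub>M lborel) P" using P_int by (simp add: lborel_prod)
    have hz_int: "integrable lborel (\<lambda>z. LINT \<theta>|lborel. P (\<theta>, z))"
      by (rule integral_lborel_prod_swapped(2)[OF P_int])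
    show "integrable lborel (\<lambda>\<theta>. signed_indicator 0 h \<theta> * C \<theta>)"
      using lborel_pair.integrable_fst'[OF P_int'] by (simp add: P_def C_def)
    define D where "D s = (LINT x|lborel. LINT \<theta>|lborel. P (\<theta>, (x, s)))" for s
    have "signed_indicator 0 h \<theta> * C \<theta> = (LINT z|lborel. P (\<theta>, z))" for \<theta>
      by (simp add: P_def C_def)
    then have "(LINT \<theta>|lborel. signed_indicator 0 h \<theta> * C \<theta>) = (LINT p|lborel. P p)"
      using lborel_pair.integral_fst'[OF P_int'] by (simp add: lborel_prod)
    also have "\<dots> = (LINT z|lborel. LINT \<theta>|lborel. P (\<theta>, z))"
      by (rule integral_lborel_prod_swapped(1)[OF P_int])
    also have "\<dots> = (LINT s|lborel. D s)"
      unfolding D_def by (rule integral_lborel_prod_swapped(1)[OF hz_int])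
    also have "\<dots> \<le> Q h"
      unfolding Q_def
    proof (rule integral_mono_AE[OF _ Q_int])
      show "integrable lborel D"
        unfolding D_def by (rule integral_lborel_prod_swapped(2)[OF hz_int])
      have "AE s in lborel. s \<noteq> 0 \<and> s \<noteq> \<tau>"
        by (intro AE_conjI AE_lborel_singleton)
      with E_increment show "AE s in lborel. D s \<le> (e (s + h) - e s) * indicator {0..\<tau>} s"
      proof eventually_elim
        case (elim s)
        show ?case
        proof (cases "s \<in> {0<..<\<tau>}")
          case False
          then have "s \<notin> {0..\<tau>}" using elim by auto
          moreover have "D s = 0"
            using False by (simp add: D_def P_def V_def)
          ultimately show ?thesis by simp
        next
          case True
          then have s: "s \<in> {0<..<T}" using \<tau> by auto
          have cls: "cl s = s" using True by (auto simp: cl_def)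
          \<comment> \<open>Clamping the end time and truncating the flux have the same effect: each
            removes the times outside \<open>{0<..<\<tau>}\<close>.\<close>
          have kap: "signed_indicator s (cl (s + h)) r *\<^sub>R J (x, r) = signed_indicator s (s + h) r *\<^sub>R j (x, r)" for r x
            using True by (auto simp: signed_indicator_def j_def indicator_def cl_def)
          have fl: "flux s (cl (s + h)) x = (LINT \<theta>|lborel. signed_indicator 0 h \<theta> *\<^sub>R j (x, s + \<theta>))" for x
          proof -
            have "flux s (cl (s + h)) x = (LINT r|lborel. signed_indicator s (s + h) r *\<^sub>R j (x, r))"
              by (simp add: flux_def kap)
            also have "\<dots> = (LINT \<theta>|lborel. signed_indicator s (s + h) (s + \<theta>) *\<^sub>R j (x, s + \<theta>))"
              using lborel_integral_real_affine[of 1 "\<lambda>r. signed_indicator s (s + h) r *\<^sub>R j (x, r)" s] by simp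
            finally show ?thesis by (simp only: signed_indicator_translate)
          qed
          have js: "AE x in lborel. integrable lborel (\<lambda>r. j (x, r))"
            by (rule integral_lborel_prod_swapped(4)[OF j_int])
          have "D s = (LINT x|lborel. flux s (cl (s + h)) x \<bullet> V (x, s))"
            unfolding D_def
          proof (rule integral_cong_AE)
            show "AE x in lborel. (LINT \<theta>|lborel. P (\<theta>, (x, s))) = flux s (cl (s + h)) x \<bullet> V (x, s)"
              using js
            proof eventually_elim
              case (elim x)
              have "integrable lborel (\<lambda>\<theta>. j (x, s + \<theta>))"
                using lborel_integrable_real_affine[OF elim, of 1 s] by simp
              then have "integrable lborel (\<lambda>\<theta>. signed_indicator 0 h \<theta> *\<^sub>R j (x, s + \<theta>))"
                by (rule Bochner_Integration.integrable_bound)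
                   (use signed_indicator_le in \<open>auto intro!: AE_I2 mult_left_le_one_le\<close>)
              then show ?case
                unfolding fl P_def
                using integral_inner_left[of "V (x, s)" lborel "\<lambda>\<theta>. signed_indicator 0 h \<theta> *\<^sub>R j (x, s + \<theta>)"]
                by simp
            qed
          qed measurable
          also have "\<dots> = (LINT x|lborel. flux s (cl (s + h)) x \<bullet> (F' (sqrt (c (x, s))) *\<^sub>R G (x, s)))"
            using True by (simp add: V_def)
          also have "\<dots> \<le> E (cl (s + h)) - E s"
            using elim s cl(1) by blast
          finally show ?thesis
            using True by (simp add: e_def cls)
        qed
      qed
    qed
    finally show "(LINT \<theta>|lborel. signed_indicator 0 h \<theta> * C \<theta>) \<le> Q h" .
  qed
  have Q_lower: "\<exists>d>0. \<forall>h. \<bar>h\<bar> < d \<longrightarrow> h * C 0 - \<eta> * \<bar>h\<bar> \<le> Q h" if \<eta>: "\<eta> > 0" for \<eta>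
  proof -
    obtain d where d: "d > 0" "\<And>\<theta>. \<bar>\<theta>\<bar> < d \<Longrightarrow> \<bar>C \<theta> - C 0\<bar> \<le> \<eta>"
      using C_cont[OF \<eta>] by blast
    have "h * C 0 - \<eta> * \<bar>h\<bar> \<le> Q h" if h: "\<bar>h\<bar> < d" for h
    proof -
      note si = integral_signed_indicator[of h]
      have "h * C 0 - \<eta> * \<bar>h\<bar> = (LINT \<theta>|lborel. signed_indicator 0 h \<theta> * C 0 - \<bar>signed_indicator 0 h \<theta>\<bar> * \<eta>)"
        using si by (simp add: mult.commute)
      also have "\<dots> \<le> (LINT \<theta>|lborel. signed_indicator 0 h \<theta> * C \<theta>)"
      proof (rule integral_mono[OF _ Q_ge(1)])
        show "integrable lborel (\<lambda>\<theta>. signed_indicator 0 h \<theta> * C 0 - \<bar>signed_indicator 0 h \<theta>\<bar> * \<eta>)"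
          using si by (intro Bochner_Integration.integrable_diff integrable_mult_left) auto
        fix \<theta>
        show "signed_indicator 0 h \<theta> * C 0 - \<bar>signed_indicator 0 h \<theta>\<bar> * \<eta> \<le> signed_indicator 0 h \<theta> * C \<theta>"
        proof (cases "\<bar>\<theta>\<bar> < d")
          case True
          have "\<bar>signed_indicator 0 h \<theta> * (C \<theta> - C 0)\<bar> \<le> \<bar>signed_indicator 0 h \<theta>\<bar> * \<eta>"
            unfolding abs_mult by (intro mult_left_mono d(2)[OF True]) auto
          then show ?thesis by (simp add: right_diff_distrib abs_le_iff)
        next
          case False
          then have "signed_indicator 0 h \<theta> = 0" using h by (auto simp: signed_indicator_def indicator_def)
          then show ?thesis by simp
        qed
      qed
      also have "\<dots> \<le> Q h" by (rule Q_ge(2))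
      finally show ?thesis .
    qed
    then show ?thesis using d(1) by blast
  qed
  have Q_lim: "((\<lambda>h. Q h / h) \<longlongrightarrow> E \<tau> - E 0) (at 0)"
  proof -
    \<comment> \<open>With an antiderivative \<open>p\<close> of \<open>e\<close>, the integral
      \<open>Q h\<close> is the change of \<open>p\<close> at \<open>\<tau>\<close> minus its change
      at \<open>0\<close>, so \<open>Q h / h\<close> tends to \<open>e \<tau> - e 0\<close>. The
      margin 1 leaves room for both signs of \<open>h\<close>.\<close>
    obtain p where p: "\<And>x. x \<in> {-1..\<tau>+1} \<Longrightarrow> (p has_vector_derivative e x) (at x within {-1..\<tau>+1})"
      using antiderivative_continuous[of "-1" "\<tau> + 1" e] continuous_on_subset[OF e_cont] by blast
    have pd: "(p has_real_derivative e x) (at x)" if "x \<in> {-1<..<\<tau>+1}" for x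
    proof -
      have "at x within {-1..\<tau>+1} = at x"
        using that by (intro at_within_interior) auto
      then show ?thesis using p[of x] that by (simp add: has_real_derivative_iff_has_vector_derivative)
    qed
    have Q_eq: "Q h = (p (\<tau> + h) - p \<tau>) - (p (0 + h) - p 0)" if h: "\<bar>h\<bar> < 1" for h
    proof -
      have "Q h = (p (\<tau> + h) - p \<tau>) - (p (0 + h) - p 0)"
        unfolding Q_def
      proof (rule integral_FTC_Icc_real)
        show "0 \<le> \<tau>" using \<tau> by simp
        fix x assume x: "0 \<le> x" "x \<le> \<tau>"
        have "x + h \<in> {-1<..<\<tau>+1}"
          using x h by (auto simp: abs_less_iff)
        from pd[OF this] have "((\<lambda>x. p (x + h)) has_real_derivative e (x + h)) (at x)"
          by (simp add: DERIV_shift)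
        then show "((\<lambda>x. p (x + h) - p x) has_real_derivative e (x + h) - e x) (at x)"
          using pd[of x] x by (intro DERIV_diff) auto
        show "isCont (\<lambda>s. e (s + h) - e s) x"
        proof -
          have "isCont e x" "isCont e (x + h)" using e_cont by (simp_all add: continuous_on_eq_continuous_at)
          moreover have "isCont (\<lambda>s. s + h) x" by simp
          ultimately have "isCont (\<lambda>s. e (s + h)) x"
            using isCont_o2[of x "\<lambda>s. s + h" e] by blast
          with \<open>isCont e x\<close> show ?thesis by (intro continuous_diff)
        qed
      qed
      then show ?thesis .
    qed
    have "((\<lambda>h. (p (\<tau> + h) - p \<tau>) / h - (p (0 + h) - p 0) / h) \<longlongrightarrow> e \<tau> - e 0) (at 0)"
      by (intro tendsto_diff) (use pd[of \<tau>] pd[of 0] \<tau> in \<open>auto simp: DERIV_def\<close>)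
    moreover have "\<forall>\<^sub>F h in at 0. (p (\<tau> + h) - p \<tau>) / h - (p (0 + h) - p 0) / h = Q h / h"
      unfolding eventually_at by (rule exI[of _ 1]) (simp add: Q_eq diff_divide_distrib)
    ultimately have "((\<lambda>h. Q h / h) \<longlongrightarrow> e \<tau> - e 0) (at 0)"
      by (rule Lim_transform_eventually)
    then show ?thesis using \<tau> by (simp add: e_def cl_def)
  qed
  have "\<bar>(E \<tau> - E 0) - C 0\<bar> \<le> \<eta>" if \<eta>: "\<eta> > 0" for \<eta>
  proof -
    obtain d where d: "d > 0" "\<And>h. \<bar>h\<bar> < d \<Longrightarrow> h * C 0 - \<eta> * \<bar>h\<bar> \<le> Q h"
      using Q_lower[OF \<eta>] by blast
    have "((\<lambda>h. Q h / h) \<longlongrightarrow> E \<tau> - E 0) (at_right 0)" "((\<lambda>h. Q h / h) \<longlongrightarrow> E \<tau> - E 0) (at_left 0)"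
      using Q_lim by (auto intro: tendsto_mono[OF at_le])
    moreover have "\<forall>\<^sub>F h in at_right 0. C 0 - \<eta> \<le> Q h / h"
      unfolding eventually_at_right_field
    proof (intro exI[of _ d] conjI allI impI)
      fix h assume "0 < h" "h < d"
      then show "C 0 - \<eta> \<le> Q h / h"
        using d(2)[of h] by (subst pos_le_divide_eq) (auto simp: algebra_simps)
    qed (rule d(1))
    moreover have "\<forall>\<^sub>F h in at_left 0. Q h / h \<le> C 0 + \<eta>"
      unfolding eventually_at_left_field
    proof (intro exI[of _ "- d"] conjI allI impI)
      fix h assume "- d < h" "h < 0"
      then show "Q h / h \<le> C 0 + \<eta>"
        using d(2)[of h] by (subst neg_divide_le_eq) (auto simp: algebra_simps)
    qed (use d(1) in simp)
    ultimately have "C 0 - \<eta> \<le> E \<tau> - E 0" "E \<tau> - E 0 \<le> C 0 + \<eta>"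
      by (auto intro: tendsto_lowerbound tendsto_upperbound)
    then show ?thesis by (simp add: abs_le_iff)
  qed
  then have "\<bar>(E \<tau> - E 0) - C 0\<bar> \<le> 0"
    by (rule field_le_epsilon) simp
  then show "E \<tau> - E 0 = (LINT z|lborel. indicator {0<..<\<tau>} (snd z) * (J z \<bullet> (F' (sqrt (c z)) *\<^sub>R G z)))"
    using C0 by simp
qed

end

section \<open>Removing the regularisation\<close>

lemma AE_lborel_prod_swapped:
  fixes N :: "('a::euclidean_space \<times> 'b::euclidean_space) set"
  assumes N: "N \<in> sets borel" and ae: "AE y in lborel. AE x in lborel. (x, y) \<notin> N"
  shows "AE z in lborel. z \<notin> N"
proof -
  have N': "N \<in> sets (lborel \<Otimes>\<^sub>M lborel)" using N by (simp only: lborel_prod sets_lborel)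
  have "AE x in lborel. AE y in lborel. (x, y) \<notin> N"
  proof (rule lborel_pair.AE_commute[where P = "\<lambda>x y. (x, y) \<notin> N", THEN iffD2])
    have "{x \<in> space (lborel \<Otimes>\<^sub>M lborel). (fst x, snd x) \<notin> N} = space (lborel \<Otimes>\<^sub>M lborel) - N"
      by auto
    then show "{x \<in> space (lborel \<Otimes>\<^sub>M lborel). (fst x, snd x) \<notin> N} \<in> sets (lborel \<Otimes>\<^sub>M lborel)"
      using N' by (simp only: sets.compl_sets)
  qed (fact ae)
  then have "AE z in lborel \<Otimes>\<^sub>M lborel. z \<notin> N"
  proof (rule lborel_pair.AE_pair_measure[rotated])
    have "{x \<in> space (lborel \<Otimes>\<^sub>M lborel). x \<notin> N} = space (lborel \<Otimes>\<^sub>M lborel) - N"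
      by auto
    then show "{x \<in> space (lborel \<Otimes>\<^sub>M lborel). x \<notin> N} \<in> sets (lborel \<Otimes>\<^sub>M lborel)"
      using N' by (simp only: sets.compl_sets)
  qed
  then show ?thesis by (simp only: lborel_prod)
qed

text \<open>The primitive of \<open>ln (s + \<delta>)\<close>, normalised so that
  \<open>\<delta> = 0\<close> gives \<open>s * (ln s - 1)\<close>.\<close>

definition regularized_entropy :: "real \<Rightarrow> real \<Rightarrow> real" where
  "regularized_entropy \<delta> s = (s + \<delta>) * ln (s + \<delta>) - s"

text \<open>From \<open>ln x \<le> x - 1\<close> at the quotient
  \<open>(a + \<delta>) / (b + \<delta>)\<close>.\<close>

lemma regularized_entropy_convex:
  assumes "\<delta> > 0" "a \<ge> 0" "b \<ge> 0"
  shows "ln (a + \<delta>) * (b - a) \<le> regularized_entropy \<delta> b - regularized_entropy \<delta> a"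
proof -
  have p: "a + \<delta> > 0" "b + \<delta> > 0" using assms by auto
  have "ln ((a + \<delta>) / (b + \<delta>)) \<le> (a + \<delta>) / (b + \<delta>) - 1"
    using p by (intro ln_le_minus_one) simp
  then have "(b + \<delta>) * (ln (a + \<delta>) - ln (b + \<delta>)) \<le> (b + \<delta>) * ((a + \<delta>) / (b + \<delta>) - 1)"
    using p by (intro mult_left_mono) (auto simp: ln_div)
  also have "\<dots> = a - b"
    using p by (simp add: field_simps)
  finally show ?thesis
    by (simp add: regularized_entropy_def algebra_simps)
qed

text \<open>The tangent inequality in both directions bounds the slope by values of
  \<open>ln (s + \<delta>)\<close>. The constant blows up as \<open>\<delta>\<close> tends to 0 and
  serves at fixed \<open>\<delta>\<close> only.\<close>

lemma regularized_entropy_lipschitz: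
  assumes "\<delta> > 0" "a \<in> {0..1}" "b \<in> {0..1}"
  shows "\<bar>regularized_entropy \<delta> b - regularized_entropy \<delta> a\<bar> \<le> (\<bar>ln \<delta>\<bar> + \<bar>ln (1 + \<delta>)\<bar>) * \<bar>b - a\<bar>"
proof -
  have K: "\<bar>ln (s + \<delta>)\<bar> \<le> \<bar>ln \<delta>\<bar> + \<bar>ln (1 + \<delta>)\<bar>" if "s \<in> {0..1}" for s
  proof -
    have "ln \<delta> \<le> ln (s + \<delta>)" "ln (s + \<delta>) \<le> ln (1 + \<delta>)"
      using that assms by (auto intro: ln_mono)
    then show ?thesis by linarith
  qed
  have "\<bar>ln (s + \<delta>) * (b - a)\<bar> \<le> (\<bar>ln \<delta>\<bar> + \<bar>ln (1 + \<delta>)\<bar>) * \<bar>b - a\<bar>" if "s \<in> {0..1}" for s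
    unfolding abs_mult by (intro mult_right_mono K that) auto
  from this[OF assms(2)] this[OF assms(3)] show ?thesis
    using regularized_entropy_convex[of \<delta> a b] regularized_entropy_convex[of \<delta> b a] assms
    by (auto simp: abs_le_iff algebra_simps)
qed

text \<open>Apply \<open>ln y \<le> y - 1\<close> to \<open>1 / sqrt x\<close>. The result yields
  both the limit at 0 and a bound uniform in \<open>\<delta>\<close>.\<close>

lemma x_ln_x_bound:
  assumes "0 < x" "x \<le> 1"
  shows "\<bar>x * ln x\<bar> \<le> 2 * sqrt x"
proof -
  have "- ln (sqrt x) = ln (1 / sqrt x)"
    using assms by (simp add: ln_div)
  also have "\<dots> \<le> 1 / sqrt x - 1"
    using assms by (intro ln_le_minus_one) simp
  finally have "- ln x \<le> 2 * (1 / sqrt x)"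
    using assms by (simp add: ln_sqrt)
  then have "x * (- ln x) \<le> x * (2 * (1 / sqrt x))"
    using assms by (intro mult_left_mono) auto
  also have "\<dots> = 2 * sqrt x"
    using assms by (simp add: divide_eq_eq)
  finally have "- (x * ln x) \<le> 2 * sqrt x" by simp
  moreover have "x * ln x \<le> 0"
    using assms by (intro mult_nonneg_nonpos) auto
  ultimately show ?thesis by linarith
qed

text \<open>A majorant uniform in \<open>\<delta>\<close>: 2 for the logarithmic term with argument
  in \<open>{0<..2}\<close>, and 1 for the subtracted \<open>s\<close>.\<close>

lemma regularized_entropy_bound:
  assumes "0 < \<delta>" "\<delta> \<le> 1" "s \<in> {0..1}"
  shows "\<bar>regularized_entropy \<delta> s\<bar> \<le> 3"
proof -
  let ?x = "s + \<delta>"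
  have x: "0 < ?x" "?x \<le> 2" using assms by auto
  have "\<bar>?x * ln ?x\<bar> \<le> 2"
  proof (cases "?x \<le> 1")
    case True
    then have "\<bar>?x * ln ?x\<bar> \<le> 2 * sqrt ?x" using x by (intro x_ln_x_bound)
    also have "\<dots> \<le> 2" using True x by simp
    finally show ?thesis .
  next
    case False
    then have "ln ?x \<le> ?x - 1" "ln ?x \<ge> 0" using x by (auto intro: ln_le_minus_one)
    then have "?x * ln ?x \<le> 2 * 1" using x by (intro mult_mono) auto
    then show ?thesis using x \<open>ln ?x \<ge> 0\<close> by (simp add: abs_mult)
  qed
  then show ?thesis
    using assms unfolding regularized_entropy_def by (auto simp: abs_le_iff)
qed

lemma regularized_entropy_tendsto:
  assumes d: "\<And>n. 0 < d n" "\<And>n. d n \<le> 1" "d \<longlonglongrightarrow> 0" and s: "s \<ge> 0"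
  shows "(\<lambda>n. regularized_entropy (d n) s) \<longlonglongrightarrow> s * (ln s - 1)"
proof (cases "s = 0")
  case True
  have "(\<lambda>n. d n * ln (d n)) \<longlonglongrightarrow> 0"
  proof (rule Lim_null_comparison)
    show "\<forall>\<^sub>F n in sequentially. norm (d n * ln (d n)) \<le> 2 * sqrt (d n)"
      using x_ln_x_bound[OF d(1,2)] by simp
    show "(\<lambda>n. 2 * sqrt (d n)) \<longlonglongrightarrow> 0"
      using tendsto_mult_right_zero[OF tendsto_real_sqrt[OF d(3), simplified], of 2] by simp
  qed
  then show ?thesis by (simp add: True regularized_entropy_def)
next
  case False
  have "(\<lambda>n. (s + d n) * ln (s + d n) - s) \<longlonglongrightarrow> (s + 0) * ln (s + 0) - s"
    by (intro tendsto_intros d(3)) (use False s in auto)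
  then show ?thesis by (simp add: regularized_entropy_def algebra_simps)
qed

text \<open>At level \<open>\<delta>\<close> the integrand is \<open>2 * c / (c + \<delta>)\<close>
  times \<open>m \<bullet> G\<close>. The factor lies between 0 and 2 and tends to 2 where
  \<open>c > 0\<close>; where \<open>c = 0\<close> it is 0, and the limit integrand is 0 as well
  because \<open>G\<close> vanishes there.\<close>

lemma (in ms_species) entropy_identity:
  assumes m: "m \<in> borel_measurable borel" "integrable lborel (\<lambda>z. (norm (m z))\<^sup>2)"
    and Jm: "\<And>z. J z = sqrt (c z) *\<^sub>R m z" and \<tau>: "\<tau> \<in> {0<..T}"
  shows "(LINT x|lborel. indicator \<Omega> x * (v \<tau> x * (ln (v \<tau> x) - 1))) - (LINT x|lborel. indicator \<Omega> x * (v 0 x * (ln (v 0 x) - 1)))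
     = (LINT z|lborel. indicator {0<..<\<tau>} (snd z) * (2 * (m z \<bullet> G z)))"
proof -
  note [measurable] = m(1)
  define d where "d n = 1 / real (Suc n)" for n
  have d: "d n > 0" "d n \<le> 1" for n by (auto simp: d_def)
  have d0: "d \<longlonglongrightarrow> 0"
    unfolding d_def using LIMSEQ_inverse_real_of_nat by (simp add: inverse_eq_divide)
  define E where "E n t = (LINT x|lborel. indicator \<Omega> x * regularized_entropy (d n) (v t x))" for n t
  define R where "R n z = indicator {0<..<\<tau>} (snd z) * (J z \<bullet> ((2 * sqrt (c z) / ((sqrt (c z))\<^sup>2 + d n)) *\<^sub>R G z))" for n z
  have bal: "E n \<tau> - E n 0 = (LINT z|lborel. R n z)" for n
  proof -
    interpret P: ms_entropy_pair \<Omega> T c J G v "\<lambda>s. ln (s\<^sup>2 + d n)" "\<lambda>s. 2 * s / (s\<^sup>2 + d n)"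
      "regularized_entropy (d n)" "\<bar>ln (d n)\<bar> + \<bar>ln (1 + d n)\<bar>"
    proof
      have pos: "s\<^sup>2 + d n > 0" for s by (intro add_nonneg_pos d) auto
      show "((\<lambda>s. ln (s\<^sup>2 + d n)) has_real_derivative 2 * s / (s\<^sup>2 + d n)) (at s)" for s
        using pos[of s] by (auto intro!: derivative_eq_intros)
      have "s\<^sup>2 + d n \<noteq> 0" for s using pos[of s] by simp
      then show "continuous_on UNIV (\<lambda>s. 2 * s / (s\<^sup>2 + d n))"
        by (intro continuous_intros) auto
      show "regularized_entropy (d n) \<in> borel_measurable borel"
        unfolding regularized_entropy_def[abs_def] by measurable
      show "ln ((sqrt a)\<^sup>2 + d n) * (b - a) \<le> regularized_entropy (d n) b - regularized_entropy (d n) a"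
        if "a \<in> {0..1}" "b \<in> {0..1}" for a b
        using regularized_entropy_convex[OF d(1), of a b] that by simp
    qed (rule regularized_entropy_lipschitz[OF d(1)])
    show ?thesis
      using P.entropy_balance(2)[OF \<tau>] by (simp only: E_def P.E_def R_def)
  qed
  have limE: "(\<lambda>n. E n t) \<longlonglongrightarrow> (LINT x|lborel. indicator \<Omega> x * (v t x * (ln (v t x) - 1)))" if t: "t \<in> {0..T}" for t
    unfolding E_def
  proof (rule integral_dominated_convergence[where w = "\<lambda>x. indicator \<Omega> x * 3"])
    note [measurable] = v(1)[OF t]
    show "(\<lambda>x. indicator \<Omega> x * (v t x * (ln (v t x) - 1))) \<in> borel_measurable lborel" by measurable
    show "(\<lambda>x. indicator \<Omega> x * regularized_entropy (d n) (v t x)) \<in> borel_measurable lborel" for n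
      unfolding regularized_entropy_def by measurable
    show "integrable lborel (\<lambda>x. indicator \<Omega> x * 3 :: real)"
      by (rule integrable_bounded_support[OF _ domain(2) domain_borel, of _ 3]) auto
    show "AE x in lborel. norm (indicator \<Omega> x * regularized_entropy (d n) (v t x)) \<le> indicator \<Omega> x * 3" for n
      using regularized_entropy_bound[OF d] v(2,3)[OF t] by (auto simp: indicator_def)
    show "AE x in lborel. (\<lambda>n. indicator \<Omega> x * regularized_entropy (d n) (v t x)) \<longlonglongrightarrow> indicator \<Omega> x * (v t x * (ln (v t x) - 1))"
      by (intro AE_I2 tendsto_mult tendsto_const regularized_entropy_tendsto d d0 v(2)[OF t])
  qed
  \<comment> \<open>The vanishing is known slice by slice in time; the Borel set \<open>N\<close> of
    bad points makes it a statement almost everywhere in space-time.\<close>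
  have G0: "AE z in lborel. c z = 0 \<longrightarrow> G z = 0"
  proof -
    define N where "N = {z. c z = 0 \<and> G z \<noteq> 0}"
    have "N \<in> sets borel" unfolding N_def by measurable
    moreover have "AE t in lborel. AE x in lborel. (x, t) \<notin> N"
      using wG integral_lborel_prod_swapped(3)[OF G(2)]
    proof eventually_elim
      case (elim t)
      show ?case
      proof (cases "t \<in> {0<..<T}")
        case True
        have "AE x in lborel. x \<in> \<Omega> \<and> sqrt (c (x, t)) = 0 \<longrightarrow> G (x, t) = 0"
        proof (rule weak_gradient_zero_on_zero_set[OF domain])
          show "integrable lborel (\<lambda>x. sqrt (c (x, t)))"
            by (rule integrable_bounded_support[OF _ domain(2) domain_borel, of _ 1])
               (use c in \<open>auto simp: real_sqrt_le_1_iff\<close>)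
          show "integrable lborel (\<lambda>x. G (x, t))"
            by (rule integrable_L2_bounded_support[OF _ domain(2) domain_borel]) (use G(3) elim in auto)
        qed (use c elim True in auto)
        then show ?thesis
        proof eventually_elim
          case (elim x)
          then show ?case using G(3)[of "(x, t)"] by (auto simp: N_def)
        qed
      qed (use G(3) in \<open>auto simp: N_def\<close>)
    qed
    ultimately have "AE z in lborel. z \<notin> N" by (rule AE_lborel_prod_swapped)
    then show ?thesis by eventually_elim (auto simp: N_def)
  qed
  have limR: "(\<lambda>n. LINT z|lborel. R n z) \<longlonglongrightarrow> (LINT z|lborel. indicator {0<..<\<tau>} (snd z) * (2 * (m z \<bullet> G z)))"
  proof (rule integral_dominated_convergence[where w = "\<lambda>z. 2 * (norm (m z) * norm (G z))"])
    show "(\<lambda>z. indicator {0<..<\<tau>} (snd z) * (2 * (m z \<bullet> G z))) \<in> borel_measurable lborel" by measurable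
    show "R n \<in> borel_measurable lborel" for n unfolding R_def[abs_def] by measurable
    show "integrable lborel (\<lambda>z. 2 * (norm (m z) * norm (G z)))"
      by (intro integrable_mult_right integrable_inner_L2(1)) (use m G in auto)
    have Req: "R n z = indicator {0<..<\<tau>} (snd z) * (2 * (c z / (c z + d n)) * (m z \<bullet> G z))" for n z
    proof -
      have "sqrt (c z) * (2 * sqrt (c z) / (c z + d n)) = 2 * (c z / (c z + d n))"
        using c(2)[of z] by simp
      moreover have "(sqrt (c z) *\<^sub>R m z) \<bullet> ((2 * sqrt (c z) / (c z + d n)) *\<^sub>R G z)
          = (sqrt (c z) * (2 * sqrt (c z) / (c z + d n))) * (m z \<bullet> G z)"
        by (simp only: inner_scaleR_left inner_scaleR_right mult_ac)
      ultimately have "(sqrt (c z) *\<^sub>R m z) \<bullet> ((2 * sqrt (c z) / (c z + d n)) *\<^sub>R G z) = 2 * (c z / (c z + d n)) * (m z \<bullet> G z)"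
        by (simp only:)
      then show ?thesis
        unfolding R_def Jm using c(2)[of z] by simp
    qed
    show "AE z in lborel. norm (R n z) \<le> 2 * (norm (m z) * norm (G z))" for n
    proof (rule AE_I2)
      fix z
      have "\<bar>2 * r * (m z \<bullet> G z)\<bar> \<le> 2 * (norm (m z) * norm (G z))" if "0 \<le> r" "r \<le> 1" for r
      proof -
        have "\<bar>2 * r\<bar> * \<bar>m z \<bullet> G z\<bar> \<le> 2 * (norm (m z) * norm (G z))"
          using that by (intro mult_mono Cauchy_Schwarz_ineq2) auto
        then show ?thesis by (simp only: abs_mult)
      qed
      moreover have "0 \<le> c z / (c z + d n)" "c z / (c z + d n) \<le> 1"
        using c(2)[of z] d(1)[of n] by (auto simp: divide_le_eq_1)
      ultimately have "\<bar>2 * (c z / (c z + d n)) * (m z \<bullet> G z)\<bar> \<le> 2 * (norm (m z) * norm (G z))"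
        by blast
      then show "norm (R n z) \<le> 2 * (norm (m z) * norm (G z))"
        unfolding Req by (auto simp: indicator_def)
    qed
    show "AE z in lborel. (\<lambda>n. R n z) \<longlonglongrightarrow> indicator {0<..<\<tau>} (snd z) * (2 * (m z \<bullet> G z))"
      using G0
    proof eventually_elim
      case (elim z)
      show ?case
      proof (cases "c z = 0")
        case True
        then show ?thesis using elim by (simp add: Req)
      next
        case False
        have "(\<lambda>n. c z / (c z + d n)) \<longlonglongrightarrow> c z / (c z + 0)"
          by (intro tendsto_intros d0) (use False in simp)
        then have "(\<lambda>n. c z / (c z + d n)) \<longlonglongrightarrow> 1" using False by simp
        from tendsto_mult[OF tendsto_const[of "indicator {0<..<\<tau>} (snd z)"]
            tendsto_mult[OF tendsto_mult[OF tendsto_const[of 2] this] tendsto_const[of "m z \<bullet> G z"]]]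
        show ?thesis unfolding Req by simp
      qed
    qed
  qed
  have "0 \<in> {0..T}" "\<tau> \<in> {0..T}" using \<tau> by auto
  then have "(\<lambda>n. E n \<tau> - E n 0) \<longlonglongrightarrow>
     (LINT x|lborel. indicator \<Omega> x * (v \<tau> x * (ln (v \<tau> x) - 1))) - (LINT x|lborel. indicator \<Omega> x * (v 0 x * (ln (v 0 x) - 1)))"
    by (intro tendsto_diff limE)
  then show ?thesis
    unfolding bal using limR LIMSEQ_unique by blast
qed

section \<open>Borel representatives\<close>

text \<open>Completeness of Lebesgue measure carries measurability across null sets. This is the
  bridge from the Lebesgue integrals of the definitions to Borel functions on the whole space, to
  which Fubini and translations apply.\<close>

lemma lebesgue_on_transfer:
  fixes f f' :: "'a::euclidean_space \<Rightarrow> 'b::euclidean_space"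
  assumes U: "U \<in> sets borel" and f': "f' \<in> borel_measurable borel"
    and ae: "AE x in lborel. x \<in> U \<longrightarrow> f x = f' x"
  shows "integrable (lebesgue_on U) f \<longleftrightarrow> integrable lborel (\<lambda>x. indicator U x *\<^sub>R f' x)"
    and "(LINT x|lebesgue_on U. f x) = (LINT x|lborel. indicator U x *\<^sub>R f' x)"
    and "f \<in> borel_measurable (lebesgue_on U)"
proof -
  have Ul: "U \<inter> space lebesgue \<in> sets lebesgue"
    using U by simp
  have mb: "(\<lambda>x. indicator U x *\<^sub>R f' x) \<in> borel_measurable borel"
    using U f' by measurable
  then have m': "(\<lambda>x. indicator U x *\<^sub>R f' x) \<in> borel_measurable lebesgue"
    by (intro measurable_completion) simp
  have ae': "AE x in lebesgue. indicator U x *\<^sub>R f' x = indicator U x *\<^sub>R f x"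
    using ae by (intro AE_completion) (auto elim!: eventually_mono simp: indicator_def)
  have m: "(\<lambda>x. indicator U x *\<^sub>R f x) \<in> borel_measurable lebesgue"
    by (rule borel_measurable_AE[OF m' ae'])
  show "f \<in> borel_measurable (lebesgue_on U)"
    using m by (simp add: borel_measurable_restrict_space_iff[OF Ul])
  have "integrable (lebesgue_on U) f \<longleftrightarrow> integrable lebesgue (\<lambda>x. indicator U x *\<^sub>R f x)"
    by (rule integrable_restrict_space[OF Ul])
  also have "\<dots> \<longleftrightarrow> integrable lebesgue (\<lambda>x. indicator U x *\<^sub>R f' x)"
    using ae' by (intro integrable_cong_AE m m') (auto elim!: eventually_mono)
  also have "\<dots> \<longleftrightarrow> integrable lborel (\<lambda>x. indicator U x *\<^sub>R f' x)"
    using mb by (intro integrable_completion) simp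
  finally show "integrable (lebesgue_on U) f \<longleftrightarrow> integrable lborel (\<lambda>x. indicator U x *\<^sub>R f' x)" .
  have "(LINT x|lebesgue_on U. f x) = (LINT x|lebesgue. indicator U x *\<^sub>R f x)"
    by (rule integral_restrict_space[OF Ul])
  also have "\<dots> = (LINT x|lebesgue. indicator U x *\<^sub>R f' x)"
    using ae' by (intro integral_cong_AE m m') (auto elim!: eventually_mono)
  also have "\<dots> = (LINT x|lborel. indicator U x *\<^sub>R f' x)"
    using mb by (intro integral_completion) simp
  finally show "(LINT x|lebesgue_on U. f x) = (LINT x|lborel. indicator U x *\<^sub>R f' x)" .
qed

lemma AE_lebesgue_on_iff:
  "U \<in> sets borel \<Longrightarrow> (AE x in lebesgue_on U. P x) \<longleftrightarrow> (AE x in lborel. x \<in> U \<longrightarrow> P x)"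
  by (subst AE_restrict_space_iff) (auto simp: AE_completion_iff)

lemma borel_representative:
  fixes f :: "'a::euclidean_space \<Rightarrow> real"
  assumes "U \<in> sets borel" "f \<in> borel_measurable (lebesgue_on U)"
  obtains f' where "f' \<in> borel_measurable borel" "AE x in lborel. x \<in> U \<longrightarrow> f x = f' x"
proof -
  have "(\<lambda>x. indicator U x *\<^sub>R f x) \<in> borel_measurable lebesgue"
    using assms by (subst borel_measurable_restrict_space_iff[symmetric]) auto
  then obtain f' where f': "f' \<in> borel_measurable lborel" "AE x in lborel. indicator U x *\<^sub>R f x = f' x"
    using completion_ex_borel_measurable_real by blast
  have "AE x in lborel. x \<in> U \<longrightarrow> f x = f' x"
    using f'(2) by eventually_elim auto
  then show ?thesis using that f'(1) by simp
qed

lemma borel_measurable_vec_lambda [measurable (raw)]: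
  fixes f :: "'a \<Rightarrow> 'n::finite \<Rightarrow> real"
  assumes "\<And>k. (\<lambda>x. f x k) \<in> borel_measurable M"
  shows "(\<lambda>x. \<chi> k. f x k) \<in> borel_measurable M"
proof (rule borel_measurable_euclidean_space[THEN iffD2], rule ballI)
  fix b :: "real^'n" assume "b \<in> Basis"
  then obtain k where "b = axis k 1" by (auto simp: Basis_vec_def)
  then show "(\<lambda>x. (\<chi> k. f x k) \<bullet> b) \<in> borel_measurable M"
    using assms by (simp add: inner_axis)
qed

lemma borel_representative_vec:
  fixes f :: "'a::euclidean_space \<Rightarrow> real^'n"
  assumes "U \<in> sets borel" and f: "\<And>k. (\<lambda>x. f x $ k) \<in> borel_measurable (lebesgue_on U)"
  obtains f' where "f' \<in> borel_measurable borel" "AE x in lborel. x \<in> U \<longrightarrow> f x = f' x"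
proof -
  have "\<exists>f'. f' \<in> borel_measurable borel \<and> (AE x in lborel. x \<in> U \<longrightarrow> f x $ k = f' x)" for k
    using borel_representative[OF assms(1) f, of k] by blast
  then obtain g where g: "\<And>k. g k \<in> borel_measurable borel" "\<And>k. AE x in lborel. x \<in> U \<longrightarrow> f x $ k = g k x"
    by metis
  show ?thesis
  proof
    show "(\<lambda>x. \<chi> k. g k x) \<in> borel_measurable borel"
      using g(1) by measurable
    have "AE x in lborel. \<forall>k. x \<in> U \<longrightarrow> f x $ k = g k x"
      unfolding AE_all_countable using g(2) ..
    then show "AE x in lborel. x \<in> U \<longrightarrow> f x = (\<chi> k. g k x)"
      by eventually_elim (simp add: vec_eq_iff)
  qed
qed

section \<open>Weak gradients and Borel representatives\<close>

lemma test_function_derivative_measurable: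
  "Ck (Suc 0) \<phi> \<Longrightarrow> (\<lambda>x. frechet_derivative \<phi> (at x) b) \<in> borel_measurable borel"
  by (rule borel_measurable_continuous_onI[OF Ck1_continuous_derivative])

lemma weak_gradient_imp_wgrad:
  assumes \<Omega>: "open \<Omega>" and wg: "weak_gradient \<Omega> u g"
    and [measurable]: "u' \<in> borel_measurable borel" "g' \<in> borel_measurable borel"
    and z: "\<And>x. x \<notin> \<Omega> \<Longrightarrow> u' x = 0" "\<And>x. x \<notin> \<Omega> \<Longrightarrow> g' x = 0"
    and ae: "AE x in lborel. x \<in> \<Omega> \<longrightarrow> u x = u' x" "AE x in lborel. x \<in> \<Omega> \<longrightarrow> g x = g' x"
  shows "wgrad \<Omega> u' g'"
  unfolding wgrad_def
proof (intro ballI allI)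
  fix \<phi> k assume \<phi>: "\<phi> \<in> test_functions \<Omega>"
  obtain S where S: "compact S" "\<And>k. Ck k \<phi>"
    using \<phi> by (rule test_functionsD) blast
  have [measurable]: "\<phi> \<in> borel_measurable borel" "(\<lambda>x. frechet_derivative \<phi> (at x) (axis k 1)) \<in> borel_measurable borel"
    using borel_measurable_Ck[OF S(2)[of 0]] test_function_derivative_measurable[OF S(2)] by auto
  have Ub: "\<Omega> \<in> sets borel" using \<Omega> by auto
  have ind: "indicator \<Omega> x *\<^sub>R (u' x * frechet_derivative \<phi> (at x) (axis k 1)) = u' x * frechet_derivative \<phi> (at x) (axis k 1)"
    "indicator \<Omega> x *\<^sub>R (g' x $ k * \<phi> x) = g' x $ k * \<phi> x" for x
    by (cases "x \<in> \<Omega>"; simp add: z)+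
  have "(LINT x|lebesgue_on \<Omega>. u x * frechet_derivative \<phi> (at x) (axis k 1))
      = (LINT x|lborel. indicator \<Omega> x *\<^sub>R (u' x * frechet_derivative \<phi> (at x) (axis k 1)))"
    by (rule lebesgue_on_transfer(2)[OF Ub]) (use ae(1) in \<open>auto elim!: eventually_mono\<close>)
  moreover have "(LINT x|lebesgue_on \<Omega>. g x $ k * \<phi> x) = (LINT x|lborel. indicator \<Omega> x *\<^sub>R (g' x $ k * \<phi> x))"
    by (rule lebesgue_on_transfer(2)[OF Ub]) (use ae(2) in \<open>auto elim!: eventually_mono\<close>)
  moreover have "(LINT x|lebesgue_on \<Omega>. u x * frechet_derivative \<phi> (at x) (axis k 1)) = - (LINT x|lebesgue_on \<Omega>. g x $ k * \<phi> x)"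
    using wg \<phi> unfolding weak_gradient_def by blast
  ultimately show "(LINT x|lborel. u' x * frechet_derivative \<phi> (at x) (axis k 1)) = - (LINT x|lborel. g' x $ k * \<phi> x)"
    by (simp only: ind)
qed

text \<open>Exhaust \<open>\<Omega>\<close> by compact sets; on each of them integrability includes
  measurability.\<close>

lemma locally_integrable_measurable:
  fixes g :: "real^3 \<Rightarrow> 'b::euclidean_space"
  assumes \<Omega>: "open \<Omega>" and g: "locally_integrable \<Omega> g"
  shows "g \<in> borel_measurable (lebesgue_on \<Omega>)"
proof -
  obtain C where C: "\<And>n. compact (C n)" "\<And>n. C n \<subseteq> \<Omega>" "\<And>n. C n \<subseteq> interior (C (Suc n))" "\<Union>(range C) = \<Omega>"
    by (rule open_Union_compact_subsets[OF \<Omega>]) blast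
  have "(\<lambda>x. indicator \<Omega> x *\<^sub>R g x) \<in> borel_measurable lebesgue"
  proof (rule borel_measurable_LIMSEQ_metric)
    show "(\<lambda>x. indicator (C n) x *\<^sub>R g x) \<in> borel_measurable lebesgue" for n
      using g C(1,2)[of n] unfolding locally_integrable_def set_integrable_def by auto
    fix x
    show "(\<lambda>n. indicator (C n) x *\<^sub>R g x) \<longlonglongrightarrow> indicator \<Omega> x *\<^sub>R g x"
    proof (cases "x \<in> \<Omega>")
      case True
      then obtain N where "x \<in> C N" using C(4) by blast
      have "incseq C"
        using C(3) interior_subset by (intro incseq_SucI) blast
      then have "x \<in> C n" if "n \<ge> N" for n
        using \<open>x \<in> C N\<close> that by (auto simp: incseq_def)
      then have "\<forall>\<^sub>F n in sequentially. indicator (C n) x *\<^sub>R g x = indicator \<Omega> x *\<^sub>R g x"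
        using True by (auto simp: eventually_sequentially intro!: exI[of _ N])
      then show ?thesis by (rule tendsto_eventually)
    next
      case False
      then have "x \<notin> C n" for n using C(2) by blast
      then show ?thesis using False by simp
    qed
  qed
  then show ?thesis
    using \<Omega> by (subst borel_measurable_restrict_space_iff) auto
qed

text \<open>Component by component, the difference of Borel representatives is annihilated by all
  test functions, so the fundamental lemma applies.\<close>

lemma weak_gradient_unique:
  assumes \<Omega>: "open \<Omega>" and g: "weak_gradient \<Omega> u g" and h: "weak_gradient \<Omega> u h"
  shows "AE x in lborel. x \<in> \<Omega> \<longrightarrow> g x = h x"
proof -
  have Ub: "\<Omega> \<in> sets borel" using \<Omega> by auto
  have gm: "g \<in> borel_measurable (lebesgue_on \<Omega>)" and hm: "h \<in> borel_measurable (lebesgue_on \<Omega>)"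
    using g h by (auto simp: weak_gradient_def intro: locally_integrable_measurable[OF \<Omega>])
  obtain g' where g': "g' \<in> borel_measurable borel" "AE x in lborel. x \<in> \<Omega> \<longrightarrow> g x = g' x"
    by (rule borel_representative_vec[OF Ub borel_measurable_vec_nth[OF gm]]) blast
  obtain h' where h': "h' \<in> borel_measurable borel" "AE x in lborel. x \<in> \<Omega> \<longrightarrow> h x = h' x"
    by (rule borel_representative_vec[OF Ub borel_measurable_vec_nth[OF hm]]) blast
  note [measurable] = g'(1) h'(1)
  have loc: "integrable lborel (\<lambda>x. indicator K x *\<^sub>R f' x)"
    if "locally_integrable \<Omega> f" "f' \<in> borel_measurable borel" "AE x in lborel. x \<in> \<Omega> \<longrightarrow> f x = f' x" "compact K" "K \<subseteq> \<Omega>"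
    for f f' :: "real^3 \<Rightarrow> real^3" and K
  proof -
    have "K \<in> sets borel" using that by (auto intro: borel_compact)
    moreover have "AE x in lborel. x \<in> K \<longrightarrow> f x = f' x"
      using that(3) by eventually_elim (use that in auto)
    moreover have "integrable (lebesgue_on K) f"
      using that \<open>K \<in> sets borel\<close> unfolding locally_integrable_def set_integrable_def
      by (subst integrable_restrict_space) auto
    ultimately show ?thesis
      using lebesgue_on_transfer(1)[of K f' f] that(2) by blast
  qed
  have "AE x in lborel. x \<in> \<Omega> \<longrightarrow> g' x $ k - h' x $ k = 0" for k
  proof (rule fundamental_lemma_of_calculus_of_variations[OF \<Omega>])
    have i: "integrable lborel (\<lambda>x. indicator K x * (g' x $ k))" "integrable lborel (\<lambda>x. indicator K x * (h' x $ k))"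
      if K: "compact K" "K \<subseteq> \<Omega>" for K
    proof -
      have "integrable lborel (\<lambda>x. indicator K x *\<^sub>R g' x)" "integrable lborel (\<lambda>x. indicator K x *\<^sub>R h' x)"
        using loc[OF _ g' K] loc[OF _ h' K] g h by (auto simp: weak_gradient_def)
      from integrable_bounded_linear[OF bounded_linear_vec_nth[of k] this(1)] integrable_bounded_linear[OF bounded_linear_vec_nth[of k] this(2)]
      show "integrable lborel (\<lambda>x. indicator K x * (g' x $ k))" "integrable lborel (\<lambda>x. indicator K x * (h' x $ k))"
        by simp_all
    qed
    show "integrable lborel (\<lambda>x. indicator K x * (g' x $ k - h' x $ k))" if K: "compact K" "K \<subseteq> \<Omega>" for K
      using Bochner_Integration.integrable_diff[OF i[OF K]] by (simp add: right_diff_distrib)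
    fix \<phi> assume \<phi>: "\<phi> \<in> test_functions \<Omega>"
    obtain S where S: "compact S" "S \<subseteq> \<Omega>" "\<And>x. x \<notin> S \<Longrightarrow> \<phi> x = 0" "\<And>k. Ck k \<phi>"
      using \<phi> by (rule test_functionsD) blast
    have cont: "continuous_on UNIV \<phi>" using S(4)[of 0] by simp
    have [measurable]: "\<phi> \<in> borel_measurable borel" using borel_measurable_Ck[OF S(4)[of 0]] .
    obtain M where M: "M \<ge> 0" "\<And>x. \<bar>\<phi> x\<bar> \<le> M"
      using continuous_compact_support_bounded[OF cont S(1,3)] by metis
    have j: "integrable lborel (\<lambda>x. f x $ k * \<phi> x)"
      if "integrable lborel (\<lambda>x. indicator S x * (f x $ k))" "f \<in> borel_measurable borel" for f :: "real^3 \<Rightarrow> real^3"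
    proof (rule Bochner_Integration.integrable_bound[OF integrable_mult_left[OF that(1), of M]])
      note [measurable] = that(2)
      show "(\<lambda>x. f x $ k * \<phi> x) \<in> borel_measurable lborel" by measurable
      have "\<bar>f x $ k * \<phi> x\<bar> \<le> \<bar>indicator S x * (f x $ k) * M\<bar>" for x
        using M(1) M(2)[of x] S(3)[of x] by (auto simp: indicator_def abs_mult mult_left_mono)
      then show "AE x in lborel. norm (f x $ k * \<phi> x) \<le> norm (indicator S x * (f x $ k) * M)"
        by simp
    qed
    have eqn: "(LINT x|lebesgue_on \<Omega>. f x $ k * \<phi> x) = (LINT x|lborel. f' x $ k * \<phi> x)"
      if [measurable]: "f' \<in> borel_measurable borel" and "AE x in lborel. x \<in> \<Omega> \<longrightarrow> f x = f' x" for f f' :: "real^3 \<Rightarrow> real^3"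
    proof -
      have "(LINT x|lebesgue_on \<Omega>. f x $ k * \<phi> x) = (LINT x|lborel. indicator \<Omega> x *\<^sub>R (f' x $ k * \<phi> x))"
        by (rule lebesgue_on_transfer(2)[OF Ub]) (use that(2) in \<open>auto elim!: eventually_mono\<close>)
      moreover have "indicator \<Omega> x *\<^sub>R (f' x $ k * \<phi> x) = f' x $ k * \<phi> x" for x
        using S(2) S(3)[of x] by (auto simp: indicator_def)
      ultimately show ?thesis by (simp only:)
    qed
    have "(LINT x|lebesgue_on \<Omega>. u x * frechet_derivative \<phi> (at x) (axis k 1)) = - (LINT x|lebesgue_on \<Omega>. f x $ k * \<phi> x)"
      if "weak_gradient \<Omega> u f" for f
      using that \<phi> unfolding weak_gradient_def by blast
    from this[OF g] this[OF h]
    have "(LINT x|lebesgue_on \<Omega>. g x $ k * \<phi> x) = (LINT x|lebesgue_on \<Omega>. h x $ k * \<phi> x)"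
      by linarith
    then have "(LINT x|lborel. g' x $ k * \<phi> x) = (LINT x|lborel. h' x $ k * \<phi> x)"
      by (simp only: eqn[OF g'] eqn[OF h'])
    then show "(LINT x|lborel. (g' x $ k - h' x $ k) * \<phi> x) = 0"
      using j[OF i(1)[OF S(1,2)] g'(1)] j[OF i(2)[OF S(1,2)] h'(1)] by (simp add: left_diff_distrib)
  qed measurable
  then have "AE x in lborel. \<forall>k. x \<in> \<Omega> \<longrightarrow> g' x $ k - h' x $ k = 0"
    unfolding AE_all_countable ..
  with g'(2) h'(2) show ?thesis
    by eventually_elim (simp add: vec_eq_iff)
qed

text \<open>\<open>H1_norm\<close> refers to a gradient chosen by \<open>SOME\<close>; uniqueness identifies it with \<open>g\<close>.\<close>

lemma H1_gradient_bound:
  assumes \<Omega>: "open \<Omega>" and u: "u \<in> H1 \<Omega>" and g: "weak_gradient \<Omega> u g"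
    and g': "g' \<in> borel_measurable borel" "AE x in lborel. x \<in> \<Omega> \<longrightarrow> g x = g' x" "\<And>x. x \<notin> \<Omega> \<Longrightarrow> g' x = 0"
  shows "(\<integral>\<^sup>+x. ennreal ((norm (g' x))\<^sup>2) \<partial>lborel) \<le> ennreal ((H1_norm \<Omega> u)\<^sup>2)"
proof -
  have Ub: "\<Omega> \<in> sets borel" using \<Omega> by auto
  define g0 where "g0 = (SOME g. weak_gradient \<Omega> u g)"
  have g0: "weak_gradient \<Omega> u g0" unfolding g0_def by (rule someI[of "weak_gradient \<Omega> u", OF g])
  \<comment> \<open>Membership in \<open>H1\<close> gives square integrability of some gradient, and
    uniqueness passes it on to \<open>g'\<close>. Otherwise the integral in the norm could be a
    default 0 and bound nothing.\<close>
  obtain g1 where g1: "weak_gradient \<Omega> u g1" "\<And>k. (\<lambda>x. g1 x $ k) \<in> L2 \<Omega>"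
    using u by (auto simp: H1_def)
  have "AE x in lborel. x \<in> \<Omega> \<longrightarrow> g1 x = g' x"
    using weak_gradient_unique[OF \<Omega> g1(1) g] g'(2) by eventually_elim auto
  have eq0: "AE x in lborel. x \<in> \<Omega> \<longrightarrow> g0 x = g' x"
    using weak_gradient_unique[OF \<Omega> g0 g] g'(2) by eventually_elim auto
  note [measurable] = g'(1)
  have ind: "indicator \<Omega> x *\<^sub>R (norm (g' x))\<^sup>2 = (norm (g' x))\<^sup>2" for x
    using g'(3)[of x] by (auto simp: indicator_def)
  have ind1: "indicator \<Omega> x *\<^sub>R (g' x $ k)\<^sup>2 = (g' x $ k)\<^sup>2" for x k
    using g'(3)[of x] by (auto simp: indicator_def)
  have "integrable lborel (\<lambda>x. (g' x $ k)\<^sup>2)" for k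
  proof -
    have "integrable (lebesgue_on \<Omega>) (\<lambda>x. (g1 x $ k)\<^sup>2)"
      using g1(2)[of k] by (simp add: L2_def)
    moreover have "AE x in lborel. x \<in> \<Omega> \<longrightarrow> (g1 x $ k)\<^sup>2 = (g' x $ k)\<^sup>2"
      using \<open>AE x in lborel. x \<in> \<Omega> \<longrightarrow> g1 x = g' x\<close> by eventually_elim auto
    ultimately have "integrable lborel (\<lambda>x. indicator \<Omega> x *\<^sub>R (g' x $ k)\<^sup>2)"
      by (subst (asm) lebesgue_on_transfer(1)[OF Ub, of "\<lambda>x. (g' x $ k)\<^sup>2"]) auto
    then show ?thesis by (simp only: ind1)
  qed
  then have "integrable lborel (\<lambda>x. \<Sum>k\<in>UNIV. (g' x $ k)\<^sup>2)"
    by (intro Bochner_Integration.integrable_sum)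
  moreover have nrm: "(norm v)\<^sup>2 = (\<Sum>k\<in>UNIV. (v $ k)\<^sup>2)" for v :: "real^3"
    unfolding power2_norm_eq_inner inner_vec_def by (simp add: power2_eq_square)
  ultimately have int: "integrable lborel (\<lambda>x. (norm (g' x))\<^sup>2)"
    by simp
  have "(LINT x|lebesgue_on \<Omega>. (norm (g0 x))\<^sup>2) = (LINT x|lborel. indicator \<Omega> x *\<^sub>R (norm (g' x))\<^sup>2)"
    by (rule lebesgue_on_transfer(2)[OF Ub]) (use eq0 in \<open>auto elim!: eventually_mono\<close>)
  then have n: "(LINT x|lebesgue_on \<Omega>. (norm (g0 x))\<^sup>2) = (LINT x|lborel. (norm (g' x))\<^sup>2)"
    by (simp only: ind)
  have "(H1_norm \<Omega> u)\<^sup>2 = (LINT x|lebesgue_on \<Omega>. (u x)\<^sup>2) + (LINT x|lebesgue_on \<Omega>. (norm (g0 x))\<^sup>2)"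
    unfolding H1_norm_def g0_def[symmetric] by (intro real_sqrt_pow2 add_nonneg_nonneg) auto
  then have "(LINT x|lborel. (norm (g' x))\<^sup>2) \<le> (H1_norm \<Omega> u)\<^sup>2"
    unfolding n by simp
  then show ?thesis
    using int by (subst nn_integral_eq_integral) (auto intro: ennreal_leI)
qed

section \<open>Values of continuous representatives at every time\<close>

lemma exists_nearby_of_AE:
  fixes t T :: real
  assumes ae: "AE s in lborel. s \<in> {0<..<T} \<longrightarrow> P s" and t: "t \<in> {0..T}" and T: "T > 0" and "d > 0"
  obtains s where "s \<in> {0<..<T}" "P s" "\<bar>s - t\<bar> < d" "s \<noteq> t"
proof -
  let ?I = "{max 0 (t - d)<..<min T (t + d)}"
  have ne: "max 0 (t - d) < min T (t + d)" using t T \<open>d > 0\<close> by auto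
  have "\<exists>s\<in>?I. P s \<and> s \<noteq> t"
  proof (rule ccontr)
    assume "\<not> ?thesis"
    then have n: "s \<in> ?I \<Longrightarrow> P s \<Longrightarrow> s = t" for s by blast
    have "AE s in lborel. s \<notin> ?I"
      using ae AE_lborel_singleton[of t] by eventually_elim (use n in auto)
    then have "emeasure lborel ?I = 0"
      by (subst (asm) AE_iff_null_sets[symmetric]) (auto simp: null_sets_def)
    moreover have "emeasure lborel ?I = ennreal (min T (t + d) - max 0 (t - d))"
      using ne by (intro emeasure_lborel_Ioo) simp
    ultimately have "min T (t + d) - max 0 (t - d) \<le> 0"
      by (simp only: ennreal_eq_0_iff)
    then show False using ne by linarith
  qed
  then obtain s where "s \<in> ?I" "P s" "s \<noteq> t" by blast
  then show ?thesis by (intro that[of s]) auto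
qed

lemma L2_diff_square:
  assumes "f \<in> L2 U" "g \<in> L2 U"
  shows "(\<lambda>x. f x - g x) \<in> L2 U"
    and "(LINT x|lebesgue_on U. (f x - g x)\<^sup>2) = (L2_norm U (\<lambda>x. f x - g x))\<^sup>2"
proof -
  have [measurable]: "f \<in> borel_measurable (lebesgue_on U)" "g \<in> borel_measurable (lebesgue_on U)"
    using assms by (auto simp: L2_def)
  have i: "integrable (lebesgue_on U) (\<lambda>x. 2 * (f x)\<^sup>2 + 2 * (g x)\<^sup>2)"
    using assms by (auto simp: L2_def)
  have "(f x - g x)\<^sup>2 \<le> 2 * (f x)\<^sup>2 + 2 * (g x)\<^sup>2" for x
    using zero_le_power2[of "f x + g x"] by (simp add: power2_diff power2_sum)
  then have "integrable (lebesgue_on U) (\<lambda>x. (f x - g x)\<^sup>2)"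
    by (intro Bochner_Integration.integrable_bound[OF i]) auto
  then show "(\<lambda>x. f x - g x) \<in> L2 U"
    by (simp add: L2_def)
  show "(LINT x|lebesgue_on U. (f x - g x)\<^sup>2) = (L2_norm U (\<lambda>x. f x - g x))\<^sup>2"
    by (simp add: L2_norm_def)
qed

text \<open>Both curves are continuous in \<open>L^2\<close> and the times of agreement are dense,
  so their distance at \<open>t\<close> is below every \<open>\<eta>\<close>. The lemma compares a
  representative with the one carrying the initial value, and with its own truncation.\<close>

lemma C_L2_unique:
  assumes v: "v \<in> C_L2 \<Omega> T" and w: "w \<in> C_L2 \<Omega> T" and T: "T > 0"
    and ae: "AE s in lborel. s \<in> {0<..<T} \<longrightarrow> (AE x in lebesgue_on \<Omega>. v s x = w s x)" and t: "t \<in> {0..T}"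
  shows "AE x in lebesgue_on \<Omega>. v t x = w t x"
proof -
  let ?M = "lebesgue_on \<Omega>"
  have vL: "v s \<in> L2 \<Omega>" and wL: "w s \<in> L2 \<Omega>" if "s \<in> {0..T}" for s
    using v w that by (auto simp: C_L2_def)
  have le: "(LINT x|?M. (v t x - w t x)\<^sup>2) \<le> \<eta>" if \<eta>: "\<eta> > 0" for \<eta>
  proof -
    have "((\<lambda>s. 2 * (L2_norm \<Omega> (\<lambda>x. v s x - v t x))\<^sup>2 + 2 * (L2_norm \<Omega> (\<lambda>x. w s x - w t x))\<^sup>2) \<longlongrightarrow> 2 * 0\<^sup>2 + 2 * 0\<^sup>2) (at t within {0..T})"
      using v w t by (intro tendsto_intros) (auto simp: C_L2_def)
    then have "\<forall>\<^sub>F s in at t within {0..T}. 2 * (L2_norm \<Omega> (\<lambda>x. v s x - v t x))\<^sup>2 + 2 * (L2_norm \<Omega> (\<lambda>x. w s x - w t x))\<^sup>2 < \<eta>"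
      using \<eta> by (intro order_tendstoD(2)) auto
    then obtain d where d: "d > 0" "\<And>s. s \<in> {0..T} \<Longrightarrow> s \<noteq> t \<Longrightarrow> dist s t < d \<Longrightarrow>
        2 * (L2_norm \<Omega> (\<lambda>x. v s x - v t x))\<^sup>2 + 2 * (L2_norm \<Omega> (\<lambda>x. w s x - w t x))\<^sup>2 < \<eta>"
      unfolding eventually_at by blast
    obtain s where s: "s \<in> {0<..<T}" "AE x in ?M. v s x = w s x" "\<bar>s - t\<bar> < d" "s \<noteq> t"
      by (rule exists_nearby_of_AE[OF ae t T d(1)])
    have s': "s \<in> {0..T}" using s by auto
    note vs = L2_diff_square[OF vL[OF s'] vL[OF t]] and ws = L2_diff_square[OF wL[OF s'] wL[OF t]]
      and vw = L2_diff_square[OF vL[OF t] wL[OF t]]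
    have "(LINT x|?M. (v t x - w t x)\<^sup>2) \<le> (LINT x|?M. 2 * (v s x - v t x)\<^sup>2 + 2 * (w s x - w t x)\<^sup>2)"
    proof (rule integral_mono_AE)
      show "integrable ?M (\<lambda>x. (v t x - w t x)\<^sup>2)" using vw(1) by (simp add: L2_def)
      show "integrable ?M (\<lambda>x. 2 * (v s x - v t x)\<^sup>2 + 2 * (w s x - w t x)\<^sup>2)"
        using vs(1) ws(1) by (simp add: L2_def)
      show "AE x in ?M. (v t x - w t x)\<^sup>2 \<le> 2 * (v s x - v t x)\<^sup>2 + 2 * (w s x - w t x)\<^sup>2"
        using s(2)
      proof eventually_elim
        case (elim x)
        have "(a - b)\<^sup>2 \<le> 2 * a\<^sup>2 + 2 * b\<^sup>2" for a b :: real
          using zero_le_power2[of "a + b"] by (simp add: power2_diff power2_sum)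
        from this[of "w s x - w t x" "v s x - v t x"] show ?case
          by (simp add: elim)
      qed
    qed
    also have "\<dots> = 2 * (L2_norm \<Omega> (\<lambda>x. v s x - v t x))\<^sup>2 + 2 * (L2_norm \<Omega> (\<lambda>x. w s x - w t x))\<^sup>2"
      using vs ws by (simp add: L2_def)
    also have "\<dots> \<le> \<eta>"
      using d(2)[OF s' s(4)] s(3) by (simp add: dist_real_def)
    finally show ?thesis .
  qed
  have i: "integrable ?M (\<lambda>x. (v t x - w t x)\<^sup>2)"
    using L2_diff_square(1)[OF vL[OF t] wL[OF t]] by (simp add: L2_def)
  have "(LINT x|?M. (v t x - w t x)\<^sup>2) \<le> 0"
    by (rule field_le_epsilon) (use le in simp)
  then have "(LINT x|?M. (v t x - w t x)\<^sup>2) = 0"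
    by (intro antisym) auto
  then have "AE x in ?M. (v t x - w t x)\<^sup>2 = 0"
    using integral_nonneg_eq_0_iff_AE[OF i] by auto
  then show ?thesis by eventually_elim simp
qed

text \<open>Truncation is a contraction of the line, hence of \<open>L^2\<close>.\<close>

lemma C_L2_clip:
  assumes v: "v \<in> C_L2 \<Omega> T"
  shows "(\<lambda>t x. max 0 (min 1 (v t x))) \<in> C_L2 \<Omega> T"
proof -
  define q where "q y = max 0 (min 1 y)" for y :: real
  have q: "\<bar>q a - q b\<bar> \<le> \<bar>a - b\<bar>" for a b by (auto simp: q_def)
  have qL: "(\<lambda>x. q (v t x)) \<in> L2 \<Omega>" if t: "t \<in> {0..T}" for t
  proof -
    have vt: "v t \<in> borel_measurable (lebesgue_on \<Omega>)" "integrable (lebesgue_on \<Omega>) (\<lambda>x. (v t x)\<^sup>2)"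
      using v t by (auto simp: C_L2_def L2_def)
    note [measurable] = vt(1)
    have "\<bar>q (v t x)\<bar> \<le> \<bar>v t x\<bar>" for x
      by (auto simp: q_def)
    then have "(q (v t x))\<^sup>2 \<le> (v t x)\<^sup>2" for x
      by (simp only: abs_le_square_iff)
    then show ?thesis
      unfolding L2_def by (auto simp: q_def intro: Bochner_Integration.integrable_bound[OF vt(2)])
  qed
  have le: "L2_norm \<Omega> (\<lambda>x. q (v t x) - q (v s x)) \<le> L2_norm \<Omega> (\<lambda>x. v t x - v s x)" if "t \<in> {0..T}" "s \<in> {0..T}" for s t
    unfolding L2_norm_def
  proof (intro real_sqrt_le_mono integral_mono)
    show "integrable (lebesgue_on \<Omega>) (\<lambda>x. (q (v t x) - q (v s x))\<^sup>2)"
      using L2_diff_square(1)[OF qL qL] that by (simp add: L2_def)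
    show "integrable (lebesgue_on \<Omega>) (\<lambda>x. (v t x - v s x)\<^sup>2)"
      using L2_diff_square(1)[of "v t" \<Omega> "v s"] v that by (auto simp: C_L2_def L2_def)
    show "(q (v t x) - q (v s x))\<^sup>2 \<le> (v t x - v s x)\<^sup>2" for x
      using q[of "v t x" "v s x"] by (simp add: abs_le_square_iff)
  qed
  have "((\<lambda>t. L2_norm \<Omega> (\<lambda>x. q (v t x) - q (v s x))) \<longlongrightarrow> 0) (at s within {0..T})" if s: "s \<in> {0..T}" for s
  proof (rule Lim_null_comparison)
    show "((\<lambda>t. L2_norm \<Omega> (\<lambda>x. v t x - v s x)) \<longlongrightarrow> 0) (at s within {0..T})"
      using v s by (simp add: C_L2_def)
    show "\<forall>\<^sub>F t in at s within {0..T}. norm (L2_norm \<Omega> (\<lambda>x. q (v t x) - q (v s x))) \<le> L2_norm \<Omega> (\<lambda>x. v t x - v s x)"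
      using le s by (auto simp: eventually_at_filter L2_norm_def)
  qed
  then show ?thesis
    using qL unfolding C_L2_def q_def by simp
qed

section \<open>The entropy identity\<close>

text \<open>The exceptional set is enclosed in a Borel null set before slicing, since
  \<open>P\<close> is arbitrary.\<close>

lemma AE_lborel_sections:
  fixes P :: "'a::euclidean_space \<times> 'b::euclidean_space \<Rightarrow> bool"
  assumes "AE z in lborel. P z"
  shows "AE y in lborel. AE x in lborel. P (x, y)"
proof -
  obtain N where N: "{z \<in> space lborel. \<not> P z} \<subseteq> N" "N \<in> sets lborel" "emeasure lborel N = 0"
    using assms by (rule AE_E)
  have N': "N \<in> sets (lborel \<Otimes>\<^sub>M lborel)" using N(2) by (simp only: lborel_prod)
  have "AE z in lborel. z \<notin> N"
    using N(2,3) by (intro AE_not_in) (auto simp: null_sets_def)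
  then have "AE z in lborel \<Otimes>\<^sub>M lborel. z \<notin> N" by (simp only: lborel_prod)
  from lborel_pair.AE_pair[OF this] have "AE x in lborel. AE y in lborel. (x, y) \<notin> N" .
  then have "AE y in lborel. AE x in lborel. (x, y) \<notin> N"
  proof (rule lborel_pair.AE_commute[where P = "\<lambda>x y. (x, y) \<notin> N", THEN iffD1, rotated])
    have "{x \<in> space (lborel \<Otimes>\<^sub>M lborel). (fst x, snd x) \<notin> N} = space (lborel \<Otimes>\<^sub>M lborel) - N"
      by auto
    then show "{x \<in> space (lborel \<Otimes>\<^sub>M lborel). (fst x, snd x) \<notin> N} \<in> sets (lborel \<Otimes>\<^sub>M lborel)"
      using N' by (simp only: sets.compl_sets)
  qed
  then show ?thesis
    by (rule eventually_mono) (rule eventually_mono, assumption, use N(1) in auto)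
qed

lemma L1_le_L2:
  fixes f :: "'a::euclidean_space \<Rightarrow> real"
  assumes [measurable]: "f \<in> borel_measurable borel" and U: "bounded U" "U \<in> sets borel"
    and z: "\<And>x. x \<notin> U \<Longrightarrow> f x = 0" and i2: "integrable lborel (\<lambda>x. (f x)\<^sup>2)"
  shows "(LINT x|lborel. \<bar>f x\<bar>) \<le> sqrt (measure lborel U) * sqrt (LINT x|lborel. (f x)\<^sup>2)"
proof -
  note [measurable] = U(2)
  have i1: "integrable lborel f"
    by (rule integrable_L2_bounded_support[OF _ U z]) (use i2 in auto)
  have fin: "emeasure lborel U < \<infinity>" by (rule emeasure_bounded_finite[OF U(1)])
  have "(\<integral>\<^sup>+x. indicator U x * ennreal \<bar>f x\<bar> \<partial>lborel)\<^sup>2 \<le> (\<integral>\<^sup>+x. (indicator U x)^2 \<partial>lborel) * (\<integral>\<^sup>+x. (ennreal \<bar>f x\<bar>)^2 \<partial>lborel)"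
    by (rule Cauchy_Schwarz_nn_integral) measurable
  also have "(\<integral>\<^sup>+x. (indicator U x :: ennreal)^2 \<partial>lborel) = (\<integral>\<^sup>+x. indicator U x \<partial>lborel)"
    by (intro nn_integral_cong) (auto simp: indicator_def)
  also have "\<dots> = ennreal (measure lborel U)"
    using fin U(2) by (simp add: emeasure_eq_ennreal_measure less_top)
  also have "(\<integral>\<^sup>+x. (ennreal \<bar>f x\<bar>)^2 \<partial>lborel) = (\<integral>\<^sup>+x. ennreal ((f x)\<^sup>2) \<partial>lborel)"
    by (intro nn_integral_cong) (simp add: ennreal_power)
  also have "\<dots> = ennreal (LINT x|lborel. (f x)\<^sup>2)"
    using i2 by (intro nn_integral_eq_integral) auto
  also have "(\<integral>\<^sup>+x. indicator U x * ennreal \<bar>f x\<bar> \<partial>lborel) = (\<integral>\<^sup>+x. ennreal \<bar>f x\<bar> \<partial>lborel)"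
    by (intro nn_integral_cong) (use z in \<open>auto simp: indicator_def\<close>)
  also have "\<dots> = ennreal (LINT x|lborel. \<bar>f x\<bar>)"
    using i1 by (intro nn_integral_eq_integral) auto
  finally have "ennreal ((LINT x|lborel. \<bar>f x\<bar>)\<^sup>2) \<le> ennreal (measure lborel U * (LINT x|lborel. (f x)\<^sup>2))"
    by (simp add: ennreal_power ennreal_mult)
  then have "(LINT x|lborel. \<bar>f x\<bar>)\<^sup>2 \<le> measure lborel U * (LINT x|lborel. (f x)\<^sup>2)"
    by (subst (asm) ennreal_le_iff) auto
  then have "sqrt ((LINT x|lborel. \<bar>f x\<bar>)\<^sup>2) \<le> sqrt (measure lborel U * (LINT x|lborel. (f x)\<^sup>2))"
    by (rule real_sqrt_le_mono)
  then show ?thesis by (simp add: real_sqrt_mult)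
qed

lemma weak_space_gradient_wgrad:
  assumes \<Omega>: "open \<Omega>" and G: "weak_space_gradient \<Omega> T u G"
    and m: "u' \<in> borel_measurable borel" "G' \<in> borel_measurable borel"
    and z: "\<And>z. z \<notin> \<Omega> \<times> {0<..<T} \<Longrightarrow> u' z = 0" "\<And>z. z \<notin> \<Omega> \<times> {0<..<T} \<Longrightarrow> G' z = 0"
    and ae: "AE z in lborel. z \<in> \<Omega> \<times> {0<..<T} \<longrightarrow> u z = u' z" "AE z in lborel. z \<in> \<Omega> \<times> {0<..<T} \<longrightarrow> G z = G' z"
  shows "AE t in lborel. t \<in> {0<..<T} \<longrightarrow> wgrad \<Omega> (\<lambda>x. u' (x, t)) (\<lambda>x. G' (x, t))"
proof -
  note [measurable] = m
  have "AE t in lborel. t \<in> {0<..<T} \<longrightarrow> weak_gradient \<Omega> (\<lambda>x. u (x, t)) (\<lambda>x. G (x, t))"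
    using G by (simp add: weak_space_gradient_def AE_lebesgue_on_iff)
  with AE_lborel_sections[OF ae(1)] AE_lborel_sections[OF ae(2)] show ?thesis
  proof eventually_elim
    case (elim t)
    show ?case
    proof
      assume t: "t \<in> {0<..<T}"
      show "wgrad \<Omega> (\<lambda>x. u' (x, t)) (\<lambda>x. G' (x, t))"
      proof (rule weak_gradient_imp_wgrad[OF \<Omega>])
        show "weak_gradient \<Omega> (\<lambda>x. u (x, t)) (\<lambda>x. G (x, t))" using elim t by blast
        show "AE x in lborel. x \<in> \<Omega> \<longrightarrow> u (x, t) = u' (x, t)" "AE x in lborel. x \<in> \<Omega> \<longrightarrow> G (x, t) = G' (x, t)"
          using elim t by auto
      qed (use z in auto)
    qed
  qed
qed

text \<open>On almost every time slice the square integral of the gradient is at most the squared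
  \<open>H1_norm\<close>, whose time integral is finite by membership in
  \<open>L2_H1\<close>.\<close>

lemma weak_space_gradient_L2:
  assumes \<Omega>: "open \<Omega>" and u: "u \<in> L2_H1 \<Omega> T" and G: "weak_space_gradient \<Omega> T u G"
    and m: "G' \<in> borel_measurable borel" and z: "\<And>z. z \<notin> \<Omega> \<times> {0<..<T} \<Longrightarrow> G' z = 0"
    and ae: "AE z in lborel. z \<in> \<Omega> \<times> {0<..<T} \<longrightarrow> G z = G' z"
  shows "integrable lborel (\<lambda>z. (norm (G' z))\<^sup>2)"
proof (rule integrableI_bounded)
  note [measurable] = m
  define N where "N t = (H1_norm \<Omega> (\<lambda>x. u (x, t)))\<^sup>2" for t
  have L2t: "(\<lambda>t x. u (x, t)) \<in> L2_time T (H1 \<Omega>) (H1_norm \<Omega>)"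
    using u by (simp add: L2_H1_def)
  have H: "AE t in lborel. t \<in> {0<..<T} \<longrightarrow> (\<lambda>x. u (x, t)) \<in> H1 \<Omega>"
    using L2t by (simp add: L2_time_def AE_lebesgue_on_iff)
  have Ni: "integrable (lebesgue_on {0<..<T}) N"
    using L2t by (simp add: L2_time_def N_def[abs_def])
  have W: "AE t in lborel. t \<in> {0<..<T} \<longrightarrow> weak_gradient \<Omega> (\<lambda>x. u (x, t)) (\<lambda>x. G (x, t))"
    using G by (simp add: weak_space_gradient_def AE_lebesgue_on_iff)
  have "(\<integral>\<^sup>+z. ennreal (norm ((norm (G' z))\<^sup>2)) \<partial>lborel) = (\<integral>\<^sup>+t. (\<integral>\<^sup>+x. ennreal ((norm (G' (x, t)))\<^sup>2) \<partial>lborel) \<partial>lborel)"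
    using lborel_pair.nn_integral_snd[of "\<lambda>z. ennreal ((norm (G' z))\<^sup>2)"] by (simp add: lborel_prod)
  also have "\<dots> \<le> (\<integral>\<^sup>+t. ennreal (N t) * indicator {0<..<T} t \<partial>lborel)"
  proof (rule nn_integral_mono_AE)
    show "AE t in lborel. (\<integral>\<^sup>+x. ennreal ((norm (G' (x, t)))\<^sup>2) \<partial>lborel) \<le> ennreal (N t) * indicator {0<..<T} t"
      using H W AE_lborel_sections[OF ae]
    proof eventually_elim
      case (elim t)
      show ?case
      proof (cases "t \<in> {0<..<T}")
        case True
        have "(\<integral>\<^sup>+x. ennreal ((norm (G' (x, t)))\<^sup>2) \<partial>lborel) \<le> ennreal (N t)"
          unfolding N_def
        proof (rule H1_gradient_bound[OF \<Omega>])
          show "(\<lambda>x. u (x, t)) \<in> H1 \<Omega>" "weak_gradient \<Omega> (\<lambda>x. u (x, t)) (\<lambda>x. G (x, t))"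
            using elim True by blast+
          show "AE x in lborel. x \<in> \<Omega> \<longrightarrow> G (x, t) = G' (x, t)" using elim True by auto
        qed (use z in auto)
        then show ?thesis using True by simp
      qed (use z in simp)
    qed
  qed
  \<comment> \<open>Measurability of \<open>N\<close> is available with respect to Lebesgue measure,
    hence the passage to the completion.\<close>
  also have "\<dots> = (\<integral>\<^sup>+t. ennreal (N t) * indicator {0<..<T} t \<partial>lebesgue)"
    by (rule nn_integral_completion[symmetric])
  also have "\<dots> = (\<integral>\<^sup>+t. ennreal (N t) \<partial>lebesgue_on {0<..<T})"
    by (rule nn_integral_restrict_space[symmetric]) auto
  also have "\<dots> < \<infinity>"
    using Ni by (simp add: integrable_iff_bounded N_def)
  finally show "(\<integral>\<^sup>+z. ennreal (norm ((norm (G' z))\<^sup>2)) \<partial>lborel) < \<infinity>" .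
qed (use m in measurable)

text \<open>A Borel version is chosen separately at each time. The range \<open>{0..1}\<close> is
  inherited from \<open>u'\<close> at almost every time and reaches every time by comparing
  \<open>w\<close> with its truncation.\<close>

lemma borel_continuous_representative:
  assumes \<Omega>: "open \<Omega>" "bounded \<Omega>" and T: "T > 0" and w: "continuous_representative \<Omega> T u w"
    and u': "AE z in lborel. z \<in> \<Omega> \<times> {0<..<T} \<longrightarrow> u z = u' z" "\<And>z. u' z \<in> {0..1}" "\<And>z. z \<notin> \<Omega> \<times> {0<..<T} \<Longrightarrow> u' z = 0"
  obtains v where "\<And>t. t \<in> {0..T} \<Longrightarrow> v t \<in> borel_measurable borel" "\<And>t x. t \<in> {0..T} \<Longrightarrow> 0 \<le> v t x"
      "\<And>t x. t \<in> {0..T} \<Longrightarrow> v t x \<le> 1" "\<And>t x. t \<in> {0..T} \<Longrightarrow> x \<notin> \<Omega> \<Longrightarrow> v t x = 0"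
      "\<And>s. s \<in> {0..T} \<Longrightarrow> ((\<lambda>t. LINT x|lborel. \<bar>v t x - v s x\<bar>) \<longlongrightarrow> 0) (at s within {0..T})"
      "AE t in lborel. t \<in> {0<..<T} \<longrightarrow> (AE x in lborel. v t x = u' (x, t))"
      "\<And>t. t \<in> {0..T} \<Longrightarrow> AE x in lborel. x \<in> \<Omega> \<longrightarrow> w t x = v t x"
proof -
  have Ub: "\<Omega> \<in> sets borel" using \<Omega> by auto
  have wC: "w \<in> C_L2 \<Omega> T" and wu: "AE t in lborel. t \<in> {0<..<T} \<longrightarrow> (AE x in lborel. x \<in> \<Omega> \<longrightarrow> w t x = u (x, t))"
    using w by (auto simp: continuous_representative_def AE_lebesgue_on_iff Ub)
  have wu': "AE t in lborel. t \<in> {0<..<T} \<longrightarrow> (AE x in lborel. x \<in> \<Omega> \<longrightarrow> w t x = u' (x, t))"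
    using wu AE_lborel_sections[OF u'(1)]
  proof eventually_elim
    case (elim t)
    show ?case
    proof
      assume t: "t \<in> {0<..<T}"
      then have "AE x in lborel. x \<in> \<Omega> \<longrightarrow> w t x = u (x, t)" using elim by blast
      with elim(2) show "AE x in lborel. x \<in> \<Omega> \<longrightarrow> w t x = u' (x, t)"
        by eventually_elim (use t in auto)
    qed
  qed
  define q where "q y = max 0 (min 1 y)" for y :: real
  have clip: "AE x in lborel. x \<in> \<Omega> \<longrightarrow> w t x = q (w t x)" if t: "t \<in> {0..T}" for t
  proof -
    have "AE s in lborel. s \<in> {0<..<T} \<longrightarrow> (AE x in lebesgue_on \<Omega>. w s x = q (w s x))"
      using wu'
    proof eventually_elim
      case (elim s)
      show ?case
      proof
        assume "s \<in> {0<..<T}"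
        with elim have "AE x in lborel. x \<in> \<Omega> \<longrightarrow> w s x = u' (x, s)" by blast
        then have "AE x in lborel. x \<in> \<Omega> \<longrightarrow> w s x = q (w s x)"
        proof eventually_elim
          case (elim x)
          show ?case using elim u'(2)[of "(x, s)"] by (auto simp: q_def)
        qed
        then show "AE x in lebesgue_on \<Omega>. w s x = q (w s x)"
          by (simp add: AE_lebesgue_on_iff[OF Ub])
      qed
    qed
    from C_L2_unique[OF wC C_L2_clip[OF wC, folded q_def] T this t] show ?thesis
      by (simp add: AE_lebesgue_on_iff[OF Ub])
  qed
  have "\<exists>f. f \<in> borel_measurable borel \<and> (AE x in lborel. x \<in> \<Omega> \<longrightarrow> w t x = f x)" if t: "t \<in> {0..T}" for t
  proof -
    have "w t \<in> borel_measurable (lebesgue_on \<Omega>)" using wC t by (auto simp: C_L2_def L2_def)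
    from borel_representative[OF Ub this] show ?thesis by blast
  qed
  then have "\<forall>t\<in>{0..T}. \<exists>f. f \<in> borel_measurable borel \<and> (AE x in lborel. x \<in> \<Omega> \<longrightarrow> w t x = f x)" ..
  from bchoice[OF this] obtain f where
    "\<forall>t\<in>{0..T}. f t \<in> borel_measurable borel \<and> (AE x in lborel. x \<in> \<Omega> \<longrightarrow> w t x = f t x)" ..
  then have f: "f t \<in> borel_measurable borel" "AE x in lborel. x \<in> \<Omega> \<longrightarrow> w t x = f t x" if "t \<in> {0..T}" for t
    using that by blast+
  define v where "v t x = indicator \<Omega> x * q (f t x)" for t x
  have vm: "v t \<in> borel_measurable borel" if t: "t \<in> {0..T}" for t
  proof -
    note [measurable] = f(1)[OF t] Ub
    show ?thesis unfolding v_def[abs_def] q_def by measurable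
  qed
  have v01: "0 \<le> v t x" "v t x \<le> 1" for t x
    by (auto simp: v_def q_def indicator_def)
  have v0: "v t x = 0" if "x \<notin> \<Omega>" for t x using that by (simp add: v_def)
  have wv: "AE x in lborel. x \<in> \<Omega> \<longrightarrow> w t x = v t x" if t: "t \<in> {0..T}" for t
    using clip[OF t] f(2)[OF t] by eventually_elim (auto simp: v_def)
  show ?thesis
  proof (rule that[of v])
    fix s assume s: "s \<in> {0..T}"
    show "((\<lambda>t. LINT x|lborel. \<bar>v t x - v s x\<bar>) \<longlongrightarrow> 0) (at s within {0..T})"
    proof (rule Lim_null_comparison)
      show "((\<lambda>t. sqrt (measure lborel \<Omega>) * L2_norm \<Omega> (\<lambda>x. w t x - w s x)) \<longlongrightarrow> 0) (at s within {0..T})"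
        using wC s by (intro tendsto_mult_right_zero) (simp add: C_L2_def)
      have "norm (LINT x|lborel. \<bar>v t x - v s x\<bar>) \<le> sqrt (measure lborel \<Omega>) * L2_norm \<Omega> (\<lambda>x. w t x - w s x)" if t: "t \<in> {0..T}" for t
      proof -
        note [measurable] = vm[OF t] vm[OF s]
        have i: "integrable lborel (\<lambda>x. (v t x - v s x)\<^sup>2)"
        proof (rule integrable_bounded_support[OF _ \<Omega>(2) Ub])
          show "norm ((v t x - v s x)\<^sup>2) \<le> 1" for x
            using v01[of t x] v01[of s x] by (simp add: abs_square_le_1 abs_le_iff)
        qed (auto simp: v0)
        have "(LINT x|lborel. \<bar>v t x - v s x\<bar>) \<le> sqrt (measure lborel \<Omega>) * sqrt (LINT x|lborel. (v t x - v s x)\<^sup>2)"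
          by (rule L1_le_L2[OF _ \<Omega>(2) Ub _ i]) (auto simp: v0)
        also have "(LINT x|lborel. (v t x - v s x)\<^sup>2) = (LINT x|lebesgue_on \<Omega>. (w t x - w s x)\<^sup>2)"
        proof -
          have "(LINT x|lebesgue_on \<Omega>. (w t x - w s x)\<^sup>2) = (LINT x|lborel. indicator \<Omega> x *\<^sub>R (v t x - v s x)\<^sup>2)"
          proof (rule lebesgue_on_transfer(2)[OF Ub])
            show "AE x in lborel. x \<in> \<Omega> \<longrightarrow> (w t x - w s x)\<^sup>2 = (v t x - v s x)\<^sup>2"
              using wv[OF t] wv[OF s] by eventually_elim auto
          qed measurable
          moreover have "indicator \<Omega> x *\<^sub>R (v t x - v s x)\<^sup>2 = (v t x - v s x)\<^sup>2" for x
            by (cases "x \<in> \<Omega>") (simp_all add: v0)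
          ultimately show ?thesis by (simp only:)
        qed
        finally show ?thesis by (simp add: L2_norm_def)
      qed
      then show "\<forall>\<^sub>F t in at s within {0..T}. norm (LINT x|lborel. \<bar>v t x - v s x\<bar>) \<le> sqrt (measure lborel \<Omega>) * L2_norm \<Omega> (\<lambda>x. w t x - w s x)"
        by (auto simp: eventually_at_filter)
    qed
  next
    show "AE t in lborel. t \<in> {0<..<T} \<longrightarrow> (AE x in lborel. v t x = u' (x, t))"
      using wu'
    proof eventually_elim
      case (elim t)
      show ?case
      proof
        assume t: "t \<in> {0<..<T}"
        then have "AE x in lborel. x \<in> \<Omega> \<longrightarrow> w t x = u' (x, t)" "t \<in> {0..T}" using elim by auto
        from this(1) wv[OF this(2)] show "AE x in lborel. v t x = u' (x, t)"
        proof eventually_elim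
          case (elim x)
          show ?case
            using elim u'(3)[of "(x, t)"] by (cases "x \<in> \<Omega>") (auto simp: v0)
        qed
      qed
    qed
  qed (use vm v01 v0 wv in auto)
qed

text \<open>The entropy at time \<open>t\<close> refers to values at that very time, hence to an
  arbitrary continuous representative \<open>c_rep\<close>. The balances of the single species are
  summed, and only the sum has a sign, through the quadratic form of the linear system.\<close>

theorem theorem2:
  fixes \<Omega> :: "(real^3) set" and T :: real
    and D :: "'n::finite \<Rightarrow> 'n \<Rightarrow> real"
    and c0 :: "'n \<Rightarrow> real^3 \<Rightarrow> real"
    and c :: "'n \<Rightarrow> (real^3) \<times> real \<Rightarrow> real"
    and m :: "'n \<Rightarrow> (real^3) \<times> real \<Rightarrow> real^3"
    and c_rep :: "'n \<Rightarrow> real \<Rightarrow> real^3 \<Rightarrow> real"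
  assumes "smooth_bounded_domain \<Omega>"
    and "T > 0"
    and "CARD('n) \<ge> 2"
    and "\<And>i j. i \<noteq> j \<Longrightarrow> D i j > 0"
    and "\<And>i j. i \<noteq> j \<Longrightarrow> D i j = D j i"
    and "AE x in lebesgue_on \<Omega>. (\<forall>i. 0 \<le> c0 i x) \<and> (\<Sum>i\<in>UNIV. c0 i x) = 1"
    and "MS_weak_solution \<Omega> T D c0 c m"
    and "\<And>i. continuous_representative \<Omega> T (c i) (c_rep i)"
  shows "\<forall>t\<in>{0<..T}.
    (\<forall>i j. i \<noteq> j \<longrightarrow> integrable (lebesgue_on (\<Omega> \<times> {0<..<t})) (dissipation_density D c m i j)) \<and>
    entropy \<Omega> (\<lambda>i. c_rep i t) +
      1/2 * (\<Sum>i\<in>UNIV. \<Sum>j\<in>UNIV - {i}.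
               LINT z|lebesgue_on (\<Omega> \<times> {0<..<t}). dissipation_density D c m i j z)
    = entropy \<Omega> c0"
proof -
  have \<Omega>: "open \<Omega>" "bounded \<Omega>" and cone: "interior_cone_condition \<Omega>"
    using assms(1) smooth_bounded_domain_cone by (auto simp: smooth_bounded_domain_def)
  have Ob: "\<Omega> \<in> sets borel" using \<Omega> by auto
  note T = assms(2) and pos = assms(4) and sym = assms(5)
  define U where "U = \<Omega> \<times> {0<..<T}"
  have Ub: "U \<in> sets borel" unfolding U_def using \<Omega> by (intro borel_open open_Times) auto
  have MS: "MS_fields \<Omega> T D c m"
    "\<And>i \<phi>. \<phi> \<in> C1c_closure \<Omega> T \<Longrightarrow> (LINT z|lebesgue_on U. c i z * time_deriv \<phi> z) +
        (LINT z|lebesgue_on U. (sqrt (c i z) *\<^sub>R m i z) \<bullet> space_grad \<phi> z) = 0"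
    "\<And>i. c i \<in> Linf \<Omega> T"
    "AE z in lebesgue_on U. (\<forall>i. 0 \<le> c i z) \<and> (\<Sum>i\<in>UNIV. c i z) = 1"
    "\<And>i. (\<lambda>z. sqrt (c i z)) \<in> L2_H1 \<Omega> T"
    "\<And>i. \<exists>v. continuous_representative \<Omega> T (c i) v \<and> (AE x in lebesgue_on \<Omega>. v 0 x = c0 i x)"
    using assms(7) unfolding MS_weak_solution_def U_def by blast+
  have "\<exists>f. f \<in> borel_measurable borel \<and> (AE z in lborel. z \<in> U \<longrightarrow> c i z = f z)" for i
  proof -
    have "c i \<in> borel_measurable (lebesgue_on U)" using MS(3)[of i] by (simp add: Linf_def U_def)
    from borel_representative[OF Ub this] show ?thesis by blast
  qed
  then have "\<forall>i. \<exists>f. f \<in> borel_measurable borel \<and> (AE z in lborel. z \<in> U \<longrightarrow> c i z = f z)" ..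
  from choice[OF this] obtain C where
    "\<forall>i. C i \<in> borel_measurable borel \<and> (AE z in lborel. z \<in> U \<longrightarrow> c i z = C i z)" ..
  then have C: "C i \<in> borel_measurable borel" "AE z in lborel. z \<in> U \<longrightarrow> c i z = C i z" for i
    by blast+
  \<comment> \<open>Borel, in \<open>{0..1}\<close> everywhere and zero off the cylinder. It agrees
    with \<open>c\<close> almost everywhere on the cylinder, because nonnegative concentrations with
    sum 1 are at most 1.\<close>
  define c' where "c' i z = indicator U z * max 0 (min 1 (C i z))" for i z
  have c'm [measurable]: "c' i \<in> borel_measurable borel" for i
  proof -
    note [measurable] = C(1) Ub
    show ?thesis unfolding c'_def[abs_def] by measurable
  qed
  have c'0: "c' i z = 0" if "z \<notin> U" for i z using that by (simp add: c'_def)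
  have c'01: "0 \<le> c' i z" "c' i z \<le> 1" for i z by (auto simp: c'_def indicator_def)
  have cae: "AE z in lborel. z \<in> U \<longrightarrow> (\<forall>i. c i z = c' i z) \<and> (\<Sum>i\<in>UNIV. c' i z) = 1"
  proof -
    have "AE z in lborel. \<forall>i. z \<in> U \<longrightarrow> c i z = C i z"
      using AE_finite_allI[of UNIV "\<lambda>i z. z \<in> U \<longrightarrow> c i z = C i z" lborel] C(2) by simp
    moreover have "AE z in lborel. z \<in> U \<longrightarrow> (\<forall>i. 0 \<le> c i z) \<and> (\<Sum>i\<in>UNIV. c i z) = 1"
      by (rule iffD1[OF AE_lebesgue_on_iff[OF Ub] MS(4)])
    ultimately show ?thesis
    proof eventually_elim
      case (elim z)
      show ?case
      proof
        assume z: "z \<in> U"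
        have "c i z \<le> 1" for i
          using elim z member_le_sum[of i UNIV "\<lambda>i. c i z"] by auto
        then have "c i z = c' i z" for i
          using elim z by (auto simp: c'_def)
        then show "(\<forall>i. c i z = c' i z) \<and> (\<Sum>i\<in>UNIV. c' i z) = 1"
          using elim z by auto
      qed
    qed
  qed
  obtain G where G: "\<And>i. weak_space_gradient \<Omega> T (\<lambda>z. sqrt (c i z)) (G i)"
    "AE z in lebesgue_on U. (\<forall>i. - (\<Sum>j\<in>UNIV. MS_matrix D (\<lambda>k. c k z) i j *\<^sub>R m j z) = 2 *\<^sub>R G i z) \<and>
       (\<Sum>i\<in>UNIV. sqrt (c i z) *\<^sub>R m i z) = 0"
    using MS(1) unfolding MS_fields_def U_def by blast
  have "\<exists>f. f \<in> borel_measurable borel \<and> (AE z in lborel. z \<in> U \<longrightarrow> G i z = f z)" for i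
  proof -
    have "G i \<in> borel_measurable (lebesgue_on U)" using G(1)[of i] by (simp add: weak_space_gradient_def U_def)
    from borel_representative_vec[OF Ub borel_measurable_vec_nth[OF this]] show ?thesis by blast
  qed
  then have "\<forall>i. \<exists>f. f \<in> borel_measurable borel \<and> (AE z in lborel. z \<in> U \<longrightarrow> G i z = f z)" ..
  from choice[OF this] obtain H where
    "\<forall>i. H i \<in> borel_measurable borel \<and> (AE z in lborel. z \<in> U \<longrightarrow> G i z = H i z)" ..
  then have H: "H i \<in> borel_measurable borel" "AE z in lborel. z \<in> U \<longrightarrow> G i z = H i z" for i
    by blast+
  define G' where "G' i z = indicator U z *\<^sub>R H i z" for i z
  have G'm [measurable]: "G' i \<in> borel_measurable borel" for i
  proof -
    note [measurable] = H(1) Ub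
    show ?thesis unfolding G'_def[abs_def] by measurable
  qed
  have G'0: "G' i z = 0" if "z \<notin> U" for i z using that by (simp add: G'_def)
  have Gae: "AE z in lborel. z \<in> U \<longrightarrow> G i z = G' i z" for i
    using H(2)[of i] by eventually_elim (simp add: G'_def)
  have cae1: "AE z in lborel. z \<in> U \<longrightarrow> c i z = c' i z" for i
    using cae by eventually_elim auto
  \<comment> \<open>A bound for all \<open>D i j\<close> that is at least 1, as the determinant
    argument demands; absolute values because the sign of the diagonal of \<open>D\<close> is
    unknown.\<close>
  define K where "K = 1 + (\<Sum>i\<in>UNIV. \<Sum>j\<in>UNIV. \<bar>D i j\<bar>)"
  have K: "D i j \<le> K" "K \<ge> 1" for i j
  proof -
    have "D i j \<le> (\<Sum>j\<in>UNIV. \<bar>D i j\<bar>)"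
      using member_le_sum[of j UNIV "\<lambda>j. \<bar>D i j\<bar>"] by auto
    also have "\<dots> \<le> (\<Sum>i\<in>UNIV. \<Sum>j\<in>UNIV. \<bar>D i j\<bar>)"
      using member_le_sum[of i UNIV "\<lambda>i. \<Sum>j\<in>UNIV. \<bar>D i j\<bar>"] by (auto intro: sum_nonneg)
    finally show "D i j \<le> K" by (simp add: K_def)
    show "K \<ge> 1" by (simp add: K_def sum_nonneg)
  qed
  define R where "R z = MS_regularized D (\<lambda>i. c' i z)" for z
  \<comment> \<open>Cramer's formula with Borel data makes \<open>m'\<close> Borel by construction;
    the given \<open>m\<close>, of unknown measurability, is then shown to agree with it almost
    everywhere on the cylinder.\<close>
  define m' where "m' k z = indicator U z *\<^sub>R (\<chi> l. det (\<chi> i j. if j = k then - 2 * G' i z $ l else R z $ i $ j) / det (R z))" for k z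
  have Rm: "(\<lambda>z. R z $ i $ j) \<in> borel_measurable borel" for i j
    unfolding R_def MS_regularized_def MS_matrix_def by (cases "i = j") simp_all
  have m'm [measurable]: "m' k \<in> borel_measurable borel" for k
  proof -
    note [measurable] = Ub
    have [measurable]: "(\<lambda>z. det (R z)) \<in> borel_measurable borel"
      by (rule borel_measurable_det) (rule Rm)
    have [measurable]: "(\<lambda>z. det (\<chi> i j. if j = k then - 2 * G' i z $ l else R z $ i $ j)) \<in> borel_measurable borel" for l
    proof (rule borel_measurable_det)
      show "(\<lambda>z. (\<chi> i j. if j = k then - 2 * G' i z $ l else R z $ i $ j) $ i $ j) \<in> borel_measurable borel" for i j
        using Rm[of i j] by (cases "j = k") simp_all
    qed
    show ?thesis unfolding m'_def[abs_def] by measurable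
  qed
  have m'0: "m' k z = 0" if "z \<notin> U" for k z using that by (simp add: m'_def)
  have sys: "AE z in lborel. z \<in> U \<longrightarrow> (\<forall>i. m i z = m' i z) \<and>
      (\<forall>i. - (\<Sum>j\<in>UNIV. MS_matrix D (\<lambda>k. c' k z) i j *\<^sub>R m' j z) = 2 *\<^sub>R G' i z) \<and>
      (\<Sum>i\<in>UNIV. sqrt (c' i z) *\<^sub>R m' i z) = 0"
  proof -
    have "AE z in lborel. \<forall>i. z \<in> U \<longrightarrow> G i z = G' i z"
      using AE_finite_allI[of UNIV "\<lambda>i z. z \<in> U \<longrightarrow> G i z = G' i z" lborel] Gae by simp
    moreover have "AE z in lborel. z \<in> U \<longrightarrow> (\<forall>i. - (\<Sum>j\<in>UNIV. MS_matrix D (\<lambda>k. c k z) i j *\<^sub>R m j z) = 2 *\<^sub>R G i z) \<and>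
       (\<Sum>i\<in>UNIV. sqrt (c i z) *\<^sub>R m i z) = 0"
      by (rule iffD1[OF AE_lebesgue_on_iff[OF Ub] G(2)])
    ultimately show ?thesis
      using cae
    proof eventually_elim
      case (elim z)
      show ?case
      proof
        assume z: "z \<in> U"
        have cc: "c i z = c' i z" and GG: "G i z = G' i z" for i using elim z by auto
        have e: "- (\<Sum>j\<in>UNIV. MS_matrix D (\<lambda>k. c' k z) i j *\<^sub>R m j z) = 2 *\<^sub>R G' i z"
          "(\<Sum>i\<in>UNIV. sqrt (c' i z) *\<^sub>R m i z) = 0" for i
          using elim(2) z by (simp_all add: cc GG)
        have det: "det (R z) \<noteq> 0"
          unfolding R_def by (rule MS_regularized_det[OF c'01(1) _ sym pos K]) (use elim z in auto)
        have "m k z $ l = m' k z $ l" for k l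
          using MS_fields_cramer[OF det[unfolded R_def] e, of k l] z unfolding m'_def R_def by simp
        then have mm: "m k z = m' k z" for k by (simp add: vec_eq_iff)
        show "(\<forall>i. m i z = m' i z) \<and>
          (\<forall>i. - (\<Sum>j\<in>UNIV. MS_matrix D (\<lambda>k. c' k z) i j *\<^sub>R m' j z) = 2 *\<^sub>R G' i z) \<and>
          (\<Sum>i\<in>UNIV. sqrt (c' i z) *\<^sub>R m' i z) = 0"
          using e unfolding mm by blast
      qed
    qed
  qed
  have G'2: "integrable lborel (\<lambda>z. (norm (G' i z))\<^sup>2)" for i
    by (rule weak_space_gradient_L2[OF \<Omega>(1) MS(5) G(1) G'm]) (use G'0 Gae in \<open>auto simp: U_def\<close>)
  define q where "q i j z = (norm (sqrt (c' j z) *\<^sub>R m' i z - sqrt (c' i z) *\<^sub>R m' j z))\<^sup>2 / D i j" for i j z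
  \<comment> \<open>Off the cylinder every quantity is zero, so identity and bound hold almost
    everywhere on the whole space.\<close>
  have bound: "AE z in lborel. 1/2 * (\<Sum>i\<in>UNIV. \<Sum>j\<in>UNIV - {i}. q i j z) = - 2 * (\<Sum>i\<in>UNIV. m' i z \<bullet> G' i z)
      \<and> (\<Sum>i\<in>UNIV. (norm (m' i z))\<^sup>2) \<le> 4 * K\<^sup>2 * (\<Sum>i\<in>UNIV. (norm (G' i z))\<^sup>2)"
    using sys cae
  proof eventually_elim
    case (elim z)
    show ?case
    proof (cases "z \<in> U")
      case True
      have K0: "K > 0" using K(2) by simp
      have y: "(\<Sum>i\<in>UNIV. c' i z) = 1" using elim True by blast
      have e: "- (\<Sum>j\<in>UNIV. MS_matrix D (\<lambda>k. c' k z) i j *\<^sub>R m' j z) = 2 *\<^sub>R G' i z"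
          "(\<Sum>i\<in>UNIV. sqrt (c' i z) *\<^sub>R m' i z) = 0" for i
        using elim True by blast+
      from MS_fields_bound[OF c'01(1) y sym pos K(1) K0 e] show ?thesis by (simp add: q_def)
    next
      case False
      then show ?thesis by (simp add: m'0 G'0 q_def)
    qed
  qed
  have m'2: "integrable lborel (\<lambda>z. (norm (m' i z))\<^sup>2)" for i
  proof (rule Bochner_Integration.integrable_bound)
    show "integrable lborel (\<lambda>z. 4 * K\<^sup>2 * (\<Sum>i\<in>UNIV. (norm (G' i z))\<^sup>2))"
      by (intro integrable_mult_right Bochner_Integration.integrable_sum G'2)
    show "AE z in lborel. norm ((norm (m' i z))\<^sup>2) \<le> norm (4 * K\<^sup>2 * (\<Sum>i\<in>UNIV. (norm (G' i z))\<^sup>2))"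
      using bound
    proof eventually_elim
      case (elim z)
      have "(norm (m' i z))\<^sup>2 \<le> (\<Sum>i\<in>UNIV. (norm (m' i z))\<^sup>2)"
        by (rule member_le_sum) auto
      with elim have "(norm (m' i z))\<^sup>2 \<le> 4 * K\<^sup>2 * (\<Sum>i\<in>UNIV. (norm (G' i z))\<^sup>2)"
        by linarith
      then show ?case
        unfolding real_norm_def abs_of_nonneg[OF zero_le_power2] by (rule order_trans[OF _ abs_ge_self])
    qed
  qed measurable
  have cm1: "sqrt (c' i z) \<le> 1" "0 \<le> sqrt (c' i z)" for i z using c'01[of i z] by auto
  define J where "J i z = sqrt (c' i z) *\<^sub>R m' i z" for i z
  have Jm [measurable]: "J i \<in> borel_measurable borel" for i
    unfolding J_def[abs_def] by measurable
  have J2: "integrable lborel (\<lambda>z. (norm (J i z))\<^sup>2)" for i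
  proof (rule Bochner_Integration.integrable_bound[OF m'2[of i]])
    have "norm (J i z) \<le> norm (m' i z)" for z
      unfolding J_def using cm1[of i z] by (simp add: mult_left_le_one_le)
    then have "(norm (J i z))\<^sup>2 \<le> (norm (m' i z))\<^sup>2" for z
      by (intro power_mono) auto
    then show "AE z in lborel. norm ((norm (J i z))\<^sup>2) \<le> norm ((norm (m' i z))\<^sup>2)" by simp
  qed measurable
  have weak: "(LINT z|lborel. c' i z * time_deriv \<phi> z) + (LINT z|lborel. J i z \<bullet> space_grad \<phi> z) = 0"
    if \<phi>: "\<phi> \<in> C1c_closure \<Omega> T" for i \<phi>
  proof -
    have \<phi>1: "Ck (Suc 0) \<phi>" using \<phi> by (simp add: C1c_closure_def)
    have [measurable]: "time_deriv \<phi> \<in> borel_measurable borel" "space_grad \<phi> \<in> borel_measurable borel"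
      unfolding time_deriv_def[abs_def] space_grad_def[abs_def]
      using test_function_derivative_measurable[OF \<phi>1] by measurable
    have "(LINT z|lebesgue_on U. c i z * time_deriv \<phi> z) = (LINT z|lborel. indicator U z *\<^sub>R (c' i z * time_deriv \<phi> z))"
    proof (rule lebesgue_on_transfer(2)[OF Ub])
      show "AE z in lborel. z \<in> U \<longrightarrow> c i z * time_deriv \<phi> z = c' i z * time_deriv \<phi> z"
        using cae1[of i] by eventually_elim auto
    qed measurable
    moreover have "(LINT z|lebesgue_on U. (sqrt (c i z) *\<^sub>R m i z) \<bullet> space_grad \<phi> z) = (LINT z|lborel. indicator U z *\<^sub>R (J i z \<bullet> space_grad \<phi> z))"
    proof (rule lebesgue_on_transfer(2)[OF Ub])
      show "AE z in lborel. z \<in> U \<longrightarrow> (sqrt (c i z) *\<^sub>R m i z) \<bullet> space_grad \<phi> z = J i z \<bullet> space_grad \<phi> z"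
        using cae1[of i] sys by eventually_elim (auto simp: J_def)
    qed measurable
    moreover have ind: "indicator U z *\<^sub>R (c' i z * time_deriv \<phi> z) = c' i z * time_deriv \<phi> z"
      "indicator U z *\<^sub>R (J i z \<bullet> space_grad \<phi> z) = J i z \<bullet> space_grad \<phi> z" for z
      by (cases "z \<in> U"; simp add: c'0 J_def)+
    ultimately show ?thesis using MS(2)[OF \<phi>, of i] by (simp only: ind)
  qed
  have wG: "AE t in lborel. t \<in> {0<..<T} \<longrightarrow> wgrad \<Omega> (\<lambda>x. sqrt (c' i (x, t))) (\<lambda>x. G' i (x, t))" for i
  proof (rule weak_space_gradient_wgrad[OF \<Omega>(1) G(1)])
    show "AE z in lborel. z \<in> \<Omega> \<times> {0<..<T} \<longrightarrow> sqrt (c i z) = sqrt (c' i z)"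
      using cae1[of i] by eventually_elim (auto simp: U_def)
  qed (use c'0 G'0 Gae in \<open>auto simp: U_def\<close>)
  have id: "\<forall>\<tau>\<in>{0<..T}. (LINT x|lebesgue_on \<Omega>. c_rep i \<tau> x * (ln (c_rep i \<tau> x) - 1)) - (LINT x|lebesgue_on \<Omega>. c0 i x * (ln (c0 i x) - 1))
     = (LINT z|lborel. indicator {0<..<\<tau>} (snd z) * (2 * (m' i z \<bullet> G' i z)))" for i
  proof -
    obtain v where v: "\<And>t. t \<in> {0..T} \<Longrightarrow> v t \<in> borel_measurable borel" "\<And>t x. t \<in> {0..T} \<Longrightarrow> 0 \<le> v t x"
      "\<And>t x. t \<in> {0..T} \<Longrightarrow> v t x \<le> 1" "\<And>t x. t \<in> {0..T} \<Longrightarrow> x \<notin> \<Omega> \<Longrightarrow> v t x = 0"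
      "\<And>s. s \<in> {0..T} \<Longrightarrow> ((\<lambda>t. LINT x|lborel. \<bar>v t x - v s x\<bar>) \<longlongrightarrow> 0) (at s within {0..T})"
      "AE t in lborel. t \<in> {0<..<T} \<longrightarrow> (AE x in lborel. v t x = c' i (x, t))"
      "\<And>t. t \<in> {0..T} \<Longrightarrow> AE x in lborel. x \<in> \<Omega> \<longrightarrow> c_rep i t x = v t x"
      by (rule borel_continuous_representative[OF \<Omega> T assms(8)[of i], of "c' i"])
         (use cae1[of i] c'01[of i] c'0[of _ i] in \<open>auto simp: U_def\<close>)
    interpret S: ms_species \<Omega> T "c' i" "J i" "G' i" v
    proof
      show "AE t in lborel. t \<in> {0<..<T} \<longrightarrow> wgrad \<Omega> (\<lambda>x. sqrt (c' i (x, t))) (\<lambda>x. G' i (x, t))" by (rule wG)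
      show "AE t in lborel. t \<in> {0<..<T} \<longrightarrow> (AE x in lborel. v t x = c' i (x, t))" by (rule v(6))
      show "c' i z = 0" "J i z = 0" "G' i z = 0" if "z \<notin> \<Omega> \<times> {0<..<T}" for z
        using that c'0[of z i] G'0[of z i] by (simp_all add: U_def J_def)
    qed (fact \<Omega> cone T c'm c'01 Jm J2 G'm G'2 weak v(1-5))+
    have tr: "(LINT x|lebesgue_on \<Omega>. f x * (ln (f x) - 1)) = (LINT x|lborel. indicator \<Omega> x * (v t x * (ln (v t x) - 1)))"
      if t: "t \<in> {0..T}" and f: "AE x in lborel. x \<in> \<Omega> \<longrightarrow> f x = v t x" for f t
    proof -
      note [measurable] = v(1)[OF t]
      have "(LINT x|lebesgue_on \<Omega>. f x * (ln (f x) - 1)) = (LINT x|lborel. indicator \<Omega> x *\<^sub>R (v t x * (ln (v t x) - 1)))"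
      proof (rule lebesgue_on_transfer(2)[OF Ob])
        show "AE x in lborel. x \<in> \<Omega> \<longrightarrow> f x * (ln (f x) - 1) = v t x * (ln (v t x) - 1)"
          using f by eventually_elim auto
      qed measurable
      then show ?thesis by simp
    qed
    obtain v0 where v0: "continuous_representative \<Omega> T (c i) v0" "AE x in lebesgue_on \<Omega>. v0 0 x = c0 i x"
      using MS(6)[of i] by blast
    have t0: "0 \<in> {0..T}" using T by simp
    \<comment> \<open>The initial condition is known for some representative \<open>v0\<close>;
      uniqueness transfers it to \<open>c_rep\<close>.\<close>
    have "AE x in lebesgue_on \<Omega>. c_rep i 0 x = v0 0 x"
    proof (rule C_L2_unique[OF _ _ T _ t0])
      show "c_rep i \<in> C_L2 \<Omega> T" "v0 \<in> C_L2 \<Omega> T"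
        using assms(8)[of i] v0(1) by (auto simp: continuous_representative_def)
      have "AE s in lborel. s \<in> {0<..<T} \<longrightarrow> (AE x in lebesgue_on \<Omega>. c_rep i s x = c i (x, s))"
        "AE s in lborel. s \<in> {0<..<T} \<longrightarrow> (AE x in lebesgue_on \<Omega>. v0 s x = c i (x, s))"
        using assms(8)[of i] v0(1) by (auto simp: continuous_representative_def AE_lebesgue_on_iff)
      then show "AE s in lborel. s \<in> {0<..<T} \<longrightarrow> (AE x in lebesgue_on \<Omega>. c_rep i s x = v0 s x)"
      proof eventually_elim
        case (elim s)
        show ?case
        proof
          assume "s \<in> {0<..<T}"
          then have "AE x in lebesgue_on \<Omega>. c_rep i s x = c i (x, s)" "AE x in lebesgue_on \<Omega>. v0 s x = c i (x, s)"
            using elim by auto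
          then show "AE x in lebesgue_on \<Omega>. c_rep i s x = v0 s x"
            by eventually_elim simp
        qed
      qed
    qed
    with v0(2) have "AE x in lebesgue_on \<Omega>. c0 i x = c_rep i 0 x"
      by eventually_elim simp
    then have "AE x in lborel. x \<in> \<Omega> \<longrightarrow> c0 i x = c_rep i 0 x"
      by (simp add: AE_lebesgue_on_iff[OF Ob])
    with v(7)[OF t0] have init: "AE x in lborel. x \<in> \<Omega> \<longrightarrow> c0 i x = v 0 x"
      by eventually_elim simp
    show ?thesis
    proof
      fix \<tau> assume \<tau>: "\<tau> \<in> {0<..T}"
      then have "\<tau> \<in> {0..T}" by simp
      from tr[OF this v(7)[OF this]] tr[OF t0 init] S.entropy_identity[OF m'm m'2 J_def \<tau>]
      show "(LINT x|lebesgue_on \<Omega>. c_rep i \<tau> x * (ln (c_rep i \<tau> x) - 1)) - (LINT x|lebesgue_on \<Omega>. c0 i x * (ln (c0 i x) - 1))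
         = (LINT z|lborel. indicator {0<..<\<tau>} (snd z) * (2 * (m' i z \<bullet> G' i z)))"
        by (simp only:)
    qed
  qed
  have qm [measurable]: "q i j \<in> borel_measurable borel" for i j
    unfolding q_def[abs_def] by measurable
  have qint: "integrable lborel (\<lambda>z. indicator V z *\<^sub>R q i j z)" if "i \<noteq> j" and V [measurable]: "V \<in> sets borel" for i j V
  proof (rule Bochner_Integration.integrable_bound)
    show "integrable lborel (\<lambda>z. (2 * (norm (m' i z))\<^sup>2 + 2 * (norm (m' j z))\<^sup>2) / D i j)"
      using m'2 by auto
    have "q i j z \<le> (2 * (norm (m' i z))\<^sup>2 + 2 * (norm (m' j z))\<^sup>2) / D i j" for z
    proof -
      have "norm (sqrt (c' j z) *\<^sub>R m' i z - sqrt (c' i z) *\<^sub>R m' j z) \<le> norm (sqrt (c' j z) *\<^sub>R m' i z) + norm (sqrt (c' i z) *\<^sub>R m' j z)"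
        by (rule norm_triangle_ineq4)
      also have "\<dots> \<le> norm (m' i z) + norm (m' j z)"
        using cm1[of i z] cm1[of j z] by (intro add_mono) (auto simp: mult_left_le_one_le)
      finally have "(norm (sqrt (c' j z) *\<^sub>R m' i z - sqrt (c' i z) *\<^sub>R m' j z))\<^sup>2 \<le> (norm (m' i z) + norm (m' j z))\<^sup>2"
        by (intro power_mono) auto
      also have "\<dots> \<le> 2 * (norm (m' i z))\<^sup>2 + 2 * (norm (m' j z))\<^sup>2"
        using sum_squares_bound[of "norm (m' i z)" "norm (m' j z)"] by (simp add: power2_sum)
      finally show ?thesis
        unfolding q_def using pos[OF that(1)] by (intro divide_right_mono) auto
    qed
    moreover have "0 \<le> q i j z" for z unfolding q_def using pos[OF that(1)] by simp
    ultimately show "AE z in lborel. norm (indicator V z *\<^sub>R q i j z) \<le> norm ((2 * (norm (m' i z))\<^sup>2 + 2 * (norm (m' j z))\<^sup>2) / D i j)"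
      using pos[OF that(1)] by (intro AE_I2) (auto simp: indicator_def)
  qed measurable
  show ?thesis
  proof (intro ballI conjI allI impI)
    fix t assume t: "t \<in> {0<..T}"
    define V where "V = \<Omega> \<times> {0<..<t}"
    have Vb [measurable]: "V \<in> sets borel" unfolding V_def using \<Omega> by (intro borel_open open_Times) auto
    have VU: "V \<subseteq> U" using t by (auto simp: V_def U_def)
    have dq: "AE z in lborel. z \<in> V \<longrightarrow> dissipation_density D c m i j z = q i j z" for i j
      using cae sys by eventually_elim (use VU in \<open>auto simp: dissipation_density_def q_def\<close>)
    show "integrable (lebesgue_on (\<Omega> \<times> {0<..<t})) (dissipation_density D c m i j)" if "i \<noteq> j" for i j
      unfolding V_def[symmetric]
      by (subst lebesgue_on_transfer(1)[OF Vb qm dq]) (rule qint[OF that Vb])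
    have tr: "(LINT z|lebesgue_on V. dissipation_density D c m i j z) = (LINT z|lborel. indicator V z *\<^sub>R q i j z)" for i j
      by (rule lebesgue_on_transfer(2)[OF Vb qm dq])
    have "1/2 * (\<Sum>i\<in>UNIV. \<Sum>j\<in>UNIV - {i}. LINT z|lebesgue_on V. dissipation_density D c m i j z)
        = 1/2 * (\<Sum>i\<in>UNIV. \<Sum>j\<in>UNIV - {i}. LINT z|lborel. indicator V z *\<^sub>R q i j z)"
      by (simp only: tr)
    also have "(\<Sum>i\<in>UNIV. \<Sum>j\<in>UNIV - {i}. LINT z|lborel. indicator V z *\<^sub>R q i j z)
        = (\<Sum>i\<in>UNIV. LINT z|lborel. (\<Sum>j\<in>UNIV - {i}. indicator V z *\<^sub>R q i j z))"
      by (intro sum.cong refl Bochner_Integration.integral_sum[symmetric] qint) auto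
    also have "\<dots> = (LINT z|lborel. (\<Sum>i\<in>UNIV. \<Sum>j\<in>UNIV - {i}. indicator V z *\<^sub>R q i j z))"
      by (intro Bochner_Integration.integral_sum[symmetric] Bochner_Integration.integrable_sum qint) auto
    also have "1/2 * \<dots> = (LINT z|lborel. 1/2 * (\<Sum>i\<in>UNIV. \<Sum>j\<in>UNIV - {i}. indicator V z *\<^sub>R q i j z))"
      by simp
    \<comment> \<open>The identity \<open>bound\<close> holds for the sum over all species only,
      which is why sums and integrals were exchanged first.\<close>
    also have "\<dots> = (LINT z|lborel. (\<Sum>i\<in>UNIV. - (indicator {0<..<t} (snd z) * (2 * (m' i z \<bullet> G' i z)))))"
    proof (rule integral_cong_AE)
      show "AE z in lborel. 1/2 * (\<Sum>i\<in>UNIV. \<Sum>j\<in>UNIV - {i}. indicator V z *\<^sub>R q i j z)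
          = (\<Sum>i\<in>UNIV. - (indicator {0<..<t} (snd z) * (2 * (m' i z \<bullet> G' i z))))"
        using bound
      proof eventually_elim
        case (elim z)
        have "1/2 * (\<Sum>i\<in>UNIV. \<Sum>j\<in>UNIV - {i}. indicator V z *\<^sub>R q i j z) = indicator V z * (1/2 * (\<Sum>i\<in>UNIV. \<Sum>j\<in>UNIV - {i}. q i j z))"
          by (cases "z \<in> V") simp_all
        also have "\<dots> = indicator V z * (- 2 * (\<Sum>i\<in>UNIV. m' i z \<bullet> G' i z))"
          using elim by (simp only:)
        also have "\<dots> = (\<Sum>i\<in>UNIV. - (indicator V z * (2 * (m' i z \<bullet> G' i z))))"
          by (simp add: sum_distrib_left sum_negf)
        also have "\<dots> = (\<Sum>i\<in>UNIV. - (indicator {0<..<t} (snd z) * (2 * (m' i z \<bullet> G' i z))))"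
        \<comment> \<open>The balances carry an indicator in time alone; outside
          \<open>\<Omega>\<close> the factor \<open>G'\<close> vanishes and makes up for it.\<close>
        proof (cases "fst z \<in> \<Omega>")
          case True
          then have "indicator V z = (indicator {0<..<t} (snd z) :: real)"
            by (cases z) (auto simp: V_def indicator_def)
          then show ?thesis by simp
        next
          case False
          then have "G' i z = 0" for i by (intro G'0) (auto simp: U_def)
          then show ?thesis by simp
        qed
        finally show ?case .
      qed
    qed measurable
    also have "\<dots> = (\<Sum>i\<in>UNIV. LINT z|lborel. - (indicator {0<..<t} (snd z) * (2 * (m' i z \<bullet> G' i z))))"
    proof (rule Bochner_Integration.integral_sum)
      fix i
      have "integrable lborel (\<lambda>z. m' i z \<bullet> G' i z)"
        by (rule integrable_inner_L2(2)[OF _ _ m'2 G'2]) auto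
      then show "integrable lborel (\<lambda>z. - (indicator {0<..<t} (snd z) * (2 * (m' i z \<bullet> G' i z))))"
        by (rule Bochner_Integration.integrable_bound[OF integrable_mult_right[of 2]])
           (auto simp: indicator_def)
    qed
    also have "\<dots> = - (\<Sum>i\<in>UNIV. LINT z|lborel. indicator {0<..<t} (snd z) * (2 * (m' i z \<bullet> G' i z)))"
      by (simp add: sum_negf)
    also have "(\<Sum>i\<in>UNIV. LINT z|lborel. indicator {0<..<t} (snd z) * (2 * (m' i z \<bullet> G' i z)))
        = entropy \<Omega> (\<lambda>i. c_rep i t) - entropy \<Omega> c0"
      unfolding entropy_def sum_subtractf[symmetric] using bspec[OF id t] by (intro sum.cong refl) simp
    finally show "entropy \<Omega> (\<lambda>i. c_rep i t) +
      1/2 * (\<Sum>i\<in>UNIV. \<Sum>j\<in>UNIV - {i}.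
               LINT z|lebesgue_on (\<Omega> \<times> {0<..<t}). dissipation_density D c m i j z)
      = entropy \<Omega> c0"
      unfolding V_def[symmetric] by linarith
  qed
qed

end
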